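(* Let $s>0$ and let $\alpha,\gamma\ge0$. Assume there are constants $C_d,C_D$ such that for every $j\ge1$ and every $\Lambda\ge1$, $$d_j\le C_d(1+\mu_j)^\gamma,\qquad\sum_{1\le j:\,\mu_j\le\Lambda}d_j\le C_D(1+\Lambda)^{\alpha+\gamma},$$ and constants $c_d,c_D>0$ and $\Lambda_0\ge1$ such that $$d_j\ge c_d(1+\mu_j)^\gamma\ \text{ whenever }\mu_j\ge\Lambda_0,\qquad\sum_{1\le j:\,\mu_j\le\Lambda}d_j\ge c_D(1+\Lambda)^{\alpha+\gamma}\ \text{ for every }\Lambda\ge\Lambda_0.$$ Then there exists a constant $c>0$, independent of $R$ and $n$, such that for every $R>1$ there is an integer $n_0=n_0(R)\ge1$ for which, for every $n\ge n_0$, $$\mathfrak R_n\big(\mathcal P_s(R,1/2,3/2)\big)\ge c\,(R-1)^{\frac{2(\alpha+\gamma)}{s+\gamma+2\alpha}}\,n^{-\frac{s+\alpha}{s+\gamma+2\alpha}}.$$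
   Context: $(M,g)$ is a compact connected smooth Riemannian manifold without boundary, $\nu$ is Riemannian volume normalized so that $\nu(M)=1$, and $L^2(M)=L^2(M,\nu)$ (real-valued). $L=-\Delta_M$ is the nonnegative Laplace–Beltrami operator with distinct eigenvalues $0=\mu_0<\mu_1<\mu_2<\cdots$; $E_j=\ker(L-\mu_jI)$, $d_j=\dim E_j$, $P_j:L^2(M)\to E_j$ is the orthogonal projector. Block-variation norm: $\|f\|_{\mathcal V^{\mathrm{spec}}_s(M)}=\sum_{j\ge0}(1+\mu_j)^{s/2}\|P_jf\|_{L^2(M)}$. For $0<a\le b<\infty$, $\mathcal P_s(R,a,b)=\{p: a\le p\le b,\ \int_Mp\,d\nu=1,\ \|p\|_{\mathcal V^{\mathrm{spec}}_s(M)}\le R\}$. For a class $\mathcal F$ of densities, the minimax risk is $\mathfrak R_n(\mathcal F)=\inf_{\widehat p}\sup_{p_0\in\mathcal F}\mathbb E_{p_0}\|\widehat p-p_0\|_{L^2(M)}^2$, where the infimum is over all measurable estimators $\widehat p$ based on $X_1,\dots,X_n$ i.i.d. with law $p_0\,d\nu$. *)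

theory Defs
  imports "HOL-Analysis.Analysis" "HOL-Library.Function_Algebras"
begin

section \<open>Smooth functions\<close>

primrec C_k_on :: "nat \<Rightarrow> 'a::real_normed_vector set \<Rightarrow> ('a \<Rightarrow> 'b::real_normed_vector) \<Rightarrow> bool"
  where
    "C_k_on 0 S f \<longleftrightarrow> continuous_on S f"
  | "C_k_on (Suc k) S f \<longleftrightarrow>
       (\<forall>x\<in>S. f differentiable (at x)) \<and>
       (\<forall>v. C_k_on k S (\<lambda>x. frechet_derivative f (at x) v))"

text \<open>Only meaningful for open \<open>S\<close>.\<close>

definition smooth_on :: "'a::real_normed_vector set \<Rightarrow> ('a \<Rightarrow> 'b::real_normed_vector) \<Rightarrow> bool"
  where "smooth_on S f \<longleftrightarrow> (\<forall>k. C_k_on k S f)"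

definition partial_derivative :: "'n::finite \<Rightarrow> (real^'n \<Rightarrow> real) \<Rightarrow> real^'n \<Rightarrow> real"
  where "partial_derivative i F x = frechet_derivative F (at x) (axis i 1)"


section \<open>Compact connected Riemannian manifolds\<close>

text \<open>
  The manifold is the whole type \<open>'m\<close>. A chart is a pair \<open>(U, \<phi>)\<close> of a domain and a coordinate map;
  the values of \<open>\<phi>\<close> outside \<open>U\<close> are irrelevant. Coordinates lie in \<open>real^'n\<close>, so the dimension
  \<open>CARD('n)\<close> is at least 1 (a connected manifold of dimension 0 is a point and has no \<open>\<mu>\<^sub>1\<close>).
  The atlas is not required to be maximal.
\<close>

type_synonym ('m, 'n) chart = "'m set \<times> ('m \<Rightarrow> real^'n)"

abbreviation chart_dom :: "('m, 'n::finite) chart \<Rightarrow> 'm set"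
  where "chart_dom c \<equiv> fst c"

abbreviation chart_map :: "('m, 'n::finite) chart \<Rightarrow> 'm \<Rightarrow> real^'n"
  where "chart_map c \<equiv> snd c"

abbreviation chart_inv :: "('m, 'n::finite) chart \<Rightarrow> real^'n \<Rightarrow> 'm"
  where "chart_inv c \<equiv> inv_into (chart_dom c) (chart_map c)"

abbreviation chart_range :: "('m, 'n::finite) chart \<Rightarrow> (real^'n) set"
  where "chart_range c \<equiv> chart_map c ` chart_dom c"

abbreviation transition :: "('m, 'n::finite) chart \<Rightarrow> ('m, 'n) chart \<Rightarrow> real^'n \<Rightarrow> real^'n"
  where "transition c d \<equiv> (\<lambda>x. chart_map d (chart_inv c x))"

definition smooth_atlas ::
  "('m::{t2_space, second_countable_topology}, 'n::finite) chart set \<Rightarrow> bool"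
  where "smooth_atlas A \<longleftrightarrow>
    (\<Union>c\<in>A. chart_dom c) = UNIV \<and>
    (\<forall>c\<in>A. open (chart_dom c) \<and> open (chart_range c) \<and>
       homeomorphism (chart_dom c) (chart_range c) (chart_map c) (chart_inv c)) \<and>
    (\<forall>c\<in>A. \<forall>d\<in>A. smooth_on (chart_map c ` (chart_dom c \<inter> chart_dom d)) (transition c d))"

text \<open>\<open>G c x\<close> is the matrix of the metric at the point with coordinates \<open>x\<close> in the chart \<open>c\<close>; the
  last clause is the transformation law of a covariant 2-tensor.\<close>

definition riemannian_metric ::
  "('m, 'n::finite) chart set \<Rightarrow> (('m, 'n) chart \<Rightarrow> real^'n \<Rightarrow> real^'n^'n) \<Rightarrow> bool"
  where "riemannian_metric A G \<longleftrightarrow>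
    (\<forall>c\<in>A. smooth_on (chart_range c) (G c) \<and>
       (\<forall>x\<in>chart_range c. transpose (G c x) = G c x \<and> (\<forall>v. v \<noteq> 0 \<longrightarrow> v \<bullet> (G c x *v v) > 0))) \<and>
    (\<forall>c\<in>A. \<forall>d\<in>A. \<forall>p\<in>chart_dom c \<inter> chart_dom d.
       let J = jacobian (transition c d) (at (chart_map c p))
       in G c (chart_map c p) = transpose J ** G d (chart_map d p) ** J)"

definition compact_connected_riemannian_manifold ::
  "('m::{t2_space, second_countable_topology}, 'n::finite) chart set \<Rightarrow>
   (('m, 'n) chart \<Rightarrow> real^'n \<Rightarrow> real^'n^'n) \<Rightarrow> bool"
  where "compact_connected_riemannian_manifold A G \<longleftrightarrow>
    compact (UNIV :: 'm set) \<and> connected (UNIV :: 'm set) \<and> smooth_atlas A \<and> riemannian_metric A G"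

text \<open>Since the charts cover the manifold, the following determines \<open>V\<close>.\<close>

definition is_riemannian_volume ::
  "('m::{t2_space, second_countable_topology}, 'n::finite) chart set \<Rightarrow>
   (('m, 'n) chart \<Rightarrow> real^'n \<Rightarrow> real^'n^'n) \<Rightarrow> 'm measure \<Rightarrow> bool"
  where "is_riemannian_volume A G V \<longleftrightarrow>
    sets V = sets borel \<and>
    (\<forall>c\<in>A. \<forall>B\<in>sets borel. B \<subseteq> chart_dom c \<longrightarrow>
       emeasure V B = (\<integral>\<^sup>+x\<in>chart_map c ` B. ennreal (sqrt (det (G c x))) \<partial>lborel))"

definition normalized :: "'m measure \<Rightarrow> 'm measure"
  where "normalized V = scale_measure (1 / emeasure V (space V)) V"


section \<open>The Laplace--Beltrami operator and its spectrum\<close>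

definition smooth_function :: "('m, 'n::finite) chart set \<Rightarrow> ('m \<Rightarrow> real) \<Rightarrow> bool"
  where "smooth_function A f \<longleftrightarrow> (\<forall>c\<in>A. smooth_on (chart_range c) (\<lambda>x. f (chart_inv c x)))"

text \<open>Coordinate expression of \<open>\<Delta>\<^sub>M f\<close> at the point \<open>p\<close> of the domain of \<open>c\<close>:
  \<open>(det g)\<^bsup>-1/2\<^esup> \<Sum>\<^sub>i \<partial>\<^sub>i ((det g)\<^bsup>1/2\<^esup> \<Sum>\<^sub>j g\<^bsup>ij\<^esup> \<partial>\<^sub>j f)\<close>.\<close>

definition laplacian_in_chart ::
  "(('m, 'n::finite) chart \<Rightarrow> real^'n \<Rightarrow> real^'n^'n) \<Rightarrow> ('m, 'n) chart \<Rightarrow> ('m \<Rightarrow> real) \<Rightarrow> 'm \<Rightarrow> real"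
  where "laplacian_in_chart G c f p =
    (let h = (\<lambda>x. f (chart_inv c x));
         w = (\<lambda>x. sqrt (det (G c x)));
         F = (\<lambda>i x. w x * (\<Sum>j\<in>UNIV. matrix_inv (G c x) $ i $ j * partial_derivative j h x))
     in (\<Sum>i\<in>UNIV. partial_derivative i (F i) (chart_map c p)) / w (chart_map c p))"

text \<open>\<open>ker (L - \<theta>I)\<close> for \<open>L = -\<Delta>\<^sub>M\<close>. By elliptic regularity, every eigenfunction of the self-adjoint
  operator on \<open>L\<^sup>2\<close> has exactly one smooth representative, so eigenfunctions are taken to be smooth.
  The coordinate expressions in different charts agree on smooth functions.\<close>

definition eigenspace ::
  "('m, 'n::finite) chart set \<Rightarrow> (('m, 'n) chart \<Rightarrow> real^'n \<Rightarrow> real^'n^'n) \<Rightarrow> real \<Rightarrow> ('m \<Rightarrow> real) set"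
  where "eigenspace A G \<theta> =
    {f. smooth_function A f \<and>
        (\<forall>c\<in>A. \<forall>p\<in>chart_dom c. - laplacian_in_chart G c f p = \<theta> * f p)}"

definition distinct_eigenvalues ::
  "('m, 'n::finite) chart set \<Rightarrow> (('m, 'n) chart \<Rightarrow> real^'n \<Rightarrow> real^'n^'n) \<Rightarrow> (nat \<Rightarrow> real) \<Rightarrow> bool"
  where "distinct_eigenvalues A G \<mu> \<longleftrightarrow>
    \<mu> 0 = 0 \<and> strict_mono \<mu> \<and> range \<mu> = {\<theta>. \<exists>f\<in>eigenspace A G \<theta>. \<exists>p. f p \<noteq> 0}"

text \<open>Functions are not an instance of class \<open>real_vector\<close>, so the dimension is taken with respect to
  an explicit pointwise scaling.\<close>

interpretation real_fun: vector_space "\<lambda>(c::real) (f :: 'm \<Rightarrow> real) x. c * f x"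
  by unfold_locales (auto simp: algebra_simps)

definition fun_dim :: "('m \<Rightarrow> real) set \<Rightarrow> nat"
  where "fun_dim E = vector_space.dim (\<lambda>(c::real) (f :: 'm \<Rightarrow> real) x. c * f x) E"


section \<open>The space of square-integrable functions and the block-variation norm\<close>

text \<open>\<open>L\<^sup>2\<close> consists of functions rather than of classes modulo null sets, and \<open>L2_norm\<close> is a seminorm on it.\<close>

definition L2_space :: "'m measure \<Rightarrow> ('m \<Rightarrow> real) set"
  where "L2_space \<nu> = {f \<in> borel_measurable \<nu>. integrable \<nu> (\<lambda>x. (f x)\<^sup>2)}"

definition L2_norm :: "'m measure \<Rightarrow> ('m \<Rightarrow> real) \<Rightarrow> real"
  where "L2_norm \<nu> f = sqrt (\<integral>x. (f x)\<^sup>2 \<partial>\<nu>)"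

definition L2_proj :: "'m measure \<Rightarrow> ('m \<Rightarrow> real) set \<Rightarrow> ('m \<Rightarrow> real) \<Rightarrow> 'm \<Rightarrow> real"
  where "L2_proj \<nu> E f = (SOME u. u \<in> E \<and> (\<forall>v\<in>E. (\<integral>x. (f x - u x) * v x \<partial>\<nu>) = 0))"

definition block_variation_norm ::
  "'m measure \<Rightarrow> (nat \<Rightarrow> real) \<Rightarrow> (nat \<Rightarrow> ('m \<Rightarrow> real) set) \<Rightarrow> real \<Rightarrow> ('m \<Rightarrow> real) \<Rightarrow> ennreal"
  where "block_variation_norm \<nu> \<mu> E s f =
    (\<Sum>j. ennreal ((1 + \<mu> j) powr (s / 2) * L2_norm \<nu> (L2_proj \<nu> (E j) f)))"

definition density_class ::
  "'m measure \<Rightarrow> (nat \<Rightarrow> real) \<Rightarrow> (nat \<Rightarrow> ('m \<Rightarrow> real) set) \<Rightarrow> real \<Rightarrow> real \<Rightarrow> real \<Rightarrow> real \<Rightarrow> ('m \<Rightarrow> real) set"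
  where "density_class \<nu> \<mu> E s R a b =
    {p \<in> L2_space \<nu>. (AE x in \<nu>. a \<le> p x \<and> p x \<le> b) \<and> (\<integral>x. p x \<partial>\<nu>) = 1 \<and>
       block_variation_norm \<nu> \<mu> E s p \<le> ennreal R}"


section \<open>Minimax risk\<close>

text \<open>The Borel \<open>\<sigma>\<close>-algebra of the topology defined by the seminorm.\<close>

definition L2_borel :: "'m measure \<Rightarrow> ('m \<Rightarrow> real) measure"
  where "L2_borel \<nu> = sigma (L2_space \<nu>)
    {U. U \<subseteq> L2_space \<nu> \<and>
        (\<forall>f\<in>U. \<exists>e>0. \<forall>g\<in>L2_space \<nu>. L2_norm \<nu> (\<lambda>x. g x - f x) < e \<longrightarrow> g \<in> U)}"

text \<open>A sample \<open>(X\<^sub>1, \<dots>, X\<^sub>n)\<close> is a function on \<open>{..<n}\<close>.\<close>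

definition estimators :: "'m measure \<Rightarrow> nat \<Rightarrow> ((nat \<Rightarrow> 'm) \<Rightarrow> ('m \<Rightarrow> real)) set"
  where "estimators \<nu> n = measurable (PiM {..<n} (\<lambda>_. \<nu>)) (L2_borel \<nu>)"

definition sample_law :: "'m measure \<Rightarrow> nat \<Rightarrow> ('m \<Rightarrow> real) \<Rightarrow> (nat \<Rightarrow> 'm) measure"
  where "sample_law \<nu> n p = PiM {..<n} (\<lambda>_. density \<nu> (\<lambda>x. ennreal (p x)))"

definition minimax_risk :: "'m measure \<Rightarrow> nat \<Rightarrow> ('m \<Rightarrow> real) set \<Rightarrow> ennreal"
  where "minimax_risk \<nu> n F =
    (INF T\<in>estimators \<nu> n. SUP p\<in>F.
       \<integral>\<^sup>+X. ennreal ((L2_norm \<nu> (\<lambda>x. T X x - p x))\<^sup>2) \<partial>(sample_law \<nu> n p))"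

end

theory Submission
  imports Defs
begin

text \<open>
  Write \<open>q\<close> for the dimension of the manifold and \<open>L = -\<Delta>\<close>. The lower bound comes from a hypercube of densities
  \<open>1 + \<tau> \<Sum>\<^sub>a \<plusminus>b\<^sub>a\<close> in which the functions \<open>b\<^sub>a\<close> have mean zero and disjoint supports. If
  \<open>n \<tau>\<^sup>2 \<integral> b\<^sub>a\<^sup>2\<close> stays bounded, the laws of the sample for two densities that differ in one sign overlap by a
  constant amount, so that a fixed proportion of the signs cannot be recovered and the risk of every
  estimator is at least of order \<open>\<tau>\<^sup>2 \<Sum>\<^sub>a \<integral> b\<^sub>a\<^sup>2\<close> (\<open>assouad_L2\<close>). The \<open>b\<^sub>a\<close> are bumps of scale \<open>1/N\<close>, one in each of
  the \<open>N\<^sup>q\<close> cells of one coordinate cube (\<open>test_functions\<close>); then \<open>\<integral> b\<^sub>a\<^sup>2\<close> is of order \<open>N\<^bsup>-q\<^esup>\<close> and the risk is of order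
  \<open>\<tau>\<^sup>2\<close>.

  The block-variation norm of a signed sum \<open>f\<close> of these bumps is \<open>O(N\<^bsup>s+\<alpha>\<^esup>)\<close>, uniformly in the signs
  (\<open>block_sum_bound\<close>). Indeed \<open>f\<close> is bounded and \<open>L\<^sup>m f\<close> is \<open>O(N\<^bsup>2m\<^esup>)\<close>. By Green's formula \<open>L\<^sup>m f\<close> pairs with
  an eigenfunction like \<open>\<mu>\<^sub>j\<^sup>m f\<close>, so Bessel's inequality for \<open>f\<close> and for \<open>L\<^sup>m f\<close> bounds \<open>\<Sum>\<^sub>j \<parallel>P\<^sub>j f\<parallel>\<^sup>2\<close> by a constant
  and \<open>\<Sum>\<^sub>j \<mu>\<^sub>j\<^bsup>2m\<^esup> \<parallel>P\<^sub>j f\<parallel>\<^sup>2\<close> by a multiple of \<open>N\<^bsup>4m\<^esup>\<close>. By the Cauchy-Schwarz inequality the norm is then at most of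
  order \<open>N\<^sup>s\<close> times the square root of the number of blocks with \<open>\<mu>\<^sub>j\<close> at most of order \<open>N\<^sup>2\<close>. A dyadic range of eigenvalues around \<open>y\<close>
  contains \<open>O(y\<^sup>\<alpha>)\<close> blocks, because their total dimension is \<open>O(y\<^bsup>\<alpha>+\<gamma>\<^esup>)\<close> and each has dimension at least
  of order \<open>y\<^sup>\<gamma>\<close> (\<open>block_count\<close>).

  The constraints are therefore \<open>\<tau> N\<^bsup>s+\<alpha>\<^esup> \<lesssim> R - 1\<close> and \<open>n \<tau>\<^sup>2 N\<^bsup>-q\<^esup> \<lesssim> 1\<close>. Balancing them yields a bound of the
  required form with \<open>q/2\<close> in place of \<open>\<alpha> + \<gamma>\<close>, and for large \<open>n\<close> this is the stronger bound as soon as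
  \<open>\<alpha> + \<gamma> \<le> q/2\<close> (\<open>calibration\<close>).

  That inequality (\<open>growth_exponent_le\<close>) compares the lower bound on the number of eigenfunctions in
  the hypothesis with the upper half of Weyl's law: there are \<open>O(\<Lambda>\<^bsup>q/2\<^esup>)\<close> independent eigenfunctions with
  eigenvalue at most \<open>\<Lambda>\<close> (\<open>eigenfunction_count\<close>). This is Neumann bracketing. Cover the manifold by finitely many coordinate
  cubes and cut each of them into \<open>N\<^sup>q\<close> cells with \<open>N\<^sup>2\<close> a large multiple of \<open>\<Lambda>\<close>. A combination \<open>f\<close> of
  these eigenfunctions has Dirichlet energy at most \<open>\<Lambda> \<parallel>f\<parallel>\<^sup>2\<close> by Green's formula (\<open>green\<close>). If it has mean
  zero on every cell, the Poincare inequality on convex sets (\<open>poincare_convex\<close>) makes the energy larger than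
  that unless \<open>f = 0\<close>; so there are at most as many eigenfunctions as cells. The same count shows that the
  eigenspaces have finite dimension, so that the orthogonal projections to them exist.
\<close>

section \<open>Scaled families of functions\<close>

lemma partial_derivative_cong:
  fixes u v :: "real^'n::finite \<Rightarrow> real"
  assumes "open S" "x \<in> S" "\<And>y. y \<in> S \<Longrightarrow> u y = v y"
  shows "partial_derivative i u x = partial_derivative i v x"
proof -
  have "((\<lambda>y. u y) has_derivative D) (at x) \<longleftrightarrow> ((\<lambda>y. v y) has_derivative D) (at x)" for D
    using assms by (metis has_derivative_transform_within_open)
  then show ?thesis
    by (simp add: partial_derivative_def frechet_derivative_def)
qed

lemma differentiable_cong_open:
  fixes u v :: "real^'n::finite \<Rightarrow> real"
  assumes "open S" "x \<in> S" "\<And>y. y \<in> S \<Longrightarrow> u y = v y" "u differentiable (at x)"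
  shows "v differentiable (at x)"
  using assms unfolding differentiable_def by (metis has_derivative_transform_within_open)

lemma partial_derivative_eq:
  "(u has_derivative D) (at x) \<Longrightarrow> partial_derivative i u x = D (axis i 1)"
  by (simp add: partial_derivative_def frechet_derivative_at[symmetric])

lemma has_derivative_frechet:
  "u differentiable (at x) \<Longrightarrow> (u has_derivative frechet_derivative u (at x)) (at x)"
  by (simp add: frechet_derivative_works)

lemma partial_derivative_const [simp]: "partial_derivative i (\<lambda>x. c) x = 0"
  by (rule partial_derivative_eq) (auto intro: derivative_eq_intros)

lemma partial_derivative_const_fun [simp]: "partial_derivative i (\<lambda>x. c) = (\<lambda>x. 0)"
  by (rule ext) simp

lemma partial_derivative_add:
  "u differentiable (at x) \<Longrightarrow> v differentiable (at x) \<Longrightarrow>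
    partial_derivative i (\<lambda>x. u x + v x) x = partial_derivative i u x + partial_derivative i v x"
  by (subst partial_derivative_eq[OF has_derivative_add[OF has_derivative_frechet has_derivative_frechet]])
     (simp_all add: partial_derivative_def)

lemma partial_derivative_mult:
  "u differentiable (at x) \<Longrightarrow> v differentiable (at x) \<Longrightarrow>
    partial_derivative i (\<lambda>x. u x * v x) x
      = u x * partial_derivative i v x + partial_derivative i u x * v x"
  by (subst partial_derivative_eq[OF has_derivative_mult[OF has_derivative_frechet has_derivative_frechet]])
     (simp_all add: partial_derivative_def)

lemma partial_derivative_chain:
  assumes "u differentiable (at x)" "(f has_real_derivative f') (at (u x))"
  shows "partial_derivative i (\<lambda>x. f (u x)) x = f' * partial_derivative i u x"
    and "(\<lambda>x. f (u x)) differentiable (at x)"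
proof -
  have *: "((\<lambda>x. f (u x)) has_derivative (\<lambda>h. f' * frechet_derivative u (at x) h)) (at x)"
    using has_derivative_compose[OF has_derivative_frechet[OF assms(1)]
        assms(2)[unfolded has_field_derivative_def]]
    by simp
  show "partial_derivative i (\<lambda>x. f (u x)) x = f' * partial_derivative i u x"
    using partial_derivative_eq[OF *] by (simp add: partial_derivative_def)
  show "(\<lambda>x. f (u x)) differentiable (at x)"
    using * differentiable_def by blast
qed

lemma partial_derivative_sum:
  assumes "finite J" "\<And>j. j \<in> J \<Longrightarrow> u j differentiable (at x)"
  shows "partial_derivative i (\<lambda>x. \<Sum>j\<in>J. u j x) x = (\<Sum>j\<in>J. partial_derivative i (u j) x)"
  by (subst partial_derivative_eq[OF has_derivative_sum[OF has_derivative_frechet[OF assms(2)]]])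
     (simp_all add: partial_derivative_def)

lemma partial_derivative_cmult:
  "u differentiable (at x) \<Longrightarrow> partial_derivative i (\<lambda>x. c * u x) x = c * partial_derivative i u x"
  by (subst partial_derivative_mult) simp_all

text \<open>The test functions below oscillate at a small scale \<open>r\<close>, and powers of the Laplacian of them have to be
  bounded uniformly in the position and in the scale. \<open>symb l k u\<close> says that a derivative of order
  \<open>m \<le> l\<close> of a member of the family \<open>u\<close> is at most a constant times \<open>r\<^bsup>-(k+m)\<^esup>\<close>. Multiplication by fixed smooth
  coefficients preserves such a bound, so it passes through any differential operator with smooth
  coefficients.\<close>

locale scaled_family =
  fixes I :: "'i set" and r :: "'i \<Rightarrow> real" and U :: "(real^'n::finite) set"
  assumes r_pos: "\<iota> \<in> I \<Longrightarrow> 0 < r \<iota>" and r_le_1: "\<iota> \<in> I \<Longrightarrow> r \<iota> \<le> 1" and open_U: "open U"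
begin

definition bnd :: "nat \<Rightarrow> ('i \<Rightarrow> real^'n \<Rightarrow> real) \<Rightarrow> bool"
  where "bnd k u \<longleftrightarrow>
    (\<forall>\<iota>\<in>I. continuous_on U (u \<iota>)) \<and> (\<exists>C\<ge>0. \<forall>\<iota>\<in>I. \<forall>x\<in>U. \<bar>u \<iota> x\<bar> \<le> C / r \<iota> ^ k)"

primrec symb :: "nat \<Rightarrow> nat \<Rightarrow> ('i \<Rightarrow> real^'n \<Rightarrow> real) \<Rightarrow> bool"
  where
    "symb 0 k u \<longleftrightarrow> bnd k u"
  | "symb (Suc l) k u \<longleftrightarrow> bnd k u \<and> (\<forall>\<iota>\<in>I. \<forall>x\<in>U. u \<iota> differentiable (at x)) \<and>
       (\<forall>i. symb l (Suc k) (\<lambda>\<iota>. partial_derivative i (u \<iota>)))"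

lemma bnd_cong:
  assumes "\<And>\<iota> x. \<iota> \<in> I \<Longrightarrow> x \<in> U \<Longrightarrow> u \<iota> x = v \<iota> x"
  shows "bnd k u \<longleftrightarrow> bnd k v"
  unfolding bnd_def using assms by (simp cong: continuous_on_cong)

lemma symb_cong:
  assumes "\<And>\<iota> x. \<iota> \<in> I \<Longrightarrow> x \<in> U \<Longrightarrow> u \<iota> x = v \<iota> x"
  shows "symb l k u \<longleftrightarrow> symb l k v"
  using assms
proof (induction l arbitrary: k u v)
  case 0
  show ?case unfolding symb.simps by (rule bnd_cong) (use 0 in simp)
next
  case (Suc l)
  have "(\<forall>\<iota>\<in>I. \<forall>x\<in>U. u \<iota> differentiable (at x)) \<longleftrightarrow> (\<forall>\<iota>\<in>I. \<forall>x\<in>U. v \<iota> differentiable (at x))"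
    using differentiable_cong_open[OF open_U] Suc.prems by metis
  moreover have "symb l (Suc k) (\<lambda>\<iota>. partial_derivative i (u \<iota>))
      \<longleftrightarrow> symb l (Suc k) (\<lambda>\<iota>. partial_derivative i (v \<iota>))" for i
    by (rule Suc.IH) (rule partial_derivative_cong[OF open_U]; use Suc.prems in auto)
  ultimately show ?case
    using bnd_cong[OF Suc.prems] by simp
qed

lemma symb_bnd: "symb l k u \<Longrightarrow> bnd k u"
  by (cases l) simp_all

lemma symb_Suc_imp: "symb (Suc l) k u \<Longrightarrow> symb l k u"
  by (induction l arbitrary: k u) simp_all

lemma symb_le: "symb l k u \<Longrightarrow> l' \<le> l \<Longrightarrow> symb l' k u"
proof (induction l)
  case (Suc l)
  then show ?case using symb_Suc_imp[of l k u] by (cases "l' = Suc l") simp_all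
qed simp

lemma symb_differentiable: "symb l k u \<Longrightarrow> 0 < l \<Longrightarrow> \<iota> \<in> I \<Longrightarrow> x \<in> U \<Longrightarrow> u \<iota> differentiable (at x)"
  by (cases l) simp_all

lemma symb_continuous: "symb l k u \<Longrightarrow> \<iota> \<in> I \<Longrightarrow> continuous_on U (u \<iota>)"
  using symb_bnd bnd_def by metis

lemma symb_partial: "symb (Suc l) k u \<Longrightarrow> symb l (Suc k) (\<lambda>\<iota>. partial_derivative i (u \<iota>))"
  by simp

lemma bnd_mono:
  assumes "bnd k u" "k \<le> k'"
  shows "bnd k' u"
proof -
  obtain C where C: "C \<ge> 0" "\<And>\<iota> x. \<iota> \<in> I \<Longrightarrow> x \<in> U \<Longrightarrow> \<bar>u \<iota> x\<bar> \<le> C / r \<iota> ^ k"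
    using assms(1) by (auto simp: bnd_def)
  have "\<bar>u \<iota> x\<bar> \<le> C / r \<iota> ^ k'" if "\<iota> \<in> I" "x \<in> U" for \<iota> x
  proof -
    have "r \<iota> ^ k' \<le> r \<iota> ^ k"
      using r_pos[OF that(1)] r_le_1[OF that(1)] assms(2) by (simp add: power_decreasing)
    then have "C / r \<iota> ^ k \<le> C / r \<iota> ^ k'"
      using C(1) r_pos[OF that(1)] by (intro divide_left_mono) simp_all
    then show ?thesis using C(2)[OF that] by simp
  qed
  then show ?thesis using assms(1) C(1) by (auto simp: bnd_def)
qed

lemma symb_zero: "symb l k (\<lambda>\<iota> x. 0)"
proof (induction l arbitrary: k)
  case 0
  show ?case by (auto simp: bnd_def intro!: exI[of _ 0])
next
  case (Suc l)
  have "bnd k (\<lambda>\<iota> x. 0)" by (auto simp: bnd_def intro!: exI[of _ 0])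
  then show ?case using Suc by simp
qed

lemma symb_const: "symb l k (\<lambda>\<iota> x. c)"
proof -
  have "bnd 0 (\<lambda>\<iota> x. c)" by (auto simp: bnd_def intro!: exI[of _ "\<bar>c\<bar>"])
  then have "bnd k (\<lambda>\<iota> x. c)" by (rule bnd_mono) simp
  then show ?thesis by (cases l) (simp_all add: symb_zero)
qed

lemma symb_add:
  assumes "symb l k u" "symb l k v"
  shows "symb l k (\<lambda>\<iota> x. u \<iota> x + v \<iota> x)"
  using assms
proof (induction l arbitrary: k u v)
  have *: "bnd k (\<lambda>\<iota> x. u \<iota> x + v \<iota> x)" if u: "bnd k u" and v: "bnd k v" for k u v
  proof -
    obtain C where C: "C \<ge> 0" "\<And>\<iota> x. \<iota> \<in> I \<Longrightarrow> x \<in> U \<Longrightarrow> \<bar>u \<iota> x\<bar> \<le> C / r \<iota> ^ k"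
      using u by (auto simp: bnd_def)
    obtain D where D: "D \<ge> 0" "\<And>\<iota> x. \<iota> \<in> I \<Longrightarrow> x \<in> U \<Longrightarrow> \<bar>v \<iota> x\<bar> \<le> D / r \<iota> ^ k"
      using v by (auto simp: bnd_def)
    have "\<bar>u \<iota> x + v \<iota> x\<bar> \<le> (C + D) / r \<iota> ^ k" if "\<iota> \<in> I" "x \<in> U" for \<iota> x
      using C(2)[OF that] D(2)[OF that] by (simp add: add_divide_distrib)
    moreover have "C + D \<ge> 0" using C D by simp
    ultimately have "\<exists>C\<ge>0. \<forall>\<iota>\<in>I. \<forall>x\<in>U. \<bar>u \<iota> x + v \<iota> x\<bar> \<le> C / r \<iota> ^ k" by blast
    then show ?thesis using u v by (auto simp: bnd_def intro: continuous_on_add)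
  qed
  case 0
  then show ?case using * by simp
next
  case (Suc l)
  have "symb l (Suc k) (\<lambda>\<iota>. partial_derivative i (\<lambda>x. u \<iota> x + v \<iota> x))" for i
  proof (subst symb_cong)
    show "symb l (Suc k) (\<lambda>\<iota> x. partial_derivative i (u \<iota>) x + partial_derivative i (v \<iota>) x)"
      using Suc by simp
  qed (use Suc.prems in \<open>simp add: partial_derivative_add\<close>)
  moreover have "bnd k (\<lambda>\<iota> x. u \<iota> x + v \<iota> x)"
    using Suc.IH[OF symb_Suc_imp symb_Suc_imp] Suc.prems symb_bnd by blast
  ultimately show ?case using Suc.prems by simp
qed

lemma bnd_mult:
  assumes u: "bnd k u" and v: "bnd k' v"
  shows "bnd (k + k') (\<lambda>\<iota> x. u \<iota> x * v \<iota> x)"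
proof -
  obtain C where C: "C \<ge> 0" "\<And>\<iota> x. \<iota> \<in> I \<Longrightarrow> x \<in> U \<Longrightarrow> \<bar>u \<iota> x\<bar> \<le> C / r \<iota> ^ k"
    using u by (auto simp: bnd_def)
  obtain D where D: "D \<ge> 0" "\<And>\<iota> x. \<iota> \<in> I \<Longrightarrow> x \<in> U \<Longrightarrow> \<bar>v \<iota> x\<bar> \<le> D / r \<iota> ^ k'"
    using v by (auto simp: bnd_def)
  have "\<bar>u \<iota> x * v \<iota> x\<bar> \<le> (C * D) / r \<iota> ^ (k + k')" if "\<iota> \<in> I" "x \<in> U" for \<iota> x
  proof -
    have "\<bar>u \<iota> x * v \<iota> x\<bar> \<le> (C / r \<iota> ^ k) * (D / r \<iota> ^ k')"
      unfolding abs_mult using C D r_pos[OF that(1)] that by (intro mult_mono) auto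
    then show ?thesis by (simp add: power_add)
  qed
  moreover have "C * D \<ge> 0" using C D by simp
  ultimately have "\<exists>C\<ge>0. \<forall>\<iota>\<in>I. \<forall>x\<in>U. \<bar>u \<iota> x * v \<iota> x\<bar> \<le> C / r \<iota> ^ (k + k')" by blast
  then show ?thesis using u v by (auto simp: bnd_def intro: continuous_on_mult)
qed

lemma symb_mult:
  assumes "symb l k u" "symb l k' v"
  shows "symb l (k + k') (\<lambda>\<iota> x. u \<iota> x * v \<iota> x)"
  using assms
proof (induction l arbitrary: k k' u v)
  case 0
  then show ?case using bnd_mult by simp
next
  case (Suc l)
  have "symb l (Suc (k + k')) (\<lambda>\<iota>. partial_derivative i (\<lambda>x. u \<iota> x * v \<iota> x))" for i
  proof (subst symb_cong)
    have "symb l (k + Suc k') (\<lambda>\<iota> x. u \<iota> x * partial_derivative i (v \<iota>) x)"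
      using Suc.IH[OF symb_Suc_imp[OF Suc.prems(1)] symb_partial[OF Suc.prems(2)]] .
    moreover have "symb l (Suc k + k') (\<lambda>\<iota> x. partial_derivative i (u \<iota>) x * v \<iota> x)"
      using Suc.IH[OF symb_partial[OF Suc.prems(1)] symb_Suc_imp[OF Suc.prems(2)]] .
    ultimately show "symb l (Suc (k + k')) (\<lambda>\<iota> x. u \<iota> x * partial_derivative i (v \<iota>) x
        + partial_derivative i (u \<iota>) x * v \<iota> x)"
      by (intro symb_add) simp_all
  qed (use Suc.prems in \<open>simp add: partial_derivative_mult\<close>)
  then show ?case using Suc.prems bnd_mult by simp
qed

lemma symb_cmult: "symb l k u \<Longrightarrow> symb l k (\<lambda>\<iota> x. c * u \<iota> x)"
  using symb_mult[OF symb_const[of l 0 c]] by simp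

lemma symb_sum:
  assumes "\<And>j. j \<in> J \<Longrightarrow> symb l k (u j)"
  shows "symb l k (\<lambda>\<iota> x. \<Sum>j\<in>J. u j \<iota> x)"
  using assms by (induction J rule: infinite_finite_induct) (simp_all add: symb_zero symb_add)

lemma symb_prod:
  assumes "\<And>j. j \<in> J \<Longrightarrow> symb l 0 (u j)"
  shows "symb l 0 (\<lambda>\<iota> x. \<Prod>j\<in>J. u j \<iota> x)"
  using assms
proof (induction J rule: infinite_finite_induct)
  case (insert j J)
  have "symb l (0 + 0) (\<lambda>\<iota> x. u j \<iota> x * (\<Prod>j\<in>J. u j \<iota> x))"
    using insert by (intro symb_mult) auto
  then show ?case using insert by simp
qed (simp_all add: symb_const)

text \<open>The derivative of \<open>1/a\<close> is \<open>- (1/a)\<^sup>2 \<partial>a\<close>, which is controlled by \<open>1/a\<close> itself at one order of differentiation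
  less; the lower bound for \<open>a\<close> starts the induction.\<close>

lemma symb_inverse:
  assumes "symb l 0 a" "\<delta> > 0" "\<And>\<iota> x. \<iota> \<in> I \<Longrightarrow> x \<in> U \<Longrightarrow> \<delta> \<le> a \<iota> x"
  shows "symb l 0 (\<lambda>\<iota> x. inverse (a \<iota> x))"
  using assms
proof (induction l)
  have pos: "0 < a \<iota> x" if "\<iota> \<in> I" "x \<in> U" for \<iota> x
    using assms that by force
  have b: "bnd 0 (\<lambda>\<iota> x. inverse (a \<iota> x))" if "symb 0 0 a"
  proof -
    have "\<bar>inverse (a \<iota> x)\<bar> \<le> inverse \<delta> / r \<iota> ^ 0" if "\<iota> \<in> I" "x \<in> U" for \<iota> x
      using assms(2) assms(3)[OF that] pos[OF that] by (simp add: le_imp_inverse_le)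
    moreover have "inverse \<delta> \<ge> 0" using assms by simp
    ultimately have "\<exists>C\<ge>0. \<forall>\<iota>\<in>I. \<forall>x\<in>U. \<bar>inverse (a \<iota> x)\<bar> \<le> C / r \<iota> ^ 0" by blast
    moreover have "continuous_on U (\<lambda>x. inverse (a \<iota> x))" if "\<iota> \<in> I" for \<iota>
      using \<open>symb 0 0 a\<close> that pos[OF that]
      by (intro continuous_on_inverse) (auto simp: bnd_def less_le)
    ultimately show ?thesis by (simp add: bnd_def)
  qed
  case 0
  then show ?case using b by simp
next
  case (Suc l)
  have pos: "0 < a \<iota> x" if "\<iota> \<in> I" "x \<in> U" for \<iota> x
    using assms that by force
  have der: "((\<lambda>y. inverse y) has_real_derivative - (inverse (a \<iota> x) * inverse (a \<iota> x))) (at (a \<iota> x))"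
    if "\<iota> \<in> I" "x \<in> U" for \<iota> x
    using pos[OF that] by (auto intro!: derivative_eq_intros)
  have da: "a \<iota> differentiable (at x)" if "\<iota> \<in> I" "x \<in> U" for \<iota> x
    using symb_differentiable[OF Suc.prems(1)] that by simp
  have IH: "symb l 0 (\<lambda>\<iota> x. inverse (a \<iota> x))"
    using Suc symb_Suc_imp by blast
  have "symb l (Suc 0) (\<lambda>\<iota>. partial_derivative i (\<lambda>x. inverse (a \<iota> x)))" for i
  proof (subst symb_cong)
    have "symb l (0 + 0 + Suc 0) (\<lambda>\<iota> x. (inverse (a \<iota> x) * inverse (a \<iota> x)) * partial_derivative i (a \<iota>) x)"
      using IH symb_partial[OF Suc.prems(1)] by (intro symb_mult)
    from symb_cmult[OF this, of "-1"]
    show "symb l (Suc 0) (\<lambda>\<iota> x. - (inverse (a \<iota> x) * inverse (a \<iota> x)) * partial_derivative i (a \<iota>) x)"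
      by simp
  qed (use partial_derivative_chain(1)[OF da der] in auto)
  moreover have "(\<lambda>x. inverse (a \<iota> x)) differentiable (at x)" if "\<iota> \<in> I" "x \<in> U" for \<iota> x
    using partial_derivative_chain(2)[OF da der] that by auto
  ultimately show ?case using symb_bnd[OF IH] by simp
qed

lemma symb_sqrt:
  assumes "symb l 0 a" "\<delta> > 0" "\<And>\<iota> x. \<iota> \<in> I \<Longrightarrow> x \<in> U \<Longrightarrow> \<delta> \<le> a \<iota> x"
  shows "symb l 0 (\<lambda>\<iota> x. sqrt (a \<iota> x))"
  using assms
proof (induction l)
  case 0
  obtain C where C: "C \<ge> 0" "\<And>\<iota> x. \<iota> \<in> I \<Longrightarrow> x \<in> U \<Longrightarrow> \<bar>a \<iota> x\<bar> \<le> C"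
    using 0 by (auto simp: bnd_def)
  have "\<bar>sqrt (a \<iota> x)\<bar> \<le> sqrt C" if "\<iota> \<in> I" "x \<in> U" for \<iota> x
    using C(2)[OF that] by (simp add: real_sqrt_abs2 abs_le_iff real_sqrt_minus[symmetric] del: real_sqrt_minus)
  then have "\<exists>C\<ge>0. \<forall>\<iota>\<in>I. \<forall>x\<in>U. \<bar>sqrt (a \<iota> x)\<bar> \<le> C / r \<iota> ^ 0"
    using C(1) by (intro exI[of _ "sqrt C"]) auto
  moreover have "continuous_on U (\<lambda>x. sqrt (a \<iota> x))" if "\<iota> \<in> I" for \<iota>
    using 0 that by (intro continuous_on_real_sqrt) (auto simp: bnd_def)
  ultimately show ?case by (simp add: bnd_def)
next
  case (Suc l)
  have pos: "0 < a \<iota> x" if "\<iota> \<in> I" "x \<in> U" for \<iota> x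
    using assms that by force
  have der: "(sqrt has_real_derivative inverse 2 * inverse (sqrt (a \<iota> x))) (at (a \<iota> x))"
    if "\<iota> \<in> I" "x \<in> U" for \<iota> x
    using pos[OF that] by (auto intro!: derivative_eq_intros)
  have da: "a \<iota> differentiable (at x)" if "\<iota> \<in> I" "x \<in> U" for \<iota> x
    using symb_differentiable[OF Suc.prems(1)] that by simp
  have IH: "symb l 0 (\<lambda>\<iota> x. sqrt (a \<iota> x))"
    using Suc symb_Suc_imp by blast
  have inv: "symb l 0 (\<lambda>\<iota> x. inverse (sqrt (a \<iota> x)))"
    using Suc.prems by (intro symb_inverse[OF IH, of "sqrt \<delta>"]) auto
  have "symb l (Suc 0) (\<lambda>\<iota>. partial_derivative i (\<lambda>x. sqrt (a \<iota> x)))" for i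
  proof (subst symb_cong)
    have "symb l (0 + Suc 0) (\<lambda>\<iota> x. (inverse 2 * inverse (sqrt (a \<iota> x))) * partial_derivative i (a \<iota>) x)"
      using symb_cmult[OF inv] symb_partial[OF Suc.prems(1)] by (intro symb_mult)
    then show "symb l (Suc 0) (\<lambda>\<iota> x. (inverse 2 * inverse (sqrt (a \<iota> x))) * partial_derivative i (a \<iota>) x)"
      by simp
  qed (use partial_derivative_chain(1)[OF da der] in auto)
  moreover have "(\<lambda>x. sqrt (a \<iota> x)) differentiable (at x)" if "\<iota> \<in> I" "x \<in> U" for \<iota> x
    using partial_derivative_chain(2)[OF da der] that by auto
  ultimately show ?case using symb_bnd[OF IH] by simp
qed

text \<open>A fixed smooth function is a scaled family on every relatively compact part of its domain, because
  \<open>r \<le> 1\<close>. The bounded linear map picks a component of a vector or of a matrix.\<close>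

lemma symb_fixed:
  fixes F :: "real^'n \<Rightarrow> 'b::real_normed_vector"
  assumes "C_k_on l S F" "bounded_linear T" "open S" "compact K" "U \<subseteq> K" "K \<subseteq> S"
  shows "symb l k (\<lambda>\<iota> x. T (F x))"
proof -
  have b: "bnd 0 (\<lambda>\<iota> x. T (F x))" if "continuous_on S F" for F :: "real^'n \<Rightarrow> 'b"
  proof -
    have cont: "continuous_on K (\<lambda>x. T (F x))"
      using bounded_linear.continuous_on[OF assms(2) continuous_on_subset[OF that assms(6)]] .
    then have "bounded ((\<lambda>x. T (F x)) ` K)"
      using assms(4) compact_continuous_image compact_imp_bounded by blast
    then obtain C where C: "C > 0" "\<And>x. x \<in> K \<Longrightarrow> \<bar>T (F x)\<bar> \<le> C"
      by (auto simp: bounded_pos)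
    have "\<exists>C\<ge>0. \<forall>\<iota>\<in>I. \<forall>x\<in>U. \<bar>T (F x)\<bar> \<le> C / r \<iota> ^ 0"
      using C assms(5) by (intro exI[of _ C]) auto
    then show ?thesis
      using continuous_on_subset[OF cont assms(5)] by (simp add: bnd_def)
  qed
  have "symb l k (\<lambda>\<iota> x. T (F x))"
    using assms(1)
  proof (induction l arbitrary: F k)
    case 0
    then show ?case using bnd_mono[OF b, of F k] by simp
  next
    case (Suc l)
    have dF: "F differentiable (at x)" if "x \<in> S" for x
      using Suc.prems that by simp
    have D: "((\<lambda>x. T (F x)) has_derivative (\<lambda>h. T (frechet_derivative F (at x) h))) (at x)"
      if "x \<in> S" for x
      using bounded_linear.has_derivative[OF assms(2)] dF[OF that] by (simp add: frechet_derivative_works)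
    have "continuous_on S F"
      using dF differentiable_imp_continuous_within continuous_at_imp_continuous_on by blast
    then have "bnd k (\<lambda>\<iota> x. T (F x))"
      using bnd_mono[OF b, of F k] by simp
    moreover have "(\<lambda>x. T (F x)) differentiable (at x)" if "x \<in> U" for x
      using D that assms differentiable_def by blast
    moreover have "symb l (Suc k) (\<lambda>\<iota>. partial_derivative i (\<lambda>x. T (F x)))" for i
    proof (subst symb_cong)
      show "symb l (Suc k) (\<lambda>\<iota> x. T (frechet_derivative F (at x) (axis i 1)))"
        using Suc by simp
    qed (use D partial_derivative_eq assms in blast)
    ultimately show ?case by simp
  qed
  then show ?thesis .
qed

end

section \<open>Integration by parts in coordinates\<close>

lemma continuous_on_of_differentiable:
  "(\<And>x. x \<in> S \<Longrightarrow> f differentiable (at x)) \<Longrightarrow> continuous_on S f"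
  by (simp add: differentiable_at_imp_differentiable_on differentiable_imp_continuous_on)

lemma partial_derivative_zero_off_closed:
  fixes u :: "real^'n::finite \<Rightarrow> real"
  assumes "closed K" "\<And>y. y \<notin> K \<Longrightarrow> u y = 0" "x \<notin> K"
  shows "partial_derivative i u x = 0"
proof -
  have "partial_derivative i u x = partial_derivative i (\<lambda>x. 0) x"
    by (rule partial_derivative_cong[of "- K"]) (use assms in auto)
  then show ?thesis by simp
qed

text \<open>The integral of a difference quotient vanishes by translation invariance of Lebesgue measure; the
  difference quotients are dominated by the mean value theorem, so their limit integrates to zero as
  well.\<close>

lemma integral_partial_derivative_zero:
  fixes f :: "real^'n::finite \<Rightarrow> real"
  assumes d: "\<And>x. f differentiable (at x)"
    and c: "continuous_on UNIV (partial_derivative i f)"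
    and z: "\<And>x. x \<notin> cbox a b \<Longrightarrow> f x = 0"
  shows "integral\<^sup>L lborel (partial_derivative i f) = 0"
proof -
  define e :: "real^'n" where "e = axis i 1"
  define D where "D = partial_derivative i f"
  have e: "norm e = 1" by (simp add: e_def)
  have D0: "D x = 0" if "x \<notin> cbox a b" for x
    unfolding D_def using partial_derivative_zero_off_closed[OF closed_cbox z that] .
  obtain M where M: "M \<ge> 0" "\<And>x. \<bar>D x\<bar> \<le> M"
  proof -
    have "bounded (D ` cbox a b)"
      using c continuous_on_subset compact_continuous_image compact_imp_bounded compact_cbox
      unfolding D_def by (metis subset_UNIV)
    then obtain M where "M > 0" "\<And>x. x \<in> cbox a b \<Longrightarrow> \<bar>D x\<bar> \<le> M"
      by (auto simp: bounded_pos)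
    then have "\<bar>D x\<bar> \<le> M" for x using D0 by (cases "x \<in> cbox a b") auto
    with \<open>M > 0\<close> show ?thesis using that[of M] by simp
  qed
  have cf: "continuous_on UNIV f"
    using d by (simp add: continuous_on_of_differentiable)
  then have [measurable]: "f \<in> borel_measurable borel"
    by (rule borel_measurable_continuous_onI)
  have intf: "integrable lborel f"
  proof -
    have "integrable lborel (\<lambda>x. indicator (cbox a b) x *\<^sub>R f x)"
      using cf continuous_on_subset by (intro borel_integrable_compact) auto
    moreover have "(\<lambda>x. indicator (cbox a b) x *\<^sub>R f x) = f"
      using z by (auto simp: indicator_def fun_eq_iff)
    ultimately show ?thesis by simp
  qed
  define t where "t k = 1 / real (Suc k)" for k
  have t: "0 < t k" "t k \<le> 1" for k by (auto simp: t_def)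
  have tlim: "t \<longlonglongrightarrow> 0"
    unfolding t_def using LIMSEQ_inverse_real_of_nat by (simp add: inverse_eq_divide)
  define q where "q k x = (f (x + t k *\<^sub>R e) - f x) / t k" for k x
  have [measurable]: "q k \<in> borel_measurable borel" for k
    unfolding q_def by measurable
  have line: "((\<lambda>s. f (x + s *\<^sub>R e)) has_real_derivative D (x + s *\<^sub>R e)) (at s)" for x s
  proof -
    have *: "(f has_derivative frechet_derivative f (at (x + s *\<^sub>R e))) (at (x + s *\<^sub>R e))"
      by (rule has_derivative_frechet[OF d])
    have "((\<lambda>s. x + s *\<^sub>R e) has_derivative (\<lambda>h. h *\<^sub>R e)) (at s)"
      by (auto intro!: derivative_eq_intros)
    from has_derivative_compose[OF this *] have "((\<lambda>s. f (x + s *\<^sub>R e)) has_derivative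
        (\<lambda>h. frechet_derivative f (at (x + s *\<^sub>R e)) (h *\<^sub>R e))) (at s)"
      .
    moreover have "frechet_derivative f (at (x + s *\<^sub>R e)) (h *\<^sub>R e) = D (x + s *\<^sub>R e) * h" for h
      using linear_frechet_derivative[OF d, of "x + s *\<^sub>R e"]
      by (simp add: linear_cmul D_def partial_derivative_def e_def)
    ultimately show ?thesis by (simp add: has_field_derivative_def)
  qed
  have qD: "\<exists>s. 0 < s \<and> s < t k \<and> q k x = D (x + s *\<^sub>R e)" for k x
  proof -
    obtain s where "0 < s" "s < t k" "f (x + t k *\<^sub>R e) - f (x + 0 *\<^sub>R e) = (t k - 0) * D (x + s *\<^sub>R e)"
      using MVT2[of 0 "t k" "\<lambda>s. f (x + s *\<^sub>R e)" "\<lambda>s. D (x + s *\<^sub>R e)"] line t(1) by blast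
    then show ?thesis using t(1)[of k] by (auto simp: q_def)
  qed
  have qint: "integral\<^sup>L lborel (q k) = 0" for k
  proof -
    have eq: "lborel = distr lborel borel ((+) (t k *\<^sub>R e))" by (simp add: lborel_distr_plus)
    have i: "integrable lborel (\<lambda>x. f (t k *\<^sub>R e + x))"
      using intf by (subst (asm) eq) (simp add: integrable_distr_eq)
    have "integral\<^sup>L lborel f = integral\<^sup>L lborel (\<lambda>x. f (t k *\<^sub>R e + x))"
      by (subst (1) eq) (simp add: integral_distr)
    then have "integral\<^sup>L lborel (\<lambda>x. f (t k *\<^sub>R e + x) - f x) = 0"
      using i intf by simp
    moreover have "q k = (\<lambda>x. (f (t k *\<^sub>R e + x) - f x) / t k)" by (auto simp: q_def add.commute)
    ultimately show ?thesis by simp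
  qed
  define o' :: "real^'n" where "o' = (\<chi> j. 1)"
  have dom: "\<bar>q k x\<bar> \<le> M * indicator (cbox (a - o') b) x" for k x
  proof (cases "x \<in> cbox (a - o') b")
    case True
    then show ?thesis using qD[of k x] M(2) by auto
  next
    case False
    obtain s where s: "0 < s" "s < t k" "q k x = D (x + s *\<^sub>R e)" using qD by blast
    have "x + s *\<^sub>R e \<notin> cbox a b"
    proof
      assume m: "x + s *\<^sub>R e \<in> cbox a b"
      have "(a - o') $ j \<le> x $ j \<and> x $ j \<le> b $ j" for j
        using m[unfolded mem_box_cart, rule_format, of j] s(1,2) t(2)[of k]
        by (auto simp: o'_def e_def axis_def split: if_splits)
      then show False using False by (simp add: mem_box_cart)
    qed
    then show ?thesis using s(3) D0 False by simp
  qed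
  have lim: "(\<lambda>k. q k x) \<longlonglongrightarrow> D x" for x
  proof -
    have "((\<lambda>h. (f (x + (0 + h) *\<^sub>R e) - f (x + 0 *\<^sub>R e)) / h) \<longlongrightarrow> D (x + 0 *\<^sub>R e)) (at 0)"
      using line[of x 0] by (simp add: DERIV_def)
    moreover have "filterlim t (at 0) sequentially"
      using tlim t(1) by (auto simp: filterlim_at less_imp_neq[symmetric] intro!: always_eventually)
    ultimately have "((\<lambda>k. (f (x + (0 + t k) *\<^sub>R e) - f (x + 0 *\<^sub>R e)) / t k) \<longlonglongrightarrow> D (x + 0 *\<^sub>R e))"
      by (rule filterlim_compose)
    then show ?thesis by (simp add: q_def)
  qed
  have [measurable]: "D \<in> borel_measurable borel"
    using c unfolding D_def by (rule borel_measurable_continuous_onI)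
  have "(\<lambda>k. integral\<^sup>L lborel (q k)) \<longlonglongrightarrow> integral\<^sup>L lborel D"
  proof (rule integral_dominated_convergence[where w = "\<lambda>x. M * indicator (cbox (a - o') b) x"])
    show "integrable lborel (\<lambda>x. M * indicator (cbox (a - o') b) x)"
      using emeasure_lborel_cbox_finite[of "a - o'" b]
      by (intro integrable_mult_right integrable_real_indicator) simp_all
  qed (use dom lim in auto)
  then show ?thesis using qint by (simp add: D_def LIMSEQ_const_iff)
qed

lemma set_integrable_compact_continuous:
  fixes f :: "real^'n::finite \<Rightarrow> real"
  assumes "compact S" "continuous_on S f"
  shows "set_integrable lborel S f"
  using borel_integrable_compact[OF assms] by (simp add: set_integrable_def)

text \<open>Only the product has to vanish outside the box, so that either factor may be the compactly supported one.\<close>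

lemma integral_by_parts_cbox:
  fixes u v :: "real^'n::finite \<Rightarrow> real"
  assumes U: "open U" "cbox a b \<subseteq> U"
    and d: "\<And>x. x \<in> U \<Longrightarrow> u differentiable (at x)" "\<And>x. x \<in> U \<Longrightarrow> v differentiable (at x)"
    and c: "continuous_on U (partial_derivative i u)" "continuous_on U (partial_derivative i v)"
    and z: "\<And>x. x \<in> U \<Longrightarrow> x \<notin> cbox a b \<Longrightarrow> u x * v x = 0"
  shows "(LINT x:cbox a b|lborel. partial_derivative i u x * v x)
    = - (LINT x:cbox a b|lborel. u x * partial_derivative i v x)"
proof -
  define \<Phi> where "\<Phi> x = (if x \<in> U then u x * v x else 0)" for x
  have z': "\<Phi> x = 0" if "x \<notin> cbox a b" for x using that z by (auto simp: \<Phi>_def)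
  have cu: "continuous_on U u" "continuous_on U v"
    using d by (simp_all add: continuous_on_of_differentiable)
  have pU: "partial_derivative i \<Phi> x = u x * partial_derivative i v x + partial_derivative i u x * v x"
    if "x \<in> U" for x
  proof -
    have "partial_derivative i \<Phi> x = partial_derivative i (\<lambda>x. u x * v x) x"
      by (rule partial_derivative_cong[OF U(1) that]) (simp add: \<Phi>_def)
    then show ?thesis using partial_derivative_mult d that by metis
  qed
  have p0: "partial_derivative i \<Phi> x = 0" if "x \<notin> cbox a b" for x
    by (rule partial_derivative_zero_off_closed[OF closed_cbox z' that])
  have "integral\<^sup>L lborel (partial_derivative i \<Phi>) = 0"
  proof (rule integral_partial_derivative_zero[OF _ _ z'])
    fix x
    show "\<Phi> differentiable (at x)"
    proof (cases "x \<in> U")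
      case True
      show ?thesis
        by (rule differentiable_cong_open[OF U(1) True, of "\<lambda>x. u x * v x"])
          (use True in \<open>auto simp: \<Phi>_def intro: differentiable_mult d\<close>)
    next
      case False
      then show ?thesis
        using U(2) z' by (intro differentiable_cong_open[of "- cbox a b" x "\<lambda>x. 0" \<Phi>]) auto
    qed
  next
    have "continuous_on (U \<union> - cbox a b) (partial_derivative i \<Phi>)"
    proof (rule continuous_on_open_Un)
      show "continuous_on U (partial_derivative i \<Phi>)"
        by (subst continuous_on_cong[OF refl pU]) (auto intro!: continuous_intros c cu)
      show "continuous_on (- cbox a b) (partial_derivative i \<Phi>)"
        by (subst continuous_on_cong[OF refl p0]) auto
    qed (use U in auto)
    moreover have "U \<union> - cbox a b = UNIV" using U(2) by auto
    ultimately show "continuous_on UNIV (partial_derivative i \<Phi>)" by simp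
  qed
  moreover have "integral\<^sup>L lborel (partial_derivative i \<Phi>)
      = (LINT x:cbox a b|lborel. u x * partial_derivative i v x + partial_derivative i u x * v x)"
    unfolding set_lebesgue_integral_def
    by (rule Bochner_Integration.integral_cong) (use p0 pU U(2) in \<open>auto simp: indicator_def\<close>)
  moreover have "\<dots> = (LINT x:cbox a b|lborel. u x * partial_derivative i v x)
      + (LINT x:cbox a b|lborel. partial_derivative i u x * v x)"
    by (rule set_integral_add)
      (auto intro!: set_integrable_compact_continuous continuous_intros continuous_on_subset[OF _ U(2)] c cu)
  ultimately show ?thesis by simp
qed


section \<open>Positive definite matrices\<close>

lemma invertible_pos_def:
  fixes A :: "real^'n::finite^'n"
  assumes "\<And>v. v \<noteq> 0 \<Longrightarrow> v \<bullet> (A *v v) > 0"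
  shows "invertible A"
proof -
  have "\<forall>x. A *v x = 0 \<longrightarrow> x = 0" using assms by (metis inner_zero_right less_irrefl)
  then show ?thesis
    using matrix_left_invertible_ker[of A] matrix_left_right_inverse unfolding invertible_def by metis
qed

lemma matrix_inv_left_right:
  fixes A :: "real^'n::finite^'n"
  assumes "invertible A"
  shows "A ** matrix_inv A = mat 1" "matrix_inv A ** A = mat 1"
  using someI_ex[OF assms[unfolded invertible_def]] by (simp_all add: matrix_inv_def)

lemma continuous_on_det:
  fixes M :: "'a::topological_space \<Rightarrow> real^'n::finite^'n"
  assumes "continuous_on S M"
  shows "continuous_on S (\<lambda>x. det (M x))"
  unfolding det_def by (intro continuous_intros assms)

text \<open>The determinant does not vanish on the segment from the identity matrix.\<close>

lemma det_pos_def: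
  fixes A :: "real^'n::finite^'n"
  assumes "\<And>v. v \<noteq> 0 \<Longrightarrow> v \<bullet> (A *v v) > 0"
  shows "det A > 0"
proof (rule ccontr)
  assume "\<not> det A > 0"
  define M where "M t = (1 - t) *\<^sub>R mat 1 + t *\<^sub>R A" for t :: real
  have "continuous_on {0..1} (\<lambda>t. det (M t))"
    unfolding M_def by (intro continuous_on_det continuous_intros)
  then obtain t where t: "0 \<le> t" "t \<le> 1" "det (M t) = 0"
    using IVT2'[of "\<lambda>t. det (M t)" 1 0 0] \<open>\<not> det A > 0\<close> by (auto simp: M_def)
  have "v \<bullet> (M t *v v) > 0" if "v \<noteq> 0" for v
  proof -
    have "v \<bullet> (M t *v v) = (1 - t) * (v \<bullet> v) + t * (v \<bullet> (A *v v))"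
      by (simp add: M_def matrix_vector_mult_add_rdistrib scaleR_matrix_vector_assoc[symmetric] inner_add_right)
    moreover have "(1 - t) * (v \<bullet> v) + t * (v \<bullet> (A *v v)) > 0"
      using t assms[OF that] that
      by (cases "t = 1") (auto intro!: add_pos_nonneg)
    ultimately show ?thesis by simp
  qed
  then have "invertible (M t)" by (rule invertible_pos_def)
  then show False using t(3) by (simp add: invertible_det_nz)
qed

text \<open>Cramer's rule turns regularity of the entries of a matrix into regularity of the entries of its inverse.\<close>

lemma matrix_inv_cramer:
  fixes A :: "real^'n::finite^'n"
  assumes "invertible A"
  shows "matrix_inv A $ k $ j = det (\<chi> i l. if l = k then axis j 1 $ i else A $ i $ l) / det A"
proof -
  have "A *v (matrix_inv A *v axis j 1) = axis j 1"
    by (metis assms matrix_inv_left_right(1) matrix_vector_mul_assoc matrix_vector_mul_lid)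
  then have "matrix_inv A *v axis j 1
      = (\<chi> k. det (\<chi> i l. if l = k then axis j 1 $ i else A $ i $ l) / det A)"
    using cramer assms invertible_det_nz by blast
  moreover have "(matrix_inv A *v axis j 1) $ k = matrix_inv A $ k $ j"
    by (simp add: matrix_vector_mult_basis column_def)
  ultimately show ?thesis by simp
qed

lemma matrix_inv_symmetric:
  fixes A :: "real^'n::finite^'n"
  assumes "invertible A" "transpose A = A"
  shows "matrix_inv A $ i $ j = matrix_inv A $ j $ i"
proof -
  have "transpose (matrix_inv A) ** A = mat 1"
    using arg_cong[OF matrix_inv_left_right(1)[OF assms(1)], of transpose]
    by (simp add: matrix_transpose_mul transpose_mat assms(2))
  then have "transpose (matrix_inv A) = matrix_inv A"
    using matrix_inv_left_right(1)[OF assms(1)] by (metis matrix_mul_assoc matrix_mul_lid matrix_mul_rid)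
  then have "transpose (matrix_inv A) $ i $ j = matrix_inv A $ i $ j" by simp
  then show ?thesis by (simp add: transpose_def)
qed

lemma matrix_inv_pos_def:
  fixes A :: "real^'n::finite^'n"
  assumes "\<And>v. v \<noteq> 0 \<Longrightarrow> v \<bullet> (A *v v) > 0" "v \<noteq> 0"
  shows "v \<bullet> (matrix_inv A *v v) > 0"
proof -
  define w where "w = matrix_inv A *v v"
  have v: "v = A *v w"
    by (metis assms(1) invertible_pos_def matrix_inv_left_right(1) matrix_vector_mul_assoc matrix_vector_mul_lid w_def)
  then have "w \<noteq> 0" using assms(2) by auto
  then show ?thesis using assms(1) v w_def by (metis inner_commute)
qed

section \<open>The Laplacian in coordinates\<close>

definition flux :: "(real^'n::finite \<Rightarrow> real^'n^'n) \<Rightarrow> (real^'n \<Rightarrow> real) \<Rightarrow> 'n \<Rightarrow> real^'n \<Rightarrow> real"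
  where "flux g u i x =
    sqrt (det (g x)) * (\<Sum>j\<in>UNIV. matrix_inv (g x) $ i $ j * partial_derivative j u x)"

definition lap :: "(real^'n::finite \<Rightarrow> real^'n^'n) \<Rightarrow> (real^'n \<Rightarrow> real) \<Rightarrow> real^'n \<Rightarrow> real"
  where "lap g u x = (\<Sum>i\<in>UNIV. partial_derivative i (flux g u i) x) / sqrt (det (g x))"

definition grad_inner ::
  "(real^'n::finite \<Rightarrow> real^'n^'n) \<Rightarrow> (real^'n \<Rightarrow> real) \<Rightarrow> (real^'n \<Rightarrow> real) \<Rightarrow> real^'n \<Rightarrow> real"
  where "grad_inner g u v x = (\<chi> i. partial_derivative i u x) \<bullet>
    (matrix_inv (g x) *v (\<chi> j. partial_derivative j v x))"

lemma laplacian_in_chart_eq: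
  "laplacian_in_chart G c f p = lap (G c) (\<lambda>x. f (chart_inv c x)) (chart_map c p)"
  by (simp add: laplacian_in_chart_def lap_def flux_def[abs_def] Let_def)

lemma sum_flux_partial:
  "(\<Sum>i\<in>UNIV. flux g u i x * partial_derivative i v x) = sqrt (det (g x)) * grad_inner g v u x"
  by (simp add: flux_def grad_inner_def inner_vec_def matrix_vector_mult_def sum_distrib_left
      sum_distrib_right mult_ac)

lemma flux_zero_off_closed:
  assumes "closed K" "\<And>y. y \<notin> K \<Longrightarrow> u y = 0" "x \<notin> K"
  shows "flux g u i x = 0"
  using partial_derivative_zero_off_closed[OF assms] by (simp add: flux_def)

lemma lap_zero_off_closed:
  assumes "closed K" "\<And>y. y \<notin> K \<Longrightarrow> u y = 0" "x \<notin> K"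
  shows "lap g u x = 0"
  using partial_derivative_zero_off_closed[OF assms(1) flux_zero_off_closed[OF assms(1,2)] assms(3)]
  by (simp add: lap_def)

lemma lap_pow_zero_off_closed:
  assumes "closed K" "\<And>y. y \<notin> K \<Longrightarrow> u y = 0" "x \<notin> K"
  shows "(lap g ^^ m) u x = 0"
  using assms(2,3)
proof (induction m arbitrary: x)
  case (Suc m)
  then show ?case using lap_zero_off_closed[OF assms(1), of "(lap g ^^ m) u"] by simp
qed simp

lemma set_integral_finite_sum:
  fixes f :: "'i \<Rightarrow> 'a \<Rightarrow> real"
  assumes "finite J" "\<And>i. i \<in> J \<Longrightarrow> set_integrable M A (f i)"
  shows "(LINT x:A|M. (\<Sum>i\<in>J. f i x)) = (\<Sum>i\<in>J. LINT x:A|M. f i x)"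
  unfolding set_lebesgue_integral_def scaleR_sum_right
  by (rule Bochner_Integration.integral_sum) (use assms in \<open>simp add: set_integrable_def\<close>)

locale coord_metric =
  fixes \<Omega> :: "(real^'n::finite) set" and g :: "real^'n \<Rightarrow> real^'n^'n"
  assumes open_\<Omega>: "open \<Omega>"
    and smooth_g: "smooth_on \<Omega> g"
    and sym_g: "x \<in> \<Omega> \<Longrightarrow> transpose (g x) = g x"
    and pos_g: "x \<in> \<Omega> \<Longrightarrow> v \<noteq> 0 \<Longrightarrow> v \<bullet> (g x *v v) > 0"
begin

lemma invertible_g: "x \<in> \<Omega> \<Longrightarrow> invertible (g x)"
  using invertible_pos_def pos_g by blast

lemma det_g_pos: "x \<in> \<Omega> \<Longrightarrow> det (g x) > 0"
  using det_pos_def pos_g by blast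

lemma continuous_g: "continuous_on \<Omega> g"
  using smooth_g unfolding smooth_on_def by (metis C_k_on.simps(1))

lemma continuous_sqrt_det: "continuous_on \<Omega> (\<lambda>x. sqrt (det (g x)))"
  by (intro continuous_on_real_sqrt continuous_on_det continuous_g)

lemma continuous_matrix_inv: "continuous_on \<Omega> (\<lambda>x. matrix_inv (g x))"
proof -
  have "continuous_on \<Omega> (\<lambda>x. matrix_inv (g x) $ k $ j)" for k j
  proof -
    have "continuous_on \<Omega> (\<lambda>x. det (\<chi> i l. if l = k then axis j 1 $ i else g x $ i $ l) / det (g x))"
    proof (intro continuous_on_divide continuous_on_det continuous_g)
      have "continuous_on \<Omega> (\<lambda>x. if l = k then axis j (1::real) $ i else g x $ i $ l)" for i l
        by (cases "l = k") (auto intro!: continuous_intros continuous_g)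
      then show "continuous_on \<Omega> (\<lambda>x. (\<chi> i l. if l = k then axis j 1 $ i else g x $ i $ l)::real^'n^'n)"
        by (intro continuous_on_vec_lambda)
    qed (use det_g_pos in force)
    then show ?thesis
      using matrix_inv_cramer[OF invertible_g] by (simp cong: continuous_on_cong)
  qed
  then have "continuous_on \<Omega> (\<lambda>x. \<chi> k j. matrix_inv (g x) $ k $ j)"
    by (intro continuous_on_vec_lambda)
  then show ?thesis by simp
qed

lemma grad_inner_commute:
  assumes "x \<in> \<Omega>"
  shows "grad_inner g u v x = grad_inner g v u x"
proof -
  have "transpose (matrix_inv (g x)) = matrix_inv (g x)"
    using matrix_inv_symmetric[OF invertible_g sym_g] assms by (simp add: transpose_def vec_eq_iff)
  then show ?thesis
    unfolding grad_inner_def by (metis dot_lmul_matrix inner_commute vector_transpose_matrix)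
qed

lemma grad_inner_nonneg: "x \<in> \<Omega> \<Longrightarrow> grad_inner g u u x \<ge> 0"
  unfolding grad_inner_def
  using matrix_inv_pos_def[OF pos_g, of x "\<chi> i. partial_derivative i u x"]
  by (cases "(\<chi> i. partial_derivative i u x) = 0") (auto simp: less_imp_le)

text \<open>The quadratic form of the inverse metric is continuous and positive on the product of the unit sphere
  and \<open>K\<close>, which is compact, so it has a positive minimum \<open>\<epsilon>\<close> there.\<close>

lemma ellipticity:
  assumes "compact K" "K \<subseteq> \<Omega>"
  obtains \<epsilon> where "\<epsilon> > 0"
    "\<And>x u. x \<in> K \<Longrightarrow> \<epsilon> * (\<Sum>i\<in>UNIV. (partial_derivative i u x)\<^sup>2) \<le> grad_inner g u u x"
proof (cases "K = {}")
  case True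
  then show ?thesis using that[of 1] by simp
next
  case False
  define h where "h = (\<lambda>(v::real^'n, x). v \<bullet> (matrix_inv (g x) *v v))"
  have comp: "compact (sphere (0::real^'n) 1 \<times> K)" "sphere (0::real^'n) 1 \<times> K \<noteq> {}"
    using assms False by (simp_all add: compact_Times)
  have "continuous_on K (\<lambda>x. matrix_inv (g x))"
    using continuous_matrix_inv assms(2) continuous_on_subset by blast
  then have "continuous_on (sphere 0 1 \<times> K) (\<lambda>p. matrix_inv (g (snd p)))"
    by (rule continuous_on_compose2) (auto intro: continuous_intros)
  then have "continuous_on (sphere 0 1 \<times> K) h"
    unfolding h_def case_prod_beta inner_vec_def matrix_vector_mult_def vec_lambda_beta inner_real_def
    by (intro continuous_intros)
  then obtain p where p: "p \<in> sphere 0 1 \<times> K" "\<And>q. q \<in> sphere 0 1 \<times> K \<Longrightarrow> h p \<le> h q"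
    using continuous_attains_inf[OF comp] by metis
  have "h p > 0"
  proof -
    have "snd p \<in> \<Omega>" "fst p \<noteq> 0" using p(1) assms(2) by auto
    then have "fst p \<bullet> (matrix_inv (g (snd p)) *v fst p) > 0"
      by (intro matrix_inv_pos_def pos_g)
    then show ?thesis by (simp add: h_def case_prod_beta)
  qed
  moreover have "h p * (\<Sum>i\<in>UNIV. (partial_derivative i u x)\<^sup>2) \<le> grad_inner g u u x" if "x \<in> K" for u x
  proof -
    define \<xi> :: "real^'n" where "\<xi> = (\<chi> i. partial_derivative i u x)"
    have n: "(\<Sum>i\<in>UNIV. (partial_derivative i u x)\<^sup>2) = (norm \<xi>)\<^sup>2"
      by (simp add: \<xi>_def norm_eq_sqrt_inner inner_vec_def power2_eq_square sum_nonneg)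
    have e: "grad_inner g u u x = \<xi> \<bullet> (matrix_inv (g x) *v \<xi>)"
      by (simp add: grad_inner_def \<xi>_def)
    show ?thesis
    proof (cases "\<xi> = 0")
      case False
      define \<eta> where "\<eta> = inverse (norm \<xi>) *\<^sub>R \<xi>"
      have \<xi>: "\<xi> = norm \<xi> *\<^sub>R \<eta>" using False by (simp add: \<eta>_def)
      have "h p \<le> \<eta> \<bullet> (matrix_inv (g x) *v \<eta>)"
        using p(2)[of "(\<eta>, x)"] that False by (simp add: h_def \<eta>_def)
      then have "(norm \<xi>)\<^sup>2 * h p \<le> (norm \<xi>)\<^sup>2 * (\<eta> \<bullet> (matrix_inv (g x) *v \<eta>))"
        by (intro mult_left_mono) auto
      also have "\<dots> = \<xi> \<bullet> (matrix_inv (g x) *v \<xi>)"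
        by (simp add: \<eta>_def matrix_vector_mult_scaleR power2_eq_square field_simps False)
      finally show ?thesis by (simp add: n e mult.commute)
    qed (simp add: n e)
  qed
  ultimately show ?thesis using that by blast
qed

end

text \<open>The compact set between the region of the scaled family and the domain of the metric makes the coefficients
  of the Laplacian uniformly bounded, together with their derivatives and with \<open>1 / det g\<close>.\<close>

locale metric_patch = scaled_family I r U + coord_metric \<Omega> g
  for I :: "'i set" and r :: "'i \<Rightarrow> real" and U :: "(real^'n::finite) set" and \<Omega> g +
  fixes K :: "(real^'n) set"
  assumes compact_K: "compact K" and U_K: "U \<subseteq> K" and K_\<Omega>: "K \<subseteq> \<Omega>"
begin

lemma symb_smooth: "smooth_on \<Omega> h \<Longrightarrow> symb l k (\<lambda>\<iota>. h)" for h :: "real^'n \<Rightarrow> real"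
  using symb_fixed[of l \<Omega> h "\<lambda>x. x" K k] open_\<Omega> compact_K U_K K_\<Omega>
  by (simp add: smooth_on_def bounded_linear_ident)

lemma symb_g: "symb l 0 (\<lambda>\<iota> x. g x $ i $ j)"
  using symb_fixed[of l \<Omega> g "\<lambda>A. A $ i $ j" K 0] smooth_g open_\<Omega> compact_K U_K K_\<Omega>
  by (simp add: smooth_on_def bounded_linear_compose[OF bounded_linear_vec_nth bounded_linear_vec_nth])

lemma symb_det:
  assumes "\<And>i j. symb l 0 (\<lambda>\<iota> x. M x $ i $ j)"
  shows "symb l 0 (\<lambda>\<iota> x. det (M x))"
  unfolding det_def by (intro symb_sum symb_cmult symb_prod assms)

lemma det_lower_bound: "\<exists>\<delta>>0. \<forall>x\<in>U. \<delta> \<le> det (g x)"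
proof (cases "K = {}")
  case False
  have "continuous_on K (\<lambda>x. det (g x))"
    using continuous_on_det[OF continuous_g] K_\<Omega> continuous_on_subset by blast
  then obtain y where "y \<in> K" "\<And>x. x \<in> K \<Longrightarrow> det (g y) \<le> det (g x)"
    using continuous_attains_inf[OF compact_K False] by metis
  then show ?thesis using det_g_pos K_\<Omega> U_K by blast
qed (use U_K in \<open>auto intro: exI[of _ 1]\<close>)

lemma symb_sqrt_det: "symb l 0 (\<lambda>\<iota> x. sqrt (det (g x)))"
  using det_lower_bound symb_sqrt[OF symb_det[OF symb_g]] by blast

lemma symb_inverse_sqrt_det: "symb l 0 (\<lambda>\<iota> x. inverse (sqrt (det (g x))))"
proof -
  obtain \<delta> where \<delta>: "\<delta> > 0" "\<forall>x\<in>U. \<delta> \<le> det (g x)" using det_lower_bound by blast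
  show ?thesis
    by (rule symb_inverse[OF symb_sqrt_det, of "sqrt \<delta>"]) (use \<delta> in auto)
qed

lemma symb_matrix_inv: "symb l 0 (\<lambda>\<iota> x. matrix_inv (g x) $ k $ j)"
proof (subst symb_cong)
  obtain \<delta> where \<delta>: "\<delta> > 0" "\<forall>x\<in>U. \<delta> \<le> det (g x)" using det_lower_bound by blast
  have inv: "symb l 0 (\<lambda>\<iota> x. inverse (det (g x)))"
    by (rule symb_inverse[OF symb_det[OF symb_g] \<delta>(1)]) (use \<delta> in auto)
  have "symb l 0 (\<lambda>\<iota> x. (\<chi> i l. if l = k then axis j 1 $ i else g x $ i $ l) $ i' $ l')" for i' l'
    by (cases "l' = k") (simp_all add: symb_const symb_g)
  then have "symb l 0 (\<lambda>\<iota> x. det (\<chi> i l. if l = k then axis j 1 $ i else g x $ i $ l))"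
    by (intro symb_det)
  from symb_mult[OF this inv]
  show "symb l 0 (\<lambda>\<iota> x. det (\<chi> i l. if l = k then axis j 1 $ i else g x $ i $ l) * inverse (det (g x)))"
    by simp
qed (use matrix_inv_cramer[OF invertible_g] U_K K_\<Omega> in \<open>simp add: divide_inverse subset_iff\<close>)

lemma symb_flux:
  assumes "symb (Suc l) k u"
  shows "symb l (Suc k) (\<lambda>\<iota>. flux g (u \<iota>) i)"
proof -
  have "symb l (0 + Suc k) (\<lambda>\<iota> x. matrix_inv (g x) $ i $ j * partial_derivative j (u \<iota>) x)" for j
    by (intro symb_mult symb_matrix_inv symb_partial assms)
  then have "symb l (0 + Suc k) (\<lambda>\<iota> x. sqrt (det (g x)) *
      (\<Sum>j\<in>UNIV. matrix_inv (g x) $ i $ j * partial_derivative j (u \<iota>) x))"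
    by (intro symb_mult symb_sqrt_det symb_sum) simp
  then show ?thesis by (simp add: flux_def[abs_def])
qed

lemma symb_lap:
  assumes "symb (l + 2) k u"
  shows "symb l (k + 2) (\<lambda>\<iota>. lap g (u \<iota>))"
proof -
  have "symb l (Suc (Suc k)) (\<lambda>\<iota> x. partial_derivative i (flux g (u \<iota>) i) x)" for i
    using assms by (intro symb_partial symb_flux) (simp add: numeral_2_eq_2 del: symb.simps)
  then have "symb l (Suc (Suc k) + 0)
      (\<lambda>\<iota> x. (\<Sum>i\<in>UNIV. partial_derivative i (flux g (u \<iota>) i) x) * inverse (sqrt (det (g x))))"
    by (intro symb_mult symb_inverse_sqrt_det symb_sum)
  then show ?thesis by (simp add: lap_def[abs_def] divide_inverse)
qed

lemma symb_lap_pow: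
  assumes "symb (l + 2 * m) k u"
  shows "symb l (k + 2 * m) (\<lambda>\<iota>. (lap g ^^ m) (u \<iota>))"
  using assms
proof (induction m arbitrary: l)
  case (Suc m)
  have "symb (l + 2) (k + 2 * m) (\<lambda>\<iota>. (lap g ^^ m) (u \<iota>))"
    using Suc.IH[of "l + 2"] Suc.prems by (simp add: add.assoc add.commute del: symb.simps)
  from symb_lap[OF this] show ?case by (simp add: ac_simps del: symb.simps)
qed simp

text \<open>The boundary term contains the product of the flux of \<open>u\<close> with \<open>v\<close>. Asking only for this product to vanish
  outside the box allows either function to be the compactly supported one, which is what makes the symmetric
  form of the formula below a consequence.\<close>

lemma green_coord:
  assumes u: "symb 2 k u" and v: "symb 1 k' v" and \<iota>: "\<iota> \<in> I" and U: "cbox a b \<subseteq> U"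
    and z: "\<And>i x. x \<in> U \<Longrightarrow> x \<notin> cbox a b \<Longrightarrow> flux g (u \<iota>) i x * v \<iota> x = 0"
  shows "(LINT x:cbox a b|lborel. sqrt (det (g x)) * (lap g (u \<iota>) x * v \<iota> x))
    = - (LINT x:cbox a b|lborel. sqrt (det (g x)) * grad_inner g (u \<iota>) (v \<iota>) x)"
proof -
  have fl: "symb 1 (Suc k) (\<lambda>\<iota>. flux g (u \<iota>) i)" for i
    using symb_flux[of 1 k u] u by (simp add: numeral_2_eq_2)
  have d: "flux g (u \<iota>) i differentiable (at x)" "v \<iota> differentiable (at x)" if "x \<in> U" for x i
    using symb_differentiable[OF fl] symb_differentiable[OF v] \<iota> that by simp_all
  have c: "continuous_on U (partial_derivative i (flux g (u \<iota>) i))"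
    "continuous_on U (partial_derivative i (v \<iota>))" for i
    using symb_continuous[OF symb_partial[of 0 "Suc k" "\<lambda>\<iota>. flux g (u \<iota>) i"] \<iota>, of i] fl[of i]
      symb_continuous[OF symb_partial[of 0 k' v] \<iota>, of i] v
    by (simp_all del: symb.simps flip: One_nat_def)
  have cu: "continuous_on U (flux g (u \<iota>) i)" "continuous_on U (v \<iota>)" for i
    using symb_continuous[OF fl \<iota>] symb_continuous[OF v \<iota>] by simp_all
  have int1: "set_integrable lborel (cbox a b) (\<lambda>x. partial_derivative i (flux g (u \<iota>) i) x * v \<iota> x)" for i
    by (intro set_integrable_compact_continuous continuous_intros continuous_on_subset[OF _ U] c cu compact_cbox)
  have int2: "set_integrable lborel (cbox a b) (\<lambda>x. flux g (u \<iota>) i x * partial_derivative i (v \<iota>) x)" for i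
    by (intro set_integrable_compact_continuous continuous_intros continuous_on_subset[OF _ U] c cu compact_cbox)
  have pos: "sqrt (det (g x)) \<noteq> 0" if "x \<in> cbox a b" for x
    using that U U_K K_\<Omega> det_g_pos by force
  have "(LINT x:cbox a b|lborel. sqrt (det (g x)) * (lap g (u \<iota>) x * v \<iota> x))
      = (LINT x:cbox a b|lborel. (\<Sum>i\<in>UNIV. partial_derivative i (flux g (u \<iota>) i) x * v \<iota> x))"
    by (intro set_lebesgue_integral_cong) (use pos in \<open>auto simp: lap_def sum_distrib_right\<close>)
  also have "\<dots> = (\<Sum>i\<in>UNIV. LINT x:cbox a b|lborel. partial_derivative i (flux g (u \<iota>) i) x * v \<iota> x)"
    by (intro set_integral_finite_sum int1) simp
  also have "\<dots> = (\<Sum>i\<in>UNIV. - (LINT x:cbox a b|lborel. flux g (u \<iota>) i x * partial_derivative i (v \<iota>) x))"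
    by (intro sum.cong refl integral_by_parts_cbox[OF open_U U] d c z)
  also have "\<dots> = - (LINT x:cbox a b|lborel. (\<Sum>i\<in>UNIV. flux g (u \<iota>) i x * partial_derivative i (v \<iota>) x))"
    by (subst set_integral_finite_sum[OF _ int2]) (simp_all add: sum_negf)
  also have "(LINT x:cbox a b|lborel. (\<Sum>i\<in>UNIV. flux g (u \<iota>) i x * partial_derivative i (v \<iota>) x))
      = (LINT x:cbox a b|lborel. sqrt (det (g x)) * grad_inner g (u \<iota>) (v \<iota>) x)"
    by (intro set_lebesgue_integral_cong)
      (use U U_K K_\<Omega> in \<open>auto simp: sum_flux_partial subset_iff grad_inner_commute\<close>)
  finally show ?thesis .
qed

lemma green_coord_symmetric:
  assumes u: "symb 2 k u" and v: "symb 2 k' v" and \<iota>: "\<iota> \<in> I" and U: "cbox a b \<subseteq> U"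
    and z: "\<And>x. x \<notin> cbox a b \<Longrightarrow> u \<iota> x = 0"
  shows "(LINT x:cbox a b|lborel. sqrt (det (g x)) * (lap g (u \<iota>) x * v \<iota> x))
    = (LINT x:cbox a b|lborel. sqrt (det (g x)) * (u \<iota> x * lap g (v \<iota>) x))"
proof -
  have 1: "symb 1 k u" "symb 1 k' v" using u v symb_le by (metis one_le_numeral)+
  have "(LINT x:cbox a b|lborel. sqrt (det (g x)) * (lap g (u \<iota>) x * v \<iota> x))
      = - (LINT x:cbox a b|lborel. sqrt (det (g x)) * grad_inner g (u \<iota>) (v \<iota>) x)"
    by (rule green_coord[OF u 1(2) \<iota> U]) (use flux_zero_off_closed[OF closed_cbox, of a b "u \<iota>"] z in simp)
  also have "\<dots> = - (LINT x:cbox a b|lborel. sqrt (det (g x)) * grad_inner g (v \<iota>) (u \<iota>) x)"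
    by (intro arg_cong[of _ _ uminus] set_lebesgue_integral_cong)
      (use U U_K K_\<Omega> in \<open>auto simp: subset_iff grad_inner_commute\<close>)
  also have "\<dots> = (LINT x:cbox a b|lborel. sqrt (det (g x)) * (lap g (v \<iota>) x * u \<iota> x))"
    by (rule green_coord[OF v 1(1) \<iota> U, symmetric]) (use z in simp)
  finally show ?thesis by (simp add: mult_ac)
qed

lemma green_coord_pow:
  assumes u: "symb (2 * m) k u" and h: "smooth_on \<Omega> h" and \<iota>: "\<iota> \<in> I" and U: "cbox a b \<subseteq> U"
    and z: "\<And>x. x \<notin> cbox a b \<Longrightarrow> u \<iota> x = 0"
    and eig: "\<And>x. x \<in> cbox a b \<Longrightarrow> lap g h x = - \<theta> * h x"
  shows "(LINT x:cbox a b|lborel. sqrt (det (g x)) * ((lap g ^^ m) (u \<iota>) x * h x))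
    = (- \<theta>) ^ m * (LINT x:cbox a b|lborel. sqrt (det (g x)) * (u \<iota> x * h x))"
  using u
proof (induction m)
  case (Suc m)
  have s: "symb 2 (k + 2 * m) (\<lambda>\<iota>. (lap g ^^ m) (u \<iota>))"
    using Suc.prems by (intro symb_lap_pow) (simp del: symb.simps)
  have "(LINT x:cbox a b|lborel. sqrt (det (g x)) * (lap g ((lap g ^^ m) (u \<iota>)) x * h x))
      = (LINT x:cbox a b|lborel. sqrt (det (g x)) * ((lap g ^^ m) (u \<iota>) x * lap g h x))"
    by (rule green_coord_symmetric[OF s symb_smooth[OF h] \<iota> U])
      (rule lap_pow_zero_off_closed[OF closed_cbox z])
  also have "\<dots> = (LINT x:cbox a b|lborel. - \<theta> * (sqrt (det (g x)) * ((lap g ^^ m) (u \<iota>) x * h x)))"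
    by (intro set_lebesgue_integral_cong) (auto simp: eig mult_ac)
  also have "\<dots> = - \<theta> * (LINT x:cbox a b|lborel. sqrt (det (g x)) * ((lap g ^^ m) (u \<iota>) x * h x))"
    by (rule set_integral_mult_right)
  also have "\<dots> = - \<theta> * ((- \<theta>) ^ m * (LINT x:cbox a b|lborel. sqrt (det (g x)) * (u \<iota> x * h x)))"
    using Suc.IH symb_le[OF Suc.prems, of "2 * m"] by simp
  finally show ?case by simp
qed simp

end

section \<open>Bump functions\<close>

text \<open>Finitely many derivatives suffice, so a bump can be a power of \<open>1 - y\<^sup>2\<close> cut off at \<open>\<plusminus>1\<close>. The polynomial
  factor makes the class closed under differentiation.\<close>

definition poly_bump :: "real poly \<Rightarrow> nat \<Rightarrow> real \<Rightarrow> real"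
  where "poly_bump p K y = poly p y * (max 0 (1 - y\<^sup>2)) ^ K"

lemma poly_bump_zero: "\<bar>y\<bar> \<ge> 1 \<Longrightarrow> K \<ge> 1 \<Longrightarrow> poly_bump p K y = 0"
  using abs_square_less_1[of y] by (simp add: poly_bump_def max_def)

text \<open>At the kink \<open>t = 0\<close> the difference quotient is at most \<open>\<bar>h\<bar>\<^bsup>K-1\<^esup>\<close> in absolute value.\<close>

lemma has_derivative_max_power:
  assumes "K \<ge> 2"
  shows "((\<lambda>t. (max 0 t) ^ K) has_real_derivative real K * (max 0 t) ^ (K - 1)) (at t)"
proof (cases "t = 0")
  case True
  have "((\<lambda>h. ((max 0 (0 + h)) ^ K - (max 0 0) ^ K) / h) \<longlongrightarrow> (0::real)) (at 0)"
  proof (rule Lim_null_comparison)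
    show "\<forall>\<^sub>F h in at (0::real). norm (((max 0 (0 + h)) ^ K - (max 0 0) ^ K) / h) \<le> \<bar>h\<bar> ^ (K - 1)"
    proof (rule always_eventually, rule allI)
      fix h :: real
      have "\<bar>(max 0 h) ^ K / h\<bar> \<le> \<bar>h\<bar> ^ (K - 1)"
      proof (cases "h > 0")
        case True
        then show ?thesis using assms by (simp add: max_def power_diff)
      next
        case False
        then show ?thesis using assms by (simp add: max_def power_0_left)
      qed
      then show "norm (((max 0 (0 + h)) ^ K - (max 0 0) ^ K) / h) \<le> \<bar>h\<bar> ^ (K - 1)"
        using assms by (simp add: power_0_left)
    qed
    have "((\<lambda>h::real. \<bar>h\<bar> ^ (K - 1)) \<longlongrightarrow> \<bar>0\<bar> ^ (K - 1)) (at 0)"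
      by (intro tendsto_intros)
    then show "((\<lambda>h::real. \<bar>h\<bar> ^ (K - 1)) \<longlongrightarrow> 0) (at 0)" using assms by (cases "K - 1") simp_all
  qed
  then show ?thesis using True assms by (simp add: DERIV_def power_0_left)
next
  case False
  then consider "t > 0" | "t < 0" by linarith
  then show ?thesis
  proof cases
    case 1
    have "((\<lambda>t. t ^ K) has_real_derivative real K * t ^ (K - 1)) (at t)"
      by (auto intro!: derivative_eq_intros)
    then have "((\<lambda>t. (max 0 t) ^ K) has_real_derivative real K * t ^ (K - 1)) (at t)"
      by (rule has_field_derivative_transform_within_open[of _ _ _ "{0<..}"]) (use 1 in auto)
    then show ?thesis using 1 by simp
  next
    case 2
    have "((\<lambda>t. 0) has_real_derivative 0) (at t)" by simp
    then have "((\<lambda>t. (max 0 t) ^ K) has_real_derivative 0) (at t)"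
      by (rule has_field_derivative_transform_within_open[of _ _ _ "{..<0}"]) (use 2 assms in auto)
    then show ?thesis using 2 assms by (simp add: max_def power_0_left)
  qed
qed

lemma poly_bump_derivative:
  assumes "K \<ge> 2"
  shows "(poly_bump p K has_real_derivative
    poly_bump (pderiv p * [:1, 0, -1:] - smult (2 * real K) ([:0, 1:] * p)) (K - 1) y) (at y)"
proof -
  define m where "m = max 0 (1 - y\<^sup>2)"
  have m: "m ^ K = (1 - y\<^sup>2) * m ^ (K - 1)"
    using assms by (cases K) (auto simp: m_def max_def)
  have inner: "((\<lambda>y. 1 - y\<^sup>2) has_real_derivative - 2 * y) (at y)"
    by (auto intro!: derivative_eq_intros)
  have 1: "((\<lambda>y. (max 0 (1 - y\<^sup>2)) ^ K) has_real_derivative real K * m ^ (K - 1) * (- 2 * y)) (at y)"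
    unfolding m_def by (rule DERIV_chain2[OF has_derivative_max_power[OF assms] inner])
  have "(poly_bump p K has_real_derivative
      poly (pderiv p) y * m ^ K + real K * m ^ (K - 1) * (- 2 * y) * poly p y) (at y)"
    using DERIV_mult[OF poly_DERIV[of p y] 1] unfolding poly_bump_def[abs_def] m_def[symmetric] .
  moreover have "poly (pderiv p) y * m ^ K + real K * m ^ (K - 1) * (- 2 * y) * poly p y
      = poly_bump (pderiv p * [:1, 0, -1:] - smult (2 * real K) ([:0, 1:] * p)) (K - 1) y"
    unfolding poly_bump_def m m_def[symmetric] by (simp add: algebra_simps power2_eq_square)
  ultimately show ?thesis by simp
qed

lemma continuous_on_poly_bump: "continuous_on S (poly_bump p K)"
  unfolding poly_bump_def[abs_def] by (intro continuous_intros)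

lemma poly_bump_bounded:
  assumes "K \<ge> 1"
  obtains B where "B \<ge> 0" "\<And>y. \<bar>poly_bump p K y\<bar> \<le> B"
proof -
  have "bounded (poly_bump p K ` {-1..1})"
    using continuous_on_poly_bump compact_continuous_image compact_imp_bounded compact_Icc by blast
  then obtain B where B: "B > 0" "\<And>y. y \<in> {-1..1} \<Longrightarrow> \<bar>poly_bump p K y\<bar> \<le> B"
    by (auto simp: bounded_pos)
  have "\<bar>poly_bump p K y\<bar> \<le> B" for y
  proof (cases "\<bar>y\<bar> \<ge> 1")
    case False
    then have "y \<in> {-1..1}" by auto
    then show ?thesis by (rule B(2))
  qed (use B poly_bump_zero assms in simp)
  then show ?thesis using that[of B] B(1) by simp
qed

definition box_bump :: "('n \<Rightarrow> real poly) \<Rightarrow> nat \<Rightarrow> real^'n::finite \<Rightarrow> real \<Rightarrow> real^'n \<Rightarrow> real"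
  where "box_bump P K z \<rho> x = (\<Prod>i\<in>UNIV. poly_bump (P i) K ((x $ i - z $ i) / \<rho>))"

definition cube :: "real^'n::finite \<Rightarrow> real \<Rightarrow> (real^'n) set"
  where "cube z \<rho> = cbox (z - (\<chi> i. \<rho>)) (z + (\<chi> i. \<rho>))"

definition open_cube :: "real^'n::finite \<Rightarrow> real \<Rightarrow> (real^'n) set"
  where "open_cube z \<rho> = box (z - (\<chi> i. \<rho>)) (z + (\<chi> i. \<rho>))"

lemma mem_cube: "x \<in> cube z \<rho> \<longleftrightarrow> (\<forall>i. \<bar>x $ i - z $ i\<bar> \<le> \<rho>)"
  unfolding cube_def mem_box_cart by (auto simp: abs_le_iff algebra_simps)

lemma mem_open_cube: "x \<in> open_cube z \<rho> \<longleftrightarrow> (\<forall>i. \<bar>x $ i - z $ i\<bar> < \<rho>)"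
  unfolding open_cube_def mem_box_cart by (auto simp: abs_less_iff algebra_simps)

lemma compact_cube [simp]: "compact (cube z \<rho>)"
  and closed_cube [simp]: "closed (cube z \<rho>)"
  and open_open_cube [simp]: "open (open_cube z \<rho>)"
  by (simp_all add: cube_def open_cube_def closed_cbox open_box)

lemma cube_subset_open_cube: "\<rho> < \<rho>' \<Longrightarrow> cube z \<rho> \<subseteq> open_cube z \<rho>'"
  and open_cube_subset_cube: "open_cube z \<rho> \<subseteq> cube z \<rho>"
  unfolding subset_iff mem_cube mem_open_cube by (meson le_less_trans, meson less_imp_le)

lemma box_bump_zero:
  assumes "K \<ge> 1" "\<rho> > 0" "x \<notin> open_cube z \<rho>"
  shows "box_bump P K z \<rho> x = 0"
proof -
  obtain i where "\<bar>x $ i - z $ i\<bar> \<ge> \<rho>" using assms(3) by (auto simp: mem_open_cube not_less)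
  then have "poly_bump (P i) K ((x $ i - z $ i) / \<rho>) = 0"
    using assms by (intro poly_bump_zero) (auto simp: field_simps)
  then show ?thesis by (auto simp: box_bump_def)
qed

lemma box_bump_pos:
  assumes "\<rho> > 0" "x \<in> open_cube z \<rho>"
  shows "box_bump (\<lambda>i. 1) K z \<rho> x > 0"
proof -
  have "1 - ((x $ i - z $ i) / \<rho>)\<^sup>2 > 0" for i
    using assms abs_square_less_1[of "(x $ i - z $ i) / \<rho>"] by (simp add: mem_open_cube)
  then show ?thesis by (auto simp: box_bump_def poly_bump_def intro!: prod_pos)
qed

lemma (in scaled_family) symb_poly_bump:
  assumes "K \<ge> l + 2"
  shows "symb l 0 (\<lambda>\<iota> x. poly_bump p K ((x $ i - z \<iota> $ i) / r \<iota>))"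
  using assms
proof (induction l arbitrary: p K)
  have cont: "continuous_on U (\<lambda>x. poly_bump p K ((x $ i - z \<iota> $ i) / r \<iota>))" for p K \<iota>
    unfolding poly_bump_def divide_inverse by (intro continuous_intros)
  have b: "bnd 0 (\<lambda>\<iota> x. poly_bump p K ((x $ i - z \<iota> $ i) / r \<iota>))" if "K \<ge> 1" for p K
  proof -
    obtain B where "B \<ge> 0" "\<And>y. \<bar>poly_bump p K y\<bar> \<le> B" using poly_bump_bounded \<open>K \<ge> 1\<close> by blast
    then show ?thesis using cont unfolding bnd_def by auto
  qed
  {
    case 0
    then show ?case using b[of K p] by simp
  next
    case (Suc l)
    define q where "q = pderiv p * [:1, 0, -1:] - smult (2 * real K) ([:0, 1:] * p)"
    have der: "((\<lambda>x. poly_bump p K ((x $ i - z \<iota> $ i) / r \<iota>)) has_derivative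
        (\<lambda>h. poly_bump q (K - 1) ((x $ i - z \<iota> $ i) / r \<iota>) * (h $ i / r \<iota>))) (at x)" for x \<iota>
    proof -
      have "((\<lambda>x. (x $ i - z \<iota> $ i) / r \<iota>) has_derivative (\<lambda>h. h $ i / r \<iota>)) (at x)"
        unfolding divide_inverse
        by (auto intro!: derivative_eq_intros bounded_linear_imp_has_derivative
            bounded_linear.has_derivative[OF bounded_linear_vec_nth])
      moreover have "(poly_bump p K has_derivative (*) (poly_bump q (K - 1) ((x $ i - z \<iota> $ i) / r \<iota>)))
          (at ((x $ i - z \<iota> $ i) / r \<iota>))"
        using poly_bump_derivative[of K p] Suc.prems by (simp add: q_def has_field_derivative_def)
      ultimately show ?thesis by (rule has_derivative_compose)
    qed
    have "symb l (Suc 0) (\<lambda>\<iota>. partial_derivative j (\<lambda>x. poly_bump p K ((x $ i - z \<iota> $ i) / r \<iota>)))" for j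
    proof -
      \<comment> \<open>Every differentiation of the rescaled bump costs one factor \<open>1/r\<close>, which is what \<open>symb\<close> counts.\<close>
      have scale: "symb l (Suc k) (\<lambda>\<iota> x. c * u \<iota> x / r \<iota>)" if "symb l k u" for l k c and u :: "'i \<Rightarrow> real^'n \<Rightarrow> real"
        using that
      proof (induction l arbitrary: k u)
        have *: "bnd (Suc k) (\<lambda>\<iota> x. c * u \<iota> x / r \<iota>)" if u: "bnd k u" for k u
        proof -
          obtain C where C: "C \<ge> 0" "\<And>\<iota> x. \<iota> \<in> I \<Longrightarrow> x \<in> U \<Longrightarrow> \<bar>u \<iota> x\<bar> \<le> C / r \<iota> ^ k"
            using u by (auto simp: bnd_def)
          have "\<bar>c * u \<iota> x / r \<iota>\<bar> \<le> (\<bar>c\<bar> * C) / r \<iota> ^ Suc k" if "\<iota> \<in> I" "x \<in> U" for \<iota> x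
          proof -
            have "\<bar>c\<bar> * \<bar>u \<iota> x\<bar> / r \<iota> \<le> \<bar>c\<bar> * (C / r \<iota> ^ k) / r \<iota>"
              using C(2)[OF that] r_pos[OF that(1)] by (intro divide_right_mono mult_left_mono) auto
            then show ?thesis using r_pos[OF that(1)] by (simp add: abs_mult mult.commute)
          qed
          moreover have "\<bar>c\<bar> * C \<ge> 0" using C by simp
          moreover have "continuous_on U (\<lambda>x. c * u \<iota> x / r \<iota>)" if "\<iota> \<in> I" for \<iota>
            unfolding divide_inverse using u that by (auto simp: bnd_def intro!: continuous_intros)
          ultimately show ?thesis unfolding bnd_def by blast
        qed
        {
          case 0
          then show ?case using *[of k u] by simp
        next
          case (Suc l)
          have "symb l (Suc (Suc k)) (\<lambda>\<iota>. partial_derivative j (\<lambda>x. c * u \<iota> x / r \<iota>))" for j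
          proof (subst symb_cong)
            show "symb l (Suc (Suc k)) (\<lambda>\<iota> x. c * partial_derivative j (u \<iota>) x / r \<iota>)"
              using Suc.prems by (intro Suc.IH) simp
            fix \<iota> x assume "\<iota> \<in> I" "x \<in> U"
            then have "u \<iota> differentiable (at x)" using Suc.prems by simp
            from partial_derivative_cmult[OF this, of j "c / r \<iota>"]
            show "partial_derivative j (\<lambda>x. c * u \<iota> x / r \<iota>) x = c * partial_derivative j (u \<iota>) x / r \<iota>"
              by simp
          qed
          moreover have "(\<lambda>x. c * u \<iota> x / r \<iota>) differentiable (at x)" if "\<iota> \<in> I" "x \<in> U" for \<iota> x
            unfolding divide_inverse using Suc.prems that by (intro differentiable_mult) auto
          ultimately show ?case using *[of k u] Suc.prems by simp
        }
      qed
      have "symb l 0 (\<lambda>\<iota> x. poly_bump q (K - 1) ((x $ i - z \<iota> $ i) / r \<iota>))"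
        using Suc.prems by (intro Suc.IH) simp
      from scale[OF this, of "axis j 1 $ i"] show ?thesis
        using partial_derivative_eq[OF der] by (simp add: mult.commute cong: symb_cong)
    qed
    moreover have "(\<lambda>x. poly_bump p K ((x $ i - z \<iota> $ i) / r \<iota>)) differentiable (at x)" for x \<iota>
      using der differentiable_def by blast
    moreover have "bnd 0 (\<lambda>\<iota> x. poly_bump p K ((x $ i - z \<iota> $ i) / r \<iota>))"
      using Suc.prems by (intro b) simp
    ultimately show ?case by simp
  }
qed

lemma (in scaled_family) symb_box_bump:
  "K \<ge> l + 2 \<Longrightarrow> symb l 0 (\<lambda>\<iota>. box_bump P K (z \<iota>) (r \<iota>))"
  unfolding box_bump_def[abs_def] by (intro symb_prod symb_poly_bump)

text \<open>An odd factor in one coordinate gives mean zero, by reflection in that coordinate.\<close>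

lemma integral_odd_box_bump:
  fixes z :: "real^'n::finite"
  assumes "P i0 = [:0, 1:]"
  shows "integral\<^sup>L lborel (box_bump P K z \<rho>) = 0"
proof -
  define c :: "real^'n \<Rightarrow> real" where "c j = (if j = axis i0 1 then -1 else 1)" for j
  define t :: "real^'n" where "t = (2 * z $ i0) *\<^sub>R axis i0 1"
  define T where "T x = t + (\<Sum>j\<in>Basis. (c j * (x \<bullet> j)) *\<^sub>R j)" for x
  have Tn: "T x $ i = (if i = i0 then 2 * z $ i0 - x $ i0 else x $ i)" for x i
  proof -
    have "T x \<bullet> axis i 1 = t $ i + c (axis i 1) * (x \<bullet> axis i 1)"
      unfolding T_def inner_add_left 
      using sum.delta[of Basis "axis i 1" "\<lambda>j. c j * (x \<bullet> j)"]
      by (simp add: inner_sum_left inner_Basis if_distrib cong: if_cong) (simp add: inner_axis)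
    moreover have "t $ i = (if i = i0 then 2 * z $ i0 else 0)" by (simp add: t_def axis_def)
    ultimately show ?thesis by (auto simp: inner_axis c_def axis_eq_axis)
  qed
  have "lborel = density (distr lborel borel T) (\<lambda>_. (\<Prod>j\<in>Basis. \<bar>c j\<bar>))"
    unfolding T_def by (rule lborel_affine_euclidean) (simp add: c_def)
  also have "(\<Prod>j\<in>Basis. \<bar>c j\<bar>) = 1" by (intro prod.neutral) (simp add: c_def)
  finally have lb: "lborel = distr lborel borel T" by (simp add: density_1)
  have odd: "box_bump P K z \<rho> (T x) = - box_bump P K z \<rho> x" for x
  proof -
    have i0: "poly_bump (P i0) K ((T x $ i0 - z $ i0) / \<rho>)
        = - poly_bump (P i0) K ((x $ i0 - z $ i0) / \<rho>)"
    proof -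
      have "(T x $ i0 - z $ i0) / \<rho> = - ((x $ i0 - z $ i0) / \<rho>)"
        by (simp add: Tn diff_divide_distrib)
      then show ?thesis by (simp add: poly_bump_def assms)
    qed
    have "box_bump P K z \<rho> y = poly_bump (P i0) K ((y $ i0 - z $ i0) / \<rho>) *
        (\<Prod>i\<in>UNIV - {i0}. poly_bump (P i) K ((y $ i - z $ i) / \<rho>))" for y
      unfolding box_bump_def by (rule prod.remove) auto
    moreover have "(\<Prod>i\<in>UNIV - {i0}. poly_bump (P i) K ((T x $ i - z $ i) / \<rho>))
        = (\<Prod>i\<in>UNIV - {i0}. poly_bump (P i) K ((x $ i - z $ i) / \<rho>))"
      by (intro prod.cong) (auto simp: Tn)
    ultimately show ?thesis using i0 by simp
  qed
  have [measurable]: "box_bump P K z \<rho> \<in> borel_measurable borel"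
    unfolding box_bump_def[abs_def] poly_bump_def divide_inverse
    by (intro borel_measurable_continuous_onI continuous_intros)
  have [measurable]: "T \<in> borel_measurable borel"
    unfolding T_def by measurable
  have "integral\<^sup>L lborel (box_bump P K z \<rho>) = integral\<^sup>L lborel (\<lambda>x. box_bump P K z \<rho> (T x))"
    by (subst lb) (simp add: integral_distr)
  then show ?thesis by (simp add: odd)
qed

definition odd_poly :: "'n \<Rightarrow> 'n \<Rightarrow> real poly"
  where "odd_poly i0 i = (if i = i0 then [:0, 1:] else 1)"

text \<open>The odd factor vanishes on a hyperplane, so the bump is bounded below on a subcube at a distance from it
  only.\<close>

lemma odd_box_bump_lower:
  fixes z :: "real^'n::finite"
  assumes "\<rho> > 0" "\<And>i. \<rho> / 4 \<le> x $ i - z $ i" "\<And>i. x $ i - z $ i \<le> \<rho> / 2"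
  shows "(1/4 * (3/4) ^ K) ^ CARD('n) \<le> box_bump (odd_poly i0) K z \<rho> x"
proof -
  have "1/4 * (3/4) ^ K \<le> poly_bump (odd_poly i0 i) K ((x $ i - z $ i) / \<rho>)" for i
  proof -
    define y where "y = (x $ i - z $ i) / \<rho>"
    have y: "1/4 \<le> y" "y \<le> 1/2" using assms by (auto simp: y_def field_simps)
    have "y\<^sup>2 \<le> (1/2)\<^sup>2" using y by (intro power_mono) auto
    then have "(3/4) ^ K \<le> (max 0 (1 - y\<^sup>2)) ^ K"
      by (intro power_mono) (auto simp: power2_eq_square)
    moreover have "1/4 \<le> poly (odd_poly i0 i) y" using y by (simp add: odd_poly_def)
    ultimately show ?thesis unfolding poly_bump_def y_def[symmetric] by (intro mult_mono) auto
  qed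
  then have "(\<Prod>i\<in>(UNIV::'n set). 1/4 * (3/4) ^ K) \<le> box_bump (odd_poly i0) K z \<rho> x"
    unfolding box_bump_def by (intro prod_mono) auto
  then show ?thesis by simp
qed

section \<open>Integration on the manifold in charts\<close>

locale riemannian =
  fixes A :: "('m::{t2_space, second_countable_topology}, 'n::finite) chart set"
    and G :: "('m, 'n) chart \<Rightarrow> real^'n \<Rightarrow> real^'n^'n"
    and V :: "'m measure"
  assumes manifold: "compact_connected_riemannian_manifold A G"
    and volume: "is_riemannian_volume A G V"
begin

lemma compact_M: "compact (UNIV :: 'm set)"
  and atlas: "smooth_atlas A" and metric: "riemannian_metric A G"
  using manifold by (auto simp: compact_connected_riemannian_manifold_def)

lemma sets_V [measurable_cong]: "sets V = sets borel"
  using volume by (simp add: is_riemannian_volume_def)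

lemma space_V: "space V = UNIV"
  using sets_eq_imp_space_eq[OF sets_V] by simp

lemma chart_cover: obtains c where "c \<in> A" "p \<in> chart_dom c"
  using atlas unfolding smooth_atlas_def by blast

context
  fixes c assumes c: "c \<in> A"
begin

lemma open_dom: "open (chart_dom c)" and open_range: "open (chart_range c)"
  and homeo: "homeomorphism (chart_dom c) (chart_range c) (chart_map c) (chart_inv c)"
  using atlas c unfolding smooth_atlas_def by blast+

lemma chart_inv_map: "p \<in> chart_dom c \<Longrightarrow> chart_inv c (chart_map c p) = p"
  and chart_map_inv: "x \<in> chart_range c \<Longrightarrow> chart_map c (chart_inv c x) = x"
  and chart_inv_dom: "x \<in> chart_range c \<Longrightarrow> chart_inv c x \<in> chart_dom c"
  and continuous_chart: "continuous_on (chart_dom c) (chart_map c)"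
  and continuous_chart_inv: "continuous_on (chart_range c) (chart_inv c)"
  using homeo unfolding homeomorphism_def by auto

lemma coord_metric: "coord_metric (chart_range c) (G c)"
  using metric c open_range unfolding riemannian_metric_def coord_metric_def by blast

lemma chart_inv_image:
  assumes "S \<subseteq> chart_range c"
  shows "p \<in> chart_inv c ` S \<longleftrightarrow> p \<in> chart_dom c \<and> chart_map c p \<in> S"
proof
  assume "p \<in> chart_inv c ` S"
  then obtain x where "x \<in> S" "p = chart_inv c x" by blast
  then show "p \<in> chart_dom c \<and> chart_map c p \<in> S"
    using assms chart_inv_dom chart_map_inv by (metis subsetD)
next
  assume "p \<in> chart_dom c \<and> chart_map c p \<in> S"
  then show "p \<in> chart_inv c ` S" using chart_inv_map by (metis image_eqI)
qed

lemma open_chart_inv_image: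
  assumes "open S" "S \<subseteq> chart_range c"
  shows "open (chart_inv c ` S)"
proof -
  have "chart_inv c ` S = chart_dom c \<inter> chart_map c -` S"
    using chart_inv_image[OF assms(2)] by auto
  then show ?thesis
    using continuous_open_preimage[OF continuous_chart open_dom assms(1)] by simp
qed

lemma compact_chart_inv_image: "compact S \<Longrightarrow> S \<subseteq> chart_range c \<Longrightarrow> compact (chart_inv c ` S)"
  using compact_continuous_image continuous_chart_inv continuous_on_subset by blast

lemma measurable_chart_extension:
  fixes u :: "real^'n \<Rightarrow> real"
  assumes [measurable]: "u \<in> borel_measurable borel"
  shows "(\<lambda>p. if p \<in> chart_dom c then u (chart_map c p) else 0) \<in> borel_measurable borel"
proof -
  have [measurable]: "(\<lambda>p. if p \<in> chart_dom c then chart_map c p else 0) \<in> borel_measurable borel"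
    using continuous_chart open_dom by (intro borel_measurable_continuous_on_if) auto
  have [measurable]: "chart_dom c \<in> sets borel" using open_dom by simp
  have "(\<lambda>p. if p \<in> chart_dom c then u (if p \<in> chart_dom c then chart_map c p else 0) else 0)
      \<in> borel_measurable borel"
    by measurable
  then show ?thesis by (simp cong: if_cong)
qed

lemma measurable_chart_inv:
  "(\<lambda>x. if x \<in> chart_range c then chart_inv c x else undefined) \<in> borel_measurable borel"
  using continuous_chart_inv open_range by (intro borel_measurable_continuous_on_if) auto

lemma measurable_sqrt_det:
  "(\<lambda>x. indicator (chart_range c) x * sqrt (det (G c x))) \<in> borel_measurable borel"
proof -
  have "(\<lambda>x. if x \<in> chart_range c then sqrt (det (G c x)) else 0) \<in> borel_measurable borel"
    using coord_metric.continuous_sqrt_det[OF coord_metric] open_range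
    by (intro borel_measurable_continuous_on_if) auto
  moreover have "(\<lambda>x. if x \<in> chart_range c then sqrt (det (G c x)) else 0)
      = (\<lambda>x. indicator (chart_range c) x * sqrt (det (G c x)))"
    by (auto simp: indicator_def)
  ultimately show ?thesis by simp
qed

lemma sqrt_det_nonneg: "0 \<le> indicator (chart_range c) x * sqrt (det (G c x))"
  using coord_metric.det_g_pos[OF coord_metric, of x] by (auto simp: indicator_def)

text \<open>The volume is defined through its values on Borel subsets of chart domains; as an identity of measures the
  definition becomes usable for integrals of functions.\<close>

lemma density_chart:
  "density V (\<lambda>p. ennreal (indicator (chart_dom c) p)) =
    distr (density lborel (\<lambda>x. ennreal (indicator (chart_range c) x * sqrt (det (G c x))))) borel
      (\<lambda>x. if x \<in> chart_range c then chart_inv c x else undefined)" (is "_ = distr ?D borel ?f")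
proof (rule measure_eqI)
  note [measurable] = measurable_chart_inv measurable_sqrt_det
  have [measurable]: "chart_dom c \<in> sets V" using open_dom by (simp add: sets_V)
  fix B assume "B \<in> sets (density V (\<lambda>p. ennreal (indicator (chart_dom c) p)))"
  then have [measurable]: "B \<in> sets borel" by (simp add: sets_V)
  have "emeasure (density V (\<lambda>p. ennreal (indicator (chart_dom c) p))) B
      = (\<integral>\<^sup>+p. ennreal (indicator (chart_dom c) p) * indicator B p \<partial>V)"
    by (rule emeasure_density) (use \<open>B \<in> sets borel\<close> in \<open>auto simp: sets_V\<close>)
  also have "\<dots> = (\<integral>\<^sup>+p. indicator (B \<inter> chart_dom c) p \<partial>V)"
    by (rule nn_integral_cong) (auto simp: indicator_def)
  also have "\<dots> = emeasure V (B \<inter> chart_dom c)"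
    by (rule nn_integral_indicator) (use \<open>B \<in> sets borel\<close> open_dom in \<open>simp add: sets_V\<close>)
  also have "\<dots> = (\<integral>\<^sup>+x\<in>chart_map c ` (B \<inter> chart_dom c). ennreal (sqrt (det (G c x))) \<partial>lborel)"
    using volume c open_dom unfolding is_riemannian_volume_def by auto
  also have "\<dots> = (\<integral>\<^sup>+x. ennreal (indicator (chart_range c) x * sqrt (det (G c x))) *
      indicator (?f -` B) x \<partial>lborel)"
  proof (rule nn_integral_cong)
    fix x
    have "x \<in> chart_map c ` (B \<inter> chart_dom c) \<longleftrightarrow> x \<in> chart_range c \<and> chart_inv c x \<in> B"
    proof
      assume "x \<in> chart_map c ` (B \<inter> chart_dom c)"
      then show "x \<in> chart_range c \<and> chart_inv c x \<in> B" using chart_inv_map by auto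
    next
      assume "x \<in> chart_range c \<and> chart_inv c x \<in> B"
      then show "x \<in> chart_map c ` (B \<inter> chart_dom c)"
        using chart_map_inv[of x] chart_inv_dom[of x] by (metis Int_iff image_eqI)
    qed
    then show "ennreal (sqrt (det (G c x))) * indicator (chart_map c ` (B \<inter> chart_dom c)) x =
        ennreal (indicator (chart_range c) x * sqrt (det (G c x))) * indicator (?f -` B) x"
      by (auto simp: indicator_def)
  qed
  also have "\<dots> = emeasure ?D (?f -` B)"
    using measurable_sets[OF measurable_chart_inv \<open>B \<in> sets borel\<close>]
    by (subst emeasure_density) auto
  also have "\<dots> = emeasure (distr ?D borel ?f) B"
    by (subst emeasure_distr) auto
  finally show "emeasure (density V (\<lambda>p. ennreal (indicator (chart_dom c) p))) B
      = emeasure (distr ?D borel ?f) B" .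
qed (simp add: sets_V)

context
  fixes h :: "'m \<Rightarrow> real"
  assumes h [measurable]: "h \<in> borel_measurable borel" and h0: "\<And>p. p \<notin> chart_dom c \<Longrightarrow> h p = 0"
begin

lemma integral_chart:
  "integral\<^sup>L V h = (LINT x:chart_range c|lborel. sqrt (det (G c x)) * h (chart_inv c x))"
proof -
  note [measurable] = measurable_chart_inv measurable_sqrt_det
  let ?f = "\<lambda>x. if x \<in> chart_range c then chart_inv c x else undefined"
  have [measurable]: "chart_dom c \<in> sets V" "h \<in> borel_measurable V" using open_dom by (simp_all add: sets_V)
  have "integral\<^sup>L V h = integral\<^sup>L (density V (\<lambda>p. ennreal (indicator (chart_dom c) p))) h"
    by (subst integral_density) (auto intro!: Bochner_Integration.integral_cong simp: indicator_def h0)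
  also have "\<dots> = integral\<^sup>L lborel (\<lambda>x. (indicator (chart_range c) x * sqrt (det (G c x))) *\<^sub>R h (?f x))"
    unfolding density_chart using sqrt_det_nonneg
    by (subst integral_distr) (auto simp: integral_density)
  also have "\<dots> = (LINT x:chart_range c|lborel. sqrt (det (G c x)) * h (chart_inv c x))"
    unfolding set_lebesgue_integral_def
    by (auto intro!: Bochner_Integration.integral_cong simp: indicator_def)
  finally show ?thesis .
qed

lemma integral_chart_subset:
  assumes "S \<subseteq> chart_range c" "\<And>p. p \<notin> chart_inv c ` S \<Longrightarrow> h p = 0"
  shows "integral\<^sup>L V h = (LINT x:S|lborel. sqrt (det (G c x)) * h (chart_inv c x))"
proof -
  have "h (chart_inv c x) = 0" if "x \<in> chart_range c" "x \<notin> S" for x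
    using assms(2)[of "chart_inv c x"] chart_inv_image[OF assms(1), of "chart_inv c x"] that
      chart_map_inv[of x] by auto
  then show ?thesis
    unfolding integral_chart set_lebesgue_integral_def using assms(1)
    by (auto intro!: Bochner_Integration.integral_cong simp: indicator_def)
qed

end

end

text \<open>Coordinate cubes of half side \<open>\<rho>\<close>. The concentric cube of twice the size leaves room for a neighbourhood in
  which functions supported in the smaller cube can be differentiated.\<close>

definition patches :: "(('m, 'n) chart \<times> (real^'n) \<times> real) set"
  where "patches = {(c, z, \<rho>). c \<in> A \<and> 0 < \<rho> \<and> \<rho> \<le> 1 \<and> cube z (2 * \<rho>) \<subseteq> chart_range c}"

lemma patchesD:
  assumes "(c, z, \<rho>) \<in> patches"
  shows "c \<in> A" "0 < \<rho>" "\<rho> \<le> 1" "cube z (2 * \<rho>) \<subseteq> chart_range c" "cube z \<rho> \<subseteq> open_cube z (2 * \<rho>)"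
    "cube z \<rho> \<subseteq> chart_range c" "open_cube z \<rho> \<subseteq> chart_range c"
    "open_cube z (2 * \<rho>) \<subseteq> cube z (2 * \<rho>)"
proof -
  show *: "c \<in> A" "0 < \<rho>" "\<rho> \<le> 1" "cube z (2 * \<rho>) \<subseteq> chart_range c"
    using assms by (auto simp: patches_def)
  show c: "cube z \<rho> \<subseteq> open_cube z (2 * \<rho>)" using * by (intro cube_subset_open_cube) simp
  show o: "open_cube z (2 * \<rho>) \<subseteq> cube z (2 * \<rho>)" by (rule open_cube_subset_cube)
  show "cube z \<rho> \<subseteq> chart_range c" using c o *(4) by blast
  then show "open_cube z \<rho> \<subseteq> chart_range c" using open_cube_subset_cube by blast
qed

lemma patch_exists:
  obtains c z \<rho> where "(c, z, \<rho>) \<in> patches" "p \<in> chart_inv c ` open_cube z \<rho>"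
proof -
  obtain c where c: "c \<in> A" "p \<in> chart_dom c" using chart_cover .
  define z where "z = chart_map c p"
  have z: "z \<in> chart_range c" using c by (simp add: z_def)
  then obtain e where e: "e > 0" "ball z e \<subseteq> chart_range c"
    using open_range[OF c(1)] open_contains_ball by blast
  define \<rho> where "\<rho> = min 1 (e / (4 * real CARD('n)))"
  have \<rho>: "0 < \<rho>" "\<rho> \<le> 1" "\<rho> \<le> e / (4 * real CARD('n))" using e by (auto simp: \<rho>_def)
  have "cube z (2 * \<rho>) \<subseteq> ball z e"
  proof
    fix x assume "x \<in> cube z (2 * \<rho>)"
    then have "\<bar>(x - z) $ i\<bar> \<le> 2 * \<rho>" for i by (simp add: mem_cube)
    then have "norm (x - z) \<le> (\<Sum>i\<in>(UNIV::'n set). 2 * \<rho>)"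
      by (intro order_trans[OF norm_le_l1_cart] sum_mono) simp
    also have "\<dots> = real CARD('n) * 2 * \<rho>" by simp
    also have "\<dots> \<le> real CARD('n) * 2 * (e / (4 * real CARD('n)))"
      by (rule mult_left_mono[OF \<rho>(3)]) simp
    also have "\<dots> = e / 2" by simp
    finally show "x \<in> ball z e" using e by (simp add: dist_norm norm_minus_commute)
  qed
  then have P: "(c, z, \<rho>) \<in> patches" using c e \<rho> by (auto simp: patches_def)
  moreover have "p \<in> chart_inv c ` open_cube z \<rho>"
    using chart_inv_image[OF c(1) patchesD(7)[OF P]] c(2) \<rho> by (simp add: z_def mem_open_cube)
  ultimately show ?thesis by (rule that)
qed

lemma finite_patch_cover:
  obtains P where "finite P" "P \<subseteq> patches" "\<And>p. \<exists>(c, z, \<rho>)\<in>P. p \<in> chart_inv c ` open_cube z \<rho>"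
proof -
  define B where "B = (\<lambda>(c :: ('m, 'n) chart, z, \<rho>). chart_inv c ` open_cube z \<rho> :: 'm set)"
  have "\<exists>Q\<subseteq>B ` patches. finite Q \<and> UNIV \<subseteq> \<Union>Q"
  proof (rule compactE[OF compact_M, of "B ` patches"])
    show "UNIV \<subseteq> \<Union> (B ` patches)"
    proof
      fix p :: 'm
      obtain c z \<rho> where "(c, z, \<rho>) \<in> patches" "p \<in> chart_inv c ` open_cube z \<rho>"
        using patch_exists .
      then show "p \<in> \<Union> (B ` patches)" by (force simp: B_def)
    qed
    show "open b" if "b \<in> B ` patches" for b
    proof -
      obtain c z \<rho> where p: "(c, z, \<rho>) \<in> patches" "b = B (c, z, \<rho>)" using \<open>b \<in> B ` patches\<close> by auto
      show ?thesis
        unfolding p(2) B_def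
        using open_chart_inv_image[OF patchesD(1)[OF p(1)] open_open_cube patchesD(7)[OF p(1)]] by simp
    qed
  qed blast
  then obtain Q where Q: "Q \<subseteq> B ` patches" "finite Q" "UNIV \<subseteq> \<Union>Q" by blast
  then obtain P where "P \<subseteq> patches" "finite P" "Q = B ` P"
    using finite_subset_image by metis
  then show ?thesis using Q(3) that[of P] by (fastforce simp: B_def)
qed

lemma continuous_measurable: "continuous_on UNIV f \<Longrightarrow> f \<in> borel_measurable V"
  for f :: "'m \<Rightarrow> real"
  using borel_measurable_continuous_onI measurable_cong_sets[OF sets_V refl] by blast

lemma emeasure_chart:
  assumes "c \<in> A" "S \<subseteq> chart_range c" "chart_inv c ` S \<in> sets borel"
  shows "emeasure V (chart_inv c ` S) = (\<integral>\<^sup>+x\<in>S. ennreal (sqrt (det (G c x))) \<partial>lborel)"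
proof -
  have "chart_inv c ` S \<subseteq> chart_dom c" using chart_inv_image[OF assms(1,2)] by blast
  moreover have "chart_map c ` (chart_inv c ` S) = S"
    using chart_map_inv[OF assms(1)] assms(2) unfolding image_image by (simp add: subset_iff cong: image_cong)
  moreover have "emeasure V B = (\<integral>\<^sup>+x\<in>chart_map c ` B. ennreal (sqrt (det (G c x))) \<partial>lborel)"
    if "B \<in> sets borel" "B \<subseteq> chart_dom c" for B
    using volume assms(1) that unfolding is_riemannian_volume_def by blast
  ultimately show ?thesis using assms(3) by simp
qed

lemma emeasure_patch_finite:
  assumes "(c, z, \<rho>) \<in> patches"
  shows "emeasure V (chart_inv c ` cube z \<rho>) < \<infinity>"
proof -
  note P = patchesD[OF assms]
  interpret coord_metric "chart_range c" "G c" using coord_metric[OF P(1)] .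
  have cont: "continuous_on (cube z \<rho>) (\<lambda>x. sqrt (det (G c x)))"
    using continuous_sqrt_det P(6) continuous_on_subset by blast
  let ?B = "chart_inv c ` cube z \<rho>"
  have "compact ?B" using compact_chart_inv_image[OF P(1)] P(6) by simp
  then have eq: "emeasure V ?B = (\<integral>\<^sup>+x\<in>cube z \<rho>. ennreal (sqrt (det (G c x))) \<partial>lborel)"
    by (intro emeasure_chart P borel_closed compact_imp_closed)
  have "integrable lborel (\<lambda>x. indicator (cube z \<rho>) x *\<^sub>R sqrt (det (G c x)))"
    by (intro borel_integrable_compact cont) simp
  then have "(\<integral>\<^sup>+x. ennreal (norm (indicator (cube z \<rho>) x *\<^sub>R sqrt (det (G c x)))) \<partial>lborel) < \<infinity>"
    by (simp add: integrable_iff_bounded)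
  also have "(\<integral>\<^sup>+x. ennreal (norm (indicator (cube z \<rho>) x *\<^sub>R sqrt (det (G c x)))) \<partial>lborel) = emeasure V ?B"
    unfolding eq by (intro nn_integral_cong) (use P(6) det_g_pos in \<open>force simp: indicator_def\<close>)
  finally show ?thesis .
qed

lemma emeasure_open_pos:
  assumes "open W" "W \<noteq> {}"
  shows "emeasure V W > 0"
proof (rule ccontr)
  assume "\<not> emeasure V W > 0"
  obtain p where "p \<in> W" using assms(2) by blast
  obtain c where c: "c \<in> A" "p \<in> chart_dom c" using chart_cover .
  interpret coord_metric "chart_range c" "G c" using coord_metric[OF c(1)] .
  define S where "S = chart_map c ` (chart_dom c \<inter> W)"
  have SW: "chart_inv c ` S = chart_dom c \<inter> W"
    using chart_inv_map[OF c(1)] by (force simp: S_def image_iff)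
  have S: "S \<subseteq> chart_range c" "S \<noteq> {}" using c \<open>p \<in> W\<close> by (auto simp: S_def)
  have "S = chart_range c \<inter> chart_inv c -` W"
    using chart_inv_map[OF c(1)] by (force simp: S_def image_iff)
  then have "open S"
    using continuous_open_preimage[OF continuous_chart_inv open_range assms(1)] c(1) by simp
  have "emeasure V (chart_inv c ` S) \<le> emeasure V W"
    using assms(1) by (intro emeasure_mono) (auto simp: SW sets_V)
  then have "emeasure V (chart_inv c ` S) = 0" using \<open>\<not> emeasure V W > 0\<close> by simp
  moreover have "chart_inv c ` S \<in> sets borel"
    using open_dom[OF c(1)] assms(1) by (auto simp: SW)
  ultimately have "(\<integral>\<^sup>+x\<in>S. ennreal (sqrt (det (G c x))) \<partial>lborel) = 0"
    using emeasure_chart[OF c(1) S(1)] by simp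
  moreover have "(\<lambda>x. ennreal (sqrt (det (G c x))) * indicator S x) \<in> borel_measurable lborel"
  proof -
    have [measurable]: "S \<in> sets borel" using \<open>open S\<close> by simp
    note [measurable] = measurable_sqrt_det[OF c(1)]
    have "(\<lambda>x. ennreal (indicator (chart_range c) x * sqrt (det (G c x))) * indicator S x)
        \<in> borel_measurable lborel" by measurable
    moreover have "(\<lambda>x. ennreal (indicator (chart_range c) x * sqrt (det (G c x))) * indicator S x)
      = (\<lambda>x. ennreal (sqrt (det (G c x))) * indicator S x)"
      using S(1) by (auto simp: indicator_def fun_eq_iff)
    ultimately show ?thesis by simp
  qed
  ultimately have "AE x in lborel. ennreal (sqrt (det (G c x))) * indicator S x = 0"
    by (simp add: nn_integral_0_iff_AE)
  then have "AE x in lborel. x \<notin> S"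
  proof (eventually_elim)
    case (elim x)
    then show ?case using S(1) det_g_pos[of x] by (auto simp: indicator_def)
  qed
  then have "S \<in> null_sets lborel"
    using \<open>open S\<close> by (auto simp: AE_iff_null_sets)
  then show False
    using open_not_negligible[OF \<open>open S\<close> S(2)] negligible_iff_null_sets null_sets_completionI by blast
qed

lemma emeasure_V_finite: "emeasure V UNIV < \<infinity>"
proof -
  obtain P where P: "finite P" "P \<subseteq> patches" "\<And>p. \<exists>(c, z, \<rho>)\<in>P. p \<in> chart_inv c ` open_cube z \<rho>"
    using finite_patch_cover by blast
  define B where "B = (\<lambda>(c :: ('m, 'n) chart, z, \<rho>). chart_inv c ` cube z \<rho> :: 'm set)"
  have B: "B p \<in> sets V \<and> emeasure V (B p) < \<infinity>" if "p \<in> P" for p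
  proof -
    obtain c z \<rho> where p: "p = (c, z, \<rho>)" by (cases p) auto
    then have pp: "(c, z, \<rho>) \<in> patches" using that P by auto
    show ?thesis
      unfolding p B_def using emeasure_patch_finite[OF pp]
        compact_chart_inv_image[OF patchesD(1)[OF pp] compact_cube patchesD(6)[OF pp]]
      by (simp add: sets_V compact_imp_closed borel_closed)
  qed
  have "UNIV \<subseteq> (\<Union>p\<in>P. B p)"
  proof
    fix p :: 'm
    obtain c z \<rho> where "(c, z, \<rho>) \<in> P" "p \<in> chart_inv c ` open_cube z \<rho>" using P(3)[of p] by blast
    then show "p \<in> (\<Union>p\<in>P. B p)"
      using open_cube_subset_cube[of z \<rho>] by (force simp: B_def)
  qed
  then have "emeasure V UNIV \<le> emeasure V (\<Union>p\<in>P. B p)"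
    using B P(1) by (intro emeasure_mono sets.finite_UN) auto
  also have "\<dots> \<le> (\<Sum>p\<in>P. emeasure V (B p))"
    using B P(1) by (intro emeasure_subadditive_finite) auto
  also have "\<dots> < \<infinity>" using B P(1) by simp
  finally show ?thesis .
qed

lemma finite_measure_V: "finite_measure V"
  using emeasure_V_finite by (intro finite_measureI) (simp add: space_V)

lemma continuous_integrable:
  fixes f :: "'m \<Rightarrow> real"
  assumes "continuous_on UNIV f"
  shows "integrable V f"
proof -
  interpret finite_measure V by (rule finite_measure_V)
  have "bounded (f ` UNIV)"
    using assms compact_M compact_continuous_image compact_imp_bounded by blast
  then obtain B where "\<And>p. \<bar>f p\<bar> \<le> B" by (auto simp: bounded_iff)
  then show ?thesis
    using continuous_measurable[OF assms] by (intro integrable_const_bound[of _ B]) auto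
qed

lemma continuous_square_integral_zero:
  fixes f :: "'m \<Rightarrow> real"
  assumes "continuous_on UNIV f" "(\<integral>p. (f p)\<^sup>2 \<partial>V) = 0"
  shows "f p = 0"
proof (rule ccontr)
  assume "f p \<noteq> 0"
  have c2: "continuous_on UNIV (\<lambda>p. (f p)\<^sup>2)" using assms(1) by (intro continuous_intros)
  have "AE p in V. (f p)\<^sup>2 = 0"
    using integral_nonneg_eq_0_iff_AE[OF continuous_integrable[OF c2]] assms(2) by simp
  moreover have W: "open (f -` (- {0}))"
    using assms(1) by (intro open_vimage) auto
  ultimately have "emeasure V (f -` (- {0})) = 0"
    by (subst (asm) AE_iff_measurable[OF _ refl]) (auto simp: sets_V space_V vimage_def)
  then show False using emeasure_open_pos[OF W] \<open>f p \<noteq> 0\<close> by auto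
qed

end

section \<open>Green's formula on the manifold\<close>

definition gradient :: "(real^'n::finite \<Rightarrow> real) \<Rightarrow> real^'n \<Rightarrow> real^'n"
  where "gradient u x = (\<chi> i. partial_derivative i u x)"

lemma grad_inner_gradient:
  "grad_inner g u v x = gradient u x \<bullet> (matrix_inv (g x) *v gradient v x)"
  by (simp add: grad_inner_def gradient_def)

lemma frechet_derivative_gradient:
  assumes "u differentiable (at x)"
  shows "frechet_derivative u (at x) v = gradient u x \<bullet> v"
proof -
  have lin: "linear (frechet_derivative u (at x))" by (rule linear_frechet_derivative[OF assms])
  have "v = (\<Sum>i\<in>UNIV. v $ i *\<^sub>R axis i 1)"
    by (simp add: vec_eq_iff axis_def if_distrib sum.delta cong: if_cong)
  then have "frechet_derivative u (at x) v
      = frechet_derivative u (at x) (\<Sum>i\<in>UNIV. v $ i *\<^sub>R axis i 1)" by simp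
  also have "\<dots> = (\<Sum>i\<in>UNIV. v $ i * frechet_derivative u (at x) (axis i 1))"
    by (simp add: linear_sum[OF lin] linear_cmul[OF lin])
  finally show ?thesis
    by (simp add: gradient_def partial_derivative_def inner_vec_def mult.commute)
qed

lemma gradient_cong:
  assumes "open S" "x \<in> S" "\<And>y. y \<in> S \<Longrightarrow> u y = v y"
  shows "gradient u x = gradient v x"
  using partial_derivative_cong[OF assms] by (simp add: gradient_def vec_eq_iff)

lemma gradient_compose:
  assumes "u differentiable (at (T x))" "T differentiable (at x)"
  shows "gradient (\<lambda>y. u (T y)) x = transpose (jacobian T (at x)) *v gradient u (T x)"
    and "(\<lambda>y. u (T y)) differentiable (at x)"
proof -
  have 1: "(T has_derivative (\<lambda>h. jacobian T (at x) *v h)) (at x)"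
    using assms(2) jacobian_works by blast
  have D: "((\<lambda>y. u (T y)) has_derivative (\<lambda>h. frechet_derivative u (at (T x)) (jacobian T (at x) *v h))) (at x)"
    by (rule has_derivative_compose[OF 1 has_derivative_frechet[OF assms(1)]])
  then show "(\<lambda>y. u (T y)) differentiable (at x)" using differentiable_def by blast
  have "partial_derivative i (\<lambda>y. u (T y)) x = (transpose (jacobian T (at x)) *v gradient u (T x)) $ i" for i
  proof -
    have "partial_derivative i (\<lambda>y. u (T y)) x = gradient u (T x) \<bullet> (jacobian T (at x) *v axis i 1)"
      using partial_derivative_eq[OF D] frechet_derivative_gradient[OF assms(1)] by simp
    also have "\<dots> = (transpose (jacobian T (at x)) *v gradient u (T x)) \<bullet> axis i 1"
      by (metis dot_lmul_matrix vector_transpose_matrix transpose_transpose)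
    finally show ?thesis by (simp add: inner_axis)
  qed
  then show "gradient (\<lambda>y. u (T y)) x = transpose (jacobian T (at x)) *v gradient u (T x)"
    by (simp add: gradient_def vec_eq_iff)
qed

text \<open>The transformation law of the metric under a change of coordinates with Jacobian \<open>J\<close>: gradients are multiplied by
  the transpose of \<open>J\<close>, and the pairing by the inverse metric is invariant.\<close>

lemma matrix_inv_congruence:
  fixes A B J :: "real^'n::finite^'n"
  assumes "A = transpose J ** B ** J" "invertible A"
  shows "(transpose J *v a) \<bullet> (matrix_inv A *v (transpose J *v b)) = a \<bullet> (matrix_inv B *v b)"
proof -
  have "det A = det J * det B * det J" by (simp add: assms(1) det_mul det_transpose)
  then have nz: "invertible J" "invertible B" "invertible (transpose J)"
    using assms(2) by (auto simp: invertible_det_nz det_transpose)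
  define y where "y = matrix_inv A *v (transpose J *v b)"
  have "A *v y = transpose J *v b"
    using matrix_inv_left_right(1)[OF assms(2)] by (simp add: y_def matrix_vector_mul_assoc)
  then have "transpose J *v (B *v (J *v y)) = transpose J *v b"
    by (simp add: assms(1) matrix_vector_mul_assoc matrix_mul_assoc)
  then have "B *v (J *v y) = b"
    using inj_matrix_vector_mult[OF nz(3)] by (simp add: inj_def)
  then have "matrix_inv B *v b = J *v y"
    using matrix_inv_left_right(2)[OF nz(2)] by (metis matrix_vector_mul_assoc matrix_vector_mul_lid)
  moreover have "(transpose J *v a) \<bullet> y = a \<bullet> (J *v y)"
    by (metis dot_lmul_matrix vector_transpose_matrix transpose_transpose)
  ultimately show ?thesis by (simp add: y_def)
qed

lemma smooth_on_C1:
  assumes "smooth_on S f" "x \<in> S"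
  shows "f differentiable (at x)" "continuous_on S (\<lambda>x. frechet_derivative f (at x) v)"
proof -
  have "C_k_on (Suc 0) S f" using assms(1) unfolding smooth_on_def by blast
  then show "f differentiable (at x)" "continuous_on S (\<lambda>x. frechet_derivative f (at x) v)"
    using assms(2) by simp_all
qed

lemma (in metric_patch) symb_C1:
  assumes "\<And>x. x \<in> \<Omega> \<Longrightarrow> u differentiable (at x)" "\<And>i. continuous_on \<Omega> (partial_derivative i u)"
  shows "symb 1 0 (\<lambda>\<iota>. u)"
proof -
  have b: "bnd 0 (\<lambda>\<iota>. v)" if "continuous_on \<Omega> v" for v
  proof -
    have "bounded (v ` K)"
      using that K_\<Omega> compact_K by (meson compact_continuous_image compact_imp_bounded continuous_on_subset)
    then obtain B where "B > 0" "\<And>x. x \<in> K \<Longrightarrow> \<bar>v x\<bar> \<le> B" by (auto simp: bounded_pos)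
    then show ?thesis
      using that U_K K_\<Omega> unfolding bnd_def
      by (auto intro!: exI[of _ B] intro: continuous_on_subset)
  qed
  have "continuous_on \<Omega> u" using assms(1) by (rule continuous_on_of_differentiable)
  then have "bnd 0 (\<lambda>\<iota>. u)" by (rule b)
  moreover have "bnd (Suc 0) (\<lambda>\<iota>. partial_derivative i u)" for i
    by (rule bnd_mono[OF b[OF assms(2)]]) simp
  ultimately show ?thesis using assms(1) U_K K_\<Omega> by auto
qed

context riemannian
begin

abbreviation rep :: "('m, 'n) chart \<Rightarrow> ('m \<Rightarrow> real) \<Rightarrow> real^'n \<Rightarrow> real"
  where "rep c f \<equiv> \<lambda>x. f (chart_inv c x)"

definition C1_fun :: "('m \<Rightarrow> real) \<Rightarrow> bool"
  where "C1_fun f \<longleftrightarrow> (\<forall>c\<in>A. (\<forall>x\<in>chart_range c. rep c f differentiable (at x)) \<and>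
    (\<forall>i. continuous_on (chart_range c) (partial_derivative i (rep c f))))"

lemma C1_funD:
  assumes "C1_fun f" "c \<in> A"
  shows "x \<in> chart_range c \<Longrightarrow> rep c f differentiable (at x)"
    "continuous_on (chart_range c) (partial_derivative i (rep c f))"
    "continuous_on (chart_range c) (rep c f)"
  using assms unfolding C1_fun_def by (auto intro: continuous_on_of_differentiable)

lemma C1_continuous:
  assumes "C1_fun f"
  shows "continuous_on UNIV f"
proof -
  have "isCont f p" for p
  proof -
    obtain c where c: "c \<in> A" "p \<in> chart_dom c" using chart_cover .
    have "continuous_on (chart_dom c) (\<lambda>p. rep c f (chart_map c p))"
      by (rule continuous_on_compose2[OF C1_funD(3)[OF assms c(1)] continuous_chart[OF c(1)]]) auto
    moreover have "rep c f (chart_map c p) = f p" if "p \<in> chart_dom c" for p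
      using chart_inv_map[OF c(1) that] by simp
    ultimately have "continuous_on (chart_dom c) f" by (simp cong: continuous_on_cong)
    then show ?thesis using open_dom[OF c(1)] c(2) by (simp add: continuous_on_eq_continuous_at)
  qed
  then show ?thesis by (simp add: continuous_at_imp_continuous_on)
qed

lemma C1_smooth: "smooth_function A f \<Longrightarrow> C1_fun f"
  unfolding C1_fun_def smooth_function_def partial_derivative_def
  using smooth_on_C1 by (metis continuous_on_empty equals0I)

lemma C1_mult:
  assumes "C1_fun f" "C1_fun h"
  shows "C1_fun (\<lambda>p. f p * h p)"
  unfolding C1_fun_def
proof (intro ballI allI conjI)
  fix c assume c: "c \<in> A"
  show "rep c (\<lambda>p. f p * h p) differentiable (at x)" if "x \<in> chart_range c" for x
    using C1_funD(1)[OF assms(1) c that] C1_funD(1)[OF assms(2) c that] by simp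
  fix i
  have "partial_derivative i (rep c (\<lambda>p. f p * h p)) x
      = rep c f x * partial_derivative i (rep c h) x + partial_derivative i (rep c f) x * rep c h x"
    if "x \<in> chart_range c" for x
    using C1_funD(1)[OF assms(1) c that] C1_funD(1)[OF assms(2) c that] by (rule partial_derivative_mult)
  then show "continuous_on (chart_range c) (partial_derivative i (rep c (\<lambda>p. f p * h p)))"
    using C1_funD(2,3)[OF assms(1) c] C1_funD(2,3)[OF assms(2) c]
    by (simp cong: continuous_on_cong) (intro continuous_intros)
qed

lemma C1_sum:
  assumes "finite J" "\<And>j. j \<in> J \<Longrightarrow> C1_fun (f j)"
  shows "C1_fun (\<lambda>p. \<Sum>j\<in>J. f j p)"
  unfolding C1_fun_def
proof (intro ballI allI conjI)
  fix c assume c: "c \<in> A"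
  show "rep c (\<lambda>p. \<Sum>j\<in>J. f j p) differentiable (at x)" if "x \<in> chart_range c" for x
    using C1_funD(1)[OF assms(2) c that] assms(1) by (intro differentiable_sum) auto
  fix i
  have "partial_derivative i (rep c (\<lambda>p. \<Sum>j\<in>J. f j p)) x = (\<Sum>j\<in>J. partial_derivative i (rep c (f j)) x)"
    if "x \<in> chart_range c" for x
    using C1_funD(1)[OF assms(2) c that] assms(1) by (intro partial_derivative_sum) auto
  then show "continuous_on (chart_range c) (partial_derivative i (rep c (\<lambda>p. \<Sum>j\<in>J. f j p)))"
    using C1_funD(2)[OF assms(2) c]
    by (simp cong: continuous_on_cong) (intro continuous_intros)
qed

lemma C1_inverse:
  assumes "C1_fun f" "\<And>p. f p \<noteq> 0"
  shows "C1_fun (\<lambda>p. inverse (f p))"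
  unfolding C1_fun_def
proof (intro ballI allI conjI)
  fix c assume c: "c \<in> A"
  have der: "((\<lambda>y. inverse y) has_real_derivative - (inverse (f p) * inverse (f p))) (at (f p))" for p
    using assms(2)[of p] by (auto intro!: derivative_eq_intros)
  show "rep c (\<lambda>p. inverse (f p)) differentiable (at x)" if "x \<in> chart_range c" for x
    using partial_derivative_chain(2)[OF C1_funD(1)[OF assms(1) c that] der] .
  fix i
  have "partial_derivative i (rep c (\<lambda>p. inverse (f p))) x
      = - (inverse (rep c f x) * inverse (rep c f x)) * partial_derivative i (rep c f) x"
    if "x \<in> chart_range c" for x
    using partial_derivative_chain(1)[OF C1_funD(1)[OF assms(1) c that] der] .
  then show "continuous_on (chart_range c) (partial_derivative i (rep c (\<lambda>p. inverse (f p))))"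
    using C1_funD(2,3)[OF assms(1) c] assms(2)
    by (simp cong: continuous_on_cong) (intro continuous_intros, auto)
qed

lemma transition_overlap:
  assumes "c \<in> A" "d \<in> A"
  shows "open (chart_map c ` (chart_dom c \<inter> chart_dom d))"
    "x \<in> chart_map c ` (chart_dom c \<inter> chart_dom d) \<longleftrightarrow> x \<in> chart_range c \<and> chart_inv c x \<in> chart_dom d"
    "smooth_on (chart_map c ` (chart_dom c \<inter> chart_dom d)) (transition c d)"
proof -
  show *: "x \<in> chart_map c ` (chart_dom c \<inter> chart_dom d) \<longleftrightarrow> x \<in> chart_range c \<and> chart_inv c x \<in> chart_dom d" for x
  proof
    assume "x \<in> chart_map c ` (chart_dom c \<inter> chart_dom d)"
    then show "x \<in> chart_range c \<and> chart_inv c x \<in> chart_dom d"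
      using chart_inv_map[OF assms(1)] by auto
  next
    assume "x \<in> chart_range c \<and> chart_inv c x \<in> chart_dom d"
    then show "x \<in> chart_map c ` (chart_dom c \<inter> chart_dom d)"
      using chart_map_inv[OF assms(1), of x] chart_inv_dom[OF assms(1), of x] by (metis Int_iff image_eqI)
  qed
  have "chart_map c ` (chart_dom c \<inter> chart_dom d) = chart_range c \<inter> chart_inv c -` chart_dom d"
    using * by auto
  then show "open (chart_map c ` (chart_dom c \<inter> chart_dom d))"
    using continuous_open_preimage[OF continuous_chart_inv open_range open_dom] assms by simp
  show "smooth_on (chart_map c ` (chart_dom c \<inter> chart_dom d)) (transition c d)"
    using atlas assms unfolding smooth_atlas_def by blast
qed

text \<open>The metric pairing of two differentials. The value does not depend on the chart that is chosen at the
  point.\<close>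

definition carre_du_champ :: "('m \<Rightarrow> real) \<Rightarrow> ('m \<Rightarrow> real) \<Rightarrow> 'm \<Rightarrow> real"
  where "carre_du_champ f h p = (let c = SOME c. c \<in> A \<and> p \<in> chart_dom c
    in grad_inner (G c) (rep c f) (rep c h) (chart_map c p))"

lemma grad_inner_chart_independent:
  assumes f: "C1_fun f" and h: "C1_fun h" and c: "c \<in> A" "p \<in> chart_dom c" and d: "d \<in> A" "p \<in> chart_dom d"
  shows "grad_inner (G c) (rep c f) (rep c h) (chart_map c p)
    = grad_inner (G d) (rep d f) (rep d h) (chart_map d p)"
proof -
  define x where "x = chart_map c p"
  define T where "T = transition c d"
  define S where "S = chart_map c ` (chart_dom c \<inter> chart_dom d)"
  have xS: "x \<in> S" using c d by (auto simp: x_def S_def)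
  have S: "open S" unfolding S_def by (rule transition_overlap(1)[OF c(1) d(1)])
  have Tx: "T x = chart_map d p" by (simp add: T_def x_def chart_inv_map[OF c])
  have dT: "T differentiable (at x)"
    using smooth_on_C1(1)[OF transition_overlap(3)[OF c(1) d(1)]] xS by (simp add: S_def T_def)
  have gr: "gradient (rep c u) x = transpose (jacobian T (at x)) *v gradient (rep d u) (chart_map d p)"
    if u: "C1_fun u" for u
  proof -
    have "gradient (rep c u) x = gradient (\<lambda>y. rep d u (T y)) x"
    proof (rule gradient_cong[OF S xS])
      fix y assume "y \<in> S"
      then show "rep c u y = rep d u (T y)"
        using transition_overlap(2)[OF c(1) d(1), of y] chart_inv_map[OF d(1), of "chart_inv c y"]
        by (simp add: S_def T_def)
    qed
    also have "\<dots> = transpose (jacobian T (at x)) *v gradient (rep d u) (T x)"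
      by (rule gradient_compose(1)[OF _ dT]) (use C1_funD(1)[OF u d(1)] d in \<open>simp add: Tx\<close>)
    finally show ?thesis by (simp add: Tx)
  qed
  have "G c x = transpose (jacobian T (at x)) ** G d (chart_map d p) ** jacobian T (at x)"
    using metric c d unfolding riemannian_metric_def Let_def x_def T_def by blast
  moreover have "invertible (G c x)"
    using coord_metric.invertible_g[OF coord_metric[OF c(1)]] c by (simp add: x_def)
  ultimately show ?thesis
    unfolding grad_inner_gradient x_def[symmetric] gr[OF f] gr[OF h] by (rule matrix_inv_congruence)
qed

lemma carre_du_champ_chart:
  assumes "C1_fun f" "C1_fun h" "c \<in> A" "p \<in> chart_dom c"
  shows "carre_du_champ f h p = grad_inner (G c) (rep c f) (rep c h) (chart_map c p)"
proof -
  define d where "d = (SOME c. c \<in> A \<and> p \<in> chart_dom c)"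
  have "d \<in> A \<and> p \<in> chart_dom d"
    unfolding d_def by (rule someI[of _ c]) (use assms in simp)
  then show ?thesis
    using grad_inner_chart_independent[OF assms(1,2) _ _ assms(3,4), of d]
    by (simp add: carre_du_champ_def Let_def d_def[symmetric])
qed

lemma carre_du_champ_commute:
  assumes "C1_fun f" "C1_fun h"
  shows "carre_du_champ f h p = carre_du_champ h f p"
proof -
  obtain c where c: "c \<in> A" "p \<in> chart_dom c" using chart_cover .
  show ?thesis
    using coord_metric.grad_inner_commute[OF coord_metric[OF c(1)]] c
    by (simp add: carre_du_champ_chart[OF assms c] carre_du_champ_chart[OF assms(2,1) c])
qed

lemma carre_du_champ_nonneg:
  assumes "C1_fun f"
  shows "carre_du_champ f f p \<ge> 0"
proof -
  obtain c where c: "c \<in> A" "p \<in> chart_dom c" using chart_cover .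
  show ?thesis
    using coord_metric.grad_inner_nonneg[OF coord_metric[OF c(1)]] c
    by (simp add: carre_du_champ_chart[OF assms assms c])
qed

lemma carre_du_champ_sum:
  assumes "C1_fun f" "finite J" "\<And>j. j \<in> J \<Longrightarrow> C1_fun (h j)"
  shows "carre_du_champ f (\<lambda>p. \<Sum>j\<in>J. h j p) p = (\<Sum>j\<in>J. carre_du_champ f (h j) p)"
proof -
  obtain c where c: "c \<in> A" "p \<in> chart_dom c" using chart_cover .
  let ?x = "chart_map c p"
  have "partial_derivative i (\<lambda>x. \<Sum>j\<in>J. rep c (h j) x) ?x
      = (\<Sum>j\<in>J. partial_derivative i (rep c (h j)) ?x)" for i
    by (rule partial_derivative_sum[OF assms(2)]) (use C1_funD(1)[OF assms(3) c(1)] c(2) in simp)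
  then have "gradient (rep c (\<lambda>p. \<Sum>j\<in>J. h j p)) ?x = (\<Sum>j\<in>J. gradient (rep c (h j)) ?x)"
    by (simp add: gradient_def vec_eq_iff)
  then have "carre_du_champ f (\<lambda>p. \<Sum>j\<in>J. h j p) p
      = gradient (rep c f) ?x \<bullet> (matrix_inv (G c ?x) *v (\<Sum>j\<in>J. gradient (rep c (h j)) ?x))"
    using carre_du_champ_chart[OF assms(1) C1_sum[OF assms(2,3)] c] by (simp add: grad_inner_gradient)
  also have "\<dots> = (\<Sum>j\<in>J. gradient (rep c f) ?x \<bullet> (matrix_inv (G c ?x) *v gradient (rep c (h j)) ?x))"
    by (simp add: linear_sum[OF matrix_vector_mul_linear] inner_sum_right)
  also have "\<dots> = (\<Sum>j\<in>J. carre_du_champ f (h j) p)"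
    using carre_du_champ_chart[OF assms(1) assms(3) c] by (simp add: grad_inner_gradient)
  finally show ?thesis .
qed

lemma carre_du_champ_zero:
  assumes "C1_fun f" "C1_fun h" "open W" "p \<in> W" "\<And>q. q \<in> W \<Longrightarrow> h q = 0"
  shows "carre_du_champ f h p = 0"
proof -
  obtain c where c: "c \<in> A" "p \<in> chart_dom c" using chart_cover .
  have "open (chart_range c \<inter> chart_inv c -` W)"
    by (rule continuous_open_preimage[OF continuous_chart_inv[OF c(1)] open_range[OF c(1)] assms(3)])
  moreover have "chart_map c p \<in> chart_range c \<inter> chart_inv c -` W"
    using c assms(4) by (simp add: chart_inv_map)
  ultimately have "gradient (rep c h) (chart_map c p) = gradient (\<lambda>x. 0) (chart_map c p)"
    by (rule gradient_cong) (use assms(5) in auto)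
  then show ?thesis
    by (simp add: carre_du_champ_chart[OF assms(1,2) c] grad_inner_gradient gradient_def[of "\<lambda>x. 0"]
        zero_vec_def[symmetric])
qed

lemma carre_du_champ_continuous:
  assumes "C1_fun f" "C1_fun h"
  shows "continuous_on UNIV (carre_du_champ f h)"
proof -
  have "isCont (carre_du_champ f h) p" for p
  proof -
    obtain c where c: "c \<in> A" "p \<in> chart_dom c" using chart_cover .
    interpret coord_metric "chart_range c" "G c" using coord_metric[OF c(1)] .
    have "continuous_on (chart_range c) (grad_inner (G c) (rep c f) (rep c h))"
      unfolding grad_inner_def[abs_def] inner_vec_def matrix_vector_mult_def vec_lambda_beta inner_real_def
      by (intro continuous_intros continuous_matrix_inv C1_funD(2)[OF _ c(1)] assms)
    then have "continuous_on (chart_dom c) (\<lambda>p. grad_inner (G c) (rep c f) (rep c h) (chart_map c p))"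
      by (rule continuous_on_compose2[OF _ continuous_chart[OF c(1)]]) auto
    then have "continuous_on (chart_dom c) (carre_du_champ f h)"
      by (simp add: carre_du_champ_chart[OF assms c(1)] cong: continuous_on_cong)
    then show ?thesis using open_dom[OF c(1)] c(2) by (simp add: continuous_on_eq_continuous_at)
  qed
  then show ?thesis by (simp add: continuous_at_imp_continuous_on)
qed

definition extend_chart :: "('m, 'n) chart \<Rightarrow> (real^'n \<Rightarrow> real) \<Rightarrow> 'm \<Rightarrow> real"
  where "extend_chart c u p = (if p \<in> chart_dom c then u (chart_map c p) else 0)"

text \<open>In another chart the extension is the composition with a smooth transition on the overlap, and it is zero on
  the complement of the compact support; these two open sets cover the domain of that chart.\<close>

lemma C1_extend_chart:
  assumes c: "c \<in> A" and d: "\<And>x. u differentiable (at x)"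
    and cont: "\<And>i. continuous_on UNIV (partial_derivative i u)"
    and K: "compact K" "K \<subseteq> chart_range c" "\<And>x. x \<notin> K \<Longrightarrow> u x = 0"
  shows "C1_fun (extend_chart c u)"
  unfolding C1_fun_def
proof (intro ballI)
  fix e assume e: "e \<in> A"
  define S where "S = chart_map e ` (chart_dom e \<inter> chart_dom c)"
  define Z where "Z = chart_range e \<inter> chart_inv e -` (- chart_inv c ` K)"
  define T where "T = transition e c"
  note ov = transition_overlap[OF e c, folded S_def T_def]
  have "closed (chart_inv c ` K)"
    using compact_chart_inv_image[OF c K(1,2)] by (rule compact_imp_closed)
  then have Z: "open Z"
    unfolding Z_def by (intro continuous_open_preimage continuous_chart_inv open_range e) (rule open_Compl)
  have SZ: "S \<union> Z = chart_range e"
    using ov(2) chart_inv_image[OF c K(2)] by (auto simp: Z_def)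
  have onS: "rep e (extend_chart c u) x = u (T x)" if "x \<in> S" for x
    using that ov(2) by (simp add: extend_chart_def T_def)
  have onZ: "rep e (extend_chart c u) x = 0" if "x \<in> Z" for x
    using that chart_inv_image[OF c K(2), of "chart_inv e x"] K(3)
    by (auto simp: extend_chart_def Z_def)
  have dT: "T differentiable (at x)" if "x \<in> S" for x using smooth_on_C1(1)[OF ov(3) that] .
  have dS: "rep e (extend_chart c u) differentiable (at x)" if "x \<in> S" for x
    by (rule differentiable_cong_open[OF ov(1) that onS[symmetric] gradient_compose(2)[OF d dT[OF that]]])
  have dZ: "rep e (extend_chart c u) differentiable (at x)" if "x \<in> Z" for x
    by (rule differentiable_cong_open[OF Z that onZ[symmetric]]) simp_all
  have cS: "continuous_on S (partial_derivative i (rep e (extend_chart c u)))" for i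
  proof -
    have eq: "partial_derivative i (rep e (extend_chart c u)) x
        = (\<Sum>j\<in>UNIV. partial_derivative j u (T x) * (frechet_derivative T (at x) (axis i 1)) $ j)"
      if "x \<in> S" for x
    proof -
      have D: "((\<lambda>y. u (T y)) has_derivative (\<lambda>h. frechet_derivative u (at (T x)) (frechet_derivative T (at x) h))) (at x)"
        by (rule has_derivative_compose[OF _ has_derivative_frechet[OF d]])
          (use dT[OF that] in \<open>simp add: frechet_derivative_works\<close>)
      have "partial_derivative i (rep e (extend_chart c u)) x = partial_derivative i (\<lambda>y. u (T y)) x"
        by (rule partial_derivative_cong[OF ov(1) that onS])
      also have "\<dots> = gradient u (T x) \<bullet> frechet_derivative T (at x) (axis i 1)"
        using partial_derivative_eq[OF D] frechet_derivative_gradient[OF d] by simp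
      finally show ?thesis by (simp add: gradient_def inner_vec_def)
    qed
    have cT: "continuous_on S T" using dT by (rule continuous_on_of_differentiable)
    have "continuous_on S (\<lambda>x. frechet_derivative T (at x) (axis i 1))"
      using smooth_on_C1(2)[OF ov(3)] by (cases "S = {}") auto
    moreover have "continuous_on S (\<lambda>x. partial_derivative j u (T x))" for j
      by (rule continuous_on_compose2[OF cont cT]) simp
    ultimately show ?thesis
      by (simp add: eq cong: continuous_on_cong) (intro continuous_intros)
  qed
  have cZ: "continuous_on Z (partial_derivative i (rep e (extend_chart c u)))" for i
  proof -
    have "partial_derivative i (rep e (extend_chart c u)) x = partial_derivative i (\<lambda>x. 0) x" if "x \<in> Z" for x
      by (rule partial_derivative_cong[OF Z that onZ])
    then show ?thesis by (simp cong: continuous_on_cong)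
  qed
  show "(\<forall>x\<in>chart_range e. rep e (extend_chart c u) differentiable (at x)) \<and>
    (\<forall>i. continuous_on (chart_range e) (partial_derivative i (rep e (extend_chart c u))))"
    using dS dZ continuous_on_open_Un[OF ov(1) Z cS cZ] unfolding SZ[symmetric] by blast
qed

lemma eigenspace_smooth: "f \<in> eigenspace A G \<theta> \<Longrightarrow> smooth_function A f"
  by (simp add: eigenspace_def)

lemma eigenspace_C1: "f \<in> eigenspace A G \<theta> \<Longrightarrow> C1_fun f"
  using eigenspace_smooth C1_smooth by blast

lemma eigenspace_lap:
  assumes "f \<in> eigenspace A G \<theta>" "c \<in> A" "x \<in> chart_range c"
  shows "lap (G c) (rep c f) x = - \<theta> * rep c f x"
proof -
  have "- laplacian_in_chart G c f (chart_inv c x) = \<theta> * f (chart_inv c x)"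
    using assms chart_inv_dom unfolding eigenspace_def by blast
  then show ?thesis
    unfolding laplacian_in_chart_eq chart_map_inv[OF assms(2,3)] by simp
qed

lemma metric_patch:
  assumes "(c, z, \<rho>) \<in> patches" "\<And>\<iota>. \<iota> \<in> I \<Longrightarrow> 0 < r \<iota> \<and> r \<iota> \<le> 1"
  shows "metric_patch I r (open_cube z (2 * \<rho>)) (chart_range c) (G c) (cube z (2 * \<rho>))"
  using coord_metric[OF patchesD(1)[OF assms(1)]] patchesD[OF assms(1)] assms(2)
  unfolding metric_patch_def metric_patch_axioms_def scaled_family_def by simp

lemma green_patch:
  assumes f: "f \<in> eigenspace A G \<theta>" and v: "C1_fun v" and P: "(c, z, \<rho>) \<in> patches"
    and v0: "\<And>p. p \<notin> chart_inv c ` cube z \<rho> \<Longrightarrow> v p = 0"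
  shows "\<theta> * (\<integral>p. f p * v p \<partial>V) = (\<integral>p. carre_du_champ f v p \<partial>V)"
proof -
  note D = patchesD[OF P]
  interpret metric_patch "{()}" "\<lambda>_. 1" "open_cube z (2 * \<rho>)" "chart_range c" "G c" "cube z (2 * \<rho>)"
    by (rule metric_patch[OF P]) simp
  have fC: "C1_fun f" using eigenspace_C1[OF f] .
  have v0': "v p = 0" if "p \<notin> chart_dom c" for p
    using that v0 chart_inv_image[OF D(1,6)] by blast
  have meas: "(\<lambda>p. f p * v p) \<in> borel_measurable borel" "carre_du_champ f v \<in> borel_measurable borel"
    by (intro borel_measurable_continuous_onI C1_continuous C1_mult carre_du_champ_continuous fC v)+
  have W: "open (- (chart_inv c ` cube z \<rho>))"
    using compact_imp_closed[OF compact_chart_inv_image[OF D(1) compact_cube D(6)]] by (simp add: open_Compl)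
  have cd0: "carre_du_champ f v p = 0" if "p \<notin> chart_inv c ` cube z \<rho>" for p
    by (rule carre_du_champ_zero[OF fC v W]) (use that v0 in auto)
  then have cd0': "carre_du_champ f v p = 0" if "p \<notin> chart_dom c" for p
    using that chart_inv_image[OF D(1,6)] by blast
  have sf: "symb 2 0 (\<lambda>\<iota>. rep c f)"
    using eigenspace_smooth[OF f] D(1) unfolding smooth_function_def by (intro symb_smooth) simp
  have sv: "symb 1 0 (\<lambda>\<iota>. rep c v)"
    by (intro symb_C1 C1_funD[OF v D(1)])
  have "(LINT x:cube z \<rho>|lborel. sqrt (det (G c x)) * (lap (G c) (rep c f) x * rep c v x))
    = - (LINT x:cube z \<rho>|lborel. sqrt (det (G c x)) * grad_inner (G c) (rep c f) (rep c v) x)"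
    unfolding cube_def
  proof (rule green_coord[OF sf sv])
    fix i x assume "x \<in> open_cube z (2 * \<rho>)" "x \<notin> cbox (z - (\<chi> i. \<rho>)) (z + (\<chi> i. \<rho>))"
    then have x: "x \<in> chart_range c" "x \<notin> cube z \<rho>" using D(4,8) by (auto simp: cube_def)
    then have "chart_inv c x \<notin> chart_inv c ` cube z \<rho>"
      using chart_inv_image[OF D(1,6)] chart_map_inv[OF D(1)] by auto
    then show "flux (G c) (rep c f) i x * rep c v x = 0" using v0 by simp
  qed (use D(5) in \<open>simp_all add: cube_def\<close>)
  moreover have "(LINT x:cube z \<rho>|lborel. sqrt (det (G c x)) * (lap (G c) (rep c f) x * rep c v x))
      = (LINT x:cube z \<rho>|lborel. - \<theta> * (sqrt (det (G c x)) * (f (chart_inv c x) * v (chart_inv c x))))"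
    by (rule set_lebesgue_integral_cong)
      (use D(6) eigenspace_lap[OF f D(1)] in \<open>auto simp: subset_iff borel_closed\<close>)
  moreover have "\<dots> = - \<theta> * (\<integral>p. f p * v p \<partial>V)"
  proof -
    have "(\<integral>p. f p * v p \<partial>V)
        = (LINT x:cube z \<rho>|lborel. sqrt (det (G c x)) * (f (chart_inv c x) * v (chart_inv c x)))"
      by (rule integral_chart_subset[OF D(1) meas(1) _ D(6)]) (use v0 v0' in auto)
    then show ?thesis by (simp only: set_integral_mult_right)
  qed
  moreover have "(LINT x:cube z \<rho>|lborel. sqrt (det (G c x)) * grad_inner (G c) (rep c f) (rep c v) x)
      = (\<integral>p. carre_du_champ f v p \<partial>V)"
  proof (subst integral_chart_subset[OF D(1) meas(2) _ D(6)])
    show "(LINT x:cube z \<rho>|lborel. sqrt (det (G c x)) * grad_inner (G c) (rep c f) (rep c v) x)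
        = (LINT x:cube z \<rho>|lborel. sqrt (det (G c x)) * carre_du_champ f v (chart_inv c x))"
    proof (rule set_lebesgue_integral_cong)
      show "cube z \<rho> \<in> sets lborel" by (simp add: borel_closed)
      show "\<forall>x. x \<in> cube z \<rho> \<longrightarrow> sqrt (det (G c x)) * grad_inner (G c) (rep c f) (rep c v) x
          = sqrt (det (G c x)) * carre_du_champ f v (chart_inv c x)"
      proof (intro allI impI)
        fix x assume "x \<in> cube z \<rho>"
        then have "x \<in> chart_range c" using D(6) by blast
        then show "sqrt (det (G c x)) * grad_inner (G c) (rep c f) (rep c v) x
          = sqrt (det (G c x)) * carre_du_champ f v (chart_inv c x)"
          using carre_du_champ_chart[OF fC v D(1) chart_inv_dom[OF D(1)]] chart_map_inv[OF D(1)] by simp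
      qed
    qed
  qed (use cd0 cd0' in auto)
  ultimately show ?thesis by simp
qed

text \<open>The second factor is cut into pieces supported in single patches. The pieces are \<open>\<psi> v / \<Sum>\<psi>\<close> with a bump \<open>\<psi>\<close>
  for each patch of a finite cover; since the pairing of differentials is additive, no derivative of the
  cutoffs has to be computed.\<close>

lemma green:
  assumes f: "f \<in> eigenspace A G \<theta>" and v: "C1_fun v"
  shows "\<theta> * (\<integral>p. f p * v p \<partial>V) = (\<integral>p. carre_du_champ f v p \<partial>V)"
proof -
  obtain P where P: "finite P" "P \<subseteq> patches" "\<And>p. \<exists>(c, z, \<rho>)\<in>P. p \<in> chart_inv c ` open_cube z \<rho>"
    using finite_patch_cover by blast
  define \<psi> where "\<psi> = (\<lambda>(c :: ('m, 'n) chart, z, \<rho>). extend_chart c (box_bump (\<lambda>i. 1) 3 z \<rho>))"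
  have \<psi>C: "C1_fun (\<psi> k)" and \<psi>0: "\<psi> k p = 0 \<or> \<psi> k p > 0" and
    \<psi>supp: "k = (c, z, \<rho>) \<Longrightarrow> p \<notin> chart_inv c ` cube z \<rho> \<Longrightarrow> \<psi> k p = 0" and
    \<psi>pos: "k = (c, z, \<rho>) \<Longrightarrow> p \<in> chart_inv c ` open_cube z \<rho> \<Longrightarrow> \<psi> k p > 0"
    if "k \<in> P" for k p c z \<rho>
  proof -
    obtain c' z' \<rho>' where k: "k = (c', z', \<rho>')" by (cases k) auto
    then have kp: "(c', z', \<rho>') \<in> patches" using that P by auto
    note D = patchesD[OF kp]
    interpret scaled_family "{()}" "\<lambda>_. \<rho>'" "UNIV :: (real^'n) set"
      by standard (use D in auto)
    have s: "symb 1 0 (\<lambda>_. box_bump (\<lambda>i. 1) 3 z' \<rho>')" by (rule symb_box_bump) simp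
    have z: "box_bump (\<lambda>i. 1) 3 z' \<rho>' x = 0" if "x \<notin> cube z' \<rho>'" for x
      using that D open_cube_subset_cube[of z' \<rho>'] by (intro box_bump_zero) auto
    have zp: "box_bump (\<lambda>i. 1) 3 z' \<rho>' x = 0 \<or> box_bump (\<lambda>i. 1) 3 z' \<rho>' x > 0" for x
      using box_bump_zero[of 3 \<rho>' x z'] box_bump_pos[of \<rho>' x z'] D by force
    show "C1_fun (\<psi> k)"
      unfolding k \<psi>_def prod.case
    proof (rule C1_extend_chart[OF D(1) _ _ compact_cube D(6) z])
      show "box_bump (\<lambda>i. 1) 3 z' \<rho>' differentiable (at x)" for x
        using symb_differentiable[OF s] by simp
      show "continuous_on UNIV (partial_derivative i (box_bump (\<lambda>i. 1) 3 z' \<rho>'))" for i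
        using symb_continuous[OF symb_partial[of 0 0 "\<lambda>_. box_bump (\<lambda>i. 1) 3 z' \<rho>'"]] s by simp
    qed
    show "\<psi> k p = 0 \<or> \<psi> k p > 0" using zp by (simp add: k \<psi>_def extend_chart_def)
    show "\<psi> k p = 0" if "k = (c, z, \<rho>)" "p \<notin> chart_inv c ` cube z \<rho>"
      using that k z chart_inv_image[OF D(1,6), of p] by (auto simp: \<psi>_def extend_chart_def)
    show "\<psi> k p > 0" if "k = (c, z, \<rho>)" "p \<in> chart_inv c ` open_cube z \<rho>"
      using that k chart_inv_image[OF D(1,7), of p] box_bump_pos[OF D(2)]
      by (auto simp: \<psi>_def extend_chart_def)
  qed
  have \<psi>nn: "\<psi> k p \<ge> 0" if "k \<in> P" for k p using \<psi>0[OF that, of p] by auto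
  define \<Psi> where "\<Psi> p = (\<Sum>k\<in>P. \<psi> k p)" for p
  have \<Psi>pos: "\<Psi> p > 0" for p
  proof -
    obtain c z \<rho> where "(c, z, \<rho>) \<in> P" "p \<in> chart_inv c ` open_cube z \<rho>" using P(3)[of p] by blast
    then show ?thesis
      unfolding \<Psi>_def using \<psi>pos[of "(c, z, \<rho>)" c z \<rho> p] P(1) \<psi>nn
      by (intro sum_pos2[of P "(c, z, \<rho>)"]) simp_all
  qed
  define w where "w k p = \<psi> k p * (v p * inverse (\<Psi> p))" for k p
  have \<Psi>C: "C1_fun \<Psi>" unfolding \<Psi>_def by (intro C1_sum P(1) \<psi>C)
  have wC: "C1_fun (w k)" if "k \<in> P" for k
    unfolding w_def using \<Psi>pos by (intro C1_mult C1_inverse \<psi>C v \<Psi>C that) (simp add: less_imp_neq[symmetric])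
  have sum_w: "v = (\<lambda>p. \<Sum>k\<in>P. w k p)"
  proof
    fix p
    have "(\<Sum>k\<in>P. w k p) = \<Psi> p * (v p * inverse (\<Psi> p))" unfolding w_def \<Psi>_def by (simp add: sum_distrib_right)
    then show "v p = (\<Sum>k\<in>P. w k p)" using \<Psi>pos[of p] by simp
  qed
  have fC: "C1_fun f" using eigenspace_C1[OF f] .
  have loc: "\<theta> * (\<integral>p. f p * w k p \<partial>V) = (\<integral>p. carre_du_champ f (w k) p \<partial>V)" if "k \<in> P" for k
  proof -
    obtain c z \<rho> where k: "k = (c, z, \<rho>)" by (cases k) auto
    show ?thesis
      by (rule green_patch[OF f wC[OF that], of c z \<rho>])
        (use that k P(2) \<psi>supp[OF that k] in \<open>auto simp: w_def\<close>)
  qed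
  have "\<theta> * (\<integral>p. f p * v p \<partial>V) = \<theta> * (\<integral>p. (\<Sum>k\<in>P. f p * w k p) \<partial>V)"
    by (subst sum_w) (simp add: sum_distrib_left)
  also have "\<dots> = (\<Sum>k\<in>P. \<theta> * (\<integral>p. f p * w k p \<partial>V))"
    by (subst Bochner_Integration.integral_sum)
      (auto simp: sum_distrib_left intro!: continuous_integrable C1_continuous C1_mult fC wC)
  also have "\<dots> = (\<Sum>k\<in>P. \<integral>p. carre_du_champ f (w k) p \<partial>V)" using loc by simp
  also have "\<dots> = (\<integral>p. (\<Sum>k\<in>P. carre_du_champ f (w k) p) \<partial>V)"
    by (rule Bochner_Integration.integral_sum[symmetric])
      (auto intro!: continuous_integrable carre_du_champ_continuous fC wC)
  also have "\<dots> = (\<integral>p. carre_du_champ f v p \<partial>V)"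
  proof -
    have "carre_du_champ f v p = (\<Sum>k\<in>P. carre_du_champ f (w k) p)" for p
      by (subst sum_w) (rule carre_du_champ_sum[OF fC P(1) wC])
    then show ?thesis by simp
  qed
  finally show ?thesis .
qed

lemma eigenspace_orthogonal:
  assumes "f \<in> eigenspace A G \<theta>" "h \<in> eigenspace A G \<theta>'" "\<theta> \<noteq> \<theta>'"
  shows "(\<integral>p. f p * h p \<partial>V) = 0"
proof -
  note C = eigenspace_C1[OF assms(1)] eigenspace_C1[OF assms(2)]
  have "\<theta> * (\<integral>p. f p * h p \<partial>V) = (\<integral>p. carre_du_champ f h p \<partial>V)" by (rule green[OF assms(1) C(2)])
  also have "\<dots> = (\<integral>p. carre_du_champ h f p \<partial>V)" by (simp add: carre_du_champ_commute[OF C])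
  also have "\<dots> = \<theta>' * (\<integral>p. h p * f p \<partial>V)" by (rule green[OF assms(2) C(1), symmetric])
  finally show ?thesis using assms(3) by (simp add: mult.commute)
qed

end

section \<open>A Poincare inequality\<close>

lemma nn_integral_lborel_affine:
  fixes F :: "'a::euclidean_space \<Rightarrow> ennreal"
  assumes [measurable]: "F \<in> borel_measurable borel" and c: "c \<noteq> 0"
  shows "(\<integral>\<^sup>+x. F x \<partial>lborel) = ennreal (\<bar>c\<bar> ^ DIM('a)) * (\<integral>\<^sup>+x. F (t + c *\<^sub>R x) \<partial>lborel)"
  by (subst lborel_affine[OF c, of t])
    (simp add: nn_integral_density nn_integral_distr nn_integral_cmult ennreal_power)

text \<open>The fundamental theorem of calculus along the segment, followed by the inequalities of Jensen and of
  Cauchy and Schwarz.\<close>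

lemma segment_difference_square:
  fixes u :: "real^'n::finite \<Rightarrow> real"
  assumes U: "open U" and S: "convex S" "S \<subseteq> U"
    and d: "\<And>x. x \<in> U \<Longrightarrow> u differentiable (at x)"
    and c: "\<And>i. continuous_on U (partial_derivative i u)"
    and xy: "x \<in> S" "y \<in> S" "norm (x - y) \<le> \<delta>"
  shows "ennreal ((u x - u y)\<^sup>2) \<le>
    ennreal (\<delta>\<^sup>2) * (\<integral>\<^sup>+t. ennreal ((norm (gradient u (y + t *\<^sub>R (x - y))))\<^sup>2) * indicator {0..1} t \<partial>lborel)"
proof -
  define p where "p t = y + t *\<^sub>R (x - y)" for t
  define \<phi> where "\<phi> t = gradient u (p t) \<bullet> (x - y)" for t
  have pU: "p t \<in> U" if "0 \<le> t" "t \<le> 1" for t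
  proof -
    have "p t = (1 - t) *\<^sub>R y + t *\<^sub>R x" by (simp add: p_def algebra_simps)
    then show ?thesis using convexD_alt[OF S(1) xy(2,1) that] S(2) by auto
  qed
  have pc: "isCont p t" for t unfolding p_def by (intro continuous_intros)
  have der: "((\<lambda>t. u (p t)) has_real_derivative \<phi> t) (at t)" if "0 \<le> t" "t \<le> 1" for t
  proof -
    have "(p has_derivative (\<lambda>h. h *\<^sub>R (x - y))) (at t)"
      unfolding p_def by (auto intro!: derivative_eq_intros)
    from has_derivative_compose[OF this has_derivative_frechet[OF d[OF pU[OF that]]]]
    have "((\<lambda>t. u (p t)) has_derivative (\<lambda>h. gradient u (p t) \<bullet> (h *\<^sub>R (x - y)))) (at t)"
      using frechet_derivative_gradient[OF d[OF pU[OF that]]] by simp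
    moreover have "(\<lambda>h. gradient u (p t) \<bullet> (h *\<^sub>R (x - y))) = (*) (\<phi> t)"
      by (auto simp: \<phi>_def mult.commute)
    ultimately show ?thesis by (simp add: has_field_derivative_def)
  qed
  have gc: "continuous_on U (gradient u)"
    unfolding gradient_def[abs_def] by (intro continuous_on_vec_lambda c)
  have cont: "isCont \<phi> t" if "0 \<le> t" "t \<le> 1" for t
  proof -
    have "isCont (gradient u) (p t)" using gc U pU[OF that] by (simp add: continuous_on_eq_continuous_at)
    from isCont_o2[OF pc this] have "isCont (\<lambda>t. gradient u (p t)) t" .
    then show ?thesis unfolding \<phi>_def by (intro continuous_intros)
  qed
  have \<phi>c: "continuous_on {0..1} \<phi>" using cont by (intro continuous_at_imp_continuous_on) auto
  define L where "L = (\<integral>t. \<phi> t * indicator {0..1} t \<partial>lborel)"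
  have L: "L = u x - u y"
    using integral_FTC_Icc_real[of 0 1 "\<lambda>t. u (p t)" \<phi>] der cont by (simp add: L_def p_def)
  have i1: "integrable lborel (\<lambda>t. \<phi> t * indicator {0..1} t)"
    using borel_integrable_compact[OF compact_Icc \<phi>c] by (simp add: mult.commute)
  have i2: "integrable lborel (\<lambda>t. (\<phi> t)\<^sup>2 * indicator {0..1} t)"
    using borel_integrable_compact[OF compact_Icc, of 0 1 "\<lambda>t. (\<phi> t)\<^sup>2"] \<phi>c
    by (simp add: mult.commute continuous_on_power)
  have i3: "integrable lborel (\<lambda>t::real. indicator {0..1} t :: real)"
    by (intro integrable_real_indicator) simp_all
  \<comment> \<open>Jensen: the variance of \<open>\<phi>\<close> over the unit interval is nonnegative.\<close>
  have "0 \<le> (\<integral>t. (\<phi> t - L)\<^sup>2 * indicator {0..1} t \<partial>lborel)"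
    by (intro integral_nonneg_AE) simp
  also have "\<dots> = (\<integral>t. (\<phi> t)\<^sup>2 * indicator {0..1} t - 2 * L * (\<phi> t * indicator {0..1} t)
      + L\<^sup>2 * indicator {0..1} t \<partial>lborel)"
    by (intro Bochner_Integration.integral_cong) (simp_all add: power2_eq_square algebra_simps)
  also have "\<dots> = (\<integral>t. (\<phi> t)\<^sup>2 * indicator {0..1} t \<partial>lborel) - 2 * L * L + L\<^sup>2"
    using i1 i2 i3 by (simp add: L_def)
  finally have "L\<^sup>2 \<le> (\<integral>t. (\<phi> t)\<^sup>2 * indicator {0..1} t \<partial>lborel)"
    by (simp add: power2_eq_square)
  then have "ennreal ((u x - u y)\<^sup>2) \<le> ennreal (\<integral>t. (\<phi> t)\<^sup>2 * indicator {0..1} t \<partial>lborel)"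
    unfolding L by (rule ennreal_leI)
  also have "\<dots> = (\<integral>\<^sup>+t. ennreal ((\<phi> t)\<^sup>2 * indicator {0..1} t) \<partial>lborel)"
    by (rule nn_integral_eq_integral[symmetric]) (use i2 in auto)
  also have "\<dots> \<le> (\<integral>\<^sup>+t. ennreal (\<delta>\<^sup>2) *
      (ennreal ((norm (gradient u (p t)))\<^sup>2) * indicator {0..1} t) \<partial>lborel)"
  proof (rule nn_integral_mono)
    fix t
    have "\<bar>\<phi> t\<bar> \<le> norm (gradient u (p t)) * \<delta>"
      unfolding \<phi>_def using Cauchy_Schwarz_ineq2 xy(3)
      by (meson mult_left_mono norm_ge_zero order_trans)
    then have "(\<phi> t)\<^sup>2 \<le> (norm (gradient u (p t)) * \<delta>)\<^sup>2" by (rule abs_le_square_iff[THEN iffD1, OF order_trans]) simp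
    then have "(\<phi> t)\<^sup>2 \<le> \<delta>\<^sup>2 * (norm (gradient u (p t)))\<^sup>2" by (simp add: power_mult_distrib mult.commute)
    then show "ennreal ((\<phi> t)\<^sup>2 * indicator {0..1} t)
        \<le> ennreal (\<delta>\<^sup>2) * (ennreal ((norm (gradient u (p t)))\<^sup>2) * indicator {0..1} t)"
      by (auto simp: indicator_def ennreal_mult[symmetric] intro!: ennreal_leI)
  qed
  also have "\<dots> = ennreal (\<delta>\<^sup>2) * (\<integral>\<^sup>+t. ennreal ((norm (gradient u (p t)))\<^sup>2) * indicator {0..1} t \<partial>lborel)"
  proof (rule nn_integral_cmult)
    define q where "q t = (if t \<in> {0..1} then norm (gradient u (p t)) else 0)" for t
    have "continuous_on {0..1} (\<lambda>t. norm (gradient u (p t)))"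
      by (intro continuous_on_norm continuous_on_compose2[OF gc] continuous_at_imp_continuous_on)
        (use pc pU in auto)
    then have [measurable]: "q \<in> borel_measurable borel"
      unfolding q_def by (intro borel_measurable_continuous_on_if) auto
    have "(\<lambda>t. ennreal ((norm (gradient u (p t)))\<^sup>2) * indicator {0..1} t) = (\<lambda>t. ennreal ((q t)\<^sup>2))"
      by (auto simp: q_def indicator_def)
    then show "(\<lambda>t. ennreal ((norm (gradient u (p t)))\<^sup>2) * indicator {0..1} t) \<in> borel_measurable lborel"
      by simp
  qed
  finally show ?thesis unfolding p_def .
qed

text \<open>Since \<open>u\<close> has mean zero, \<open>\<integral> u\<^sup>2\<close> is at most the average over \<open>y\<close> of \<open>\<integral> (u x - u y)\<^sup>2 dx\<close>. The previous bound is
  averaged over pairs of points of the convex set: for fixed \<open>t \<ge> 1/2\<close> the point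
  \<open>(1 - t) y + t x\<close> is, as a function of \<open>x\<close>, an affine image with Jacobian at least \<open>2\<^bsup>-n\<^esup>\<close>; for \<open>t \<le> 1/2\<close>
  the same holds as a function of \<open>y\<close>.\<close>

lemma poincare_convex:
  fixes u :: "real^'n::finite \<Rightarrow> real"
  assumes U: "open U" and S: "convex S" "S \<subseteq> K" and K: "compact K" "K \<subseteq> U"
    and Sm [measurable]: "S \<in> sets borel" and pos: "emeasure lborel S > 0"
    and d: "\<And>x. x \<in> U \<Longrightarrow> u differentiable (at x)"
    and c: "\<And>i. continuous_on U (partial_derivative i u)"
    and diam: "\<And>x y. x \<in> S \<Longrightarrow> y \<in> S \<Longrightarrow> norm (x - y) \<le> \<delta>"
    and mean: "(LINT x:S|lborel. u x) = 0"
  shows "(LINT x:S|lborel. (u x)\<^sup>2) \<le> 2 ^ CARD('n) * \<delta>\<^sup>2 * (LINT x:S|lborel. (norm (gradient u x))\<^sup>2)"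
proof -
  define g where "g x = (norm (gradient u x))\<^sup>2" for x
  have gc: "continuous_on U (gradient u)"
    unfolding gradient_def[abs_def] by (intro continuous_on_vec_lambda c)
  have cu: "continuous_on U u" using d by (rule continuous_on_of_differentiable)
  have bnd: "bounded S" using K(1) S(2) compact_imp_bounded bounded_subset by blast
  have fin: "emeasure lborel S < \<infinity>" by (rule emeasure_bounded_finite[OF bnd])
  define s where "s = measure lborel S"
  have s: "emeasure lborel S = ennreal s" "s > 0"
  proof -
    show *: "emeasure lborel S = ennreal s"
      unfolding s_def by (rule emeasure_eq_ennreal_measure) (use fin in simp)
    show "s > 0" using pos unfolding * by (cases "s > 0") (simp_all add: ennreal_neg not_less)
  qed
  have setint: "set_integrable lborel S h" if "continuous_on U h" for h :: "real^'n \<Rightarrow> real"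
    using set_integrable_subset[OF set_integrable_compact_continuous[OF K(1) continuous_on_subset[OF that K(2)]] _ S(2)]
    by simp
  have intu: "set_integrable lborel S u" by (rule setint[OF cu])
  have intu2: "set_integrable lborel S (\<lambda>x. (u x)\<^sup>2)" by (intro setint continuous_on_power cu)
  have intg: "set_integrable lborel S g" unfolding g_def by (intro setint continuous_intros gc)
  define I where "I = (LINT x:S|lborel. (u x)\<^sup>2)"
  have I0: "I \<ge> 0" unfolding I_def set_lebesgue_integral_def by (intro integral_nonneg_AE) (auto simp: indicator_def)
  \<comment> \<open>Fubini needs Borel functions on the whole space, so the squared gradient is extended by zero, to \<open>H\<close> outside
    \<open>U\<close> and to \<open>F\<close> outside \<open>S\<close>.\<close>
  define H where "H x = ennreal (if x \<in> U then g x else 0)" for x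
  have [measurable]: "H \<in> borel_measurable borel"
    unfolding H_def g_def using U
    by (intro measurable_compose[OF borel_measurable_continuous_on_if measurable_ennreal] continuous_intros gc) auto
  define F where "F x = H x * indicator S x" for x
  have [measurable]: "F \<in> borel_measurable borel" unfolding F_def by measurable
  have F: "(\<integral>\<^sup>+x. F x \<partial>lborel) = ennreal (LINT x:S|lborel. g x)"
  proof -
    have "F x = ennreal (indicator S x *\<^sub>R g x)" for x
      using S(2) K(2) by (auto simp: F_def H_def indicator_def)
    then show ?thesis
      using intg by (simp add: set_integrable_def set_lebesgue_integral_def nn_integral_eq_integral g_def)
  qed
  define \<Phi> where "\<Phi> t x y = H (y + t *\<^sub>R (x - y)) * (indicator {0..1} t * (indicator S x * indicator S y))" for t :: real and x y
  have \<Phi>F: "\<Phi> t x y \<le> F (y + t *\<^sub>R (x - y)) * (indicator S x * indicator S y)" for t x y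
  proof -
    have "y + t *\<^sub>R (x - y) = (1 - t) *\<^sub>R y + t *\<^sub>R x" by (simp add: algebra_simps)
    then have "y + t *\<^sub>R (x - y) \<in> S" if "x \<in> S" "y \<in> S" "0 \<le> t" "t \<le> 1"
      using convexD_alt[OF S(1) that(2,1,3,4)] by simp
    then show ?thesis by (auto simp: \<Phi>_def F_def indicator_def)
  qed
  have half: "(\<integral>\<^sup>+x. F (a + t *\<^sub>R x) \<partial>lborel) \<le> 2 ^ CARD('n) * (\<integral>\<^sup>+x. F x \<partial>lborel)"
    if t: "t \<ge> 1/2" for t :: real and a
  proof -
    have "1 \<le> (2 * \<bar>t\<bar>) ^ CARD('n)" using t by (intro one_le_power) simp
    then have "1 \<le> (2::ennreal) ^ CARD('n) * ennreal (\<bar>t\<bar> ^ CARD('n))"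
    proof -
      assume "1 \<le> (2 * \<bar>t\<bar>) ^ CARD('n)"
      then have "1 \<le> ennreal (2 ^ CARD('n) * \<bar>t\<bar> ^ CARD('n))"
        by (simp add: power_mult_distrib)
      also have "\<dots> = (2::ennreal) ^ CARD('n) * ennreal (\<bar>t\<bar> ^ CARD('n))"
        by (simp add: ennreal_mult flip: ennreal_power)
      finally show ?thesis .
    qed
    then have "1 * (\<integral>\<^sup>+x. F (a + t *\<^sub>R x) \<partial>lborel)
        \<le> 2 ^ CARD('n) * ennreal (\<bar>t\<bar> ^ CARD('n)) * (\<integral>\<^sup>+x. F (a + t *\<^sub>R x) \<partial>lborel)"
      by (rule mult_right_mono) simp
    also have "\<dots> = 2 ^ CARD('n) * (\<integral>\<^sup>+x. F x \<partial>lborel)"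
      using nn_integral_lborel_affine[of F t a] t by (simp add: mult.assoc)
    finally show ?thesis by simp
  qed
  have indS: "(\<integral>\<^sup>+x. indicator S x * C \<partial>lborel) = ennreal s * C" for C :: ennreal
    using s(1) by (simp add: nn_integral_multc)
  have perT: "(\<integral>\<^sup>+x. \<integral>\<^sup>+y. \<Phi> t x y \<partial>lborel \<partial>lborel) \<le> 2 ^ CARD('n) * ennreal s * (\<integral>\<^sup>+x. F x \<partial>lborel) * indicator {0..1} t"
    for t
  proof (cases "t \<in> {0..1}")
    case True
    show ?thesis
    proof (cases "t \<ge> 1/2")
      case True
      have "(\<integral>\<^sup>+x. \<integral>\<^sup>+y. \<Phi> t x y \<partial>lborel \<partial>lborel) \<le> (\<integral>\<^sup>+x. \<integral>\<^sup>+y. F (y + t *\<^sub>R (x - y)) * indicator S y \<partial>lborel \<partial>lborel)"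
        by (intro nn_integral_mono order_trans[OF \<Phi>F]) (auto simp: indicator_def)
      also have "\<dots> = (\<integral>\<^sup>+y. \<integral>\<^sup>+x. F (y + t *\<^sub>R (x - y)) * indicator S y \<partial>lborel \<partial>lborel)"
        by (rule lborel_pair.Fubini'[symmetric]) measurable
      also have "\<dots> = (\<integral>\<^sup>+y. indicator S y * (\<integral>\<^sup>+x. F ((1 - t) *\<^sub>R y + t *\<^sub>R x) \<partial>lborel) \<partial>lborel)"
        by (subst nn_integral_multc) (auto simp: algebra_simps intro!: nn_integral_cong)
      also have "\<dots> \<le> (\<integral>\<^sup>+y. indicator S y * (2 ^ CARD('n) * (\<integral>\<^sup>+x. F x \<partial>lborel)) \<partial>lborel)"
        by (intro nn_integral_mono mult_left_mono half True) simp
      also have "\<dots> = ennreal s * (2 ^ CARD('n) * (\<integral>\<^sup>+x. F x \<partial>lborel))" by (rule indS)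
      finally show ?thesis using \<open>t \<in> {0..1}\<close> by (simp add: ac_simps)
    next
      case False
      have "(\<integral>\<^sup>+x. \<integral>\<^sup>+y. \<Phi> t x y \<partial>lborel \<partial>lborel) \<le> (\<integral>\<^sup>+x. \<integral>\<^sup>+y. F (y + t *\<^sub>R (x - y)) * indicator S x \<partial>lborel \<partial>lborel)"
        by (intro nn_integral_mono order_trans[OF \<Phi>F]) (auto simp: indicator_def)
      also have "\<dots> = (\<integral>\<^sup>+x. indicator S x * (\<integral>\<^sup>+y. F (t *\<^sub>R x + (1 - t) *\<^sub>R y) \<partial>lborel) \<partial>lborel)"
        by (subst nn_integral_multc) (auto simp: algebra_simps intro!: nn_integral_cong)
      also have "\<dots> \<le> (\<integral>\<^sup>+x. indicator S x * (2 ^ CARD('n) * (\<integral>\<^sup>+x. F x \<partial>lborel)) \<partial>lborel)"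
        by (intro nn_integral_mono mult_left_mono half) (use False in simp_all)
      also have "\<dots> = ennreal s * (2 ^ CARD('n) * (\<integral>\<^sup>+x. F x \<partial>lborel))" by (rule indS)
      finally show ?thesis using \<open>t \<in> {0..1}\<close> by (simp add: ac_simps)
    qed
  qed (simp add: \<Phi>_def)
  have \<Phi>m: "(\<lambda>y. \<integral>\<^sup>+t. \<Phi> t x y \<partial>lborel) \<in> borel_measurable lborel"
    "(\<lambda>x. \<integral>\<^sup>+y. \<integral>\<^sup>+t. \<Phi> t x y \<partial>lborel \<partial>lborel) \<in> borel_measurable lborel" for x
    unfolding \<Phi>_def by measurable
  have lower: "ennreal (s * I) \<le> (\<integral>\<^sup>+x. \<integral>\<^sup>+y. indicator S x * (ennreal ((u x - u y)\<^sup>2) * indicator S y) \<partial>lborel \<partial>lborel)"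
  proof -
    have "ennreal I * indicator S x \<le> (\<integral>\<^sup>+y. indicator S x * (ennreal ((u x - u y)\<^sup>2) * indicator S y) \<partial>lborel)" for x
    proof (cases "x \<in> S")
      case True
      have int3: "set_integrable lborel S (\<lambda>y. (u x - u y)\<^sup>2)"
        by (intro setint continuous_intros cu)
      have "(LINT y:S|lborel. (u x - u y)\<^sup>2) = (LINT y:S|lborel. (u x)\<^sup>2 + (- 2 * u x * u y + (u y)\<^sup>2))"
        by (intro set_lebesgue_integral_cong) (auto simp: power2_eq_square algebra_simps)
      also have "\<dots> = (LINT y:S|lborel. (u x)\<^sup>2) + ((LINT y:S|lborel. - 2 * u x * u y) + I)"
        unfolding I_def
        by (subst set_integral_add, (intro setint continuous_intros cu)+)
          (subst set_integral_add, (intro setint continuous_intros cu)+, simp)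
      also have "(LINT y:S|lborel. - 2 * u x * u y) = 0"
        by (simp only: set_integral_mult_right mean mult_zero_right)
      finally have "(LINT y:S|lborel. (u x - u y)\<^sup>2) = (LINT y:S|lborel. (u x)\<^sup>2) + I" by simp
      moreover have "(LINT y:S|lborel. (u x)\<^sup>2) \<ge> 0"
        unfolding set_lebesgue_integral_def by (intro integral_nonneg_AE) (auto simp: indicator_def)
      ultimately have "I \<le> (LINT y:S|lborel. (u x - u y)\<^sup>2)" by simp
      then have "ennreal I \<le> ennreal (LINT y:S|lborel. (u x - u y)\<^sup>2)" by (rule ennreal_leI)
      also have "\<dots> = (\<integral>\<^sup>+y. ennreal (indicator S y *\<^sub>R (u x - u y)\<^sup>2) \<partial>lborel)"
        unfolding set_lebesgue_integral_def using int3
        by (intro nn_integral_eq_integral[symmetric]) (auto simp: set_integrable_def indicator_def)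
      also have "\<dots> = (\<integral>\<^sup>+y. indicator S x * (ennreal ((u x - u y)\<^sup>2) * indicator S y) \<partial>lborel)"
        using True by (intro nn_integral_cong) (auto simp: indicator_def)
      finally show ?thesis using True by simp
    qed simp
    then have "(\<integral>\<^sup>+x. ennreal I * indicator S x \<partial>lborel)
        \<le> (\<integral>\<^sup>+x. \<integral>\<^sup>+y. indicator S x * (ennreal ((u x - u y)\<^sup>2) * indicator S y) \<partial>lborel \<partial>lborel)"
      by (rule nn_integral_mono)
    moreover have "(\<integral>\<^sup>+x. ennreal I * indicator S x \<partial>lborel) = ennreal (s * I)"
      using s I0 by (simp add: nn_integral_cmult ennreal_mult mult.commute)
    ultimately show ?thesis by simp
  qed
  also have "\<dots> \<le> (\<integral>\<^sup>+x. \<integral>\<^sup>+y. ennreal (\<delta>\<^sup>2) * (\<integral>\<^sup>+t. \<Phi> t x y \<partial>lborel) \<partial>lborel \<partial>lborel)"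
  proof (intro nn_integral_mono)
    fix x y
    show "indicator S x * (ennreal ((u x - u y)\<^sup>2) * indicator S y)
        \<le> ennreal (\<delta>\<^sup>2) * (\<integral>\<^sup>+t. \<Phi> t x y \<partial>lborel)"
    proof (cases "x \<in> S \<and> y \<in> S")
      case True
      have SU: "S \<subseteq> U" using S(2) K(2) by blast
      have "ennreal ((u x - u y)\<^sup>2) \<le>
        ennreal (\<delta>\<^sup>2) * (\<integral>\<^sup>+t. ennreal ((norm (gradient u (y + t *\<^sub>R (x - y))))\<^sup>2) * indicator {0..1} t \<partial>lborel)"
        by (rule segment_difference_square[OF U S(1) SU d c]) (use True diam in auto)
      also have "(\<integral>\<^sup>+t. ennreal ((norm (gradient u (y + t *\<^sub>R (x - y))))\<^sup>2) * indicator {0..1} t \<partial>lborel)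
          = (\<integral>\<^sup>+t. \<Phi> t x y \<partial>lborel)"
      proof (rule nn_integral_cong)
        fix t
        have "y + t *\<^sub>R (x - y) \<in> U" if "t \<in> {0..1}"
        proof -
          have "y + t *\<^sub>R (x - y) = (1 - t) *\<^sub>R y + t *\<^sub>R x" by (simp add: algebra_simps)
          then show ?thesis using convexD_alt[OF S(1), of y x t] True that SU by auto
        qed
        then show "ennreal ((norm (gradient u (y + t *\<^sub>R (x - y))))\<^sup>2) * indicator {0..1} t = \<Phi> t x y"
          using True by (auto simp: \<Phi>_def H_def g_def indicator_def)
      qed
      finally show ?thesis using True by simp
    qed auto
  qed
  also have "\<dots> = ennreal (\<delta>\<^sup>2) * (\<integral>\<^sup>+x. \<integral>\<^sup>+y. \<integral>\<^sup>+t. \<Phi> t x y \<partial>lborel \<partial>lborel \<partial>lborel)"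
    by (simp only: nn_integral_cmult[OF \<Phi>m(1)] nn_integral_cmult[OF \<Phi>m(2)])
  also have "(\<integral>\<^sup>+x. \<integral>\<^sup>+y. \<integral>\<^sup>+t. \<Phi> t x y \<partial>lborel \<partial>lborel \<partial>lborel)
      = (\<integral>\<^sup>+x. \<integral>\<^sup>+t. \<integral>\<^sup>+y. \<Phi> t x y \<partial>lborel \<partial>lborel \<partial>lborel)"
    by (intro nn_integral_cong lborel_pair.Fubini') (unfold \<Phi>_def, measurable)
  also have "\<dots> = (\<integral>\<^sup>+t. \<integral>\<^sup>+x. \<integral>\<^sup>+y. \<Phi> t x y \<partial>lborel \<partial>lborel \<partial>lborel)"
    by (rule lborel_pair.Fubini') (unfold \<Phi>_def, measurable)
  also have "\<dots> \<le> (\<integral>\<^sup>+t. 2 ^ CARD('n) * ennreal s * (\<integral>\<^sup>+x. F x \<partial>lborel) * indicator {0..1::real} t \<partial>lborel)"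
    by (intro nn_integral_mono perT)
  also have "\<dots> = 2 ^ CARD('n) * ennreal s * (\<integral>\<^sup>+x. F x \<partial>lborel)"
    by (simp add: nn_integral_cmult)
  also have "ennreal (\<delta>\<^sup>2) * (2 ^ CARD('n) * ennreal s * (\<integral>\<^sup>+x. F x \<partial>lborel))
      = ennreal (\<delta>\<^sup>2 * (2 ^ CARD('n) * s * (LINT x:S|lborel. g x)))"
  proof -
    have "(LINT x:S|lborel. g x) \<ge> 0"
      unfolding set_lebesgue_integral_def by (intro integral_nonneg_AE) (auto simp: indicator_def g_def)
    moreover have "(2::ennreal) ^ CARD('n) = ennreal (2 ^ CARD('n))"
      by (simp flip: ennreal_power ennreal_numeral)
    ultimately show ?thesis unfolding F using s(2) by (simp add: ennreal_mult)
  qed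
  finally have "ennreal (s * I) \<le> ennreal (\<delta>\<^sup>2 * (2 ^ CARD('n) * s * (LINT x:S|lborel. g x)))"
    by (simp add: mult_left_mono)
  moreover have "(LINT x:S|lborel. g x) \<ge> 0"
    unfolding set_lebesgue_integral_def by (intro integral_nonneg_AE) (auto simp: indicator_def g_def)
  ultimately have "s * I \<le> s * (2 ^ CARD('n) * \<delta>\<^sup>2 * (LINT x:S|lborel. g x))"
    using s(2) by (subst (asm) ennreal_le_iff) (auto simp: mult_ac)
  then show ?thesis using s(2) by (simp add: I_def g_def)
qed

section \<open>Subdivision of coordinate cubes\<close>

definition cells :: "nat \<Rightarrow> ('n::finite \<Rightarrow> nat) set"
  where "cells N = {a. \<forall>i. a i < N}"

definition cell :: "real^'n::finite \<Rightarrow> real \<Rightarrow> nat \<Rightarrow> ('n \<Rightarrow> nat) \<Rightarrow> (real^'n) set"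
  where "cell z \<rho> N a = {x. \<forall>i. z $ i - \<rho> + 2 * \<rho> / N * a i \<le> x $ i \<and>
    x $ i < z $ i - \<rho> + 2 * \<rho> / N * (a i + 1)}"

definition cell_center :: "real^'n::finite \<Rightarrow> real \<Rightarrow> nat \<Rightarrow> ('n \<Rightarrow> nat) \<Rightarrow> real^'n"
  where "cell_center z \<rho> N a = (\<chi> i. z $ i - \<rho> + 2 * \<rho> / N * (a i + 1/2))"

lemma cells_PiE: "cells N = PiE UNIV (\<lambda>_. {..<N})"
  by (auto simp: cells_def PiE_def)

lemma finite_cells [simp]: "finite (cells N :: ('n::finite \<Rightarrow> nat) set)"
  unfolding cells_PiE by (intro finite_PiE) auto

lemma card_cells: "card (cells N :: ('n::finite \<Rightarrow> nat) set) = N ^ CARD('n)"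
  unfolding cells_PiE by (subst card_PiE) auto

lemma emeasure_open_nonempty:
  fixes S :: "(real^'n::finite) set"
  assumes "open S" "S \<noteq> {}"
  shows "emeasure lborel S > 0"
proof (rule ccontr)
  assume "\<not> emeasure lborel S > 0"
  then have "S \<in> null_sets lborel" using assms(1) by (intro null_setsI) auto
  then show False
    using open_not_negligible[OF assms] negligible_iff_null_sets null_sets_completionI by blast
qed

lemma convex_cell: "convex (cell z \<rho> N a)"
proof -
  have "cell z \<rho> N a = (\<Inter>i. (\<lambda>x. x $ i) -` {z $ i - \<rho> + 2 * \<rho> / N * a i ..<
      z $ i - \<rho> + 2 * \<rho> / N * (a i + 1)})"
    by (auto simp: cell_def)
  then show ?thesis
    by (simp only:) (intro convex_INT convex_linear_vimage bounded_linear.linear bounded_linear_vec_nth convex_real_interval)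
qed

lemma cell_borel [measurable]: "cell z \<rho> N a \<in> sets borel"
proof -
  have [measurable]: "(\<lambda>x::real^'n. x $ i) \<in> borel_measurable borel" for i
    by (intro borel_measurable_continuous_onI continuous_intros)
  have "{x \<in> space borel. \<forall>i. z $ i - \<rho> + 2 * \<rho> / N * a i \<le> x $ i \<and>
    x $ i < z $ i - \<rho> + 2 * \<rho> / N * (a i + 1)} \<in> sets borel" by measurable
  then show ?thesis by (simp add: cell_def)
qed

context
  fixes z :: "real^'n::finite" and \<rho> :: real and N :: nat
  assumes \<rho>: "\<rho> > 0" and N: "N \<ge> 1"
begin

lemma cell_subset_cube: "a \<in> cells N \<Longrightarrow> cell z \<rho> N a \<subseteq> cube z \<rho>"
proof
  fix x assume a: "a \<in> cells N" and x: "x \<in> cell z \<rho> N a"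
  show "x \<in> cube z \<rho>"
    unfolding mem_cube
  proof
    fix i
    have "2 * \<rho> / N * (a i + 1) \<le> 2 * \<rho> / N * N"
      using a \<rho> by (intro mult_left_mono) (auto simp: cells_def Suc_le_eq simp flip: of_nat_Suc)
    then have 1: "2 * \<rho> / N * (a i + 1) \<le> 2 * \<rho>" using N by simp
    have "0 \<le> 2 * \<rho> / N * a i" using \<rho> by simp
    moreover have "z $ i - \<rho> + 2 * \<rho> / N * a i \<le> x $ i" "x $ i < z $ i - \<rho> + 2 * \<rho> / N * (a i + 1)"
      using x by (auto simp: cell_def)
    ultimately show "\<bar>x $ i - z $ i\<bar> \<le> \<rho>" using 1 by (auto simp: abs_le_iff)
  qed
qed

lemma cell_diameter:
  assumes "x \<in> cell z \<rho> N a" "y \<in> cell z \<rho> N a"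
  shows "norm (x - y) \<le> CARD('n) * (2 * \<rho> / N)"
proof -
  have "\<bar>(x - y) $ i\<bar> \<le> 2 * \<rho> / N" for i
  proof -
    have "z $ i - \<rho> + 2 * \<rho> / N * a i \<le> x $ i" "x $ i < z $ i - \<rho> + 2 * \<rho> / N * (a i + 1)"
      "z $ i - \<rho> + 2 * \<rho> / N * a i \<le> y $ i" "y $ i < z $ i - \<rho> + 2 * \<rho> / N * (a i + 1)"
      using assms by (auto simp: cell_def)
    moreover have "2 * \<rho> / N * (a i + 1) = 2 * \<rho> / N * a i + 2 * \<rho> / N" by (simp add: distrib_left)
    ultimately show ?thesis by (auto simp: abs_le_iff)
  qed
  then have "norm (x - y) \<le> (\<Sum>i\<in>(UNIV::'n set). 2 * \<rho> / N)"
    by (intro order_trans[OF norm_le_l1_cart] sum_mono)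
  then show ?thesis by simp
qed

lemma cube_center_subset_cell:
  assumes "r < \<rho> / N"
  shows "cube (cell_center z \<rho> N a) r \<subseteq> cell z \<rho> N a"
proof
  fix x assume x: "x \<in> cube (cell_center z \<rho> N a) r"
  have "z $ i - \<rho> + 2 * \<rho> / N * a i \<le> x $ i \<and> x $ i < z $ i - \<rho> + 2 * \<rho> / N * (a i + 1)" for i
  proof -
    have "\<bar>x $ i - (z $ i - \<rho> + 2 * \<rho> / N * (a i + 1/2))\<bar> \<le> r"
      using x by (simp add: mem_cube cell_center_def)
    moreover have "2 * \<rho> / N * (a i + 1/2) = 2 * \<rho> / N * a i + \<rho> / N"
      "2 * \<rho> / N * (a i + 1) = 2 * \<rho> / N * a i + \<rho> / N + \<rho> / N"
      by (simp_all add: distrib_left)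
    ultimately show ?thesis using assms by (auto simp: abs_le_iff)
  qed
  then show "x \<in> cell z \<rho> N a" by (simp add: cell_def)
qed

lemma emeasure_cell_pos: "emeasure lborel (cell z \<rho> N a) > 0"
proof -
  have "0 < \<rho> / N" using \<rho> N by simp
  then have r: "\<rho> / N / 2 < \<rho> / N" "0 < \<rho> / N / 2" by auto
  have "cell_center z \<rho> N a \<in> open_cube (cell_center z \<rho> N a) (\<rho> / N / 2)"
    using r by (simp add: mem_open_cube)
  then have "0 < emeasure lborel (open_cube (cell_center z \<rho> N a) (\<rho> / N / 2))"
    by (intro emeasure_open_nonempty) auto
  also have "\<dots> \<le> emeasure lborel (cell z \<rho> N a)"
    by (rule emeasure_mono[OF order_trans[OF open_cube_subset_cube cube_center_subset_cell[OF r(1)]]]) simp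
  finally show ?thesis .
qed

lemma cell_index:
  assumes "x \<in> cell z \<rho> N a"
  shows "\<lfloor>(x $ i - z $ i + \<rho>) * N / (2 * \<rho>)\<rfloor> = int (a i)"
proof -
  have "z $ i - \<rho> + 2 * \<rho> / N * a i \<le> x $ i" "x $ i < z $ i - \<rho> + 2 * \<rho> / N * (a i + 1)"
    using assms by (auto simp: cell_def)
  then have "2 * \<rho> / N * a i \<le> x $ i - z $ i + \<rho>" "x $ i - z $ i + \<rho> < 2 * \<rho> / N * (a i + 1)" by auto
  then have "a i \<le> (x $ i - z $ i + \<rho>) * N / (2 * \<rho>)" "(x $ i - z $ i + \<rho>) * N / (2 * \<rho>) < a i + 1"
    using \<rho> N by (auto simp: field_simps)
  then show ?thesis by (intro floor_unique) auto
qed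

lemma cells_disjoint: "disjoint_family_on (cell z \<rho> N) (cells N)"
proof -
  have "a = b" if "x \<in> cell z \<rho> N a" "x \<in> cell z \<rho> N b" for x a b
    using cell_index[OF that(1)] cell_index[OF that(2)] by (metis ext of_nat_eq_iff)
  then show ?thesis by (auto simp: disjoint_family_on_def)
qed

lemma open_cube_subset_cells: "open_cube z \<rho> \<subseteq> (\<Union>a\<in>cells N. cell z \<rho> N a)"
proof
  fix x assume x: "x \<in> open_cube z \<rho>"
  define t where "t i = (x $ i - z $ i + \<rho>) * N / (2 * \<rho>)" for i
  define a where "a i = nat \<lfloor>t i\<rfloor>" for i
  have t: "0 \<le> t i" "t i < N" for i
  proof -
    have "\<bar>x $ i - z $ i\<bar> < \<rho>" using x unfolding mem_open_cube by blast
    then have b: "- \<rho> < x $ i - z $ i" "x $ i - z $ i < \<rho>" by auto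
    then show "0 \<le> t i" using \<rho> by (simp add: t_def)
    have "(x $ i - z $ i + \<rho>) * N < (2 * \<rho>) * N" using b N by (intro mult_strict_right_mono) auto
    then show "t i < N" using \<rho> by (simp add: t_def field_simps)
  qed
  have fl: "real (a i) \<le> t i" "t i < real (a i) + 1" for i
    using t(1)[of i] by (simp_all add: a_def)
  have "a i < N" for i using fl(1)[of i] t(2)[of i] by linarith
  then have "a \<in> cells N" by (simp add: cells_def)
  moreover have "x \<in> cell z \<rho> N a"
    using fl \<rho> N unfolding cell_def t_def by (auto simp: field_simps)
  ultimately show "x \<in> (\<Union>a\<in>cells N. cell z \<rho> N a)" by blast
qed

lemma sum_cells_integral:
  fixes h :: "real^'n \<Rightarrow> real"
  assumes "continuous_on (cube z \<rho>) h" "\<And>x. x \<in> cube z \<rho> \<Longrightarrow> h x \<ge> 0"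
  shows "(LINT x:open_cube z \<rho>|lborel. h x) \<le> (\<Sum>a\<in>cells N. LINT x:cell z \<rho> N a|lborel. h x)"
    and "(\<Sum>a\<in>cells N. LINT x:cell z \<rho> N a|lborel. h x) \<le> (LINT x:cube z \<rho>|lborel. h x)"
proof -
  have int: "set_integrable lborel S h" if "S \<in> sets borel" "S \<subseteq> cube z \<rho>" for S
    using set_integrable_subset[OF set_integrable_compact_continuous[OF compact_cube assms(1)]] that by simp
  define W where "W = (\<Union>a\<in>cells N. cell z \<rho> N a)"
  have W: "W \<subseteq> cube z \<rho>" "W \<in> sets borel"
    unfolding W_def using cell_subset_cube by (auto intro!: sets.finite_UN)
  have eq: "(\<Sum>a\<in>cells N. LINT x:cell z \<rho> N a|lborel. h x) = (LINT x:W|lborel. h x)"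
  proof -
    have "(\<Sum>a\<in>cells N. LINT x:cell z \<rho> N a|lborel. h x)
        = (\<integral>x. (\<Sum>a\<in>cells N. indicator (cell z \<rho> N a) x *\<^sub>R h x) \<partial>lborel)"
      unfolding set_lebesgue_integral_def
      by (rule Bochner_Integration.integral_sum[symmetric])
        (use int[OF cell_borel cell_subset_cube] in \<open>simp add: set_integrable_def\<close>)
    also have "\<dots> = (LINT x:W|lborel. h x)"
      unfolding set_lebesgue_integral_def W_def
      by (simp add: scaleR_sum_left[symmetric] indicator_UN_disjoint[OF finite_cells cells_disjoint] sum_distrib_right)
    finally show ?thesis .
  qed
  have mono: "(LINT x:S|lborel. h x) \<le> (LINT x:S'|lborel. h x)"
    if "S \<in> sets borel" "S' \<in> sets borel" "S \<subseteq> S'" "S' \<subseteq> cube z \<rho>" for S S'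
    unfolding set_lebesgue_integral_def
    by (rule integral_mono) (use int[of S] int[of S'] that assms(2) in \<open>auto simp: set_integrable_def indicator_def\<close>)
  show "(LINT x:open_cube z \<rho>|lborel. h x) \<le> (\<Sum>a\<in>cells N. LINT x:cell z \<rho> N a|lborel. h x)"
    unfolding eq by (rule mono) (use W open_cube_subset_cells in \<open>auto simp: W_def\<close>)
  show "(\<Sum>a\<in>cells N. LINT x:cell z \<rho> N a|lborel. h x) \<le> (LINT x:cube z \<rho>|lborel. h x)"
    unfolding eq by (rule mono) (use W in \<open>auto simp: borel_closed\<close>)
qed

lemma poincare_cells:
  fixes u :: "real^'n \<Rightarrow> real"
  assumes U: "open U" "cube z \<rho> \<subseteq> U"
    and d: "\<And>x. x \<in> U \<Longrightarrow> u differentiable (at x)"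
    and c: "\<And>i. continuous_on U (partial_derivative i u)"
    and mean: "\<And>a. a \<in> cells N \<Longrightarrow> (LINT x:cell z \<rho> N a|lborel. u x) = 0"
  shows "(LINT x:open_cube z \<rho>|lborel. (u x)\<^sup>2)
    \<le> 2 ^ CARD('n) * (CARD('n) * (2 * \<rho> / N))\<^sup>2 * (LINT x:cube z \<rho>|lborel. (norm (gradient u x))\<^sup>2)"
proof -
  have cu: "continuous_on (cube z \<rho>) u"
    using continuous_on_of_differentiable[OF d] U(2) continuous_on_subset by blast
  have gc: "continuous_on (cube z \<rho>) (gradient u)"
    unfolding gradient_def[abs_def] by (intro continuous_on_vec_lambda continuous_on_subset[OF c U(2)])
  let ?C = "2 ^ CARD('n) * (CARD('n) * (2 * \<rho> / N))\<^sup>2"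
  have "(LINT x:open_cube z \<rho>|lborel. (u x)\<^sup>2) \<le> (\<Sum>a\<in>cells N. LINT x:cell z \<rho> N a|lborel. (u x)\<^sup>2)"
    by (rule sum_cells_integral(1)) (auto intro!: continuous_intros cu)
  also have "\<dots> \<le> (\<Sum>a\<in>cells N. ?C * (LINT x:cell z \<rho> N a|lborel. (norm (gradient u x))\<^sup>2))"
    by (intro sum_mono poincare_convex[OF U(1) convex_cell cell_subset_cube compact_cube U(2) cell_borel
      emeasure_cell_pos d c cell_diameter mean])
  also have "\<dots> = ?C * (\<Sum>a\<in>cells N. LINT x:cell z \<rho> N a|lborel. (norm (gradient u x))\<^sup>2)"
    by (rule sum_distrib_left[symmetric])
  also have "\<dots> \<le> ?C * (LINT x:cube z \<rho>|lborel. (norm (gradient u x))\<^sup>2)"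
    by (intro mult_left_mono sum_cells_integral(2)) (auto intro!: continuous_intros gc)
  finally show ?thesis .
qed

end

context riemannian
begin

text \<open>On a compact cube the volume density and the metric are comparable to the Euclidean ones, so the Poincare
  inequality on the cells holds on the manifold with another constant. The cells are convex of diameter of order \<open>1/N\<close>.
  The mean values are taken with respect to Lebesgue measure in the coordinates, without the volume density.\<close>

lemma poincare_patch:
  assumes P: "(c, z, \<rho>) \<in> patches"
  obtains C where "C \<ge> 0" "\<And>f N. C1_fun f \<Longrightarrow> N \<ge> 1 \<Longrightarrow>
    (\<And>a. a \<in> cells N \<Longrightarrow> (LINT x:cell z \<rho> N a|lborel. rep c f x) = 0) \<Longrightarrow>
    (\<integral>p. (f p)\<^sup>2 * indicator (chart_inv c ` open_cube z \<rho>) p \<partial>V)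
      \<le> C / (real N)\<^sup>2 * (\<integral>p. carre_du_champ f f p \<partial>V)"
proof -
  note D = patchesD[OF P]
  interpret coord_metric "chart_range c" "G c" using coord_metric[OF D(1)] .
  define w where "w x = sqrt (det (G c x))" for x
  have wc: "continuous_on (cube z \<rho>) w"
    unfolding w_def using continuous_sqrt_det D(6) continuous_on_subset by blast
  have wpos: "w x > 0" if "x \<in> cube z \<rho>" for x using that D(6) det_g_pos by (auto simp: w_def)
  have "z \<in> cube z \<rho>" using D(2) by (simp add: mem_cube)
  then have ne: "cube z \<rho> \<noteq> {}" by blast
  obtain y1 where y1: "y1 \<in> cube z \<rho>" "\<And>x. x \<in> cube z \<rho> \<Longrightarrow> w x \<le> w y1"
    using continuous_attains_sup[OF compact_cube ne wc] by blast
  obtain y2 where y2: "y2 \<in> cube z \<rho>" "\<And>x. x \<in> cube z \<rho> \<Longrightarrow> w y2 \<le> w x"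
    using continuous_attains_inf[OF compact_cube ne wc] by blast
  obtain \<epsilon> where \<epsilon>: "\<epsilon> > 0"
    "\<And>x u. x \<in> cube z \<rho> \<Longrightarrow> \<epsilon> * (\<Sum>i\<in>UNIV. (partial_derivative i u x)\<^sup>2) \<le> grad_inner (G c) u u x"
    using ellipticity[OF compact_cube D(6)] by blast
  define B where "B = w y1 * (2 ^ CARD('n) * (real CARD('n) * (2 * \<rho>))\<^sup>2) / (w y2 * \<epsilon>)"
  show ?thesis
  proof (rule that[of B])
    show "B \<ge> 0" unfolding B_def using wpos y1(1) y2(1) \<epsilon>(1) by (simp add: less_imp_le)
  next
    fix f :: "'m \<Rightarrow> real" and N :: nat
    assume f: "C1_fun f" and N: "N \<ge> 1"
      and mean: "\<And>a. a \<in> cells N \<Longrightarrow> (LINT x:cell z \<rho> N a|lborel. rep c f x) = 0"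
    define u where "u = rep c f"
    note u = C1_funD[OF f D(1), folded u_def]
    have cu: "continuous_on (cube z \<rho>) u" using u(3) D(6) continuous_on_subset by blast
    have gc: "continuous_on (cube z \<rho>) (gradient u)"
      unfolding gradient_def[abs_def] by (intro continuous_on_vec_lambda continuous_on_subset[OF u(2) D(6)])
    have int: "set_integrable lborel S h" if "continuous_on (cube z \<rho>) h" "S \<in> sets borel" "S \<subseteq> cube z \<rho>"
      for S and h :: "real^'n \<Rightarrow> real"
      using set_integrable_subset[OF set_integrable_compact_continuous[OF compact_cube that(1)]] that by simp
    have ob: "open_cube z \<rho> \<in> sets borel" "open_cube z \<rho> \<subseteq> cube z \<rho>" "cube z \<rho> \<in> sets borel"
      by (auto simp: open_cube_subset_cube borel_closed)
    have O: "open (chart_inv c ` open_cube z \<rho>)" by (rule open_chart_inv_image[OF D(1) _ D(7)]) simp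
    have Cl: "closed (chart_inv c ` cube z \<rho>)"
      by (rule compact_imp_closed[OF compact_chart_inv_image[OF D(1) _ D(6)]]) simp
    have cont_cc: "continuous_on UNIV (carre_du_champ f f)" by (rule carre_du_champ_continuous[OF f f])
    have [measurable]: "f \<in> borel_measurable borel" "carre_du_champ f f \<in> borel_measurable borel"
      using C1_continuous[OF f] cont_cc by (auto intro: borel_measurable_continuous_onI)
    have [measurable]: "chart_inv c ` open_cube z \<rho> \<in> sets borel" "chart_inv c ` cube z \<rho> \<in> sets borel"
      using O Cl by (auto simp: borel_closed)
    have gi: "grad_inner (G c) u u x = carre_du_champ f f (chart_inv c x)" if "x \<in> chart_range c" for x
      using carre_du_champ_chart[OF f f D(1) chart_inv_dom[OF D(1) that]] chart_map_inv[OF D(1) that]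
      by (simp add: u_def)
    have norm_g: "(norm (gradient u x))\<^sup>2 = (\<Sum>i\<in>UNIV. (partial_derivative i u x)\<^sup>2)" for x
      by (simp add: gradient_def norm_eq_sqrt_inner inner_vec_def power2_eq_square sum_nonneg)
    have "(\<integral>p. (f p)\<^sup>2 * indicator (chart_inv c ` open_cube z \<rho>) p \<partial>V)
        = (LINT x:open_cube z \<rho>|lborel. sqrt (det (G c x)) *
            ((f (chart_inv c x))\<^sup>2 * indicator (chart_inv c ` open_cube z \<rho>) (chart_inv c x)))"
      by (rule integral_chart_subset[OF D(1) _ _ D(7)]) (use chart_inv_image[OF D(1,7)] in auto)
    also have "\<dots> = (LINT x:open_cube z \<rho>|lborel. w x * (u x)\<^sup>2)"
      by (rule set_lebesgue_integral_cong) (auto simp: w_def u_def)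
    also have "\<dots> \<le> (LINT x:open_cube z \<rho>|lborel. w y1 * (u x)\<^sup>2)"
      using y1(2) ob(2)
      by (intro set_integral_mono int ob continuous_intros wc cu mult_right_mono) auto
    also have "\<dots> = w y1 * (LINT x:open_cube z \<rho>|lborel. (u x)\<^sup>2)" by (rule set_integral_mult_right)
    also have "\<dots> \<le> w y1 * (2 ^ CARD('n) * (CARD('n) * (2 * \<rho> / N))\<^sup>2 *
        (LINT x:cube z \<rho>|lborel. (norm (gradient u x))\<^sup>2))"
      using wpos[OF y1(1)] mean
      by (intro mult_left_mono poincare_cells[OF D(2) N open_\<Omega> D(6) u(1,2)]) (auto simp: u_def)
    also have "\<dots> = B / (real N)\<^sup>2 * (LINT x:cube z \<rho>|lborel. (w y2 * \<epsilon>) * (norm (gradient u x))\<^sup>2)"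
    proof -
      have "w y2 > 0" using wpos y2(1) by simp
      then have "w y1 * (2 ^ CARD('n) * (CARD('n) * (2 * \<rho> / N))\<^sup>2) = B / (real N)\<^sup>2 * (w y2 * \<epsilon>)"
        using \<epsilon>(1) by (simp add: B_def power_mult_distrib power_divide)
      then show ?thesis unfolding set_integral_mult_right mult.assoc[symmetric] by simp
    qed
    also have "\<dots> \<le> B / (real N)\<^sup>2 * (LINT x:cube z \<rho>|lborel. w x * carre_du_champ f f (chart_inv c x))"
    proof (rule mult_left_mono[OF set_integral_mono])
      show "set_integrable lborel (cube z \<rho>) (\<lambda>x. (w y2 * \<epsilon>) * (norm (gradient u x))\<^sup>2)"
        by (intro int ob continuous_intros gc) auto
      have "continuous_on (cube z \<rho>) (\<lambda>x. carre_du_champ f f (chart_inv c x))"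
        by (rule continuous_on_compose2[OF cont_cc continuous_on_subset[OF continuous_chart_inv[OF D(1)] D(6)]]) simp
      then show "set_integrable lborel (cube z \<rho>) (\<lambda>x. w x * carre_du_champ f f (chart_inv c x))"
        by (intro int ob continuous_intros wc) auto
      show "w y2 * \<epsilon> * (norm (gradient u x))\<^sup>2 \<le> w x * carre_du_champ f f (chart_inv c x)"
        if "x \<in> cube z \<rho>" for x
      proof -
        have "\<epsilon> * (norm (gradient u x))\<^sup>2 \<le> carre_du_champ f f (chart_inv c x)"
        proof -
          have "x \<in> chart_range c" using that D(6) by blast
          from gi[OF this] show ?thesis using \<epsilon>(2)[OF that, of u] by (simp only: norm_g)
        qed
        then have "w y2 * (\<epsilon> * (norm (gradient u x))\<^sup>2) \<le> w x * carre_du_champ f f (chart_inv c x)"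
          using y2(2)[OF that] wpos[OF that] \<epsilon>(1) by (intro mult_mono) auto
        then show ?thesis by (simp add: mult.assoc)
      qed
      show "0 \<le> B / (real N)\<^sup>2" unfolding B_def using wpos y1(1) y2(1) \<epsilon>(1) by (simp add: less_imp_le)
    qed
    also have "(LINT x:cube z \<rho>|lborel. w x * carre_du_champ f f (chart_inv c x))
        = (LINT x:cube z \<rho>|lborel. sqrt (det (G c x)) *
            (carre_du_champ f f (chart_inv c x) * indicator (chart_inv c ` cube z \<rho>) (chart_inv c x)))"
      by (rule set_lebesgue_integral_cong) (auto simp: w_def borel_closed)
    also have "\<dots> = (\<integral>p. carre_du_champ f f p * indicator (chart_inv c ` cube z \<rho>) p \<partial>V)"
      by (rule integral_chart_subset[OF D(1) _ _ D(6), symmetric]) (use chart_inv_image[OF D(1,6)] in auto)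
    also have "B / (real N)\<^sup>2 * \<dots> \<le> B / (real N)\<^sup>2 * (\<integral>p. carre_du_champ f f p \<partial>V)"
    proof (rule mult_left_mono[OF integral_mono])
      have *: "integrable V (carre_du_champ f f)" by (rule continuous_integrable[OF cont_cc])
      then show "integrable V (carre_du_champ f f)" .
      show "integrable V (\<lambda>p. carre_du_champ f f p * indicator (chart_inv c ` cube z \<rho>) p)"
        using * by (intro integrable_real_mult_indicator) (auto simp: sets_V)
      show "carre_du_champ f f p * indicator (chart_inv c ` cube z \<rho>) p \<le> carre_du_champ f f p" for p
        using carre_du_champ_nonneg[OF f, of p] by (auto simp: indicator_def)
      show "0 \<le> B / (real N)\<^sup>2" unfolding B_def using wpos y1(1) y2(1) \<epsilon>(1) by (simp add: less_imp_le)
    qed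
    finally show "(\<integral>p. (f p)\<^sup>2 * indicator (chart_inv c ` open_cube z \<rho>) p \<partial>V)
        \<le> B / (real N)\<^sup>2 * (\<integral>p. carre_du_champ f f p \<partial>V)" .
  qed
qed

lemma poincare_manifold:
  assumes P: "finite P" "P \<subseteq> patches" "\<And>p. \<exists>(c, z, \<rho>)\<in>P. p \<in> chart_inv c ` open_cube z \<rho>"
  obtains C where "C \<ge> 0" "\<And>f N. C1_fun f \<Longrightarrow> N \<ge> 1 \<Longrightarrow>
    (\<And>c z \<rho> a. (c, z, \<rho>) \<in> P \<Longrightarrow> a \<in> cells N \<Longrightarrow> (LINT x:cell z \<rho> N a|lborel. rep c f x) = 0) \<Longrightarrow>
    (\<integral>p. (f p)\<^sup>2 \<partial>V) \<le> C / (real N)\<^sup>2 * (\<integral>p. carre_du_champ f f p \<partial>V)"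
proof -
  define B where "B = (\<lambda>(c :: ('m, 'n) chart, z, \<rho>). chart_inv c ` open_cube z \<rho> :: 'm set)"
  have "\<forall>k\<in>P. \<exists>C\<ge>0. \<forall>f N. C1_fun f \<longrightarrow> N \<ge> 1 \<longrightarrow>
      (\<forall>c z \<rho> a. (c, z, \<rho>) \<in> P \<longrightarrow> a \<in> cells N \<longrightarrow> (LINT x:cell z \<rho> N a|lborel. rep c f x) = 0) \<longrightarrow>
      (\<integral>p. (f p)\<^sup>2 * indicator (B k) p \<partial>V) \<le> C / (real N)\<^sup>2 * (\<integral>p. carre_du_champ f f p \<partial>V)"
  proof
    fix k assume k: "k \<in> P"
    obtain c z \<rho> where kk: "k = (c, z, \<rho>)" by (cases k) auto
    then have "(c, z, \<rho>) \<in> patches" using k P(2) by auto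
    from poincare_patch[OF this] obtain C where C: "C \<ge> 0" "\<And>f N. C1_fun f \<Longrightarrow> N \<ge> 1 \<Longrightarrow>
      (\<And>a. a \<in> cells N \<Longrightarrow> (LINT x:cell z \<rho> N a|lborel. rep c f x) = 0) \<Longrightarrow>
      (\<integral>p. (f p)\<^sup>2 * indicator (chart_inv c ` open_cube z \<rho>) p \<partial>V)
      \<le> C / (real N)\<^sup>2 * (\<integral>p. carre_du_champ f f p \<partial>V)" by blast
    show "\<exists>C\<ge>0. \<forall>f N. C1_fun f \<longrightarrow> N \<ge> 1 \<longrightarrow>
      (\<forall>c z \<rho> a. (c, z, \<rho>) \<in> P \<longrightarrow> a \<in> cells N \<longrightarrow> (LINT x:cell z \<rho> N a|lborel. rep c f x) = 0) \<longrightarrow>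
      (\<integral>p. (f p)\<^sup>2 * indicator (B k) p \<partial>V) \<le> C / (real N)\<^sup>2 * (\<integral>p. carre_du_champ f f p \<partial>V)"
      unfolding kk B_def prod.case by (intro exI[of _ C] conjI allI impI C) (use k kk in auto)
  qed
  then obtain C where C: "\<And>k. k \<in> P \<Longrightarrow> C k \<ge> 0" "\<And>k f N. k \<in> P \<Longrightarrow> C1_fun f \<Longrightarrow> N \<ge> 1 \<Longrightarrow>
      (\<And>c z \<rho> a. (c, z, \<rho>) \<in> P \<Longrightarrow> a \<in> cells N \<Longrightarrow> (LINT x:cell z \<rho> N a|lborel. rep c f x) = 0) \<Longrightarrow>
      (\<integral>p. (f p)\<^sup>2 * indicator (B k) p \<partial>V) \<le> C k / (real N)\<^sup>2 * (\<integral>p. carre_du_champ f f p \<partial>V)"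
    unfolding bchoice_iff by blast
  show ?thesis
  proof (rule that[of "\<Sum>k\<in>P. C k"])
    show "0 \<le> (\<Sum>k\<in>P. C k)" using C(1) by (intro sum_nonneg)
    fix f N assume f: "C1_fun f" and N: "1 \<le> (N::nat)" and
      mean: "\<And>c z \<rho> a. (c, z, \<rho>) \<in> P \<Longrightarrow> a \<in> cells N \<Longrightarrow> (LINT x:cell z \<rho> N a|lborel. rep c f x) = 0"
    have f2: "integrable V (\<lambda>p. (f p)\<^sup>2)" by (intro continuous_integrable continuous_intros C1_continuous f)
    have int: "integrable V (\<lambda>p. (f p)\<^sup>2 * indicator (B k) p)" if "k \<in> P" for k
    proof (rule integrable_real_mult_indicator[OF _ f2])
      obtain c z \<rho> where kk: "k = (c, z, \<rho>)" by (cases k) auto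
      then have p: "(c, z, \<rho>) \<in> patches" using that P(2) by auto
      show "B k \<in> sets V"
        using open_chart_inv_image[OF patchesD(1)[OF p] open_open_cube patchesD(7)[OF p]]
        by (simp add: kk B_def sets_V)
    qed
    have "(\<integral>p. (f p)\<^sup>2 \<partial>V) \<le> (\<integral>p. (\<Sum>k\<in>P. (f p)\<^sup>2 * indicator (B k) p) \<partial>V)"
    proof (rule integral_mono[OF f2 Bochner_Integration.integrable_sum[OF int]])
      fix p
      obtain c z \<rho> where k: "(c, z, \<rho>) \<in> P" "p \<in> chart_inv c ` open_cube z \<rho>" using P(3)[of p] by blast
      then have "(f p)\<^sup>2 = (f p)\<^sup>2 * indicator (B (c, z, \<rho>)) p" by (simp add: B_def)
      also have "\<dots> \<le> (\<Sum>k\<in>P. (f p)\<^sup>2 * indicator (B k) p)"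
        using P(1) k(1) by (intro member_le_sum) auto
      finally show "(f p)\<^sup>2 \<le> (\<Sum>k\<in>P. (f p)\<^sup>2 * indicator (B k) p)" .
    qed
    also have "\<dots> = (\<Sum>k\<in>P. \<integral>p. (f p)\<^sup>2 * indicator (B k) p \<partial>V)"
      by (rule Bochner_Integration.integral_sum[OF int])
    also have "\<dots> \<le> (\<Sum>k\<in>P. C k / (real N)\<^sup>2 * (\<integral>p. carre_du_champ f f p \<partial>V))"
      by (intro sum_mono C(2) f N mean)
    also have "\<dots> = (\<Sum>k\<in>P. C k) / (real N)\<^sup>2 * (\<integral>p. carre_du_champ f f p \<partial>V)"
      by (simp add: sum_distrib_right sum_divide_distrib)
    finally show "(\<integral>p. (f p)\<^sup>2 \<partial>V) \<le> (\<Sum>k\<in>P. C k) / (real N)\<^sup>2 * (\<integral>p. carre_du_champ f f p \<partial>V)" .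
  qed
qed

end

section \<open>The number of eigenfunctions\<close>

text \<open>A homogeneous linear system with more unknowns than equations, by Gaussian elimination of one unknown per
  equation.\<close>

lemma nontrivial_solution:
  fixes M :: "'l \<Rightarrow> 'i \<Rightarrow> real"
  assumes "finite L" "finite I" "card L < card I"
  obtains x where "\<exists>i\<in>I. x i \<noteq> 0" "\<And>l. l \<in> L \<Longrightarrow> (\<Sum>i\<in>I. x i * M l i) = 0"
proof -
  have "\<exists>x. (\<exists>i\<in>I. x i \<noteq> 0) \<and> (\<forall>l\<in>L. (\<Sum>i\<in>I. x i * M l i) = 0)"
    using assms
  proof (induction L arbitrary: I M rule: finite_induct)
    case empty
    then have "I \<noteq> {}" by auto
    then show ?case by (intro exI[of _ "\<lambda>_. 1"]) auto
  next
    case (insert l L)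
    show ?case
    proof (cases "\<forall>i\<in>I. M l i = 0")
      case True
      have "card L < card I" using insert by simp
      then obtain x where "\<exists>i\<in>I. x i \<noteq> 0" "\<forall>l\<in>L. (\<Sum>i\<in>I. x i * M l i) = 0"
        using insert.IH[OF insert.prems(1), of M] by blast
      then show ?thesis using True by (intro exI[of _ x]) simp
    next
      case False
      then obtain i0 where i0: "i0 \<in> I" "M l i0 \<noteq> 0" by blast
      define I' where "I' = I - {i0}"
      have I': "finite I'" "i0 \<notin> I'" "I = insert i0 I'" using insert.prems i0 by (auto simp: I'_def)
      have "card L < card I'" using insert.prems insert.hyps I' by simp
      then obtain x where x: "\<exists>i\<in>I'. x i \<noteq> 0"
        "\<forall>k\<in>L. (\<Sum>i\<in>I'. x i * (M k i - M k i0 * M l i / M l i0)) = 0"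
        using insert.IH[OF I'(1), of "\<lambda>k i. M k i - M k i0 * M l i / M l i0"] by blast
      define t where "t = - (\<Sum>i\<in>I'. x i * M l i) / M l i0"
      define x' where "x' = x(i0 := t)"
      have s: "(\<Sum>i\<in>I. x' i * M k i) = t * M k i0 + (\<Sum>i\<in>I'. x i * M k i)" for k
      proof -
        have "(\<Sum>i\<in>I'. x' i * M k i) = (\<Sum>i\<in>I'. x i * M k i)"
          using I'(2) by (intro sum.cong) (auto simp: x'_def)
        then show ?thesis using I' by (simp add: x'_def)
      qed
      have "(\<Sum>i\<in>I. x' i * M k i) = 0" if "k \<in> L" for k
      proof -
        have "(\<Sum>i\<in>I'. x i * (M k i - M k i0 * M l i / M l i0))
            = (\<Sum>i\<in>I'. x i * M k i) - M k i0 / M l i0 * (\<Sum>i\<in>I'. x i * M l i)"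
          by (simp add: sum_subtractf right_diff_distrib sum_distrib_left mult_ac)
        then show ?thesis using x(2) that unfolding s t_def by simp
      qed
      moreover have "(\<Sum>i\<in>I. x' i * M l i) = 0" unfolding s t_def using i0 by simp
      moreover have "\<exists>i\<in>I. x' i \<noteq> 0" using x(1) I' by (auto simp: x'_def)
      ultimately show ?thesis by (intro exI[of _ x']) auto
    qed
  qed
  then show ?thesis using that by blast
qed

lemma C_k_on_cong:
  assumes "open S" "\<And>x. x \<in> S \<Longrightarrow> f x = h x"
  shows "C_k_on k S f \<longleftrightarrow> C_k_on k S h"
  using assms(2)
proof (induction k arbitrary: f h)
  case 0
  then show ?case by (simp cong: continuous_on_cong)
next
  case (Suc k)
  have d: "f differentiable (at x) \<longleftrightarrow> h differentiable (at x)"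
    and fr: "frechet_derivative f (at x) = frechet_derivative h (at x)" if "x \<in> S" for x
  proof -
    have "(f has_derivative D) (at x) \<longleftrightarrow> (h has_derivative D) (at x)" for D
      using has_derivative_transform_within_open[OF _ assms(1) that] Suc.prems by metis
    then show "f differentiable (at x) \<longleftrightarrow> h differentiable (at x)"
      "frechet_derivative f (at x) = frechet_derivative h (at x)"
      by (simp_all add: differentiable_def frechet_derivative_def)
  qed
  have "C_k_on k S (\<lambda>x. frechet_derivative f (at x) v) \<longleftrightarrow> C_k_on k S (\<lambda>x. frechet_derivative h (at x) v)" for v
    by (rule Suc.IH) (simp add: fr)
  then show ?case using d by simp
qed

lemma smooth_on_lincomb:
  fixes f h :: "'a::real_normed_vector \<Rightarrow> real"
  assumes "open S" "smooth_on S f" "smooth_on S h"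
  shows "smooth_on S (\<lambda>x. a * f x + h x)"
proof -
  have "C_k_on k S (\<lambda>x. a * f x + h x)" if "C_k_on k S f" "C_k_on k S h" for k
    using that
  proof (induction k arbitrary: f h)
    case 0
    then show ?case by (auto intro!: continuous_intros)
  next
    case (Suc k)
    have D: "((\<lambda>x. a * f x + h x) has_derivative
        (\<lambda>v. a * frechet_derivative f (at x) v + frechet_derivative h (at x) v)) (at x)" if "x \<in> S" for x
      using Suc.prems that
      by (intro has_derivative_add has_derivative_mult_right) (auto simp: frechet_derivative_works)
    have "C_k_on k S (\<lambda>x. frechet_derivative (\<lambda>x. a * f x + h x) (at x) v)" for v
    proof (subst C_k_on_cong[OF assms(1)])
      show "C_k_on k S (\<lambda>x. a * frechet_derivative f (at x) v + frechet_derivative h (at x) v)"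
        using Suc by simp
    qed (simp add: frechet_derivative_at[OF D, symmetric])
    then show ?case using D unfolding differentiable_def C_k_on.simps by blast
  qed
  then show ?thesis using assms(2,3) by (simp add: smooth_on_def)
qed

lemma smooth_on_const: "smooth_on S (\<lambda>x. c)" for c :: "'b::real_normed_vector"
proof -
  have "C_k_on k S (\<lambda>x. c)" for k and c :: 'b by (induction k arbitrary: c) simp_all
  then show ?thesis by (simp add: smooth_on_def)
qed

lemma lap_const: "lap g (\<lambda>x. c) x = 0"
  by (simp add: lap_def flux_def[abs_def])

context coord_metric
begin

lemma flux_differentiable:
  assumes h: "smooth_on \<Omega> h" and x: "x \<in> \<Omega>"
  shows "flux g h i differentiable (at x)"
proof -
  obtain e where e: "e > 0" "cball x e \<subseteq> \<Omega>" using open_\<Omega> x open_contains_cball by blast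
  interpret metric_patch "{()}" "\<lambda>_. 1" "ball x e" \<Omega> g "cball x e"
    by unfold_locales (use e in auto)
  have "symb 1 (Suc 0) (\<lambda>_. flux g h i)"
    using symb_flux[OF symb_smooth[OF h, of "Suc 1" 0]] by simp
  then show ?thesis using symb_differentiable[of 1 "Suc 0" "\<lambda>_. flux g h i" "()" x] e(1) by simp
qed

lemma lap_lincomb:
  assumes h: "smooth_on \<Omega> h" and k: "smooth_on \<Omega> k" and x: "x \<in> \<Omega>"
  shows "lap g (\<lambda>x. a * h x + k x) x = a * lap g h x + lap g k x"
proof -
  have pd: "partial_derivative j (\<lambda>x. a * h x + k x) y = a * partial_derivative j h y + partial_derivative j k y"
    if "y \<in> \<Omega>" for y j
    using smooth_on_C1(1)[OF h that] smooth_on_C1(1)[OF k that]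
    by (simp add: partial_derivative_add partial_derivative_cmult)
  have fl: "flux g (\<lambda>x. a * h x + k x) i y = a * flux g h i y + flux g k i y" if "y \<in> \<Omega>" for y i
    using pd[OF that] by (simp add: flux_def sum.distrib sum_distrib_left distrib_left mult_ac)
  have "partial_derivative i (flux g (\<lambda>x. a * h x + k x) i) x
      = a * partial_derivative i (flux g h i) x + partial_derivative i (flux g k i) x" for i
  proof -
    have "partial_derivative i (flux g (\<lambda>x. a * h x + k x) i) x
        = partial_derivative i (\<lambda>y. a * flux g h i y + flux g k i y) x"
      by (rule partial_derivative_cong[OF open_\<Omega> x fl])
    then show ?thesis
      using flux_differentiable[OF h x] flux_differentiable[OF k x]
      by (simp add: partial_derivative_add partial_derivative_cmult)
  qed
  then show ?thesis
    by (simp add: lap_def sum.distrib sum_distrib_left add_divide_distrib)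
qed

end

lemma fun_sum_apply: "(\<Sum>v\<in>S. F v) p = (\<Sum>v\<in>S. F v p)"
  for F :: "'i \<Rightarrow> 'a \<Rightarrow> 'b::comm_monoid_add"
  by (induction S rule: infinite_finite_induct) simp_all

context riemannian
begin

lemma const_eigenspace: "(\<lambda>p. a) \<in> eigenspace A G 0"
  by (simp add: eigenspace_def smooth_function_def smooth_on_const laplacian_in_chart_eq lap_const)

lemma zero_eigenspace: "(\<lambda>p. 0) \<in> eigenspace A G \<theta>"
  by (simp add: eigenspace_def smooth_function_def smooth_on_const laplacian_in_chart_eq lap_const)

lemma eigenspace_lincomb:
  assumes f: "f \<in> eigenspace A G \<theta>" and h: "h \<in> eigenspace A G \<theta>"
  shows "(\<lambda>p. a * f p + h p) \<in> eigenspace A G \<theta>"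
  unfolding eigenspace_def mem_Collect_eq
proof (intro conjI ballI)
  have s: "smooth_on (chart_range c) (rep c f)" "smooth_on (chart_range c) (rep c h)" if "c \<in> A" for c
    using that f h unfolding eigenspace_def smooth_function_def by auto
  show "smooth_function A (\<lambda>p. a * f p + h p)"
    unfolding smooth_function_def using s open_range by (auto intro!: smooth_on_lincomb)
  fix c p assume c: "c \<in> A" "p \<in> chart_dom c"
  interpret coord_metric "chart_range c" "G c" by (rule coord_metric[OF c(1)])
  have x: "chart_map c p \<in> chart_range c" using c by simp
  have "lap (G c) (\<lambda>x. a * rep c f x + rep c h x) (chart_map c p)
      = - \<theta> * (a * f p + h p)"
    unfolding lap_lincomb[OF s[OF c(1)] x] eigenspace_lap[OF f c(1) x] eigenspace_lap[OF h c(1) x]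
    using chart_inv_map[OF c] by (simp add: algebra_simps)
  then show "- laplacian_in_chart G c (\<lambda>p. a * f p + h p) p = \<theta> * (a * f p + h p)"
    by (simp add: laplacian_in_chart_eq)
qed

lemma eigenspace_sum:
  assumes "finite B" "\<And>b. b \<in> B \<Longrightarrow> \<phi> b \<in> eigenspace A G \<theta>"
  shows "(\<lambda>p. \<Sum>b\<in>B. x b * \<phi> b p) \<in> eigenspace A G \<theta>"
  using assms
proof (induction B rule: finite_induct)
  case empty
  then show ?case by (simp add: zero_eigenspace)
next
  case (insert b B)
  then show ?case using eigenspace_lincomb[of "\<phi> b" \<theta> "\<lambda>p. \<Sum>b\<in>B. x b * \<phi> b p" "x b"] by simp
qed

lemma eigenspace_integrable:
  assumes "f \<in> eigenspace A G \<theta>" "h \<in> eigenspace A G \<theta>'"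
  shows "integrable V (\<lambda>p. f p * h p)"
  using assms by (intro continuous_integrable C1_continuous C1_mult eigenspace_C1)

text \<open>Neumann bracketing. If there were more eigenfunctions than cells, a nontrivial combination would have mean
  zero on every cell; its Rayleigh quotient is at most \<open>\<Lambda>\<close> by Green's formula, but at least of order
  \<open>N\<^sup>2\<close> by the Poincare inequality.\<close>

lemma eigenfunction_count_cells:
  assumes P: "finite P" "P \<subseteq> patches"
    and C: "C \<ge> 0" "\<And>f. C1_fun f \<Longrightarrow>
      (\<And>c z \<rho> a. (c, z, \<rho>) \<in> P \<Longrightarrow> a \<in> cells N \<Longrightarrow> (LINT x:cell z \<rho> N a|lborel. rep c f x) = 0) \<Longrightarrow>
      (\<integral>p. (f p)\<^sup>2 \<partial>V) \<le> C / (real N)\<^sup>2 * (\<integral>p. carre_du_champ f f p \<partial>V)"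
    and N: "N \<ge> 1" "C * \<Lambda> < (real N)\<^sup>2"
    and J: "finite J" "inj_on \<theta> J" "\<And>j. j \<in> J \<Longrightarrow> \<theta> j \<le> \<Lambda>"
    and B: "\<And>j. j \<in> J \<Longrightarrow> finite (B j)" "\<And>j. j \<in> J \<Longrightarrow> B j \<subseteq> eigenspace A G (\<theta> j)"
      "\<And>j. j \<in> J \<Longrightarrow> real_fun.independent (B j)"
  shows "(\<Sum>j\<in>J. card (B j)) \<le> card P * N ^ CARD('n)"
proof (rule ccontr)
  assume "\<not> (\<Sum>j\<in>J. card (B j)) \<le> card P * N ^ CARD('n)"
  define I where "I = Sigma J B"
  define L where "L = P \<times> (cells N :: ('n \<Rightarrow> nat) set)"
  have fin: "finite I" "finite L" using J B P by (auto simp: I_def L_def)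
  have "card L < card I"
    using \<open>\<not> _\<close> J B P by (simp add: I_def L_def card_cartesian_product card_cells card_SigmaI)
  then obtain x where x: "\<exists>i\<in>I. x i \<noteq> 0"
    "\<And>l. l \<in> L \<Longrightarrow> (\<Sum>i\<in>I. x i * (case (l, i) of (((c, z, \<rho>), a), (j, b)) \<Rightarrow>
      LINT y:cell z \<rho> N a|lborel. rep c b y)) = 0"
    using nontrivial_solution[OF fin(2,1), of "\<lambda>l i. case (l, i) of (((c, z, \<rho>), a), (j, b)) \<Rightarrow>
      LINT y:cell z \<rho> N a|lborel. rep c b y"] by blast
  define fj where "fj j p = (\<Sum>b\<in>B j. x (j, b) * b p)" for j p
  define f where "f p = (\<Sum>j\<in>J. fj j p)" for p
  have fjE: "fj j \<in> eigenspace A G (\<theta> j)" if "j \<in> J" for j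
    unfolding fj_def using eigenspace_sum[of "B j" "\<lambda>b. b" "\<theta> j" "\<lambda>b. x (j, b)"] B that by blast
  have fjC: "C1_fun (fj j)" if "j \<in> J" for j using eigenspace_C1[OF fjE[OF that]] .
  have fC: "C1_fun f" unfolding f_def by (intro C1_sum J fjC)
  have mean: "(LINT y:cell z \<rho> N a|lborel. rep c f y) = 0" if k: "(c, z, \<rho>) \<in> P" "a \<in> cells N" for c z \<rho> a
  proof -
    have kp: "(c, z, \<rho>) \<in> patches" using k P by auto
    note D = patchesD[OF kp]
    have int: "set_integrable lborel (cell z \<rho> N a) (rep c b)" if "C1_fun b" for b
    proof (rule set_integrable_subset[of lborel "cube z \<rho>"])
      show "set_integrable lborel (cube z \<rho>) (rep c b)"
        by (intro set_integrable_compact_continuous continuous_on_subset[OF C1_funD(3)[OF that D(1)] D(6)]) simp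
    qed (use cell_subset_cube[OF D(2) N(1) k(2)] in auto)
    have bC: "C1_fun (snd i)" if "i \<in> I" for i
    proof -
      have "snd i \<in> eigenspace A G (\<theta> (fst i))" using \<open>i \<in> I\<close> B(2)[of "fst i"] by (auto simp: I_def)
      then show ?thesis by (rule eigenspace_C1)
    qed
    have "(LINT y:cell z \<rho> N a|lborel. rep c f y)
        = (LINT y:cell z \<rho> N a|lborel. (\<Sum>i\<in>I. x i * rep c (snd i) y))"
      unfolding f_def fj_def I_def using J(1) B(1) by (simp add: sum.Sigma split_beta)
    also have "\<dots> = (\<Sum>i\<in>I. x i * (LINT y:cell z \<rho> N a|lborel. rep c (snd i) y))"
      by (subst set_integral_finite_sum[OF fin(1)]) (intro set_integrable_mult_right int bC, simp_all)
    also have "\<dots> = 0" using x(2)[of "((c, z, \<rho>), a)"] k by (simp add: L_def split_beta)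
    finally show ?thesis .
  qed
  have orth: "(\<integral>p. fj j p * fj k p \<partial>V) = 0" if "j \<in> J" "k \<in> J" "j \<noteq> k" for j k
    using eigenspace_orthogonal[OF fjE[OF that(1)] fjE[OF that(2)]] J(2) that by (auto simp: inj_on_def)
  have inner: "(\<integral>p. fj j p * f p \<partial>V) = (\<integral>p. (fj j p)\<^sup>2 \<partial>V)" if "j \<in> J" for j
  proof -
    have "(\<integral>p. fj j p * f p \<partial>V) = (\<Sum>k\<in>J. \<integral>p. fj j p * fj k p \<partial>V)"
      unfolding f_def sum_distrib_left
      by (rule Bochner_Integration.integral_sum) (use eigenspace_integrable fjE that in blast)
    also have "\<dots> = (\<Sum>k\<in>J. if k = j then \<integral>p. (fj j p)\<^sup>2 \<partial>V else 0)"
      using orth[OF that] by (intro sum.cong) (auto simp: power2_eq_square)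
    finally show ?thesis using J(1) that by (simp add: sum.delta)
  qed
  have f2: "(\<integral>p. (f p)\<^sup>2 \<partial>V) = (\<Sum>j\<in>J. \<integral>p. (fj j p)\<^sup>2 \<partial>V)"
  proof -
    have "(\<integral>p. (f p)\<^sup>2 \<partial>V) = (\<integral>p. (\<Sum>j\<in>J. fj j p * f p) \<partial>V)"
      by (simp add: power2_eq_square f_def sum_distrib_right)
    also have "\<dots> = (\<Sum>j\<in>J. \<integral>p. fj j p * f p \<partial>V)"
      by (rule Bochner_Integration.integral_sum)
        (intro continuous_integrable C1_continuous C1_mult fjC fC)
    finally show ?thesis using inner by simp
  qed
  have "(\<integral>p. carre_du_champ f f p \<partial>V) = (\<integral>p. (\<Sum>j\<in>J. carre_du_champ f (fj j) p) \<partial>V)"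
  proof -
    have "carre_du_champ f f p = (\<Sum>j\<in>J. carre_du_champ f (fj j) p)" for p
      by (subst (2) f_def[abs_def]) (rule carre_du_champ_sum[OF fC J(1) fjC])
    then show ?thesis by simp
  qed
  also have "\<dots> = (\<Sum>j\<in>J. \<integral>p. carre_du_champ f (fj j) p \<partial>V)"
    by (rule Bochner_Integration.integral_sum) (intro continuous_integrable carre_du_champ_continuous fC fjC)
  also have "\<dots> = (\<Sum>j\<in>J. \<theta> j * (\<integral>p. (fj j p)\<^sup>2 \<partial>V))"
    using green[OF fjE fC] inner by (intro sum.cong) (auto simp: carre_du_champ_commute[OF fC fjC])
  also have "\<dots> \<le> (\<Sum>j\<in>J. \<Lambda> * (\<integral>p. (fj j p)\<^sup>2 \<partial>V))"
    using J(3) by (intro sum_mono mult_right_mono) auto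
  also have "\<dots> = \<Lambda> * (\<integral>p. (f p)\<^sup>2 \<partial>V)" by (simp add: f2 sum_distrib_left)
  finally have energy: "(\<integral>p. carre_du_champ f f p \<partial>V) \<le> \<Lambda> * (\<integral>p. (f p)\<^sup>2 \<partial>V)" .
  have "(\<integral>p. (f p)\<^sup>2 \<partial>V) \<le> C / (real N)\<^sup>2 * (\<integral>p. carre_du_champ f f p \<partial>V)" by (rule C(2)[OF fC mean])
  also have "\<dots> \<le> C / (real N)\<^sup>2 * (\<Lambda> * (\<integral>p. (f p)\<^sup>2 \<partial>V))" using energy C(1) by (intro mult_left_mono) auto
  also have "\<dots> = (C * \<Lambda> / (real N)\<^sup>2) * (\<integral>p. (f p)\<^sup>2 \<partial>V)" by simp
  finally have le: "(1 - C * \<Lambda> / (real N)\<^sup>2) * (\<integral>p. (f p)\<^sup>2 \<partial>V) \<le> 0" by (simp add: left_diff_distrib)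
  have "1 - C * \<Lambda> / (real N)\<^sup>2 > 0" using N by (simp add: field_simps)
  with le have "(\<integral>p. (f p)\<^sup>2 \<partial>V) \<le> 0" by (simp add: mult_le_0_iff)
  then have "(\<Sum>j\<in>J. \<integral>p. (fj j p)\<^sup>2 \<partial>V) = 0" unfolding f2[symmetric] by (intro antisym) simp_all
  then have z: "(\<integral>p. (fj j p)\<^sup>2 \<partial>V) = 0" if "j \<in> J" for j
    using sum_nonneg_eq_0_iff[OF J(1), of "\<lambda>j. \<integral>p. (fj j p)\<^sup>2 \<partial>V"] that by simp
  have "x (j, b) = 0" if "j \<in> J" "b \<in> B j" for j b
  proof -
    have "fj j p = 0" for p
      using continuous_square_integral_zero[OF C1_continuous[OF fjC[OF that(1)]] z[OF that(1)]] .
    then have "(\<Sum>b\<in>B j. (\<lambda>p. x (j, b) * b p)) = 0"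
      by (auto simp: fun_eq_iff fun_sum_apply fj_def)
    then show ?thesis
      using real_fun.dependent_finite[OF B(1)[OF that(1)]] B(3)[OF that(1)] that(2) by fast
  qed
  then show False using x(1) by (auto simp: I_def)
qed

text \<open>With \<open>N\<close> just above \<open>\<surd>(C \<Lambda>)\<close> the number of cells is of order \<open>\<Lambda>\<close> to the power half the dimension.\<close>

lemma eigenfunction_count:
  obtains C where "C > 0" "\<And>\<Lambda> (J :: nat set) \<theta> B. \<Lambda> \<ge> 1 \<Longrightarrow> finite J \<Longrightarrow> inj_on \<theta> J \<Longrightarrow>
    (\<And>j. j \<in> J \<Longrightarrow> \<theta> j \<le> \<Lambda>) \<Longrightarrow> (\<And>j. j \<in> J \<Longrightarrow> finite (B j)) \<Longrightarrow>
    (\<And>j. j \<in> J \<Longrightarrow> B j \<subseteq> eigenspace A G (\<theta> j)) \<Longrightarrow> (\<And>j. j \<in> J \<Longrightarrow> real_fun.independent (B j)) \<Longrightarrow>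
    (\<Sum>j\<in>J. card (B j)) \<le> C * \<Lambda> powr (CARD('n) / 2)"
proof -
  obtain P where P: "finite P" "P \<subseteq> patches" "\<And>p. \<exists>(c, z, \<rho>)\<in>P. p \<in> chart_inv c ` open_cube z \<rho>"
    using finite_patch_cover by blast
  obtain C where C: "C \<ge> 0" "\<And>f N. C1_fun f \<Longrightarrow> N \<ge> 1 \<Longrightarrow>
    (\<And>c z \<rho> a. (c, z, \<rho>) \<in> P \<Longrightarrow> a \<in> cells N \<Longrightarrow> (LINT x:cell z \<rho> N a|lborel. rep c f x) = 0) \<Longrightarrow>
    (\<integral>p. (f p)\<^sup>2 \<partial>V) \<le> C / (real N)\<^sup>2 * (\<integral>p. carre_du_champ f f p \<partial>V)"
    using poincare_manifold[OF P] by blast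
  define D where "D = (card P + 1) * (sqrt C + 2) ^ CARD('n)"
  show ?thesis
  proof (rule that[of D])
    show "D > 0" unfolding D_def using C(1) by (intro mult_pos_pos zero_less_power) (auto intro: add_nonneg_pos)
    fix \<Lambda> :: real and J :: "nat set" and \<theta> and B :: "nat \<Rightarrow> ('m \<Rightarrow> real) set"
    assume \<Lambda>: "\<Lambda> \<ge> 1" and J: "finite J" "inj_on \<theta> J" "\<And>j. j \<in> J \<Longrightarrow> \<theta> j \<le> \<Lambda>"
      and B: "\<And>j. j \<in> J \<Longrightarrow> finite (B j)" "\<And>j. j \<in> J \<Longrightarrow> B j \<subseteq> eigenspace A G (\<theta> j)"
        "\<And>j. j \<in> J \<Longrightarrow> real_fun.independent (B j)"
    define N where "N = nat \<lceil>sqrt (C * \<Lambda>)\<rceil> + 1"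
    have s0: "0 \<le> sqrt (C * \<Lambda>)" using C(1) \<Lambda> by simp
    have N: "sqrt (C * \<Lambda>) < N" "N \<le> sqrt (C * \<Lambda>) + 2" "N \<ge> 1"
      using s0 unfolding N_def by linarith+
    have "C * \<Lambda> = (sqrt (C * \<Lambda>))\<^sup>2" using C(1) \<Lambda> by simp
    also have "\<dots> < (real N)\<^sup>2" using s0 N(1) by (intro power_strict_mono) auto
    finally have CN: "C * \<Lambda> < (real N)\<^sup>2" .
    have "(\<Sum>j\<in>J. card (B j)) \<le> card P * N ^ CARD('n)"
      using C(2)[OF _ N(3)] by (intro eigenfunction_count_cells[OF P(1,2) C(1) _ N(3) CN J B]) auto
    then have "real (\<Sum>j\<in>J. card (B j)) \<le> real (card P * N ^ CARD('n))"
      by (simp only: of_nat_le_iff)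
    also have "\<dots> = card P * real N ^ CARD('n)" by simp
    also have "\<dots> \<le> (card P + 1) * ((sqrt C + 2) * sqrt \<Lambda>) ^ CARD('n)"
    proof (intro mult_mono power_mono)
      have "1 \<le> sqrt \<Lambda>" using \<Lambda> by simp
      then show "real N \<le> (sqrt C + 2) * sqrt \<Lambda>"
        using N(2) unfolding real_sqrt_mult distrib_right by linarith
    qed auto
    also have "\<dots> = D * sqrt \<Lambda> ^ CARD('n)" by (simp add: D_def power_mult_distrib)
    also have "sqrt \<Lambda> ^ CARD('n) = \<Lambda> powr (CARD('n) / 2)"
      using \<Lambda> by (simp add: powr_half_sqrt[symmetric] powr_powr flip: powr_realpow)
    finally show "(\<Sum>j\<in>J. card (B j)) \<le> D * \<Lambda> powr (CARD('n) / 2)" .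
  qed
qed

lemma eigenspace_basis:
  obtains B where "finite B" "B \<subseteq> eigenspace A G \<theta>" "real_fun.independent B"
    "eigenspace A G \<theta> \<subseteq> real_fun.span B" "card B = fun_dim (eigenspace A G \<theta>)"
proof -
  obtain B where B: "B \<subseteq> eigenspace A G \<theta>" "real_fun.independent B"
    "eigenspace A G \<theta> \<subseteq> real_fun.span B" "card B = fun_dim (eigenspace A G \<theta>)"
    using real_fun.basis_exists[of "eigenspace A G \<theta>"] unfolding fun_dim_def by blast
  have "finite B"
  proof (rule ccontr)
    assume inf: "infinite B"
    obtain C where C: "C > 0" "\<And>\<Lambda> (J :: nat set) \<theta> B. \<Lambda> \<ge> 1 \<Longrightarrow> finite J \<Longrightarrow> inj_on \<theta> J \<Longrightarrow>
      (\<And>j. j \<in> J \<Longrightarrow> \<theta> j \<le> \<Lambda>) \<Longrightarrow> (\<And>j. j \<in> J \<Longrightarrow> finite (B j)) \<Longrightarrow>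
      (\<And>j. j \<in> J \<Longrightarrow> B j \<subseteq> eigenspace A G (\<theta> j)) \<Longrightarrow> (\<And>j. j \<in> J \<Longrightarrow> real_fun.independent (B j)) \<Longrightarrow>
      (\<Sum>j\<in>J. card (B j)) \<le> C * \<Lambda> powr (CARD('n) / 2)"
      using eigenfunction_count by blast
    define m where "m = nat \<lceil>C * max 1 \<theta> powr (CARD('n) / 2)\<rceil> + 1"
    obtain B' where B': "B' \<subseteq> B" "finite B'" "card B' = m" using infinite_arbitrarily_large[OF inf] by blast
    have "real_fun.independent B'" using real_fun.independent_mono[OF B(2) B'(1)] .
    then have "real (card B') \<le> C * max 1 \<theta> powr (CARD('n) / 2)"
      using C(2)[of "max 1 \<theta>" "{0}" "\<lambda>_. \<theta>" "\<lambda>_. B'"] B' B(1) by auto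
    then show False unfolding B'(3) m_def by linarith
  qed
  then show ?thesis using that B by blast
qed

end

section \<open>Orthogonal blocks in the space of square-integrable functions\<close>

lemma L2_mult_integrable:
  assumes "f \<in> L2_space \<nu>" "h \<in> L2_space \<nu>"
  shows "integrable \<nu> (\<lambda>x. f x * h x)"
proof (rule Bochner_Integration.integrable_bound[of _ "\<lambda>x. (f x)\<^sup>2 + (h x)\<^sup>2"])
  show "integrable \<nu> (\<lambda>x. (f x)\<^sup>2 + (h x)\<^sup>2)" using assms by (simp add: L2_space_def)
  show "(\<lambda>x. f x * h x) \<in> borel_measurable \<nu>" using assms by (auto simp: L2_space_def)
  have "\<bar>f x * h x\<bar> \<le> (f x)\<^sup>2 + (h x)\<^sup>2" for x
  proof -
    have "2 * (\<bar>f x\<bar> * \<bar>h x\<bar>) \<le> (f x)\<^sup>2 + (h x)\<^sup>2"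
      using sum_squares_bound[of "\<bar>f x\<bar>" "\<bar>h x\<bar>"] by (simp add: mult.assoc)
    moreover have "0 \<le> \<bar>f x\<bar> * \<bar>h x\<bar>" by simp
    ultimately show ?thesis unfolding abs_mult by linarith
  qed
  then show "AE x in \<nu>. norm (f x * h x) \<le> norm ((f x)\<^sup>2 + (h x)\<^sup>2)" by simp
qed

lemma L2_lincomb:
  assumes "f \<in> L2_space \<nu>" "h \<in> L2_space \<nu>"
  shows "(\<lambda>x. a * f x + h x) \<in> L2_space \<nu>"
proof -
  have "integrable \<nu> (\<lambda>x. a\<^sup>2 * (f x)\<^sup>2 + 2 * a * (f x * h x) + (h x)\<^sup>2)"
    using assms L2_mult_integrable[OF assms] by (simp add: L2_space_def)
  moreover have "(\<lambda>x. a\<^sup>2 * (f x)\<^sup>2 + 2 * a * (f x * h x) + (h x)\<^sup>2) = (\<lambda>x. (a * f x + h x)\<^sup>2)"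
    by (simp add: fun_eq_iff power2_eq_square algebra_simps)
  ultimately show ?thesis using assms by (auto simp: L2_space_def)
qed

lemma L2_zero: "(\<lambda>x. 0) \<in> L2_space \<nu>"
  by (simp add: L2_space_def)

lemma L2_diff: "f \<in> L2_space \<nu> \<Longrightarrow> h \<in> L2_space \<nu> \<Longrightarrow> (\<lambda>x. f x - h x) \<in> L2_space \<nu>"
  using L2_lincomb[of h \<nu> f "-1"] by simp

lemma L2_sum: "(\<And>i. i \<in> J \<Longrightarrow> f i \<in> L2_space \<nu>) \<Longrightarrow> (\<lambda>x. \<Sum>i\<in>J. a i * f i x) \<in> L2_space \<nu>"
  by (induction J rule: infinite_finite_induct) (simp_all add: L2_zero L2_lincomb)

lemma L2_norm_square: "(L2_norm \<nu> f)\<^sup>2 = (\<integral>x. (f x)\<^sup>2 \<partial>\<nu>)"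
  by (simp add: L2_norm_def)

lemma integral_square_eq: "(\<integral>x. f x * f x \<partial>\<nu>) = (L2_norm \<nu> f)\<^sup>2"
  unfolding L2_norm_square by (simp add: power2_eq_square)

lemma L2_norm_nonneg [simp]: "0 \<le> L2_norm \<nu> f"
  by (simp add: L2_norm_def)

lemma integral_mult_sum:
  assumes "\<And>i. i \<in> J \<Longrightarrow> f i \<in> L2_space \<nu>" "h \<in> L2_space \<nu>"
  shows "(\<integral>x. (\<Sum>i\<in>J. a i * f i x) * h x \<partial>\<nu>) = (\<Sum>i\<in>J. a i * (\<integral>x. f i x * h x \<partial>\<nu>))"
proof -
  have "(\<integral>x. (\<Sum>i\<in>J. a i * f i x) * h x \<partial>\<nu>) = (\<integral>x. (\<Sum>i\<in>J. a i * (f i x * h x)) \<partial>\<nu>)"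
    by (simp add: sum_distrib_right mult.assoc)
  also have "\<dots> = (\<Sum>i\<in>J. \<integral>x. a i * (f i x * h x) \<partial>\<nu>)"
    by (rule Bochner_Integration.integral_sum) (use L2_mult_integrable assms in auto)
  finally show ?thesis by simp
qed

lemma integral_null_factor:
  assumes "e \<in> L2_space \<nu>" "h \<in> L2_space \<nu>" "(\<integral>x. (e x)\<^sup>2 \<partial>\<nu>) = 0"
  shows "(\<integral>x. h x * e x \<partial>\<nu>) = 0"
proof -
  have "AE x in \<nu>. (e x)\<^sup>2 = 0"
    using assms integral_nonneg_eq_0_iff_AE[of \<nu> "\<lambda>x. (e x)\<^sup>2"] by (simp add: L2_space_def)
  then have "AE x in \<nu>. h x * e x = 0" by eventually_elim simp
  then show ?thesis by (rule integral_eq_zero_AE)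
qed

text \<open>Gram-Schmidt orthogonalization. The component \<open>e\<close> of the new vector that is orthogonal to the earlier ones may be
  a null function; its coefficient \<open>t\<close> is then \<open>0\<close> through division by zero, and pairings with \<open>e\<close> vanish anyway.\<close>

lemma finite_projection:
  assumes "finite B" "B \<subseteq> L2_space \<nu>" "f \<in> L2_space \<nu>"
  shows "\<exists>x. \<forall>b\<in>B. (\<integral>p. (f p - (\<Sum>b'\<in>B. x b' * b' p)) * b p \<partial>\<nu>) = 0"
  using assms
proof (induction B arbitrary: f rule: finite_induct)
  case (insert b B)
  note L2i = L2_mult_integrable
  have bL: "b \<in> L2_space \<nu>" and BL: "\<And>b'. b' \<in> B \<Longrightarrow> b' \<in> L2_space \<nu>" using insert.prems by auto
  obtain x where x: "\<forall>b'\<in>B. (\<integral>p. (f p - (\<Sum>b'\<in>B. x b' * b' p)) * b' p \<partial>\<nu>) = 0"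
    using insert.IH[of f] insert.prems by auto
  obtain y where y: "\<forall>b'\<in>B. (\<integral>p. (b p - (\<Sum>b'\<in>B. y b' * b' p)) * b' p \<partial>\<nu>) = 0"
    using insert.IH[of b] insert.prems by auto
  define fh where "fh p = (\<Sum>b'\<in>B. x b' * b' p)" for p
  define bh where "bh p = (\<Sum>b'\<in>B. y b' * b' p)" for p
  define e where "e p = b p - bh p" for p
  define d where "d p = f p - fh p" for p
  have fhL: "fh \<in> L2_space \<nu>" and bhL: "bh \<in> L2_space \<nu>"
    unfolding fh_def[abs_def] bh_def[abs_def] by (intro L2_sum BL; simp)+
  have eL: "e \<in> L2_space \<nu>" and dL: "d \<in> L2_space \<nu>"
    unfolding e_def[abs_def] d_def[abs_def] using L2_diff bL bhL insert.prems fhL by auto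
  have dB: "(\<integral>p. d p * b' p \<partial>\<nu>) = 0" if "b' \<in> B" for b'
    using x that by (simp add: d_def fh_def)
  have eB: "(\<integral>p. e p * b' p \<partial>\<nu>) = 0" if "b' \<in> B" for b'
    using y that by (simp add: e_def bh_def)
  have comb0: "(\<integral>p. (\<Sum>b'\<in>B. w b' * b' p) * k p \<partial>\<nu>) = 0"
    if "k \<in> L2_space \<nu>" "\<And>b'. b' \<in> B \<Longrightarrow> (\<integral>p. k p * b' p \<partial>\<nu>) = 0" for w k
    using integral_mult_sum[of B "\<lambda>b. b" \<nu> k w] BL that by (simp add: mult.commute)
  have dbh: "(\<integral>p. bh p * d p \<partial>\<nu>) = 0" unfolding bh_def by (rule comb0[OF dL dB])
  have ebh: "(\<integral>p. bh p * e p \<partial>\<nu>) = 0" unfolding bh_def by (rule comb0[OF eL eB])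
  define t where "t = (\<integral>p. d p * e p \<partial>\<nu>) / (\<integral>p. (e p)\<^sup>2 \<partial>\<nu>)"
  define w where "w b' = (if b' = b then t else x b' - t * y b')" for b'
  have sum: "f p - (\<Sum>b'\<in>insert b B. w b' * b' p) = d p - t * e p" for p
  proof -
    have "(\<Sum>b'\<in>B. w b' * b' p) = (\<Sum>b'\<in>B. (x b' - t * y b') * b' p)"
      using insert.hyps(2) by (intro sum.cong) (auto simp: w_def)
    then have "(\<Sum>b'\<in>insert b B. w b' * b' p) = t * b p + (\<Sum>b'\<in>B. (x b' - t * y b') * b' p)"
      using insert.hyps by (simp add: w_def)
    then show ?thesis
      by (simp add: d_def e_def fh_def bh_def algebra_simps sum_subtractf sum_distrib_left)
  qed
  have lin: "(\<integral>p. (d p - t * e p) * k p \<partial>\<nu>) = (\<integral>p. d p * k p \<partial>\<nu>) - t * (\<integral>p. e p * k p \<partial>\<nu>)"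
    if "k \<in> L2_space \<nu>" for k
  proof -
    have "(\<integral>p. (d p - t * e p) * k p \<partial>\<nu>) = (\<integral>p. d p * k p - t * (e p * k p) \<partial>\<nu>)"
      by (simp add: left_diff_distrib mult.assoc)
    then show ?thesis using L2i[OF dL that] L2i[OF eL that] by simp
  qed
  have te: "(\<integral>p. d p * e p \<partial>\<nu>) - t * (\<integral>p. e p * e p \<partial>\<nu>) = 0"
  proof (cases "(\<integral>p. (e p)\<^sup>2 \<partial>\<nu>) = 0")
    case True
    then show ?thesis using integral_null_factor[OF eL dL True] by (simp add: power2_eq_square)
  qed (simp add: t_def power2_eq_square)
  have "(\<integral>p. (d p - t * e p) * b' p \<partial>\<nu>) = 0" if "b' \<in> insert b B" for b'
  proof (cases "b' = b")
    case True
    have "(\<integral>p. (d p - t * e p) * b p \<partial>\<nu>) = (\<integral>p. (d p - t * e p) * e p + (d p - t * e p) * bh p \<partial>\<nu>)"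
      by (simp add: e_def algebra_simps)
    also have "\<dots> = (\<integral>p. (d p - t * e p) * e p \<partial>\<nu>) + (\<integral>p. (d p - t * e p) * bh p \<partial>\<nu>)"
      using L2_lincomb[OF eL dL, of "- t"]
      by (intro Bochner_Integration.integral_add L2i eL bhL) simp_all
    also have "\<dots> = 0" using lin[OF eL] lin[OF bhL] te dbh ebh by (simp add: mult.commute)
    finally show ?thesis using True by simp
  next
    case False
    then show ?thesis using that lin[OF BL] dB eB by simp
  qed
  then show ?case by (intro exI[of _ w]) (simp add: sum del: sum.insert)
qed simp

text \<open>Functions are not identified modulo null sets, so the finite families spanning the blocks need not be
  independent in the seminorm; being spanned by a finite family is enough for projections to exist.\<close>

locale orthogonal_blocks =
  fixes \<nu> :: "'m measure" and E :: "nat \<Rightarrow> ('m \<Rightarrow> real) set"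
  assumes E_L2: "f \<in> E j \<Longrightarrow> f \<in> L2_space \<nu>"
    and E_sum: "finite B \<Longrightarrow> B \<subseteq> E j \<Longrightarrow> (\<lambda>p. \<Sum>b\<in>B. x b * b p) \<in> E j"
    and E_finite: "\<exists>B. finite B \<and> B \<subseteq> E j \<and> (\<forall>v\<in>E j. \<exists>x. v = (\<lambda>p. \<Sum>b\<in>B. x b * b p))"
    and E_orth: "i \<noteq> j \<Longrightarrow> f \<in> E i \<Longrightarrow> h \<in> E j \<Longrightarrow> (\<integral>x. f x * h x \<partial>\<nu>) = 0"
begin

abbreviation Pr :: "nat \<Rightarrow> ('m \<Rightarrow> real) \<Rightarrow> 'm \<Rightarrow> real"
  where "Pr j \<equiv> L2_proj \<nu> (E j)"

lemma L2_proj: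
  assumes "f \<in> L2_space \<nu>"
  shows "Pr j f \<in> E j" "v \<in> E j \<Longrightarrow> (\<integral>x. (f x - Pr j f x) * v x \<partial>\<nu>) = 0"
proof -
  obtain B where B: "finite B" "B \<subseteq> E j" "\<And>v. v \<in> E j \<Longrightarrow> \<exists>x. v = (\<lambda>p. \<Sum>b\<in>B. x b * b p)"
    using E_finite[of j] by metis
  have BL: "\<And>b. b \<in> B \<Longrightarrow> b \<in> L2_space \<nu>" using B(2) E_L2 by blast
  then obtain x where x: "\<And>b. b \<in> B \<Longrightarrow> (\<integral>p. (f p - (\<Sum>b'\<in>B. x b' * b' p)) * b p \<partial>\<nu>) = 0"
    using finite_projection[OF B(1) _ assms] by blast
  define u where "u p = (\<Sum>b\<in>B. x b * b p)" for p
  have uE: "u \<in> E j" unfolding u_def[abs_def] by (rule E_sum[OF B(1,2)])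
  have "(\<integral>p. (f p - u p) * v p \<partial>\<nu>) = 0" if v: "v \<in> E j" for v
  proof -
    obtain y where y: "v = (\<lambda>p. \<Sum>b\<in>B. y b * b p)" using B(3)[OF v] by blast
    have "(\<integral>p. (\<Sum>b\<in>B. y b * b p) * (f p - u p) \<partial>\<nu>) = (\<Sum>b\<in>B. y b * (\<integral>p. b p * (f p - u p) \<partial>\<nu>))"
      by (rule integral_mult_sum[OF BL L2_diff[OF assms E_L2[OF uE]]])
    also have "\<dots> = 0" using x by (intro sum.neutral) (simp add: u_def mult.commute)
    finally show ?thesis by (simp add: y mult.commute)
  qed
  then have "\<exists>u. u \<in> E j \<and> (\<forall>v\<in>E j. (\<integral>x. (f x - u x) * v x \<partial>\<nu>) = 0)" using uE by blast
  from someI_ex[OF this, folded L2_proj_def]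
  show "Pr j f \<in> E j" "v \<in> E j \<Longrightarrow> (\<integral>x. (f x - Pr j f x) * v x \<partial>\<nu>) = 0" by blast+
qed

lemma Pr_L2: "f \<in> L2_space \<nu> \<Longrightarrow> Pr j f \<in> L2_space \<nu>"
  using L2_proj(1) E_L2 by blast

lemma integral_Pr:
  assumes "f \<in> L2_space \<nu>" "v \<in> E j"
  shows "(\<integral>x. Pr j f x * v x \<partial>\<nu>) = (\<integral>x. f x * v x \<partial>\<nu>)"
proof -
  have "(\<integral>x. (f x - Pr j f x) * v x \<partial>\<nu>) = (\<integral>x. f x * v x \<partial>\<nu>) - (\<integral>x. Pr j f x * v x \<partial>\<nu>)"
    unfolding left_diff_distrib
    by (intro Bochner_Integration.integral_diff L2_mult_integrable assms Pr_L2 E_L2[OF assms(2)])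
  then show ?thesis using L2_proj(2)[OF assms(1,2)] by simp
qed

text \<open>The norm of the projection depends only on the pairings with the block.\<close>

lemma L2_norm_Pr_scaled:
  assumes "f \<in> L2_space \<nu>" "h \<in> L2_space \<nu>"
    "\<And>v. v \<in> E j \<Longrightarrow> (\<integral>x. h x * v x \<partial>\<nu>) = c * (\<integral>x. f x * v x \<partial>\<nu>)"
  shows "L2_norm \<nu> (Pr j h) = \<bar>c\<bar> * L2_norm \<nu> (Pr j f)"
proof -
  note P = L2_proj(1)[OF assms(1), of j] L2_proj(1)[OF assms(2), of j]
  have "(\<integral>x. (Pr j h x)\<^sup>2 \<partial>\<nu>) = (\<integral>x. Pr j h x * Pr j h x \<partial>\<nu>)" by (simp add: power2_eq_square)
  also have "\<dots> = c * (\<integral>x. f x * Pr j h x \<partial>\<nu>)" unfolding integral_Pr[OF assms(2) P(2)] by (rule assms(3)[OF P(2)])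
  also have "(\<integral>x. f x * Pr j h x \<partial>\<nu>) = (\<integral>x. Pr j h x * Pr j f x \<partial>\<nu>)"
    by (simp add: integral_Pr[OF assms(1) P(2), symmetric] mult.commute)
  also have "\<dots> = c * (\<integral>x. f x * Pr j f x \<partial>\<nu>)" unfolding integral_Pr[OF assms(2) P(1)] by (rule assms(3)[OF P(1)])
  also have "(\<integral>x. f x * Pr j f x \<partial>\<nu>) = (\<integral>x. (Pr j f x)\<^sup>2 \<partial>\<nu>)"
    by (simp add: integral_Pr[OF assms(1) P(1), symmetric] power2_eq_square)
  finally have "(\<integral>x. (Pr j h x)\<^sup>2 \<partial>\<nu>) = c\<^sup>2 * (\<integral>x. (Pr j f x)\<^sup>2 \<partial>\<nu>)" by (simp add: power2_eq_square)
  then show ?thesis by (simp add: L2_norm_def real_sqrt_mult)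
qed

lemma bessel:
  assumes f: "f \<in> L2_space \<nu>" and J: "finite J"
  shows "(\<Sum>j\<in>J. (L2_norm \<nu> (Pr j f))\<^sup>2) \<le> (L2_norm \<nu> f)\<^sup>2"
proof -
  define h where "h p = (\<Sum>j\<in>J. 1 * Pr j f p)" for p
  have hL: "h \<in> L2_space \<nu>" unfolding h_def[abs_def] by (intro L2_sum Pr_L2 f)
  have fP: "(\<integral>x. Pr j f x * f x \<partial>\<nu>) = (L2_norm \<nu> (Pr j f))\<^sup>2" for j
    using integral_Pr[OF f L2_proj(1)[OF f, of j]]
    unfolding L2_norm_square by (simp add: power2_eq_square mult.commute)
  have hf: "(\<integral>x. h x * f x \<partial>\<nu>) = (\<Sum>j\<in>J. (L2_norm \<nu> (Pr j f))\<^sup>2)"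
    unfolding h_def by (subst integral_mult_sum) (simp_all add: Pr_L2 f fP)
  have hh: "(\<integral>x. h x * h x \<partial>\<nu>) = (\<Sum>j\<in>J. (L2_norm \<nu> (Pr j f))\<^sup>2)"
  proof -
    have "(\<integral>x. h x * h x \<partial>\<nu>) = (\<Sum>j\<in>J. 1 * (\<integral>x. Pr j f x * h x \<partial>\<nu>))"
      by (subst (1) h_def) (rule integral_mult_sum[OF Pr_L2[OF f] hL])
    also have "\<dots> = (\<Sum>j\<in>J. (L2_norm \<nu> (Pr j f))\<^sup>2)"
    proof (rule sum.cong[OF refl])
      fix j assume j: "j \<in> J"
      have "(\<integral>x. h x * Pr j f x \<partial>\<nu>) = (\<Sum>i\<in>J. 1 * (\<integral>x. Pr i f x * Pr j f x \<partial>\<nu>))"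
        unfolding h_def by (rule integral_mult_sum[OF Pr_L2[OF f] Pr_L2[OF f]])
      also have "\<dots> = (\<Sum>i\<in>J. if i = j then (L2_norm \<nu> (Pr j f))\<^sup>2 else 0)"
        using E_orth[OF _ L2_proj(1)[OF f] L2_proj(1)[OF f]]
        by (intro sum.cong) (auto simp: integral_square_eq)
      finally show "1 * (\<integral>x. Pr j f x * h x \<partial>\<nu>) = (L2_norm \<nu> (Pr j f))\<^sup>2"
        using J j by (simp add: mult.commute sum.delta)
    qed
    finally show ?thesis .
  qed
  have "0 \<le> (\<integral>x. (f x - h x)\<^sup>2 \<partial>\<nu>)" by simp
  also have "\<dots> = (\<integral>x. (f x)\<^sup>2 - 2 * (h x * f x) + h x * h x \<partial>\<nu>)"
    by (simp add: power2_eq_square algebra_simps)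
  also have "\<dots> = (\<integral>x. (f x)\<^sup>2 \<partial>\<nu>) - 2 * (\<integral>x. h x * f x \<partial>\<nu>) + (\<integral>x. h x * h x \<partial>\<nu>)"
    using f L2_mult_integrable[OF hL f] L2_mult_integrable[OF hL hL] by (simp add: L2_space_def)
  finally show ?thesis by (simp add: hf hh L2_norm_square)
qed

end

section \<open>The test functions\<close>

lemma measurable_zero_off_closed:
  fixes F :: "real^'n::finite \<Rightarrow> real"
  assumes "open U" "continuous_on U F" "Q \<subseteq> U" "\<And>x. x \<notin> Q \<Longrightarrow> F x = 0"
  shows "F \<in> borel_measurable borel"
proof -
  have "(\<lambda>x. if x \<in> U then F x else 0) \<in> borel_measurable borel"
    using assms by (intro borel_measurable_continuous_on_if) auto
  moreover have "(\<lambda>x. if x \<in> U then F x else 0) = F" using assms by (auto simp: fun_eq_iff)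
  ultimately show ?thesis by simp
qed

lemma measure_cbox_const:
  fixes y :: "real^'n::finite"
  assumes "s \<le> t"
  shows "measure lborel (cbox (y + (\<chi> i. s)) (y + (\<chi> i. t))) = (t - s) ^ CARD('n)"
proof -
  have "y + (\<chi> i. s) \<in> cbox (y + (\<chi> i. s)) (y + (\<chi> i. t))" using assms by (simp add: mem_box_cart)
  then have "cbox (y + (\<chi> i. s)) (y + (\<chi> i. t)) \<noteq> {}" by blast
  from content_cbox_cart[OF this] show ?thesis by simp
qed

context riemannian
begin

lemma integral_extend_chart:
  assumes c: "c \<in> A" and Q: "Q \<subseteq> chart_range c" "\<And>x. x \<notin> Q \<Longrightarrow> F x = 0"
    and m: "F \<in> borel_measurable borel" "v \<in> borel_measurable borel"
  shows "(\<integral>p. extend_chart c F p * v p \<partial>V) = (LINT x:Q|lborel. sqrt (det (G c x)) * (F x * v (chart_inv c x)))"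
proof -
  have [measurable]: "extend_chart c F \<in> borel_measurable borel"
    unfolding extend_chart_def[abs_def] by (rule measurable_chart_extension[OF c m(1)])
  note [measurable] = m(2)
  have z: "extend_chart c F p = 0" if "p \<notin> chart_inv c ` Q" for p
    using that Q(2) chart_inv_image[OF c Q(1), of p] by (auto simp: extend_chart_def)
  have "(\<integral>p. extend_chart c F p * v p \<partial>V)
      = (LINT x:Q|lborel. sqrt (det (G c x)) * (extend_chart c F (chart_inv c x) * v (chart_inv c x)))"
  proof (rule integral_chart_subset[OF c _ _ Q(1)])
    show "(\<lambda>p. extend_chart c F p * v p) \<in> borel_measurable borel" by measurable
  qed (use z in \<open>auto simp: extend_chart_def\<close>)
  also have "\<dots> = (LINT x:Q|lborel. sqrt (det (G c x)) * (F x * v (chart_inv c x)))"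
  proof -
    have "indicator Q x *\<^sub>R (sqrt (det (G c x)) * (extend_chart c F (chart_inv c x) * v (chart_inv c x)))
      = indicator Q x *\<^sub>R (sqrt (det (G c x)) * (F x * v (chart_inv c x)))" for x
      using chart_map_inv[OF c, of x] chart_inv_dom[OF c, of x] Q(1)
      by (auto simp: extend_chart_def indicator_def)
    then show ?thesis
      unfolding set_lebesgue_integral_def by (rule Bochner_Integration.integral_cong[OF refl])
  qed
  finally show ?thesis .
qed

text \<open>One bump of scale \<open>1/N\<close> in every cell of one coordinate cube. It is an odd bump divided by the volume
  density, so that its integral over the manifold is the Lebesgue integral of the odd bump. The function \<open>g a\<close> is \<open>\<Delta>\<^sup>m\<close> applied to \<open>b a\<close>;
  the pairing identity is what makes the projections of \<open>b a\<close> to high eigenspaces small.\<close>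

lemma test_functions:
  obtains C c1 where "C > 0" "c1 > 0" and
    "\<And>N. N \<ge> 1 \<Longrightarrow> \<exists>(b :: ('n \<Rightarrow> nat) \<Rightarrow> 'm \<Rightarrow> real) g S. disjoint_family_on S (cells N) \<and>
      (\<forall>a\<in>cells N. b a \<in> borel_measurable borel \<and> g a \<in> borel_measurable borel \<and> S a \<in> sets borel \<and>
        (\<forall>p. \<bar>b a p\<bar> \<le> C * indicator (S a) p) \<and> (\<forall>p. \<bar>g a p\<bar> \<le> C * real N ^ (2 * m) * indicator (S a) p) \<and>
        (\<integral>p. b a p \<partial>V) = 0 \<and> c1 / real N ^ CARD('n) \<le> (\<integral>p. (b a p)\<^sup>2 \<partial>V) \<and>
        (\<integral>p. (b a p)\<^sup>2 \<partial>V) \<le> C / real N ^ CARD('n) \<and>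
        (\<forall>\<theta> v. v \<in> eigenspace A G \<theta> \<longrightarrow> (\<integral>p. g a p * v p \<partial>V) = (- \<theta>) ^ m * (\<integral>p. b a p * v p \<partial>V)))"
proof -
  obtain c z \<rho> where P: "(c, z, \<rho>) \<in> patches" using patch_exists[of undefined] by blast
  note D = patchesD[OF P]
  \<comment> \<open>The bumps of all scales \<open>N\<close> form one scaled family, so that the constants do not depend on \<open>N\<close>.\<close>
  define I where "I = {(N, a :: 'n \<Rightarrow> nat). N \<ge> (1::nat) \<and> a \<in> cells N}"
  define r where "r = (\<lambda>(N, a :: 'n \<Rightarrow> nat). \<rho> / (2 * real N))"
  define y where "y = (\<lambda>(N, a). cell_center z \<rho> N a)"
  have r: "0 < r \<iota> \<and> r \<iota> \<le> 1" if mem: "\<iota> \<in> I" for \<iota>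
  proof -
    obtain N a where \<iota>: "\<iota> = (N, a)" "N \<ge> 1" using mem by (cases \<iota>) (auto simp: I_def)
    have "\<rho> \<le> 2 * real N" using \<iota>(2) D(3) by simp
    then show ?thesis using \<iota> D(2) by (simp add: r_def)
  qed
  interpret metric_patch I r "open_cube z (2 * \<rho>)" "chart_range c" "G c" "cube z (2 * \<rho>)"
    by (rule metric_patch[OF P r])
  define Q where "Q \<iota> = cube (y \<iota>) (r \<iota>)" for \<iota>
  have Qcell: "Q (N, a) \<subseteq> cell z \<rho> N a" if "N \<ge> 1" for N a
    unfolding Q_def y_def r_def prod.case using D(2) that
    by (intro cube_center_subset_cell) (auto simp: field_simps)
  have Qcube: "Q \<iota> \<subseteq> cube z \<rho>" if "\<iota> \<in> I" for \<iota>
    using that Qcell cell_subset_cube[OF D(2)] unfolding I_def by fastforce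
  have QU: "Q \<iota> \<subseteq> open_cube z (2 * \<rho>)" "Q \<iota> \<subseteq> chart_range c" if "\<iota> \<in> I" for \<iota>
    using Qcube[OF that] D(5,6) by auto
  define w where "w x = sqrt (det (G c x))" for x
  define i0 :: 'n where "i0 = undefined"
  define \<beta> where "\<beta> \<iota> = box_bump (odd_poly i0) (2 * m + 2) (y \<iota>) (r \<iota>)" for \<iota>
  define u where "u \<iota> x = inverse (w x) * \<beta> \<iota> x" for \<iota> x
  define h where "h \<iota> = (lap (G c) ^^ m) (u \<iota>)" for \<iota>
  have s\<beta>: "symb (2 * m) 0 \<beta>" unfolding \<beta>_def[abs_def] by (rule symb_box_bump) simp
  have su: "symb (2 * m) 0 u"
    unfolding u_def[abs_def] w_def using symb_mult[OF symb_inverse_sqrt_det s\<beta>] by simp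
  have sh: "symb 0 (2 * m) h"
    using symb_lap_pow[of 0 m 0 u] su by (simp add: h_def[abs_def])
  have \<beta>0: "\<beta> \<iota> x = 0" if "\<iota> \<in> I" "x \<notin> Q \<iota>" for \<iota> x
    unfolding \<beta>_def by (rule box_bump_zero) (use r[OF that(1)] that(2) open_cube_subset_cube in \<open>auto simp: Q_def\<close>)
  have u0: "u \<iota> x = 0" if "\<iota> \<in> I" "x \<notin> Q \<iota>" for \<iota> x using \<beta>0[OF that] by (simp add: u_def)
  have h0: "h \<iota> x = 0" if "\<iota> \<in> I" "x \<notin> Q \<iota>" for \<iota> x
    unfolding h_def by (rule lap_pow_zero_off_closed[of "Q \<iota>"]) (use u0 that in \<open>auto simp: Q_def\<close>)
  have \<beta>m: "\<beta> \<iota> \<in> borel_measurable borel" and um: "u \<iota> \<in> borel_measurable borel" and hm: "h \<iota> \<in> borel_measurable borel" if "\<iota> \<in> I" for \<iota>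
    using symb_continuous[OF s\<beta> that] symb_continuous[OF su that] symb_continuous[OF sh that]
      \<beta>0[OF that] u0[OF that] h0[OF that]
    by (blast intro: measurable_zero_off_closed[OF open_open_cube _ QU(1)[OF that]])+
  obtain Cu where Cu: "Cu \<ge> 0" "\<And>\<iota> x. \<iota> \<in> I \<Longrightarrow> x \<in> open_cube z (2 * \<rho>) \<Longrightarrow> \<bar>u \<iota> x\<bar> \<le> Cu"
    using symb_bnd[OF su] by (auto simp: bnd_def)
  obtain Ch where Ch: "Ch \<ge> 0" "\<And>\<iota> x. \<iota> \<in> I \<Longrightarrow> x \<in> open_cube z (2 * \<rho>) \<Longrightarrow> \<bar>h \<iota> x\<bar> \<le> Ch / r \<iota> ^ (2 * m)"
    using symb_bnd[OF sh] by (auto simp: bnd_def)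
  have wc: "continuous_on (cube z \<rho>) w"
    unfolding w_def[abs_def] using continuous_sqrt_det D(6) continuous_on_subset by blast
  have wpos: "w x > 0" if "x \<in> chart_range c" for x using det_g_pos[OF that] by (simp add: w_def)
  have "z \<in> cube z \<rho>" using D(2) by (simp add: mem_cube)
  then obtain yw where yw: "yw \<in> cube z \<rho>" "\<And>x. x \<in> cube z \<rho> \<Longrightarrow> w x \<le> w yw"
    using continuous_attains_sup[OF compact_cube _ wc] by blast
  define W where "W = w yw"
  have W: "W > 0" using wpos yw(1) D(6) by (auto simp: W_def)
  define \<delta> where "\<delta> = (1/4 * (3/4) ^ (2 * m + 2) :: real) ^ CARD('n)"
  have \<delta>: "\<delta> > 0" by (simp add: \<delta>_def)
  define C where "C = Cu + Ch * (2 / \<rho>) ^ (2 * m) + W * Cu\<^sup>2 * \<rho> ^ CARD('n) + 1"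
  have C: "C > 0" "Cu \<le> C" "Ch * (2 / \<rho>) ^ (2 * m) \<le> C" "W * Cu\<^sup>2 * \<rho> ^ CARD('n) \<le> C"
  proof -
    have "0 \<le> Ch * (2 / \<rho>) ^ (2 * m)" "0 \<le> W * Cu\<^sup>2 * \<rho> ^ CARD('n)" using Ch(1) W D(2) by simp_all
    then show "C > 0" "Cu \<le> C" "Ch * (2 / \<rho>) ^ (2 * m) \<le> C" "W * Cu\<^sup>2 * \<rho> ^ CARD('n) \<le> C"
      using Cu(1) unfolding C_def by linarith+
  qed
  define c1 where "c1 = \<delta>\<^sup>2 / W * (\<rho> / 8) ^ CARD('n)"
  have c1: "c1 > 0" using \<delta> W D(2) by (simp add: c1_def)
  show ?thesis
  proof (rule that[OF C(1) c1])
    fix N :: nat assume N: "N \<ge> 1"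
    define b where "b a = extend_chart c (u (N, a))" for a
    define g where "g a = extend_chart c (h (N, a))" for a
    define S where "S a = chart_inv c ` Q (N, a)" for a
    have inI: "(N, a) \<in> I" if "a \<in> cells N" for a using that N by (simp add: I_def)
    have memS: "p \<in> S a \<longleftrightarrow> p \<in> chart_dom c \<and> chart_map c p \<in> Q (N, a)" if "a \<in> cells N" for a p
      unfolding S_def by (rule chart_inv_image[OF D(1) QU(2)[OF inI[OF that]]])
    have disj: "disjoint_family_on S (cells N)"
    proof -
      have "a = a'" if a: "a \<in> cells N" "a' \<in> cells N" and p: "p \<in> S a" "p \<in> S a'" for a a' p
      proof (rule ccontr)
        assume "a \<noteq> a'"
        then have "cell z \<rho> N a \<inter> cell z \<rho> N a' = {}"
          using cells_disjoint[OF D(2) N] a by (auto simp: disjoint_family_on_def)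
        then show False using p memS[OF a(1)] memS[OF a(2)] Qcell[OF N] by blast
      qed
      then show ?thesis by (auto simp: disjoint_family_on_def)
    qed
    have each: "b a \<in> borel_measurable borel \<and> g a \<in> borel_measurable borel \<and> S a \<in> sets borel \<and>
        (\<forall>p. \<bar>b a p\<bar> \<le> C * indicator (S a) p) \<and> (\<forall>p. \<bar>g a p\<bar> \<le> C * real N ^ (2 * m) * indicator (S a) p) \<and>
        (\<integral>p. b a p \<partial>V) = 0 \<and> c1 / real N ^ CARD('n) \<le> (\<integral>p. (b a p)\<^sup>2 \<partial>V) \<and>
        (\<integral>p. (b a p)\<^sup>2 \<partial>V) \<le> C / real N ^ CARD('n) \<and>
        (\<forall>\<theta> v. v \<in> eigenspace A G \<theta> \<longrightarrow> (\<integral>p. g a p * v p \<partial>V) = (- \<theta>) ^ m * (\<integral>p. b a p * v p \<partial>V))"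
      if a: "a \<in> cells N" for a
    proof -
      let ?\<iota> = "(N, a)"
      note \<iota> = inI[OF a]
      have ri: "r ?\<iota> = \<rho> / (2 * real N)" "r ?\<iota> > 0" using r[OF \<iota>] by (simp_all add: r_def)
      have bm [measurable]: "b a \<in> borel_measurable borel"
        unfolding b_def extend_chart_def[abs_def] by (rule measurable_chart_extension[OF D(1) um[OF \<iota>]])
      have gm [measurable]: "g a \<in> borel_measurable borel"
        unfolding g_def extend_chart_def[abs_def] by (rule measurable_chart_extension[OF D(1) hm[OF \<iota>]])
      have Sm: "S a \<in> sets borel"
        using compact_imp_closed[OF compact_chart_inv_image[OF D(1) _ QU(2)[OF \<iota>]]]
        by (simp add: S_def Q_def borel_closed)
      have ub: "\<bar>u ?\<iota> x\<bar> \<le> Cu * indicator (Q ?\<iota>) x" for x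
        using Cu(2)[OF \<iota>, of x] u0[OF \<iota>, of x] QU(1)[OF \<iota>] by (cases "x \<in> Q ?\<iota>") auto
      have b_bd: "\<bar>b a p\<bar> \<le> C * indicator (S a) p" for p
        using ub[of "chart_map c p"] C(2) memS[OF a, of p]
        by (auto simp: b_def extend_chart_def indicator_def split: if_splits)
      have g_bd: "\<bar>g a p\<bar> \<le> C * real N ^ (2 * m) * indicator (S a) p" for p
      proof (cases "p \<in> S a")
        case True
        then have p: "p \<in> chart_dom c" "chart_map c p \<in> Q ?\<iota>" using memS[OF a] by auto
        then have "\<bar>g a p\<bar> \<le> Ch / r ?\<iota> ^ (2 * m)" using Ch(2)[OF \<iota>] QU(1)[OF \<iota>] by (auto simp: g_def extend_chart_def)
        also have "\<dots> = Ch * (2 / \<rho>) ^ (2 * m) * real N ^ (2 * m)"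
          using N D(2) by (simp add: ri(1) power_divide power_mult_distrib)
        also have "\<dots> \<le> C * real N ^ (2 * m)" by (rule mult_right_mono[OF C(3)]) simp
        finally show ?thesis using True by simp
      next
        case False
        then have "g a p = 0" using memS[OF a, of p] h0[OF \<iota>] by (auto simp: g_def extend_chart_def)
        then show ?thesis using False by simp
      qed
      have intu: "(\<integral>p. extend_chart c (u ?\<iota>) p * v p \<partial>V)
          = (LINT x:Q ?\<iota>|lborel. sqrt (det (G c x)) * (u ?\<iota> x * rep c v x))"
        and inth: "(\<integral>p. extend_chart c (h ?\<iota>) p * v p \<partial>V)
          = (LINT x:Q ?\<iota>|lborel. sqrt (det (G c x)) * (h ?\<iota> x * rep c v x))"
        if "v \<in> borel_measurable borel" for v
        using u0[OF \<iota>] um[OF \<iota>] h0[OF \<iota>] hm[OF \<iota>] that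
        by (intro integral_extend_chart[OF D(1) QU(2)[OF \<iota>]]; simp)+
      have "(\<integral>p. b a p \<partial>V) = (LINT x:Q ?\<iota>|lborel. sqrt (det (G c x)) * (u ?\<iota> x * 1))"
        using intu[of "\<lambda>p. 1"] by (simp add: b_def)
      also have "\<dots> = integral\<^sup>L lborel (\<beta> ?\<iota>)"
        unfolding set_lebesgue_integral_def
      proof (rule Bochner_Integration.integral_cong[OF refl])
        fix x
        show "indicator (Q ?\<iota>) x *\<^sub>R (sqrt (det (G c x)) * (u ?\<iota> x * 1)) = \<beta> ?\<iota> x"
          using wpos[of x] \<beta>0[OF \<iota>, of x] QU(2)[OF \<iota>] by (cases "x \<in> Q ?\<iota>") (auto simp: u_def w_def)
      qed
      also have "\<dots> = 0" unfolding \<beta>_def by (rule integral_odd_box_bump[of _ i0]) (simp add: odd_poly_def)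
      finally have b0: "(\<integral>p. b a p \<partial>V) = 0" .
      have b2: "(\<integral>p. (b a p)\<^sup>2 \<partial>V) = (\<integral>x. indicator (Q ?\<iota>) x * (w x * (u ?\<iota> x)\<^sup>2) \<partial>lborel)"
      proof -
        have "(\<integral>p. (b a p)\<^sup>2 \<partial>V) = (\<integral>p. extend_chart c (u ?\<iota>) p * b a p \<partial>V)" by (simp add: b_def power2_eq_square)
        also have "\<dots> = (LINT x:Q ?\<iota>|lborel. w x * (u ?\<iota> x * b a (chart_inv c x)))"
          unfolding w_def by (rule intu[OF bm])
        also have "\<dots> = (\<integral>x. indicator (Q ?\<iota>) x * (w x * (u ?\<iota> x)\<^sup>2) \<partial>lborel)"
          unfolding set_lebesgue_integral_def
        proof (rule Bochner_Integration.integral_cong[OF refl])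
          fix x
          show "indicator (Q ?\<iota>) x *\<^sub>R (w x * (u ?\<iota> x * b a (chart_inv c x))) = indicator (Q ?\<iota>) x * (w x * (u ?\<iota> x)\<^sup>2)"
            using QU(2)[OF \<iota>] chart_map_inv[OF D(1), of x] chart_inv_dom[OF D(1), of x]
            by (cases "x \<in> Q ?\<iota>") (auto simp: b_def extend_chart_def power2_eq_square)
        qed
        finally show ?thesis .
      qed
      have uc: "continuous_on (Q ?\<iota>) (u ?\<iota>)" "continuous_on (Q ?\<iota>) w"
        using continuous_on_subset[OF symb_continuous[OF su \<iota>] QU(1)[OF \<iota>]]
          continuous_on_subset[OF wc Qcube[OF \<iota>]] by auto
      have int: "integrable lborel (\<lambda>x. indicator (Q ?\<iota>) x * (w x * (u ?\<iota> x)\<^sup>2))"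
        using borel_integrable_compact[of "Q ?\<iota>" "\<lambda>x. w x * (u ?\<iota> x)\<^sup>2"] uc
        by (simp add: Q_def continuous_on_mult continuous_on_power)
      have mQ: "measure lborel (Q ?\<iota>) = (\<rho> / N) ^ CARD('n)"
      proof -
        have e: "y ?\<iota> - (\<chi> i. r ?\<iota>) = y ?\<iota> + (\<chi> i. - r ?\<iota>)" by (simp add: vec_eq_iff)
        have "measure lborel (Q ?\<iota>) = (r ?\<iota> - - r ?\<iota>) ^ CARD('n)"
          unfolding Q_def cube_def e by (rule measure_cbox_const) (use ri in simp)
        then show ?thesis by (simp add: ri(1))
      qed
      have "(\<integral>x. indicator (Q ?\<iota>) x * (w x * (u ?\<iota> x)\<^sup>2) \<partial>lborel) \<le> (\<integral>x. (W * Cu\<^sup>2) * indicator (Q ?\<iota>) x \<partial>lborel)"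
      proof (rule integral_mono[OF int])
        show "integrable lborel (\<lambda>x. (W * Cu\<^sup>2) * indicator (Q ?\<iota>) x :: real)"
          using emeasure_lborel_cbox_finite unfolding Q_def cube_def
          by (intro integrable_mult_right integrable_real_indicator) auto
        show "indicator (Q ?\<iota>) x * (w x * (u ?\<iota> x)\<^sup>2) \<le> (W * Cu\<^sup>2) * indicator (Q ?\<iota>) x" for x
        proof (cases "x \<in> Q ?\<iota>")
          case True
          have "(u ?\<iota> x)\<^sup>2 \<le> Cu\<^sup>2" using ub[of x] True Cu(1) by (simp add: abs_le_square_iff[symmetric])
          moreover have "w x \<le> W" using yw(2) True Qcube[OF \<iota>] by (auto simp: W_def)
          ultimately show ?thesis using True W by (auto intro!: mult_mono)
        qed simp
      qed
      also have "\<dots> = W * Cu\<^sup>2 * (\<rho> / N) ^ CARD('n)"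
        using mQ by (simp add: Q_def borel_closed)
      also have "\<dots> = W * Cu\<^sup>2 * \<rho> ^ CARD('n) / real N ^ CARD('n)" by (simp add: power_divide)
      also have "\<dots> \<le> C / real N ^ CARD('n)" by (rule divide_right_mono[OF C(4)]) simp
      finally have upper: "(\<integral>p. (b a p)\<^sup>2 \<partial>V) \<le> C / real N ^ CARD('n)" unfolding b2 .
      \<comment> \<open>The subcube on which the odd bump is at least \<open>\<delta>\<close>.\<close>
      define R where "R = cbox (y ?\<iota> + (\<chi> i. r ?\<iota> / 4)) (y ?\<iota> + (\<chi> i. r ?\<iota> / 2))"
      have R: "\<rho> / (2 * real N) / 4 \<le> x $ i - y ?\<iota> $ i \<and> x $ i - y ?\<iota> $ i \<le> \<rho> / (2 * real N) / 2" if "x \<in> R" for x i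
        using that ri(1) unfolding R_def mem_box_cart by (auto simp: algebra_simps)
      have mR: "measure lborel R = (r ?\<iota> / 4) ^ CARD('n)"
        unfolding R_def using measure_cbox_const[of "r ?\<iota> / 4" "r ?\<iota> / 2" "y ?\<iota>"] ri(2) by simp
      have "c1 / real N ^ CARD('n) = \<delta>\<^sup>2 / W * (r ?\<iota> / 4) ^ CARD('n)"
        using D(2) by (simp add: c1_def ri(1) power_divide power_mult_distrib)
      also have "\<dots> = (\<integral>x. (\<delta>\<^sup>2 / W) * indicator R x \<partial>lborel)"
        using mR by (simp add: R_def)
      also have "\<dots> \<le> (\<integral>x. indicator (Q ?\<iota>) x * (w x * (u ?\<iota> x)\<^sup>2) \<partial>lborel)"
      proof (rule integral_mono[OF _ int])
        show "integrable lborel (\<lambda>x. (\<delta>\<^sup>2 / W) * indicator R x :: real)"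
          using emeasure_lborel_cbox_finite unfolding R_def
          by (intro integrable_mult_right integrable_real_indicator) auto
        show "(\<delta>\<^sup>2 / W) * indicator R x \<le> indicator (Q ?\<iota>) x * (w x * (u ?\<iota> x)\<^sup>2)" for x
        proof (cases "x \<in> R")
          case True
          have xx: "r ?\<iota> / 4 \<le> x $ i - y ?\<iota> $ i" "x $ i - y ?\<iota> $ i \<le> r ?\<iota> / 2" for i
            using R[OF True, of i] by (simp_all add: ri(1))
          have "\<bar>x $ i - y ?\<iota> $ i\<bar> \<le> r ?\<iota>" for i using xx[of i] ri(2) by linarith
          then have xQ: "x \<in> Q ?\<iota>" by (simp add: Q_def mem_cube)
          have "\<delta> \<le> \<beta> ?\<iota> x" unfolding \<delta>_def \<beta>_def by (rule odd_box_bump_lower[OF ri(2) xx])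
          then have d2: "\<delta>\<^sup>2 \<le> (\<beta> ?\<iota> x)\<^sup>2" using \<delta> by (intro power_mono) auto
          have wx: "0 < w x" "w x \<le> W" using wpos[of x] QU(2)[OF \<iota>] xQ yw(2)[of x] Qcube[OF \<iota>] by (auto simp: W_def)
          have "\<delta>\<^sup>2 / W \<le> (\<beta> ?\<iota> x)\<^sup>2 / w x" using d2 wx by (intro frac_le) auto
          also have "\<dots> = w x * (u ?\<iota> x)\<^sup>2"
            using wx by (simp add: u_def power_mult_distrib divide_inverse power2_eq_square)
          finally show ?thesis using True xQ by simp
        next
          case False
          have "0 \<le> indicator (Q ?\<iota>) x * (w x * (u ?\<iota> x)\<^sup>2)"
          proof (cases "x \<in> Q ?\<iota>")
            case True
            then have "w x > 0" using wpos QU(2)[OF \<iota>] by blast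
            then show ?thesis by simp
          qed simp
          then show ?thesis using False by simp
        qed
      qed
      finally have lower: "c1 / real N ^ CARD('n) \<le> (\<integral>p. (b a p)\<^sup>2 \<partial>V)" unfolding b2 .
      have pair: "(\<integral>p. g a p * v p \<partial>V) = (- \<theta>) ^ m * (\<integral>p. b a p * v p \<partial>V)"
        if v: "v \<in> eigenspace A G \<theta>" for \<theta> v
      proof -
        have vm: "v \<in> borel_measurable borel"
          by (rule borel_measurable_continuous_onI[OF C1_continuous[OF eigenspace_C1[OF v]]])
        have vs: "smooth_on (chart_range c) (rep c v)"
          using eigenspace_smooth[OF v] D(1) by (simp add: smooth_function_def)
        have "(LINT x:Q ?\<iota>|lborel. sqrt (det (G c x)) * (h ?\<iota> x * rep c v x))
            = (- \<theta>) ^ m * (LINT x:Q ?\<iota>|lborel. sqrt (det (G c x)) * (u ?\<iota> x * rep c v x))"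
          unfolding h_def Q_def cube_def
        proof (rule green_coord_pow[OF su vs \<iota>])
          show "cbox (y ?\<iota> - (\<chi> i. r ?\<iota>)) (y ?\<iota> + (\<chi> i. r ?\<iota>)) \<subseteq> open_cube z (2 * \<rho>)"
            using QU(1)[OF \<iota>] by (simp add: Q_def cube_def)
          show "u ?\<iota> x = 0" if "x \<notin> cbox (y ?\<iota> - (\<chi> i. r ?\<iota>)) (y ?\<iota> + (\<chi> i. r ?\<iota>))" for x
            using u0[OF \<iota>, of x] that by (simp add: Q_def cube_def)
          show "lap (G c) (rep c v) x = - \<theta> * rep c v x" if "x \<in> cbox (y ?\<iota> - (\<chi> i. r ?\<iota>)) (y ?\<iota> + (\<chi> i. r ?\<iota>))" for x
            by (rule eigenspace_lap[OF v D(1)]) (use QU(2)[OF \<iota>] that in \<open>auto simp: Q_def cube_def\<close>)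
        qed
        then show ?thesis
          unfolding g_def b_def intu[OF vm] inth[OF vm] .
      qed
      show ?thesis using bm gm Sm b_bd g_bd b0 lower upper pair by blast
    qed
    show "\<exists>(b :: ('n \<Rightarrow> nat) \<Rightarrow> 'm \<Rightarrow> real) g S. disjoint_family_on S (cells N) \<and>
      (\<forall>a\<in>cells N. b a \<in> borel_measurable borel \<and> g a \<in> borel_measurable borel \<and> S a \<in> sets borel \<and>
        (\<forall>p. \<bar>b a p\<bar> \<le> C * indicator (S a) p) \<and> (\<forall>p. \<bar>g a p\<bar> \<le> C * real N ^ (2 * m) * indicator (S a) p) \<and>
        (\<integral>p. b a p \<partial>V) = 0 \<and> c1 / real N ^ CARD('n) \<le> (\<integral>p. (b a p)\<^sup>2 \<partial>V) \<and>
        (\<integral>p. (b a p)\<^sup>2 \<partial>V) \<le> C / real N ^ CARD('n) \<and>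
        (\<forall>\<theta> v. v \<in> eigenspace A G \<theta> \<longrightarrow> (\<integral>p. g a p * v p \<partial>V) = (- \<theta>) ^ m * (\<integral>p. b a p * v p \<partial>V)))"
      by (intro exI[of _ b] exI[of _ g] exI[of _ S] conjI disj ballI each)
  qed
qed

end

section \<open>The block-variation norm of the test functions\<close>

text \<open>The indices are grouped by the dyadic range of \<open>l j\<close>. A group at height \<open>y\<close> contributes at most a multiple of
  \<open>y\<^bsup>\<beta> + \<alpha>\<^esup>\<close>, and these contributions decay geometrically.\<close>

lemma dyadic_group_sum:
  fixes l :: "nat \<Rightarrow> real" and y :: "nat \<Rightarrow> real"
  assumes count: "\<And>y. y > 0 \<Longrightarrow> finite {j. y \<le> l j \<and> l j \<le> 2 * y} \<and>
      real (card {j. y \<le> l j \<and> l j \<le> 2 * y}) \<le> C * y powr \<alpha>"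
    and J: "finite J" "\<And>j. j \<in> J \<Longrightarrow> y (k j) \<le> l j \<and> l j \<le> 2 * y (k j)"
    and y: "\<And>i. y i > 0" "\<And>i. y i powr (\<beta> + \<alpha>) \<le> M * q ^ i"
    and q: "0 \<le> q" "q < 1" and C: "C \<ge> 0"
  shows "(\<Sum>j\<in>J. l j powr \<beta>) \<le> C * 2 powr \<bar>\<beta>\<bar> * M / (1 - q)"
proof -
  have M: "M \<ge> 0"
    using order_trans[OF powr_ge_zero y(2)[of 0]] by simp
  have each: "(\<Sum>j\<in>{j\<in>J. k j = i}. l j powr \<beta>) \<le> C * 2 powr \<bar>\<beta>\<bar> * M * q ^ i" for i
  proof -
    have "(\<Sum>j\<in>{j\<in>J. k j = i}. l j powr \<beta>) \<le> (\<Sum>j\<in>{j\<in>J. k j = i}. 2 powr \<bar>\<beta>\<bar> * y i powr \<beta>)"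
    proof (rule sum_mono)
      fix j assume "j \<in> {j \<in> J. k j = i}"
      then have b: "y i \<le> l j" "l j \<le> 2 * y i" using J(2) by auto
      show "l j powr \<beta> \<le> 2 powr \<bar>\<beta>\<bar> * y i powr \<beta>"
      proof (cases "\<beta> \<ge> 0")
        case True
        then have "l j powr \<beta> \<le> (2 * y i) powr \<beta>" using b y(1)[of i] by (intro powr_mono2) auto
        then show ?thesis using True y(1)[of i] by (simp add: powr_mult)
      next
        case False
        then have "l j powr \<beta> \<le> y i powr \<beta>" using b y(1)[of i] by (intro powr_mono2') auto
        also have "\<dots> \<le> 2 powr \<bar>\<beta>\<bar> * y i powr \<beta>"
        proof -
          have "1 \<le> 2 powr \<bar>\<beta>\<bar>" by (intro ge_one_powr_ge_zero) auto
          from mult_right_mono[OF this powr_ge_zero] show ?thesis by simp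
        qed
        finally show ?thesis .
      qed
    qed
    also have "\<dots> = real (card {j\<in>J. k j = i}) * (2 powr \<bar>\<beta>\<bar> * y i powr \<beta>)" by simp
    also have "\<dots> \<le> (C * y i powr \<alpha>) * (2 powr \<bar>\<beta>\<bar> * y i powr \<beta>)"
    proof (rule mult_right_mono)
      have "card {j\<in>J. k j = i} \<le> card {j. y i \<le> l j \<and> l j \<le> 2 * y i}"
        using count[OF y(1)[of i]] J(2) by (intro card_mono) auto
      then show "real (card {j\<in>J. k j = i}) \<le> C * y i powr \<alpha>"
        using count[OF y(1)[of i]] by linarith
    qed simp
    also have "\<dots> = C * 2 powr \<bar>\<beta>\<bar> * y i powr (\<beta> + \<alpha>)" by (simp add: powr_add)
    also have "\<dots> \<le> C * 2 powr \<bar>\<beta>\<bar> * (M * q ^ i)" using y(2)[of i] C by (intro mult_left_mono) auto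
    finally show ?thesis by (simp add: mult.assoc)
  qed
  have "(\<Sum>j\<in>J. l j powr \<beta>) = (\<Sum>i\<in>k ` J. \<Sum>j\<in>{j\<in>J. k j = i}. l j powr \<beta>)"
    by (rule sum.group[symmetric]) (use J(1) in auto)
  also have "\<dots> \<le> (\<Sum>i\<in>k ` J. C * 2 powr \<bar>\<beta>\<bar> * M * q ^ i)" by (intro sum_mono each)
  also have "\<dots> = C * 2 powr \<bar>\<beta>\<bar> * M * (\<Sum>i\<in>k ` J. q ^ i)" by (rule sum_distrib_left[symmetric])
  also have "\<dots> \<le> C * 2 powr \<bar>\<beta>\<bar> * M * (1 / (1 - q))"
  proof (rule mult_left_mono)
    have "(\<Sum>i\<in>k ` J. q ^ i) \<le> (\<Sum>i. q ^ i)"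
      using q J(1) by (intro sum_le_suminf summable_geometric) auto
    also have "\<dots> = 1 / (1 - q)" using q by (intro suminf_geometric) auto
    finally show "(\<Sum>i\<in>k ` J. q ^ i) \<le> 1 / (1 - q)" .
    show "0 \<le> C * 2 powr \<bar>\<beta>\<bar> * M" using C M by simp
  qed
  finally show ?thesis by simp
qed

lemma dyadic_index:
  fixes x :: real
  assumes "x \<ge> 1"
  shows "2 ^ nat \<lfloor>log 2 x\<rfloor> \<le> x" "x \<le> 2 * 2 ^ nat \<lfloor>log 2 x\<rfloor>"
proof -
  define k where "k = nat \<lfloor>log 2 x\<rfloor>"
  have "0 \<le> log 2 x" using assms by simp
  then have k: "real k \<le> log 2 x" "log 2 x \<le> real k + 1" unfolding k_def by linarith+
  have "2 powr real k \<le> 2 powr log 2 x" "2 powr log 2 x \<le> 2 powr (real k + 1)"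
    using k by (simp_all only: powr_mono)
  then have "2 ^ k \<le> x" "x \<le> 2 * 2 ^ k"
    using assms by (simp_all add: powr_add powr_realpow)
  then show "2 ^ nat \<lfloor>log 2 x\<rfloor> \<le> x" "x \<le> 2 * 2 ^ nat \<lfloor>log 2 x\<rfloor>" by (simp_all add: k_def)
qed

lemma power_of_two_powr: "(2 ^ i :: real) powr t = (2 powr t) ^ i"
  by (simp add: powr_powr powr_power mult.commute flip: powr_realpow)

text \<open>The power sum behaves as if \<open>l\<close> had density \<open>y\<^bsup>\<alpha> - 1\<^esup>\<close>: it is dominated by the largest terms if \<open>\<beta> + \<alpha> > 0\<close>
  and by the smallest ones if \<open>\<beta> + \<alpha> < 0\<close>. Accordingly the dyadic ranges descend or ascend from \<open>L\<close>.\<close>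

lemma dyadic_sum:
  fixes l :: "nat \<Rightarrow> real"
  assumes count: "\<And>y. y > 0 \<Longrightarrow> finite {j. y \<le> l j \<and> l j \<le> 2 * y} \<and>
      real (card {j. y \<le> l j \<and> l j \<le> 2 * y}) \<le> C * y powr \<alpha>"
    and l: "\<And>j. l j > 0" and C: "C \<ge> 0" and ne: "\<beta> + \<alpha> \<noteq> 0"
  obtains D where "D \<ge> 0"
    "\<And>J L. L > 0 \<Longrightarrow> finite J \<Longrightarrow>
      (if \<beta> + \<alpha> > 0 then \<forall>j\<in>J. l j \<le> L else \<forall>j\<in>J. L \<le> l j) \<Longrightarrow>
      (\<Sum>j\<in>J. l j powr \<beta>) \<le> D * L powr (\<beta> + \<alpha>)"
proof -
  define q where "q = 2 powr - \<bar>\<beta> + \<alpha>\<bar>"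
  have q: "0 \<le> q" "q < 1" using ne by (auto simp: q_def powr_less_one)
  show ?thesis
  proof (rule that[of "C * 2 powr \<bar>\<beta>\<bar> / (1 - q)"])
    show "0 \<le> C * 2 powr \<bar>\<beta>\<bar> / (1 - q)" using C q by simp
    fix J :: "nat set" and L :: real
    assume L: "L > 0" and J: "finite J" and c: "if \<beta> + \<alpha> > 0 then \<forall>j\<in>J. l j \<le> L else \<forall>j\<in>J. L \<le> l j"
    have "(\<Sum>j\<in>J. l j powr \<beta>) \<le> C * 2 powr \<bar>\<beta>\<bar> * L powr (\<beta> + \<alpha>) / (1 - q)"
    proof (cases "\<beta> + \<alpha> > 0")
      case True
      define y where "y i = L / 2 ^ Suc i" for i
      show ?thesis
      proof (rule dyadic_group_sum[OF count J, where y = y and k = "\<lambda>j. nat \<lfloor>log 2 (L / l j)\<rfloor>"])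
        fix j assume "j \<in> J"
        then have "1 \<le> L / l j" using c True l[of j] by simp
        from dyadic_index[OF this]
        show "y (nat \<lfloor>log 2 (L / l j)\<rfloor>) \<le> l j \<and> l j \<le> 2 * y (nat \<lfloor>log 2 (L / l j)\<rfloor>)"
          using l[of j] by (simp add: y_def field_simps)
      next
        fix i
        have "y i powr (\<beta> + \<alpha>) \<le> (L / 2 ^ i) powr (\<beta> + \<alpha>)"
          using L True by (intro powr_mono2) (auto simp: y_def field_simps)
        also have "\<dots> = L powr (\<beta> + \<alpha>) * q ^ i"
        proof -
          have "q = 1 / 2 powr (\<beta> + \<alpha>)" using True by (simp add: q_def powr_minus_divide del: minus_add_distrib)
          then show ?thesis using L by (simp add: powr_divide power_of_two_powr power_divide)
        qed
        finally show "y i powr (\<beta> + \<alpha>) \<le> L powr (\<beta> + \<alpha>) * q ^ i" .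
      qed (use L q C in \<open>auto simp: y_def\<close>)
    next
      case False
      define y where "y i = L * 2 ^ i" for i
      show ?thesis
      proof (rule dyadic_group_sum[OF count J, where y = y and k = "\<lambda>j. nat \<lfloor>log 2 (l j / L)\<rfloor>"])
        fix j assume "j \<in> J"
        then have "1 \<le> l j / L" using c False L by simp
        from dyadic_index[OF this]
        show "y (nat \<lfloor>log 2 (l j / L)\<rfloor>) \<le> l j \<and> l j \<le> 2 * y (nat \<lfloor>log 2 (l j / L)\<rfloor>)"
          using L by (simp add: y_def field_simps)
      next
        fix i
        have "- \<bar>\<beta> + \<alpha>\<bar> = \<beta> + \<alpha>" using False by simp
        then have "y i powr (\<beta> + \<alpha>) = L powr (\<beta> + \<alpha>) * q ^ i"
          using L by (simp add: y_def q_def powr_mult power_of_two_powr add.commute)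
        then show "y i powr (\<beta> + \<alpha>) \<le> L powr (\<beta> + \<alpha>) * q ^ i" by simp
      qed (use L q C in \<open>auto simp: y_def\<close>)
    qed
    then show "(\<Sum>j\<in>J. l j powr \<beta>) \<le> C * 2 powr \<bar>\<beta>\<bar> / (1 - q) * L powr (\<beta> + \<alpha>)" by simp
  qed
qed

lemma cauchy_schwarz_sum_sqrt:
  fixes a b :: "'i \<Rightarrow> real"
  assumes "(\<Sum>i\<in>J. (a i)\<^sup>2) \<le> X" "(\<Sum>i\<in>J. (b i)\<^sup>2) \<le> Y\<^sup>2" "Y \<ge> 0"
  shows "(\<Sum>i\<in>J. a i * b i) \<le> sqrt X * Y"
proof -
  have "(\<Sum>i\<in>J. a i * b i)\<^sup>2 \<le> (\<Sum>i\<in>J. (a i)\<^sup>2) * (\<Sum>i\<in>J. (b i)\<^sup>2)" by (rule Cauchy_Schwarz_ineq_sum)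
  also have "\<dots> \<le> X * Y\<^sup>2" using assms by (intro mult_mono) (auto intro!: sum_nonneg order_trans[OF sum_nonneg assms(1)])
  finally have "(\<Sum>i\<in>J. a i * b i) \<le> sqrt (X * Y\<^sup>2)" by (rule real_le_rsqrt)
  then show ?thesis using assms(3) by (simp add: real_sqrt_mult)
qed

context orthogonal_blocks
begin

text \<open>Think of \<open>g\<close> as \<open>\<Delta>\<^sup>m f\<close>. Blocks with \<open>1 + \<mu>\<^sub>j \<le> 2 N\<^sup>2\<close> are estimated by the inequalities of Cauchy and Schwarz and of
  Bessel for \<open>f\<close>; for the others \<open>P\<^sub>j f\<close> is \<open>\<mu>\<^sub>j\<^bsup>-m\<^esup>\<close> times \<open>P\<^sub>j g\<close> up to sign, and Bessel's inequality for \<open>g\<close> is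
  used. The number of blocks enters through the square root of a weighted sum; the condition on \<open>m\<close> makes that sum
  over high blocks converge.\<close>

lemma block_sum_bound:
  fixes \<mu> :: "nat \<Rightarrow> real" and m :: nat
  assumes count: "\<And>y. y > 0 \<Longrightarrow> finite {j. y \<le> 1 + \<mu> j \<and> 1 + \<mu> j \<le> 2 * y} \<and>
      real (card {j. y \<le> 1 + \<mu> j \<and> 1 + \<mu> j \<le> 2 * y}) \<le> C * y powr \<alpha>"
    and \<mu>: "\<And>j. \<mu> j \<ge> 0" and C: "C \<ge> 0" and s: "s > 0" "\<alpha> \<ge> 0" "2 * real m > s + \<alpha>"
  obtains K where "K > 0" "\<And>f g F N J. f \<in> L2_space \<nu> \<Longrightarrow> g \<in> L2_space \<nu> \<Longrightarrow> N \<ge> (1::nat) \<Longrightarrow>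
    L2_norm \<nu> f \<le> F \<Longrightarrow> L2_norm \<nu> g \<le> F * real N ^ (2 * m) \<Longrightarrow>
    (\<And>j v. v \<in> E j \<Longrightarrow> (\<integral>x. g x * v x \<partial>\<nu>) = (- \<mu> j) ^ m * (\<integral>x. f x * v x \<partial>\<nu>)) \<Longrightarrow> finite J \<Longrightarrow>
    (\<Sum>j\<in>J. (1 + \<mu> j) powr (s / 2) * L2_norm \<nu> (Pr j f)) \<le> K * F * real N powr (s + \<alpha>)"
proof -
  define l where "l j = 1 + \<mu> j" for j
  have l: "l j > 0" "l j \<ge> 1" for j using \<mu>[of j] by (simp_all add: l_def)
  note count' = count[folded l_def]
  have "s + \<alpha> \<noteq> 0" "(s - 2 * real m) + \<alpha> \<noteq> 0" using s by auto
  obtain D1 where D1: "D1 \<ge> 0" "\<And>J L. L > 0 \<Longrightarrow> finite J \<Longrightarrow> \<forall>j\<in>J. l j \<le> L \<Longrightarrow>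
      (\<Sum>j\<in>J. l j powr s) \<le> D1 * L powr (s + \<alpha>)"
  proof -
    from dyadic_sum[OF count' l(1) C \<open>s + \<alpha> \<noteq> 0\<close>] obtain D where D: "D \<ge> 0"
      "\<And>J L. L > 0 \<Longrightarrow> finite J \<Longrightarrow> (if s + \<alpha> > 0 then \<forall>j\<in>J. l j \<le> L else \<forall>j\<in>J. L \<le> l j) \<Longrightarrow>
      (\<Sum>j\<in>J. l j powr s) \<le> D * L powr (s + \<alpha>)" by blast
    have "s + \<alpha> > 0" using s by simp
    then show ?thesis using D that[of D] by simp
  qed
  obtain D2 where D2: "D2 \<ge> 0" "\<And>J L. L > 0 \<Longrightarrow> finite J \<Longrightarrow> \<forall>j\<in>J. L \<le> l j \<Longrightarrow>
      (\<Sum>j\<in>J. l j powr (s - 2 * real m)) \<le> D2 * L powr ((s - 2 * real m) + \<alpha>)"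
  proof -
    from dyadic_sum[OF count' l(1) C \<open>(s - 2 * real m) + \<alpha> \<noteq> 0\<close>] obtain D where D: "D \<ge> 0"
      "\<And>J L. L > 0 \<Longrightarrow> finite J \<Longrightarrow>
        (if (s - 2 * real m) + \<alpha> > 0 then \<forall>j\<in>J. l j \<le> L else \<forall>j\<in>J. L \<le> l j) \<Longrightarrow>
      (\<Sum>j\<in>J. l j powr (s - 2 * real m)) \<le> D * L powr ((s - 2 * real m) + \<alpha>)" by blast
    have "\<not> (s - 2 * real m) + \<alpha> > 0" using s by simp
    then show ?thesis using D that[of D] by simp
  qed
  define K where "K = 2 powr ((s + \<alpha>) / 2) * (sqrt D1 + sqrt D2) + 1"
  have K: "K > 0" unfolding K_def using D1(1) D2(1) by (intro add_nonneg_pos mult_nonneg_nonneg) auto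
  show ?thesis
  proof (rule that[OF K])
    fix f g F N and J :: "nat set"
    assume f: "f \<in> L2_space \<nu>" and g: "g \<in> L2_space \<nu>" and N: "N \<ge> (1::nat)"
      and fF: "L2_norm \<nu> f \<le> F" and gF: "L2_norm \<nu> g \<le> F * real N ^ (2 * m)" and J: "finite J"
      and pair: "\<And>j v. v \<in> E j \<Longrightarrow> (\<integral>x. g x * v x \<partial>\<nu>) = (- \<mu> j) ^ m * (\<integral>x. f x * v x \<partial>\<nu>)"
    have F: "F \<ge> 0" using fF L2_norm_nonneg[of \<nu> f] by linarith
    \<comment> \<open>The factor 2 makes \<open>l j > 2\<close> for the high blocks, so that \<open>l j\<close> and \<open>\<mu> j\<close> are comparable there.\<close>
    define L where "L = 2 * (real N)\<^sup>2"
    have L: "L \<ge> 2" using N by (simp add: L_def one_le_power)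
    define J1 where "J1 = {j\<in>J. l j \<le> L}"
    define J2 where "J2 = {j\<in>J. L < l j}"
    have J12: "finite J1" "finite J2" "J = J1 \<union> J2" "J1 \<inter> J2 = {}"
      using J unfolding J1_def J2_def by (simp_all, auto)
    have LN: "L powr t = 2 powr t * real N powr (2 * t)" for t
    proof -
      have "((real N)\<^sup>2) powr t = real N powr (2 * t)"
        using N powr_powr[of "real N" 2 t] by simp
      then show ?thesis by (simp add: L_def powr_mult)
    qed
    have sq: "(l j powr t)\<^sup>2 = l j powr (2 * t)" for j t
      unfolding power2_eq_square powr_add[symmetric] by simp
    have low: "(\<Sum>j\<in>J1. l j powr (s / 2) * L2_norm \<nu> (Pr j f))
        \<le> sqrt (D1 * L powr (s + \<alpha>)) * F"
    proof (rule cauchy_schwarz_sum_sqrt[OF _ _ F])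
      have e: "2 * (s / 2) = s" by simp
      show "(\<Sum>j\<in>J1. (l j powr (s / 2))\<^sup>2) \<le> D1 * L powr (s + \<alpha>)"
        unfolding sq e by (rule D1(2)) (use L J12(1) in \<open>auto simp: J1_def\<close>)
      show "(\<Sum>j\<in>J1. (L2_norm \<nu> (Pr j f))\<^sup>2) \<le> F\<^sup>2"
        by (rule order_trans[OF bessel[OF f J12(1)] power_mono[OF fF L2_norm_nonneg]])
    qed
    have hi: "l j powr (s / 2) * L2_norm \<nu> (Pr j f) \<le> 2 ^ m * (l j powr (s / 2 - real m) * L2_norm \<nu> (Pr j g))"
      if "j \<in> J2" for j
    proof -
      have lj: "l j > 2" using that L by (auto simp: J2_def)
      have \<mu>l: "\<mu> j = l j - 1" "l j \<le> 2 * \<mu> j" using lj by (simp_all add: l_def)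
      have "L2_norm \<nu> (Pr j g) = \<bar>(- \<mu> j) ^ m\<bar> * L2_norm \<nu> (Pr j f)"
        by (rule L2_norm_Pr_scaled[OF f g pair])
      also have "\<bar>(- \<mu> j) ^ m\<bar> = \<mu> j ^ m" using \<mu>[of j] by (simp add: power_abs)
      finally have Pg: "L2_norm \<nu> (Pr j g) = \<mu> j ^ m * L2_norm \<nu> (Pr j f)" .
      have "l j powr (s / 2) = l j powr (s / 2 - real m) * l j ^ m"
        using lj by (simp add: powr_diff powr_realpow)
      also have "\<dots> \<le> l j powr (s / 2 - real m) * (2 * \<mu> j) ^ m"
        using \<mu>l lj by (intro mult_left_mono power_mono) auto
      finally have "l j powr (s / 2) * L2_norm \<nu> (Pr j f)
          \<le> (l j powr (s / 2 - real m) * (2 * \<mu> j) ^ m) * L2_norm \<nu> (Pr j f)"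
        by (rule mult_right_mono) simp
      then show ?thesis by (simp add: Pg power_mult_distrib mult_ac)
    qed
    have "(\<Sum>j\<in>J2. l j powr (s / 2) * L2_norm \<nu> (Pr j f))
        \<le> 2 ^ m * (\<Sum>j\<in>J2. l j powr (s / 2 - real m) * L2_norm \<nu> (Pr j g))"
      unfolding sum_distrib_left by (intro sum_mono hi)
    also have "\<dots> \<le> 2 ^ m * (sqrt (D2 * L powr ((s - 2 * real m) + \<alpha>)) * (F * real N ^ (2 * m)))"
    proof (intro mult_left_mono cauchy_schwarz_sum_sqrt)
      have e: "2 * (s / 2 - real m) = s - 2 * real m" by simp
      show "(\<Sum>j\<in>J2. (l j powr (s / 2 - real m))\<^sup>2) \<le> D2 * L powr ((s - 2 * real m) + \<alpha>)"
        unfolding sq e by (rule D2(2)) (use L J12(2) in \<open>auto simp: J2_def\<close>)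
      show "(\<Sum>j\<in>J2. (L2_norm \<nu> (Pr j g))\<^sup>2) \<le> (F * real N ^ (2 * m))\<^sup>2"
        by (rule order_trans[OF bessel[OF g J12(2)] power_mono[OF gF L2_norm_nonneg]])
    qed (use F in auto)
    finally have high: "(\<Sum>j\<in>J2. l j powr (s / 2) * L2_norm \<nu> (Pr j f))
        \<le> 2 ^ m * (sqrt (D2 * L powr ((s - 2 * real m) + \<alpha>)) * (F * real N ^ (2 * m)))" .
    have e1: "sqrt (D1 * L powr (s + \<alpha>)) = sqrt D1 * (2 powr ((s + \<alpha>) / 2) * real N powr (s + \<alpha>))"
    proof -
      have "sqrt (L powr (s + \<alpha>)) = L powr ((s + \<alpha>) / 2)" using L by (simp add: powr_half_sqrt[symmetric] powr_powr)
      also have "\<dots> = 2 powr ((s + \<alpha>) / 2) * real N powr (s + \<alpha>)"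
      proof -
        have e: "2 * ((s + \<alpha>) / 2) = s + \<alpha>" by simp
        show ?thesis using LN[of "(s + \<alpha>) / 2"] unfolding e .
      qed
      finally show ?thesis by (simp add: real_sqrt_mult)
    qed
    have e2: "2 ^ m * (sqrt (D2 * L powr ((s - 2 * real m) + \<alpha>)) * (F * real N ^ (2 * m)))
        = sqrt D2 * (2 powr ((s + \<alpha>) / 2) * real N powr (s + \<alpha>)) * F"
    proof -
      have "sqrt (L powr ((s - 2 * real m) + \<alpha>)) = L powr ((s + \<alpha>) / 2 - real m)"
        using L by (simp add: powr_half_sqrt[symmetric] powr_powr diff_divide_distrib add_divide_distrib algebra_simps)
      also have "\<dots> = 2 powr ((s + \<alpha>) / 2 - real m) * real N powr (s + \<alpha> - 2 * real m)"
      proof -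
        have e: "2 * ((s + \<alpha>) / 2 - real m) = s + \<alpha> - 2 * real m" by simp
        show ?thesis unfolding LN e ..
      qed
      also have "2 powr ((s + \<alpha>) / 2 - real m) = 2 powr ((s + \<alpha>) / 2) / 2 ^ m"
        by (simp add: powr_diff powr_realpow)
      also have "real N powr (s + \<alpha> - 2 * real m) = real N powr (s + \<alpha>) / real N ^ (2 * m)"
        using N by (simp add: powr_diff flip: powr_realpow)
      finally show ?thesis using N by (simp add: real_sqrt_mult)
    qed
    have "(\<Sum>j\<in>J. l j powr (s / 2) * L2_norm \<nu> (Pr j f))
        = (\<Sum>j\<in>J1. l j powr (s / 2) * L2_norm \<nu> (Pr j f)) + (\<Sum>j\<in>J2. l j powr (s / 2) * L2_norm \<nu> (Pr j f))"
      unfolding J12(3) by (rule sum.union_disjoint[OF J12(1,2,4)])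
    also have "\<dots> \<le> sqrt D1 * (2 powr ((s + \<alpha>) / 2) * real N powr (s + \<alpha>)) * F
        + sqrt D2 * (2 powr ((s + \<alpha>) / 2) * real N powr (s + \<alpha>)) * F"
      using low high unfolding e1 e2 by (rule add_mono)
    also have "\<dots> = (K - 1) * F * real N powr (s + \<alpha>)" by (simp add: K_def algebra_simps)
    also have "\<dots> \<le> K * F * real N powr (s + \<alpha>)" using F by (intro mult_right_mono) auto
    finally show "(\<Sum>j\<in>J. (1 + \<mu> j) powr (s / 2) * L2_norm \<nu> (Pr j f)) \<le> K * F * real N powr (s + \<alpha>)"
      by (simp add: l_def)
  qed
qed

text \<open>The constant function contributes its norm \<open>1\<close> in block \<open>0\<close>, where it is orthogonal to the projection of \<open>f\<close>.\<close>

lemma block_variation_norm_perturbation: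
  fixes \<mu> :: "nat \<Rightarrow> real"
  assumes one: "(\<lambda>x. 1) \<in> E 0" "(\<integral>x. 1 \<partial>\<nu>) = (1 :: real)" and f: "f \<in> L2_space \<nu>" "(\<integral>x. f x \<partial>\<nu>) = 0"
    and \<mu>: "\<mu> 0 = 0" and \<tau>: "\<tau> \<ge> 0"
    and B: "\<And>J. finite J \<Longrightarrow> (\<Sum>j\<in>J. (1 + \<mu> j) powr (s / 2) * L2_norm \<nu> (Pr j f)) \<le> B"
  shows "block_variation_norm \<nu> \<mu> E s (\<lambda>x. 1 + \<tau> * f x) \<le> ennreal (1 + \<tau> * B)"
proof -
  define h where "h x = 1 + \<tau> * f x" for x
  have oneL: "(\<lambda>x. 1) \<in> L2_space \<nu>" by (rule E_L2[OF one(1)])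
  have hL: "h \<in> L2_space \<nu>" unfolding h_def[abs_def] using L2_lincomb[OF f(1) oneL, of \<tau>] by (simp add: add.commute)
  have hv: "(\<integral>x. h x * v x \<partial>\<nu>) = (\<integral>x. 1 * v x \<partial>\<nu>) + \<tau> * (\<integral>x. f x * v x \<partial>\<nu>)" if "v \<in> L2_space \<nu>" for v
  proof -
    have "(\<integral>x. h x * v x \<partial>\<nu>) = (\<integral>x. 1 * v x + \<tau> * (f x * v x) \<partial>\<nu>)" by (simp add: h_def algebra_simps)
    then show ?thesis using L2_mult_integrable[OF oneL that] L2_mult_integrable[OF f(1) that] by simp
  qed
  have pos: "L2_norm \<nu> (Pr j h) = \<tau> * L2_norm \<nu> (Pr j f)" if "j \<noteq> 0" for j
  proof -
    have "L2_norm \<nu> (Pr j h) = \<bar>\<tau>\<bar> * L2_norm \<nu> (Pr j f)"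
    proof (rule L2_norm_Pr_scaled[OF f(1) hL])
      fix v assume v: "v \<in> E j"
      show "(\<integral>x. h x * v x \<partial>\<nu>) = \<tau> * (\<integral>x. f x * v x \<partial>\<nu>)"
        using hv[OF E_L2[OF v]] E_orth[OF _ one(1) v] that by simp
    qed
    then show ?thesis using \<tau> by simp
  qed
  have zero: "L2_norm \<nu> (Pr 0 h) \<le> 1 + \<tau> * L2_norm \<nu> (Pr 0 f)"
  proof -
    note P = L2_proj(1)[OF f(1), of 0] L2_proj(1)[OF hL, of 0]
    have "(\<integral>x. Pr 0 h x * 1 \<partial>\<nu>) = 1"
      using integral_Pr[OF hL one(1)] hv[OF oneL] one(2) f(2) by simp
    moreover have "(\<integral>x. f x * Pr 0 h x \<partial>\<nu>) = \<tau> * (L2_norm \<nu> (Pr 0 f))\<^sup>2"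
    proof -
      have "(\<integral>x. f x * Pr 0 h x \<partial>\<nu>) = (\<integral>x. Pr 0 h x * Pr 0 f x \<partial>\<nu>)"
        using integral_Pr[OF f(1) P(2)] by (simp add: mult.commute)
      also have "\<dots> = (\<integral>x. h x * Pr 0 f x \<partial>\<nu>)" by (rule integral_Pr[OF hL P(1)])
      also have "\<dots> = (\<integral>x. 1 * Pr 0 f x \<partial>\<nu>) + \<tau> * (\<integral>x. f x * Pr 0 f x \<partial>\<nu>)" by (rule hv[OF Pr_L2[OF f(1)]])
      also have "(\<integral>x. 1 * Pr 0 f x \<partial>\<nu>) = 0" using integral_Pr[OF f(1) one(1)] f(2) by simp
      also have "(\<integral>x. f x * Pr 0 f x \<partial>\<nu>) = (L2_norm \<nu> (Pr 0 f))\<^sup>2"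
        using integral_Pr[OF f(1) P(1)] by (simp add: integral_square_eq)
      finally show ?thesis by simp
    qed
    moreover have "(L2_norm \<nu> (Pr 0 h))\<^sup>2 = (\<integral>x. 1 * Pr 0 h x \<partial>\<nu>) + \<tau> * (\<integral>x. f x * Pr 0 h x \<partial>\<nu>)"
      using integral_Pr[OF hL P(2)] hv[OF Pr_L2[OF hL]] by (simp add: integral_square_eq)
    ultimately have "(L2_norm \<nu> (Pr 0 h))\<^sup>2 = 1 + \<tau>\<^sup>2 * (L2_norm \<nu> (Pr 0 f))\<^sup>2"
      by (simp add: power2_eq_square)
    also have "\<dots> \<le> (1 + \<tau> * L2_norm \<nu> (Pr 0 f))\<^sup>2" using \<tau> by (simp add: power2_eq_square algebra_simps)
    finally show ?thesis by (rule power2_le_imp_le) (use \<tau> in simp)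
  qed
  have "(\<Sum>j<n. ennreal ((1 + \<mu> j) powr (s / 2) * L2_norm \<nu> (Pr j h))) \<le> ennreal (1 + \<tau> * B)" for n
  proof -
    have "(\<Sum>j<n. (1 + \<mu> j) powr (s / 2) * L2_norm \<nu> (Pr j h))
        \<le> (\<Sum>j<n. (if j = 0 then 1 else 0) + \<tau> * ((1 + \<mu> j) powr (s / 2) * L2_norm \<nu> (Pr j f)))"
      using zero pos \<mu> by (intro sum_mono) (auto simp: mult_ac)
    also have "\<dots> \<le> 1 + \<tau> * B"
      using mult_left_mono[OF B[of "{..<n}"] \<tau>] B[of "{}"] \<tau> by (simp add: sum.distrib sum_distrib_left)
    finally show ?thesis by (subst sum_ennreal) (auto intro: ennreal_leI)
  qed
  then show ?thesis
    unfolding block_variation_norm_def h_def[abs_def, symmetric] by (intro suminf_le_const summableI)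
qed

end

section \<open>Lower bounds for the minimax risk\<close>

lemma product_density:
  fixes p :: "'m \<Rightarrow> real"
  assumes \<nu>: "finite_measure \<nu>" and p: "p \<in> borel_measurable \<nu>" "\<And>x. 0 \<le> p x" "\<And>x. p x \<le> B"
  shows "sample_law \<nu> n p = density (PiM {..<n} (\<lambda>_. \<nu>)) (\<lambda>X. ennreal (\<Prod>i<n. p (X i)))"
proof -
  interpret \<nu>: finite_measure \<nu> by fact
  interpret product_sigma_finite "\<lambda>_::nat. \<nu>" by unfold_locales
  have "finite_measure (density \<nu> (\<lambda>x. ennreal (p x)))"
  proof (rule finite_measureI)
    have "emeasure (density \<nu> (\<lambda>x. ennreal (p x))) (space \<nu>) = (\<integral>\<^sup>+x. ennreal (p x) \<partial>\<nu>)"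
      using p(1) by (subst emeasure_density) (auto intro!: nn_integral_cong)
    also have "\<dots> \<le> (\<integral>\<^sup>+x. ennreal B \<partial>\<nu>)" by (intro nn_integral_mono ennreal_leI p)
    also have "\<dots> < \<infinity>" using \<nu>.emeasure_finite[of "space \<nu>"] by (simp add: ennreal_mult_eq_top_iff less_top[symmetric])
    finally show "emeasure (density \<nu> (\<lambda>x. ennreal (p x))) (space (density \<nu> (\<lambda>x. ennreal (p x)))) \<noteq> \<infinity>" by simp
  qed
  then interpret D: finite_measure "density \<nu> (\<lambda>x. ennreal (p x))" .
  interpret D: product_sigma_finite "\<lambda>_::nat. density \<nu> (\<lambda>x. ennreal (p x))" by unfold_locales
  note [measurable] = p(1)
  show ?thesis
    unfolding sample_law_def
  proof (rule D.PiM_eqI[symmetric])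
    show "sets (density (PiM {..<n} (\<lambda>_. \<nu>)) (\<lambda>X. ennreal (\<Prod>i<n. p (X i))))
        = sets (PiM {..<n} (\<lambda>_. density \<nu> (\<lambda>x. ennreal (p x))))"
      by (simp cong: sets_PiM_cong)
    fix A assume "\<And>i. i \<in> {..<n} \<Longrightarrow> A i \<in> sets (density \<nu> (\<lambda>x. ennreal (p x)))"
    then have A [measurable]: "A i \<in> sets \<nu>" if "i \<in> {..<n}" for i using that by simp
    have "emeasure (density (PiM {..<n} (\<lambda>_. \<nu>)) (\<lambda>X. ennreal (\<Prod>i<n. p (X i)))) (PiE {..<n} A)
        = (\<integral>\<^sup>+X. ennreal (\<Prod>i<n. p (X i)) * indicator (PiE {..<n} A) X \<partial>PiM {..<n} (\<lambda>_. \<nu>))"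
      by (rule emeasure_density) (use A in \<open>auto intro!: sets_PiM_I_finite\<close>)
    also have "\<dots> = (\<integral>\<^sup>+X. (\<Prod>i<n. ennreal (p (X i)) * indicator (A i) (X i)) \<partial>PiM {..<n} (\<lambda>_. \<nu>))"
    proof (rule nn_integral_cong)
      fix X assume X: "X \<in> space (PiM {..<n} (\<lambda>_. \<nu>))"
      have "indicator (PiE {..<n} A) X = (\<Prod>i<n. indicator (A i) (X i) :: ennreal)"
      proof (cases "X \<in> PiE {..<n} A")
        case True
        then have "(\<Prod>i<n. indicator (A i) (X i) :: ennreal) = 1"
          by (intro prod.neutral) (auto simp: PiE_def Pi_def)
        then show ?thesis using True by simp
      next
        case False
        then obtain i where "i < n" "X i \<notin> A i" using X by (auto simp: space_PiM PiE_def Pi_def)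
        then have "(\<Prod>i<n. indicator (A i) (X i) :: ennreal) = 0" by (intro prod_zero) (auto intro!: bexI[of _ i])
        then show ?thesis using False by simp
      qed
      then show "ennreal (\<Prod>i<n. p (X i)) * indicator (PiE {..<n} A) X
          = (\<Prod>i<n. ennreal (p (X i)) * indicator (A i) (X i))"
        using p(2) by (simp add: prod.distrib prod_ennreal)
    qed
    also have "\<dots> = (\<Prod>i<n. \<integral>\<^sup>+x. ennreal (p x) * indicator (A i) x \<partial>\<nu>)"
      by (rule product_nn_integral_prod) (use A in auto)
    also have "\<dots> = (\<Prod>i<n. emeasure (density \<nu> (\<lambda>x. ennreal (p x))) (A i))"
      by (intro prod.cong refl emeasure_density[symmetric]) (use A in auto)
    finally show "emeasure (density (PiM {..<n} (\<lambda>_. \<nu>)) (\<lambda>X. ennreal (\<Prod>i<n. p (X i)))) (PiE {..<n} A)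
        = (\<Prod>i<n. emeasure (density \<nu> (\<lambda>x. ennreal (p x))) (A i))" .
  qed simp
qed

text \<open>The overlap of two product densities. By the inequality of arithmetic and geometric means,
  \<open>\<surd>(PQ) \<le> 2 min P Q + (P + Q) / 8\<close>, and the Hellinger affinity \<open>\<integral> \<surd>(PQ)\<close> tensorizes.\<close>

lemma product_overlap:
  fixes p q :: "'m \<Rightarrow> real"
  assumes \<nu>: "finite_measure \<nu>"
    and p: "p \<in> borel_measurable \<nu>" "\<And>x. 1/2 \<le> p x" "\<And>x. p x \<le> B" "(\<integral>x. p x \<partial>\<nu>) = 1"
    and q: "q \<in> borel_measurable \<nu>" "\<And>x. 1/2 \<le> q x" "\<And>x. q x \<le> B" "(\<integral>x. q x \<partial>\<nu>) = 1"
    and close: "real n * (\<integral>x. (p x - q x)\<^sup>2 \<partial>\<nu>) \<le> 2"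
  shows "ennreal (1/8) \<le> (\<integral>\<^sup>+X. ennreal (min (\<Prod>i<n. p (X i)) (\<Prod>i<n. q (X i))) \<partial>PiM {..<n} (\<lambda>_. \<nu>))"
proof -
  interpret \<nu>: finite_measure \<nu> by fact
  interpret product_sigma_finite "\<lambda>_::nat. \<nu>" by unfold_locales
  note [measurable] = p(1) q(1)
  let ?N = "PiM {..<n} (\<lambda>_. \<nu>)"
  have p0: "0 \<le> p x" "0 \<le> q x" for x using p(2)[of x] q(2)[of x] by linarith+
  have int: "integrable \<nu> h" if "h \<in> borel_measurable \<nu>" "\<And>x. \<bar>h x\<bar> \<le> K" for h :: "'m \<Rightarrow> real" and K
    using that by (intro \<nu>.integrable_const_bound[of _ K]) auto
  have ip: "integrable \<nu> p" "integrable \<nu> q"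
    using p(3) q(3) p0 by (auto intro!: int[of _ B])
  have idiff: "integrable \<nu> (\<lambda>x. (p x - q x)\<^sup>2)"
  proof (rule int[of _ "B\<^sup>2"])
    fix x
    have "\<bar>p x - q x\<bar> \<le> \<bar>B\<bar>" using p(3)[of x] q(3)[of x] p0[of x] by (auto simp: abs_if)
    then show "\<bar>(p x - q x)\<^sup>2\<bar> \<le> B\<^sup>2" by (simp add: abs_le_square_iff)
  qed simp
  have isq: "integrable \<nu> (\<lambda>x. sqrt (p x * q x))"
  proof (rule int[of _ B])
    fix x
    have "sqrt (p x * q x) \<le> sqrt (B * B)" using p(3)[of x] q(3)[of x] p0[of x] by (intro real_sqrt_le_mono mult_mono) auto
    then show "\<bar>sqrt (p x * q x)\<bar> \<le> B" using p(3)[of x] p0[of x] by simp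
  qed simp
  define h where "h = (\<integral>x. (p x - q x)\<^sup>2 \<partial>\<nu>) / 4"
  have h: "0 \<le> h" "n * h \<le> 1/2" using close by (simp_all add: h_def)
  \<comment> \<open>Equivalently \<open>(\<surd>p - \<surd>q)\<^sup>2 \<le> (p - q)\<^sup>2 / 2\<close>, because \<open>(\<surd>p + \<surd>q)\<^sup>2 \<ge> 2\<close> for \<open>p, q \<ge> 1/2\<close>.\<close>
  have pt: "p x / 2 + q x / 2 - (p x - q x)\<^sup>2 / 4 \<le> sqrt (p x * q x)" for x
  proof -
    define a b where "a = sqrt (p x)" and "b = sqrt (q x)"
    have ab: "p x = a\<^sup>2" "q x = b\<^sup>2" "0 \<le> a" "0 \<le> b" using p0[of x] by (simp_all add: a_def b_def)
    have "1/2 \<le> a\<^sup>2" "1/2 \<le> b\<^sup>2" using p(2)[of x] q(2)[of x] ab by auto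
    moreover have "(1/2)\<^sup>2 \<le> (a * b)\<^sup>2"
      using mult_mono[OF \<open>1/2 \<le> a\<^sup>2\<close> \<open>1/2 \<le> b\<^sup>2\<close>] by (simp add: power2_eq_square mult_ac)
    then have "1/2 \<le> a * b" by (rule power2_le_imp_le) (use ab in simp)
    ultimately have "2 \<le> (a + b)\<^sup>2" by (simp add: power2_sum)
    then have "(a - b)\<^sup>2 * 2 \<le> (a - b)\<^sup>2 * (a + b)\<^sup>2" by (rule mult_left_mono) simp
    also have "\<dots> = (p x - q x)\<^sup>2" by (simp add: ab power2_eq_square algebra_simps)
    finally have "(a - b)\<^sup>2 / 2 \<le> (p x - q x)\<^sup>2 / 4" by simp
    moreover have "(a - b)\<^sup>2 = p x + q x - 2 * (a * b)" by (simp add: ab power2_diff)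
    moreover have "sqrt (p x * q x) = a * b" by (simp add: real_sqrt_mult a_def b_def)
    ultimately show ?thesis by linarith
  qed
  have aff: "1 - h \<le> (\<integral>x. sqrt (p x * q x) \<partial>\<nu>)"
  proof -
    have "1 - h = (\<integral>x. p x / 2 + q x / 2 - (p x - q x)\<^sup>2 / 4 \<partial>\<nu>)"
      using ip idiff p(4) q(4) by (simp add: h_def)
    also have "\<dots> \<le> (\<integral>x. sqrt (p x * q x) \<partial>\<nu>)"
      using ip idiff isq pt by (intro integral_mono) auto
    finally show ?thesis .
  qed
  define P where "P X = (\<Prod>i<n. p (X i))" for X
  define Q where "Q X = (\<Prod>i<n. q (X i))" for X
  have [measurable]: "P \<in> borel_measurable ?N" "Q \<in> borel_measurable ?N"
    unfolding P_def[abs_def] Q_def[abs_def] by measurable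
  have PQ0: "0 \<le> P X" "0 \<le> Q X" for X unfolding P_def Q_def using p0 by (auto intro: prod_nonneg)
  have one: "(\<integral>\<^sup>+X. ennreal (P X) \<partial>?N) = 1" "(\<integral>\<^sup>+X. ennreal (Q X) \<partial>?N) = 1"
  proof -
    have "(\<integral>\<^sup>+X. (\<Prod>i<n. ennreal (p (X i))) \<partial>?N) = (\<Prod>i<n. \<integral>\<^sup>+x. ennreal (p x) \<partial>\<nu>)"
      "(\<integral>\<^sup>+X. (\<Prod>i<n. ennreal (q (X i))) \<partial>?N) = (\<Prod>i<n. \<integral>\<^sup>+x. ennreal (q x) \<partial>\<nu>)"
      by (rule product_nn_integral_prod; simp)+
    moreover have "(\<integral>\<^sup>+x. ennreal (p x) \<partial>\<nu>) = 1" "(\<integral>\<^sup>+x. ennreal (q x) \<partial>\<nu>) = 1"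
      using nn_integral_eq_integral[OF ip(1)] nn_integral_eq_integral[OF ip(2)] p0 p(4) q(4) by simp_all
    ultimately show "(\<integral>\<^sup>+X. ennreal (P X) \<partial>?N) = 1" "(\<integral>\<^sup>+X. ennreal (Q X) \<partial>?N) = 1"
      using p0 by (simp_all add: P_def Q_def prod_ennreal)
  qed
  have "1/2 \<le> 1 - n * h" using h by simp
  also have "\<dots> = 1 + of_nat n * (- h)" by simp
  also have "\<dots> \<le> (1 + - h) ^ n"
  proof (cases "n = 0")
    case False
    then have "1 * h \<le> n * h" using h by (intro mult_right_mono) auto
    then have "h \<le> 1" using h(2) by linarith
    then show ?thesis by (intro Bernoulli_inequality) simp
  qed simp
  also have "\<dots> \<le> (\<integral>x. sqrt (p x * q x) \<partial>\<nu>) ^ n"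
  proof (cases "n = 0")
    case False
    then have "1 * h \<le> n * h" using h by (intro mult_right_mono) auto
    then have "h \<le> 1" using h(2) by linarith
    then show ?thesis using aff by (intro power_mono) auto
  qed simp
  finally have "ennreal (1/2) \<le> ennreal ((\<integral>x. sqrt (p x * q x) \<partial>\<nu>) ^ n)" by (rule ennreal_leI)
  also have "\<dots> = (\<Prod>i<n. \<integral>\<^sup>+x. ennreal (sqrt (p x * q x)) \<partial>\<nu>)"
    using nn_integral_eq_integral[OF isq] p0 by (simp add: ennreal_power integral_nonneg_AE)
  also have "\<dots> = (\<integral>\<^sup>+X. (\<Prod>i<n. ennreal (sqrt (p (X i) * q (X i)))) \<partial>?N)"
    by (rule product_nn_integral_prod[symmetric]) simp_all
  also have "\<dots> = (\<integral>\<^sup>+X. ennreal (sqrt (P X * Q X)) \<partial>?N)"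
  proof (rule nn_integral_cong)
    fix X
    have "sqrt (P X * Q X) = (\<Prod>i<n. sqrt (p (X i) * q (X i)))"
    proof -
      have "sqrt (\<Prod>i<n. f i) = (\<Prod>i<n. sqrt (f i))" for f :: "nat \<Rightarrow> real"
        by (induction n) (simp_all add: real_sqrt_mult)
      then show ?thesis unfolding P_def Q_def prod.distrib[symmetric] .
    qed
    then show "(\<Prod>i<n. ennreal (sqrt (p (X i) * q (X i)))) = ennreal (sqrt (P X * Q X))"
      using p0 by (simp add: prod_ennreal)
  qed
  also have "\<dots> \<le> (\<integral>\<^sup>+X. 2 * ennreal (min (P X) (Q X)) + (ennreal (1/8) * ennreal (P X) + ennreal (1/8) * ennreal (Q X)) \<partial>?N)"
  proof (rule nn_integral_mono)
    fix X
    have "sqrt (P X * Q X) \<le> 2 * min (P X) (Q X) + (P X + Q X) / 8"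
    proof -
      define a b where "a = sqrt (min (P X) (Q X))" and "b = sqrt (max (P X) (Q X))"
      have ab: "a\<^sup>2 = min (P X) (Q X)" "b\<^sup>2 = max (P X) (Q X)" using PQ0[of X] by (simp_all add: a_def b_def)
      have "sqrt (P X * Q X) = a * b" unfolding a_def b_def real_sqrt_mult[symmetric] by (simp add: min_def max_def mult.commute)
      also have "\<dots> \<le> 2 * a\<^sup>2 + b\<^sup>2 / 8"
      proof -
        have "0 \<le> (4 * a - b)\<^sup>2" by simp
        then show ?thesis by (simp add: power2_diff power_mult_distrib)
      qed
      also have "b\<^sup>2 \<le> P X + Q X" using PQ0[of X] by (simp add: ab)
      finally show ?thesis by (simp add: ab)
    qed
    then have "ennreal (sqrt (P X * Q X)) \<le> ennreal (2 * min (P X) (Q X) + (1/8 * P X + 1/8 * Q X))"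
      by (intro ennreal_leI) (simp add: add_divide_distrib)
    also have "\<dots> = 2 * ennreal (min (P X) (Q X)) + (ennreal (1/8) * ennreal (P X) + ennreal (1/8) * ennreal (Q X))"
    proof -
      have e: "ennreal (1/8) * ennreal t = ennreal (1/8 * t)" for t by (rule ennreal_mult'[symmetric]) simp
      show ?thesis unfolding e using PQ0[of X] by (simp add: ennreal_mult ennreal_plus)
    qed
    finally show "ennreal (sqrt (P X * Q X)) \<le> 2 * ennreal (min (P X) (Q X)) + (ennreal (1/8) * ennreal (P X) + ennreal (1/8) * ennreal (Q X))" .
  qed
  also have "\<dots> = 2 * (\<integral>\<^sup>+X. ennreal (min (P X) (Q X)) \<partial>?N) + (ennreal (1/8) + ennreal (1/8))"
    by (simp add: nn_integral_add nn_integral_cmult one)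
  also have "ennreal (1/8) + ennreal (1/8) = ennreal (1/4)" by (simp add: ennreal_plus[symmetric] del: ennreal_plus)
  finally have main: "ennreal (1/2) \<le> 2 * (\<integral>\<^sup>+X. ennreal (min (P X) (Q X)) \<partial>?N) + ennreal (1/4)" .
  have "ennreal (1/8) \<le> t" if "ennreal (1/2) \<le> 2 * t + ennreal (1/4)" for t
  proof (cases t)
    case (real r)
    have e: "2 * t + ennreal (1/4) = ennreal (2 * r + 1/4)"
      using real by (simp add: ennreal_mult ennreal_plus)
    have "ennreal (1/2) \<le> ennreal (2 * r + 1/4)" using that unfolding e .
    then have "1/2 \<le> 2 * r + 1/4" by (subst (asm) ennreal_le_iff) (use real in auto)
    then have "1/8 \<le> r" by simp
    then show ?thesis unfolding real by (rule ennreal_leI)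
  qed simp
  then show ?thesis using main unfolding P_def Q_def by blast
qed

text \<open>No value of the estimate can have small loss for both densities, so the sum of the two risks is at least \<open>\<delta>\<close>
  times the overlap of the two sample laws.\<close>

lemma two_point_bound:
  fixes p q :: "'m \<Rightarrow> real" and u v :: "(nat \<Rightarrow> 'm) \<Rightarrow> ennreal"
  assumes \<nu>: "finite_measure \<nu>"
    and p: "p \<in> borel_measurable \<nu>" "\<And>x. 1/2 \<le> p x" "\<And>x. p x \<le> B" "(\<integral>x. p x \<partial>\<nu>) = 1"
    and q: "q \<in> borel_measurable \<nu>" "\<And>x. 1/2 \<le> q x" "\<And>x. q x \<le> B" "(\<integral>x. q x \<partial>\<nu>) = 1"
    and close: "real n * (\<integral>x. (p x - q x)\<^sup>2 \<partial>\<nu>) \<le> 2"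
    and u: "u \<in> borel_measurable (PiM {..<n} (\<lambda>_. \<nu>))" and v: "v \<in> borel_measurable (PiM {..<n} (\<lambda>_. \<nu>))"
    and uv: "\<And>X. X \<in> space (PiM {..<n} (\<lambda>_. \<nu>)) \<Longrightarrow> ennreal \<delta> \<le> u X + v X" and \<delta>: "\<delta> \<ge> 0"
  shows "ennreal (\<delta> / 8) \<le> (\<integral>\<^sup>+X. u X \<partial>sample_law \<nu> n p) + (\<integral>\<^sup>+X. v X \<partial>sample_law \<nu> n q)"
proof -
  note [measurable] = p(1) q(1) u v
  let ?N = "PiM {..<n} (\<lambda>_. \<nu>)"
  define P where "P X = (\<Prod>i<n. p (X i))" for X
  define Q where "Q X = (\<Prod>i<n. q (X i))" for X
  have p0: "0 \<le> p x" "0 \<le> q x" for x using p(2)[of x] q(2)[of x] by linarith+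
  have [measurable]: "P \<in> borel_measurable ?N" "Q \<in> borel_measurable ?N"
    unfolding P_def[abs_def] Q_def[abs_def] by measurable
  have "ennreal (\<delta> / 8) = ennreal \<delta> * ennreal (1/8)" using \<delta> by (simp add: ennreal_mult[symmetric])
  also have "\<dots> \<le> ennreal \<delta> * (\<integral>\<^sup>+X. ennreal (min (P X) (Q X)) \<partial>?N)"
    unfolding P_def Q_def by (rule mult_left_mono[OF product_overlap[OF \<nu> p q close]]) simp
  also have "\<dots> = (\<integral>\<^sup>+X. ennreal \<delta> * ennreal (min (P X) (Q X)) \<partial>?N)"
    by (rule nn_integral_cmult[symmetric]) measurable
  also have "\<dots> \<le> (\<integral>\<^sup>+X. ennreal (P X) * u X + ennreal (Q X) * v X \<partial>?N)"
  proof (rule nn_integral_mono)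
    fix X assume "X \<in> space ?N"
    then have "ennreal \<delta> * ennreal (min (P X) (Q X)) \<le> (u X + v X) * ennreal (min (P X) (Q X))"
      by (intro mult_right_mono uv) simp_all
    also have "\<dots> = ennreal (min (P X) (Q X)) * u X + ennreal (min (P X) (Q X)) * v X"
      by (simp add: distrib_right mult.commute)
    also have "\<dots> \<le> ennreal (P X) * u X + ennreal (Q X) * v X"
      by (intro add_mono mult_right_mono ennreal_leI) simp_all
    finally show "ennreal \<delta> * ennreal (min (P X) (Q X)) \<le> ennreal (P X) * u X + ennreal (Q X) * v X" .
  qed
  also have "\<dots> = (\<integral>\<^sup>+X. ennreal (P X) * u X \<partial>?N) + (\<integral>\<^sup>+X. ennreal (Q X) * v X \<partial>?N)"
    by (rule nn_integral_add) measurable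
  also have "\<dots> = (\<integral>\<^sup>+X. u X \<partial>sample_law \<nu> n p) + (\<integral>\<^sup>+X. v X \<partial>sample_law \<nu> n q)"
    unfolding product_density[OF \<nu> p(1) p0(1) p(3)] product_density[OF \<nu> q(1) p0(2) q(3)] P_def Q_def
    by (simp add: nn_integral_density)
  finally show ?thesis .
qed

lemma L2_cauchy_schwarz:
  assumes f: "f \<in> L2_space \<nu>" and h: "h \<in> L2_space \<nu>"
  shows "(\<integral>x. f x * h x \<partial>\<nu>) \<le> L2_norm \<nu> f * L2_norm \<nu> h"
proof (cases "L2_norm \<nu> f = 0 \<or> L2_norm \<nu> h = 0")
  case True
  then show ?thesis
    using integral_null_factor[OF f h] integral_null_factor[OF h f]
    unfolding L2_norm_square[symmetric] by (auto simp: mult.commute)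
next
  case False
  define a b where "a = L2_norm \<nu> f" and "b = L2_norm \<nu> h"
  have ab: "a > 0" "b > 0" using False by (auto simp: a_def b_def less_le)
  have "0 \<le> (\<integral>x. (b * f x - a * h x)\<^sup>2 \<partial>\<nu>)" by simp
  also have "\<dots> = (\<integral>x. b\<^sup>2 * (f x)\<^sup>2 - 2 * a * b * (f x * h x) + a\<^sup>2 * (h x)\<^sup>2 \<partial>\<nu>)"
    by (rule Bochner_Integration.integral_cong) (simp_all add: power2_diff power_mult_distrib mult_ac)
  also have "\<dots> = b\<^sup>2 * (\<integral>x. (f x)\<^sup>2 \<partial>\<nu>) - 2 * a * b * (\<integral>x. f x * h x \<partial>\<nu>) + a\<^sup>2 * (\<integral>x. (h x)\<^sup>2 \<partial>\<nu>)"
    using f h L2_mult_integrable[OF f h] by (simp add: L2_space_def)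
  also have "\<dots> = 2 * a * b * (a * b - (\<integral>x. f x * h x \<partial>\<nu>))"
    unfolding L2_norm_square[symmetric] a_def[symmetric] b_def[symmetric]
    by (simp add: power2_eq_square right_diff_distrib mult_ac)
  finally have "2 * a * b * 0 \<le> 2 * a * b * (a * b - (\<integral>x. f x * h x \<partial>\<nu>))" by simp
  moreover have "2 * a * b > 0" using ab by simp
  ultimately have "0 \<le> a * b - (\<integral>x. f x * h x \<partial>\<nu>)" by (simp only: mult_le_cancel_left_pos)
  then show ?thesis by (simp add: a_def b_def)
qed

lemma L2_norm_triangle:
  assumes f: "f \<in> L2_space \<nu>" and h: "h \<in> L2_space \<nu>"
  shows "L2_norm \<nu> (\<lambda>x. f x + h x) \<le> L2_norm \<nu> f + L2_norm \<nu> h"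
proof (rule power2_le_imp_le)
  have "(L2_norm \<nu> (\<lambda>x. f x + h x))\<^sup>2 = (\<integral>x. (f x)\<^sup>2 + 2 * (f x * h x) + (h x)\<^sup>2 \<partial>\<nu>)"
    unfolding L2_norm_square by (rule Bochner_Integration.integral_cong) (simp_all add: power2_sum mult_ac)
  also have "\<dots> = (L2_norm \<nu> f)\<^sup>2 + 2 * (\<integral>x. f x * h x \<partial>\<nu>) + (L2_norm \<nu> h)\<^sup>2"
    using f h L2_mult_integrable[OF f h] by (simp add: L2_space_def L2_norm_square)
  also have "\<dots> \<le> (L2_norm \<nu> f + L2_norm \<nu> h)\<^sup>2"
    using L2_cauchy_schwarz[OF f h] by (simp add: power2_sum)
  finally show "(L2_norm \<nu> (\<lambda>x. f x + h x))\<^sup>2 \<le> (L2_norm \<nu> f + L2_norm \<nu> h)\<^sup>2" .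
qed simp

lemma L2_indicator:
  assumes "f \<in> L2_space \<nu>" "S \<in> sets \<nu>"
  shows "(\<lambda>x. indicator S x * f x) \<in> L2_space \<nu>"
    and "L2_norm \<nu> (\<lambda>x. indicator S x * f x) \<le> L2_norm \<nu> f"
proof -
  have e: "(\<lambda>x. (indicator S x * f x)\<^sup>2) = (\<lambda>x. indicator S x * (f x)\<^sup>2)"
    by (auto simp: indicator_def)
  have i: "integrable \<nu> (\<lambda>x. indicator S x * (f x)\<^sup>2)"
    using assms integrable_real_mult_indicator[of S \<nu> "\<lambda>x. (f x)\<^sup>2"] by (simp add: L2_space_def mult.commute)
  show "(\<lambda>x. indicator S x * f x) \<in> L2_space \<nu>"
    using assms i by (auto simp: L2_space_def e)
  have "(\<integral>x. (indicator S x * f x)\<^sup>2 \<partial>\<nu>) \<le> (\<integral>x. (f x)\<^sup>2 \<partial>\<nu>)"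
    unfolding e using assms i by (intro integral_mono) (auto simp: L2_space_def indicator_def)
  then show "L2_norm \<nu> (\<lambda>x. indicator S x * f x) \<le> L2_norm \<nu> f"
    by (simp add: L2_norm_def)
qed

lemma space_L2_borel: "space (L2_borel \<nu>) = L2_space \<nu>"
  unfolding L2_borel_def by (rule space_measure_of) auto

text \<open>Localized losses are measurable functions of the estimate, because they are continuous for the seminorm that
  generates the \<open>\<sigma>\<close>-algebra.\<close>

lemma measurable_localized_loss:
  assumes p: "p \<in> L2_space \<nu>" and S: "S \<in> sets \<nu>"
  shows "(\<lambda>h. L2_norm \<nu> (\<lambda>x. indicator S x * (h x - p x))) \<in> borel_measurable (L2_borel \<nu>)"
proof (rule borel_measurable_iff_less[THEN iffD2, rule_format])
  fix y
  define \<Phi> where "\<Phi> h = L2_norm \<nu> (\<lambda>x. indicator S x * (h x - p x))" for h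
  have "{h \<in> L2_space \<nu>. \<Phi> h < y} \<in> sigma_sets (L2_space \<nu>) {U. U \<subseteq> L2_space \<nu> \<and>
      (\<forall>f\<in>U. \<exists>e>0. \<forall>g\<in>L2_space \<nu>. L2_norm \<nu> (\<lambda>x. g x - f x) < e \<longrightarrow> g \<in> U)}"
  proof (rule sigma_sets.Basic, rule CollectI, intro conjI ballI)
    fix f assume "f \<in> {h \<in> L2_space \<nu>. \<Phi> h < y}"
    then have f: "f \<in> L2_space \<nu>" "\<Phi> f < y" by auto
    have "g \<in> {h \<in> L2_space \<nu>. \<Phi> h < y}" if g: "g \<in> L2_space \<nu>" "L2_norm \<nu> (\<lambda>x. g x - f x) < y - \<Phi> f" for g
    proof -
      note L = L2_diff[OF f(1) p] L2_diff[OF g(1) f(1)]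
      have "\<Phi> g = L2_norm \<nu> (\<lambda>x. indicator S x * (f x - p x) + indicator S x * (g x - f x))"
        unfolding \<Phi>_def by (rule arg_cong[of _ _ "L2_norm \<nu>"]) (auto simp: algebra_simps)
      also have "\<dots> \<le> \<Phi> f + L2_norm \<nu> (\<lambda>x. indicator S x * (g x - f x))"
        unfolding \<Phi>_def by (intro L2_norm_triangle L2_indicator(1) L S)
      also have "\<dots> \<le> \<Phi> f + L2_norm \<nu> (\<lambda>x. g x - f x)" using L2_indicator(2)[OF L(2) S] by simp
      finally show ?thesis using g by simp
    qed
    then show "\<exists>e>0. \<forall>g\<in>L2_space \<nu>. L2_norm \<nu> (\<lambda>x. g x - f x) < e \<longrightarrow> g \<in> {h \<in> L2_space \<nu>. \<Phi> h < y}"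
      using f(2) by (intro exI[of _ "y - \<Phi> f"]) auto
  qed auto
  moreover have "sets (L2_borel \<nu>) = sigma_sets (L2_space \<nu>) {U. U \<subseteq> L2_space \<nu> \<and>
      (\<forall>f\<in>U. \<exists>e>0. \<forall>g\<in>L2_space \<nu>. L2_norm \<nu> (\<lambda>x. g x - f x) < e \<longrightarrow> g \<in> U)}"
    unfolding L2_borel_def by (rule sets_measure_of) auto
  ultimately show "{h \<in> space (L2_borel \<nu>). L2_norm \<nu> (\<lambda>x. indicator S x * (h x - p x)) < y} \<in> sets (L2_borel \<nu>)"
    unfolding space_L2_borel \<Phi>_def by (simp only:)
qed

lemma abs_signed_sum_le:
  fixes \<sigma> :: "'a \<Rightarrow> real"
  assumes I: "finite I" "disjoint_family_on S I" and u: "\<And>a. a \<in> I \<Longrightarrow> \<bar>u a x\<bar> \<le> D * indicator (S a) x"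
    and \<sigma>: "\<And>a. \<bar>\<sigma> a\<bar> = 1" and D: "D \<ge> 0"
  shows "\<bar>\<Sum>a\<in>I. \<sigma> a * u a x\<bar> \<le> D"
proof -
  have "\<bar>\<Sum>a\<in>I. \<sigma> a * u a x\<bar> \<le> (\<Sum>a\<in>I. D * indicator (S a) x)"
    by (rule order_trans[OF sum_abs]) (intro sum_mono, simp add: abs_mult \<sigma> u)
  also have "\<dots> = D * (\<Sum>a\<in>I. indicator (S a) x)" by (rule sum_distrib_left[symmetric])
  also have "(\<Sum>a\<in>I. indicator (S a) x :: real) = indicator (\<Union>a\<in>I. S a) x"
    by (rule indicator_UN_disjoint[symmetric, OF I])
  also have "D * \<dots> \<le> D * 1" using D by (intro mult_left_mono) (auto simp: indicator_def)
  finally show ?thesis by simp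
qed

definition signed_density :: "'a set \<Rightarrow> ('a \<Rightarrow> 'm \<Rightarrow> real) \<Rightarrow> real \<Rightarrow> 'a set \<Rightarrow> 'm \<Rightarrow> real"
  where "signed_density I b \<tau> \<theta> x = 1 + \<tau> * (\<Sum>a\<in>I. (if a \<in> \<theta> then 1 else -1) * b a x)"

text \<open>The hypercube argument. The squared loss dominates the sum of its localizations to the disjoint supports \<open>S a\<close>.
  For each \<open>a\<close> the two-point bound applies to every pair of densities that differ in the sign at \<open>a\<close>; averaging over
  all sign patterns yields a pattern with the claimed risk.\<close>

lemma assouad_L2:
  fixes b :: "'a \<Rightarrow> 'm \<Rightarrow> real"
  assumes \<nu>: "finite_measure \<nu>" "measure \<nu> (space \<nu>) = 1" and I: "finite I"
    and b: "\<And>a. a \<in> I \<Longrightarrow> b a \<in> borel_measurable \<nu>" "\<And>a. a \<in> I \<Longrightarrow> S a \<in> sets \<nu>"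
      "\<And>a x. a \<in> I \<Longrightarrow> \<bar>b a x\<bar> \<le> C * indicator (S a) x" and disj: "disjoint_family_on S I"
    and b0: "\<And>a. a \<in> I \<Longrightarrow> (\<integral>x. b a x \<partial>\<nu>) = 0" and b2: "\<And>a. a \<in> I \<Longrightarrow> \<beta> \<le> (\<integral>x. (b a x)\<^sup>2 \<partial>\<nu>)" "\<beta> \<ge> 0"
    and \<tau>: "\<tau> \<ge> 0" "\<tau> * C \<le> 1/2" "C \<ge> 0"
    and close: "\<And>a. a \<in> I \<Longrightarrow> real n * (4 * \<tau>\<^sup>2 * (\<integral>x. (b a x)\<^sup>2 \<partial>\<nu>)) \<le> 2"
    and F: "\<And>\<theta>. \<theta> \<subseteq> I \<Longrightarrow> signed_density I b \<tau> \<theta> \<in> F"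
  shows "ennreal (real (card I) * \<tau>\<^sup>2 * \<beta> / 8) \<le> minimax_risk \<nu> n F"
proof -
  interpret \<nu>: finite_measure \<nu> by (rule \<nu>(1))
  define \<sigma> where "\<sigma> \<theta> a = (if a \<in> \<theta> then 1 else -1 :: real)" for \<theta> and a :: 'a
  define P where "P \<theta> x = 1 + \<tau> * (\<Sum>a\<in>I. \<sigma> \<theta> a * b a x)" for \<theta> x
  have PF: "P \<theta> \<in> F" if "\<theta> \<subseteq> I" for \<theta>
    using F[OF that] unfolding P_def[abs_def] \<sigma>_def signed_density_def[abs_def] .
  have boff: "b a x = 0" if "a \<in> I" "x \<notin> S a" for a x using b(3)[OF that(1), of x] that(2) by simp
  have bC: "\<bar>b a x\<bar> \<le> C" if "a \<in> I" for a x
    using b(3)[OF that, of x] \<tau>(3) by (cases "x \<in> S a") auto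
  have sumC: "\<bar>\<Sum>a\<in>I. \<sigma> \<theta> a * b a x\<bar> \<le> C" for \<theta> x
    by (rule abs_signed_sum_le[OF I disj b(3) _ \<tau>(3)]) (simp_all add: \<sigma>_def)
  have Pb: "1/2 \<le> P \<theta> x" "P \<theta> x \<le> 3/2" for \<theta> x
  proof -
    have "\<bar>\<tau> * (\<Sum>a\<in>I. \<sigma> \<theta> a * b a x)\<bar> \<le> \<tau> * C" unfolding abs_mult using sumC \<tau>(1) by (simp add: mult_left_mono)
    then show "1/2 \<le> P \<theta> x" "P \<theta> x \<le> 3/2" using \<tau>(2) unfolding P_def by linarith+
  qed
  have Pm: "P \<theta> \<in> borel_measurable \<nu>" for \<theta> unfolding P_def[abs_def] using b(1) by measurable
  have ib: "integrable \<nu> (b a)" if "a \<in> I" for a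
    using b(1)[OF that] bC[OF that] by (intro \<nu>.integrable_const_bound[of _ C]) auto
  have P1: "(\<integral>x. P \<theta> x \<partial>\<nu>) = 1" for \<theta>
    using ib b0 I \<nu>(2) unfolding P_def by (simp add: Bochner_Integration.integral_sum)
  have PL: "P \<theta> \<in> L2_space \<nu>" for \<theta>
  proof -
    have "integrable \<nu> (\<lambda>x. (P \<theta> x)\<^sup>2)"
    proof (rule \<nu>.integrable_const_bound[of _ "(3/2)\<^sup>2"])
      have "\<bar>P \<theta> x\<bar> \<le> \<bar>3/2\<bar>" for x using Pb[of \<theta> x] by (simp add: abs_if)
      then show "AE x in \<nu>. norm ((P \<theta> x)\<^sup>2) \<le> (3/2)\<^sup>2" by (simp only: abs_le_square_iff) simp
    qed (use Pm in measurable)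
    then show ?thesis using Pm by (simp add: L2_space_def)
  qed
  have Pdiff: "P \<theta> x - P (insert a \<theta>) x = - 2 * \<tau> * b a x" if "a \<in> I" "a \<notin> \<theta>" for \<theta> a x
  proof -
    have "(\<Sum>a'\<in>I - {a}. \<sigma> (insert a \<theta>) a' * b a' x) = (\<Sum>a'\<in>I - {a}. \<sigma> \<theta> a' * b a' x)"
      by (intro sum.cong) (auto simp: \<sigma>_def)
    then show ?thesis
      using that unfolding P_def sum.remove[OF I that(1)] by (simp add: \<sigma>_def algebra_simps)
  qed
  have Pdiff2: "(\<integral>x. (P \<theta> x - P (insert a \<theta>) x)\<^sup>2 \<partial>\<nu>) = 4 * \<tau>\<^sup>2 * (\<integral>x. (b a x)\<^sup>2 \<partial>\<nu>)"
    if "a \<in> I" "a \<notin> \<theta>" for \<theta> a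
    unfolding Pdiff[OF that] by (simp add: power_mult_distrib)
  show ?thesis
    unfolding minimax_risk_def
  proof (rule INF_greatest)
    fix T assume "T \<in> estimators \<nu> n"
    then have Tm: "T \<in> measurable (PiM {..<n} (\<lambda>_. \<nu>)) (L2_borel \<nu>)" by (simp add: estimators_def)
    define r where "r = (SUP p\<in>F. \<integral>\<^sup>+X. ennreal ((L2_norm \<nu> (\<lambda>x. T X x - p x))\<^sup>2) \<partial>sample_law \<nu> n p)"
    define loss where "loss a \<theta> X = ennreal ((L2_norm \<nu> (\<lambda>x. indicator (S a) x * (T X x - P \<theta> x)))\<^sup>2)" for a \<theta> X
    define M where "M a \<theta> = (\<integral>\<^sup>+X. loss a \<theta> X \<partial>sample_law \<nu> n (P \<theta>))" for a \<theta>
    have TL: "T X \<in> L2_space \<nu>" if "X \<in> space (PiM {..<n} (\<lambda>_. \<nu>))" for X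
      using measurable_space[OF Tm that] by (simp add: space_L2_borel)
    have lm: "loss a \<theta> \<in> borel_measurable (PiM {..<n} (\<lambda>_. \<nu>))" if "a \<in> I" for a \<theta>
    proof -
      have [measurable]: "(\<lambda>X. L2_norm \<nu> (\<lambda>x. indicator (S a) x * (T X x - P \<theta> x)))
          \<in> borel_measurable (PiM {..<n} (\<lambda>_. \<nu>))"
        by (rule measurable_compose[OF Tm measurable_localized_loss[OF PL b(2)[OF that]]])
      show ?thesis unfolding loss_def[abs_def] by measurable
    qed
    have sp: "space (sample_law \<nu> n p) = space (PiM {..<n} (\<lambda>_. \<nu>))"
      and st: "sets (sample_law \<nu> n p) = sets (PiM {..<n} (\<lambda>_. \<nu>))" for p
      unfolding sample_law_def by (simp_all add: space_PiM cong: sets_PiM_cong)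
    have total: "(\<Sum>a\<in>I. M a \<theta>) \<le> r" if "\<theta> \<subseteq> I" for \<theta>
    proof -
      have "(\<Sum>a\<in>I. M a \<theta>) = (\<integral>\<^sup>+X. (\<Sum>a\<in>I. loss a \<theta> X) \<partial>sample_law \<nu> n (P \<theta>))"
        unfolding M_def by (rule nn_integral_sum[symmetric]) (use lm measurable_cong_sets[OF st refl] in blast)
      also have "\<dots> \<le> (\<integral>\<^sup>+X. ennreal ((L2_norm \<nu> (\<lambda>x. T X x - P \<theta> x))\<^sup>2) \<partial>sample_law \<nu> n (P \<theta>))"
      proof (rule nn_integral_mono)
        fix X assume "X \<in> space (sample_law \<nu> n (P \<theta>))"
        then have X: "T X \<in> L2_space \<nu>" using TL sp by simp
        define h where "h x = T X x - P \<theta> x" for x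
        have hL: "h \<in> L2_space \<nu>" unfolding h_def[abs_def] by (rule L2_diff[OF X PL])
        have ih: "integrable \<nu> (\<lambda>x. (indicator (S a) x * h x)\<^sup>2)" if "a \<in> I" for a
          using L2_indicator(1)[OF hL b(2)[OF that]] by (simp add: L2_space_def)
        have "(\<Sum>a\<in>I. (L2_norm \<nu> (\<lambda>x. indicator (S a) x * h x))\<^sup>2)
            = (\<integral>x. (\<Sum>a\<in>I. (indicator (S a) x * h x)\<^sup>2) \<partial>\<nu>)"
          unfolding L2_norm_square by (rule Bochner_Integration.integral_sum[symmetric, OF ih])
        also have "\<dots> \<le> (\<integral>x. (h x)\<^sup>2 \<partial>\<nu>)"
        proof (rule integral_mono)
          show "integrable \<nu> (\<lambda>x. \<Sum>a\<in>I. (indicator (S a) x * h x)\<^sup>2)"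
            by (rule Bochner_Integration.integrable_sum[OF ih])
          show "integrable \<nu> (\<lambda>x. (h x)\<^sup>2)" using hL by (simp add: L2_space_def)
          fix x
          have "(\<Sum>a\<in>I. (indicator (S a) x * h x)\<^sup>2) = (\<Sum>a\<in>I. indicator (S a) x) * (h x)\<^sup>2"
            by (auto simp: sum_distrib_right indicator_def intro!: sum.cong)
          also have "(\<Sum>a\<in>I. indicator (S a) x :: real) = indicator (\<Union>a\<in>I. S a) x"
            by (rule indicator_UN_disjoint[symmetric, OF I disj])
          also have "\<dots> * (h x)\<^sup>2 \<le> 1 * (h x)\<^sup>2" by (intro mult_right_mono) (auto simp: indicator_def)
          finally show "(\<Sum>a\<in>I. (indicator (S a) x * h x)\<^sup>2) \<le> (h x)\<^sup>2" by simp
        qed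
        finally have "(\<Sum>a\<in>I. (L2_norm \<nu> (\<lambda>x. indicator (S a) x * h x))\<^sup>2) \<le> (L2_norm \<nu> h)\<^sup>2"
          by (simp add: L2_norm_square)
        then show "(\<Sum>a\<in>I. loss a \<theta> X) \<le> ennreal ((L2_norm \<nu> (\<lambda>x. T X x - P \<theta> x))\<^sup>2)"
          unfolding loss_def h_def[symmetric] by (simp add: sum_ennreal ennreal_leI)
      qed
      also have "\<dots> \<le> r" unfolding r_def by (rule SUP_upper[OF PF[OF that]])
      finally show ?thesis .
    qed
    have pair: "ennreal (\<tau>\<^sup>2 * \<beta> / 4) \<le> M a \<theta> + M a (insert a \<theta>)" if a: "a \<in> I" "a \<notin> \<theta>" for a \<theta>
    proof -
      have "ennreal (2 * \<tau>\<^sup>2 * \<beta> / 8) \<le> M a \<theta> + M a (insert a \<theta>)"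
        unfolding M_def
      proof (rule two_point_bound[OF \<nu>(1) Pm Pb P1 Pm Pb P1 _ lm[OF a(1)] lm[OF a(1)]])
        show "real n * (\<integral>x. (P \<theta> x - P (insert a \<theta>) x)\<^sup>2 \<partial>\<nu>) \<le> 2"
          unfolding Pdiff2[OF a] by (rule close[OF a(1)])
        show "0 \<le> 2 * \<tau>\<^sup>2 * \<beta>" using b2(2) by simp
        fix X assume "X \<in> space (PiM {..<n} (\<lambda>_. \<nu>))"
        then have X: "T X \<in> L2_space \<nu>" by (rule TL)
        have iL: "integrable \<nu> (\<lambda>x. (indicator (S a) x * (T X x - P \<theta> x))\<^sup>2)" for \<theta>
          using L2_indicator(1)[OF L2_diff[OF X PL] b(2)[OF a(1)]] by (simp add: L2_space_def)
        have ib2: "integrable \<nu> (\<lambda>x. (b a x)\<^sup>2)"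
        proof (rule \<nu>.integrable_const_bound[of _ "C\<^sup>2"])
          have "\<bar>b a x\<bar> \<le> \<bar>C\<bar>" for x using bC[OF a(1), of x] \<tau>(3) by simp
          then show "AE x in \<nu>. norm ((b a x)\<^sup>2) \<le> C\<^sup>2" by (simp add: abs_le_square_iff)
        qed (use b(1)[OF a(1)] in measurable)
        have "2 * \<tau>\<^sup>2 * \<beta> \<le> 2 * \<tau>\<^sup>2 * (\<integral>x. (b a x)\<^sup>2 \<partial>\<nu>)" using b2(1)[OF a(1)] by (intro mult_left_mono) auto
        also have "\<dots> = (\<integral>x. 2 * \<tau>\<^sup>2 * (b a x)\<^sup>2 \<partial>\<nu>)" by simp
        also have "\<dots> \<le> (\<integral>x. (indicator (S a) x * (T X x - P \<theta> x))\<^sup>2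
            + (indicator (S a) x * (T X x - P (insert a \<theta>) x))\<^sup>2 \<partial>\<nu>)"
        proof (rule integral_mono)
          show "integrable \<nu> (\<lambda>x. 2 * \<tau>\<^sup>2 * (b a x)\<^sup>2)" using ib2 by simp
          show "integrable \<nu> (\<lambda>x. (indicator (S a) x * (T X x - P \<theta> x))\<^sup>2
              + (indicator (S a) x * (T X x - P (insert a \<theta>) x))\<^sup>2)" using iL by simp
          fix x
          show "2 * \<tau>\<^sup>2 * (b a x)\<^sup>2 \<le> (indicator (S a) x * (T X x - P \<theta> x))\<^sup>2
              + (indicator (S a) x * (T X x - P (insert a \<theta>) x))\<^sup>2"
          proof (cases "x \<in> S a")
            case True
            define y z where "y = T X x - P \<theta> x" and "z = T X x - P (insert a \<theta>) x"
            have "z - y = - 2 * \<tau> * b a x" using Pdiff[OF a, of x] by (simp add: y_def z_def)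
            then have "(z - y)\<^sup>2 = 4 * \<tau>\<^sup>2 * (b a x)\<^sup>2" by (simp add: power_mult_distrib)
            moreover have "0 \<le> (z + y)\<^sup>2" by simp
            ultimately have "2 * \<tau>\<^sup>2 * (b a x)\<^sup>2 \<le> y\<^sup>2 + z\<^sup>2" by (simp add: power2_sum power2_diff)
            then show ?thesis using True by (simp add: y_def z_def)
          qed (simp add: boff[OF a(1)])
        qed
        also have "\<dots> = (L2_norm \<nu> (\<lambda>x. indicator (S a) x * (T X x - P \<theta> x)))\<^sup>2
            + (L2_norm \<nu> (\<lambda>x. indicator (S a) x * (T X x - P (insert a \<theta>) x)))\<^sup>2"
          unfolding L2_norm_square by (rule Bochner_Integration.integral_add[OF iL iL])
        finally show "ennreal (2 * \<tau>\<^sup>2 * \<beta>) \<le> loss a \<theta> X + loss a (insert a \<theta>) X"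
          unfolding loss_def ennreal_plus[OF zero_le_power2 zero_le_power2, symmetric] by (rule ennreal_leI)
      qed
      moreover have "2 * \<tau>\<^sup>2 * \<beta> / 8 = \<tau>\<^sup>2 * \<beta> / 4" by simp
      ultimately show ?thesis by (simp only:)
    qed
    show "ennreal (real (card I) * \<tau>\<^sup>2 * \<beta> / 8)
        \<le> (SUP p\<in>F. \<integral>\<^sup>+X. ennreal ((L2_norm \<nu> (\<lambda>x. T X x - p x))\<^sup>2) \<partial>sample_law \<nu> n p)"
      unfolding r_def[symmetric]
    proof (cases "I = {}")
      case False
      then have cI: "card I > 0" using I by (simp add: card_gt_0_iff)
      have half: "ennreal (2 ^ (card I - 1) * (\<tau>\<^sup>2 * \<beta> / 4)) \<le> (\<Sum>\<theta>\<in>Pow I. M a \<theta>)" if a: "a \<in> I" for a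
      proof -
        have Pw: "Pow I = Pow (I - {a}) \<union> insert a ` Pow (I - {a})"
          using Pow_insert[of a "I - {a}"] a by (simp add: insert_absorb)
        have "(\<Sum>\<theta>\<in>Pow I. M a \<theta>) = (\<Sum>\<theta>\<in>Pow (I - {a}). M a \<theta>) + (\<Sum>\<theta>\<in>insert a ` Pow (I - {a}). M a \<theta>)"
          unfolding Pw using I by (intro sum.union_disjoint) auto
        also have "(\<Sum>\<theta>\<in>insert a ` Pow (I - {a}). M a \<theta>) = (\<Sum>\<theta>\<in>Pow (I - {a}). M a (insert a \<theta>))"
          by (subst sum.reindex) (auto simp: inj_on_def)
        finally have e: "(\<Sum>\<theta>\<in>Pow I. M a \<theta>) = (\<Sum>\<theta>\<in>Pow (I - {a}). M a \<theta> + M a (insert a \<theta>))"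
          by (simp add: sum.distrib)
        have "ennreal (2 ^ (card I - 1) * (\<tau>\<^sup>2 * \<beta> / 4)) = (\<Sum>\<theta>\<in>Pow (I - {a}). ennreal (\<tau>\<^sup>2 * \<beta> / 4))"
        proof -
          have "ennreal (2 ^ (card I - 1) * t) = of_nat (2 ^ (card I - 1)) * ennreal t" for t
            by (subst ennreal_mult') (simp_all flip: ennreal_power)
          moreover have "card (Pow (I - {a})) = 2 ^ (card I - 1)"
            using I a by (simp add: card_Pow card_Diff_singleton)
          ultimately show ?thesis by (simp only: sum_constant)
        qed
        also have "\<dots> \<le> (\<Sum>\<theta>\<in>Pow (I - {a}). M a \<theta> + M a (insert a \<theta>))"
          by (intro sum_mono pair[OF a]) auto
        finally show ?thesis unfolding e .
      qed
      have "ennreal (2 ^ card I) * ennreal (real (card I) * \<tau>\<^sup>2 * \<beta> / 8)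
          = (\<Sum>a\<in>I. ennreal (2 ^ (card I - 1) * (\<tau>\<^sup>2 * \<beta> / 4)))"
      proof -
        have "(2::real) ^ card I = 2 * 2 ^ (card I - 1)" using cI by (simp flip: power_Suc)
        then have "2 ^ card I * (real (card I) * \<tau>\<^sup>2 * \<beta> / 8) = (\<Sum>a\<in>I. 2 ^ (card I - 1) * (\<tau>\<^sup>2 * \<beta> / 4))"
          by simp
        then show ?thesis
          using b2(2) by (subst sum_ennreal) (auto simp: ennreal_mult'[symmetric])
      qed
      also have "\<dots> \<le> (\<Sum>a\<in>I. \<Sum>\<theta>\<in>Pow I. M a \<theta>)" by (intro sum_mono half)
      also have "\<dots> = (\<Sum>\<theta>\<in>Pow I. \<Sum>a\<in>I. M a \<theta>)" by (rule sum.swap)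
      also have "\<dots> \<le> (\<Sum>\<theta>\<in>Pow I. r)" by (intro sum_mono total) auto
      also have "\<dots> = ennreal (2 ^ card I) * r" using I by (simp add: card_Pow ennreal_power[symmetric])
      finally show "ennreal (real (card I) * \<tau>\<^sup>2 * \<beta> / 8) \<le> r"
        by (subst (asm) ennreal_mult_le_mult_iff) auto
    qed simp
  qed
qed

section \<open>Choice of the scale and of the amplitude\<close>

text \<open>Put \<open>p = s + \<alpha>\<close> and \<open>\<kappa> = d / 2\<close>. With \<open>X = ((R - 1)\<^sup>2 n)\<^bsup>1/(p + \<kappa>)\<^esup>\<close>, the scale \<open>N \<approx> \<surd>X\<close> and the amplitude
  \<open>\<tau> = c (R - 1) X\<^bsup>-p/2\<^esup>\<close> balance the norm constraint and the information constraint; the amplitude tends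
  to zero as \<open>n\<close> grows, which takes care of the pointwise bounds. Since \<open>s + \<gamma> + 2 \<alpha> \<le> p + \<kappa>\<close> and \<open>X \<ge> 1\<close>, the value
  \<open>\<tau>\<^sup>2\<close> is at least the required rate.\<close>

lemma calibration:
  fixes s \<alpha> \<gamma> C K B :: real and d :: nat
  assumes s: "s > 0" "\<alpha> \<ge> 0" "\<gamma> \<ge> 0" and d: "\<alpha> + \<gamma> \<le> d / 2"
    and C: "C > 0" "K > 0" "B > 0"
  shows "\<exists>c>0. \<forall>R>1. \<exists>n\<^sub>0\<ge>1. \<forall>n\<ge>n\<^sub>0. \<exists>N\<ge>(1::nat). \<exists>\<tau>\<ge>0. \<tau> * C \<le> 1/2 \<and>
    \<tau> * (K * real N powr (s + \<alpha>)) \<le> R - 1 \<and> real n * (4 * \<tau>\<^sup>2 * (B / real N ^ d)) \<le> 2 \<and>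
    c * (R - 1) powr (2 * (\<alpha> + \<gamma>) / (s + \<gamma> + 2 * \<alpha>)) * real n powr (- (s + \<alpha>) / (s + \<gamma> + 2 * \<alpha>)) \<le> \<tau>\<^sup>2"
proof -
  define p where "p = s + \<alpha>"
  define \<kappa> where "\<kappa> = real d / 2"
  define D where "D = s + \<gamma> + 2 * \<alpha>"
  have p: "p > 0" using s by (simp add: p_def)
  have \<kappa>: "\<kappa> \<ge> 0" "D \<le> p + \<kappa>" "D > 0" using s d by (auto simp: \<kappa>_def p_def D_def)
  define c where "c = min (1 / (K * 2 powr p)) (sqrt (1 / (2 * B)))"
  have c: "c > 0" "c \<le> 1 / (K * 2 powr p)" "c\<^sup>2 \<le> 1 / (2 * B)"
  proof -
    show c0: "c > 0" using C by (simp add: c_def)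
    show "c \<le> 1 / (K * 2 powr p)" by (simp add: c_def)
    have "c \<le> sqrt (1 / (2 * B))" by (simp add: c_def)
    then have "c\<^sup>2 \<le> (sqrt (1 / (2 * B)))\<^sup>2" using c0 by (intro power_mono) auto
    then show "c\<^sup>2 \<le> 1 / (2 * B)" using C by simp
  qed
  show ?thesis
  proof (intro exI[of _ "c\<^sup>2"] conjI allI impI)
    show "c\<^sup>2 > 0" using c by simp
    fix R :: real assume R: "R > 1"
    define e where "e = p / (2 * (p + \<kappa>))"
    have e: "e > 0" using p \<kappa> by (simp add: e_def)
    define Z where "Z = max 1 ((2 * c * (R - 1) * C) powr (1 / e))"
    define n0 where "n0 = nat \<lceil>Z / (R - 1)\<^sup>2\<rceil> + 1"
    show "\<exists>n\<^sub>0\<ge>1. \<forall>n\<ge>n\<^sub>0. \<exists>N\<ge>(1::nat). \<exists>\<tau>\<ge>0. \<tau> * C \<le> 1/2 \<and>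
      \<tau> * (K * real N powr (s + \<alpha>)) \<le> R - 1 \<and> real n * (4 * \<tau>\<^sup>2 * (B / real N ^ d)) \<le> 2 \<and>
      c\<^sup>2 * (R - 1) powr (2 * (\<alpha> + \<gamma>) / (s + \<gamma> + 2 * \<alpha>)) * real n powr (- (s + \<alpha>) / (s + \<gamma> + 2 * \<alpha>)) \<le> \<tau>\<^sup>2"
    proof (rule exI[of _ n0], intro conjI allI impI)
      show "n0 \<ge> 1" by (simp add: n0_def)
      fix n assume n: "n \<ge> n0"
      define Y where "Y = (R - 1)\<^sup>2 * real n"
      have YZ: "Z \<le> Y"
      proof -
        have "Z / (R - 1)\<^sup>2 \<le> real n" using n unfolding n0_def by linarith
        then show ?thesis using R by (simp add: Y_def field_simps)
      qed
      have Y: "Y \<ge> 1" "(2 * c * (R - 1) * C) powr (1 / e) \<le> Y" using YZ by (auto simp: Z_def)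
      have n1: "real n > 0" using Y(1) R by (cases "n = 0") (auto simp: Y_def)
      define X where "X = Y powr (1 / (p + \<kappa>))"
      have X: "X \<ge> 1" using Y p \<kappa> by (simp add: X_def ge_one_powr_ge_zero)
      have XY: "X powr t = Y powr (t / (p + \<kappa>))" for t by (simp add: X_def powr_powr)
      define N where "N = nat \<lceil>sqrt X\<rceil>"
      have sX: "sqrt X \<ge> 1" using X by simp
      have N: "sqrt X \<le> N" "N \<le> 2 * sqrt X" "N \<ge> 1" using sX unfolding N_def by linarith+
      have sqX: "sqrt X powr t = X powr (t / 2)" for t
        using X by (simp add: powr_half_sqrt[symmetric] powr_powr)
      define \<tau> where "\<tau> = c * (R - 1) * X powr (- p / 2)"
      have \<tau>0: "\<tau> \<ge> 0" using c R by (simp add: \<tau>_def)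
      have \<tau>2: "\<tau>\<^sup>2 = c\<^sup>2 * (R - 1)\<^sup>2 * X powr (- p)"
      proof -
        have "(X powr (- p / 2))\<^sup>2 = X powr (- p)" unfolding power2_eq_square powr_add[symmetric] by simp
        then show ?thesis by (simp add: \<tau>_def power_mult_distrib)
      qed
      have amp: "\<tau> * C \<le> 1/2"
      proof -
        have "((2 * c * (R - 1) * C) powr (1 / e)) powr e \<le> Y powr e" using Y e by (intro powr_mono2) auto
        then have "2 * c * (R - 1) * C \<le> Y powr e" using c R C e by (simp add: powr_powr)
        then have "(2 * c * (R - 1) * C) / (2 * Y powr e) \<le> Y powr e / (2 * Y powr e)"
          by (rule divide_right_mono) simp
        moreover have "X powr (- p / 2) = 1 / Y powr e"
          unfolding XY e_def by (simp add: powr_minus_divide[symmetric])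
        ultimately show ?thesis using Y(1) by (simp add: \<tau>_def)
      qed
      have norm: "\<tau> * (K * real N powr (s + \<alpha>)) \<le> R - 1"
      proof -
        have "real N powr p \<le> (2 * sqrt X) powr p" using N p by (intro powr_mono2) auto
        also have "\<dots> = 2 powr p * X powr (p / 2)" using X by (simp add: powr_mult sqX)
        finally have "\<tau> * (K * real N powr p) \<le> \<tau> * (K * (2 powr p * X powr (p / 2)))"
          using \<tau>0 C by (intro mult_left_mono) auto
        also have "\<dots> = (c * (K * 2 powr p)) * (R - 1) * (X powr (- p / 2) * X powr (p / 2))"
          by (simp add: \<tau>_def)
        also have "X powr (- p / 2) * X powr (p / 2) = 1" using X by (simp flip: powr_add)
        also have "(c * (K * 2 powr p)) * (R - 1) * 1 \<le> 1 * (R - 1) * 1"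
          using c(2) C R by (intro mult_right_mono) (auto simp: field_simps)
        finally show ?thesis by (simp add: p_def)
      qed
      have info: "real n * (4 * \<tau>\<^sup>2 * (B / real N ^ d)) \<le> 2"
      proof -
        have "X powr \<kappa> = sqrt X ^ d" using sqX[of "real d"] X by (simp add: \<kappa>_def flip: powr_realpow)
        also have "\<dots> \<le> real N ^ d" using N X by (intro power_mono) auto
        finally have "B / real N ^ d \<le> B / X powr \<kappa>" using C X N(3) by (intro divide_left_mono mult_pos_pos) auto
        then have "real n * (4 * \<tau>\<^sup>2 * (B / real N ^ d)) \<le> real n * (4 * \<tau>\<^sup>2 * (B / X powr \<kappa>))"
          by (intro mult_left_mono) auto
        also have "\<dots> = 4 * c\<^sup>2 * B * (Y * (X powr (- p) / X powr \<kappa>))" by (simp add: \<tau>2 Y_def)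
        also have "X powr (- p) / X powr \<kappa> = X powr (- (p + \<kappa>))" by (simp add: powr_diff[symmetric])
        also have "\<dots> = 1 / Y"
        proof -
          have "- (p + \<kappa>) / (p + \<kappa>) = - 1" using p \<kappa>(1) by (simp only: minus_divide_left[symmetric]) simp
          then show ?thesis unfolding XY using Y(1) by (simp only: powr_minus_divide) simp
        qed
        also have "4 * c\<^sup>2 * B * (Y * (1 / Y)) \<le> 2" using c(3) C Y(1) by (simp add: field_simps)
        finally show ?thesis .
      qed
      have risk: "c\<^sup>2 * (R - 1) powr (2 * (\<alpha> + \<gamma>) / D) * real n powr (- p / D) \<le> \<tau>\<^sup>2"
      proof -
        have "- p / D \<le> - p / (p + \<kappa>)" using p \<kappa> by (simp add: divide_left_mono)
        then have "Y powr (- p / D) \<le> Y powr (- p / (p + \<kappa>))" by (rule powr_mono[OF _ Y(1)])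
        then have "(R - 1)\<^sup>2 * Y powr (- p / D) \<le> (R - 1)\<^sup>2 * X powr (- p)"
          unfolding XY by (intro mult_left_mono) auto
        moreover have "(R - 1)\<^sup>2 * Y powr (- p / D) = (R - 1) powr (2 * (\<alpha> + \<gamma>) / D) * real n powr (- p / D)"
        proof -
          have r2: "(R - 1)\<^sup>2 = (R - 1) powr 2" using R by (simp add: powr_realpow[of "R - 1" 2, simplified])
          have ex: "2 + 2 * (- p / D) = 2 * (\<alpha> + \<gamma>) / D"
          proof -
            have "2 + 2 * (- p / D) = 2 * (D - p) / D" using \<kappa>(3) by (simp add: field_simps)
            then show ?thesis by (simp add: D_def p_def)
          qed
          have "Y powr (- p / D) = (R - 1) powr (2 * (- p / D)) * real n powr (- p / D)"
          proof -
            have "((R - 1)\<^sup>2) powr t = (R - 1) powr (2 * t)" for t unfolding r2 by (rule powr_powr)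
            then show ?thesis unfolding Y_def by (simp only: powr_mult)
          qed
          then have "(R - 1)\<^sup>2 * Y powr (- p / D) = (R - 1) powr (2 + 2 * (- p / D)) * real n powr (- p / D)"
            unfolding r2 powr_add by simp
          then show ?thesis unfolding ex .
        qed
        ultimately show ?thesis unfolding \<tau>2 using c(1) by (simp add: mult.assoc)
      qed
      show "\<exists>N\<ge>(1::nat). \<exists>\<tau>\<ge>0. \<tau> * C \<le> 1/2 \<and> \<tau> * (K * real N powr (s + \<alpha>)) \<le> R - 1 \<and>
        real n * (4 * \<tau>\<^sup>2 * (B / real N ^ d)) \<le> 2 \<and>
        c\<^sup>2 * (R - 1) powr (2 * (\<alpha> + \<gamma>) / (s + \<gamma> + 2 * \<alpha>)) * real n powr (- (s + \<alpha>) / (s + \<gamma> + 2 * \<alpha>)) \<le> \<tau>\<^sup>2"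
        using N(3) \<tau>0 amp norm info risk unfolding D_def p_def by blast
    qed
  qed
qed

section \<open>The lower bound\<close>

context riemannian
begin

definition vol :: real
  where "vol = measure V UNIV"

lemma vol_pos: "vol > 0" and emeasure_V: "emeasure V UNIV = ennreal vol"
proof -
  show e: "emeasure V UNIV = ennreal vol"
    unfolding vol_def by (rule emeasure_eq_ennreal_measure) (use emeasure_V_finite in simp)
  have "emeasure V UNIV > 0" by (rule emeasure_open_pos) auto
  then show "vol > 0" unfolding e by (cases "vol > 0") (simp_all add: ennreal_neg not_less)
qed

lemma normalized_density: "normalized V = density V (\<lambda>_. ennreal (1 / vol))"
proof (rule measure_eqI)
  show "sets (normalized V) = sets (density V (\<lambda>_. ennreal (1 / vol)))" by (simp add: normalized_def)
  fix X assume "X \<in> sets (normalized V)"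
  then have X: "X \<in> sets V" by (simp add: normalized_def)
  have "1 / emeasure V (space V) = ennreal (1 / vol)"
    using vol_pos by (simp add: space_V emeasure_V divide_ennreal[symmetric])
  then show "emeasure (normalized V) X = emeasure (density V (\<lambda>_. ennreal (1 / vol))) X"
    using X by (simp add: normalized_def emeasure_density nn_integral_cmult_indicator)
qed

lemma sets_normalized: "sets (normalized V) = sets borel" "space (normalized V) = UNIV"
  by (simp_all add: normalized_density sets_V space_V)

lemma measurable_normalized: "f \<in> borel_measurable (normalized V) \<longleftrightarrow> f \<in> borel_measurable borel"
  for f :: "'m \<Rightarrow> real"
  using measurable_cong_sets[OF sets_normalized(1) refl] by blast

lemma integral_normalized:
  fixes f :: "'m \<Rightarrow> real"
  assumes "f \<in> borel_measurable borel"
  shows "integral\<^sup>L (normalized V) f = (\<integral>p. f p \<partial>V) / vol"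
    and "integrable (normalized V) f \<longleftrightarrow> integrable V f"
proof -
  have m: "f \<in> borel_measurable V" using assms measurable_cong_sets[OF sets_V refl] by blast
  show "integral\<^sup>L (normalized V) f = (\<integral>p. f p \<partial>V) / vol"
    unfolding normalized_density using m vol_pos by (subst integral_density) (auto simp: less_imp_le)
  show "integrable (normalized V) f \<longleftrightarrow> integrable V f"
    unfolding normalized_density using m vol_pos
    by (subst integrable_density) (simp_all add: less_imp_le integrable_mult_left_iff divide_inverse mult.commute[of "inverse vol"])
qed

lemma finite_measure_normalized: "finite_measure (normalized V)"
  and measure_normalized: "measure (normalized V) (space (normalized V)) = 1"
proof -
  have "emeasure (normalized V) UNIV = 1"
    unfolding normalized_density using vol_pos
    by (subst emeasure_density) (simp_all add: sets_V nn_integral_cmult_indicator emeasure_V ennreal_mult'[symmetric] space_V)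
  then show "finite_measure (normalized V)" "measure (normalized V) (space (normalized V)) = 1"
    by (auto intro!: finite_measureI simp: sets_normalized(2) measure_def)
qed

lemma continuous_L2:
  assumes "continuous_on UNIV f"
  shows "f \<in> L2_space (normalized V)"
proof -
  have c2: "continuous_on UNIV (\<lambda>p. (f p)\<^sup>2)" using assms by (intro continuous_intros)
  show ?thesis
    using continuous_integrable[OF c2] integral_normalized(2)[OF borel_measurable_continuous_onI[OF c2]]
      borel_measurable_continuous_onI[OF assms]
    by (simp add: L2_space_def measurable_normalized)
qed

lemma eigenspace_measurable: "v \<in> eigenspace A G \<theta> \<Longrightarrow> v \<in> borel_measurable borel"
  by (rule borel_measurable_continuous_onI[OF C1_continuous[OF eigenspace_C1]])

lemma orthogonal_blocks_eigenspaces: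
  assumes "inj \<mu>" and E: "\<And>j. E j = eigenspace A G (\<mu> j)"
  shows "orthogonal_blocks (normalized V) E"
proof
  show "f \<in> L2_space (normalized V)" if "f \<in> E j" for f j
    using that unfolding E by (intro continuous_L2 C1_continuous eigenspace_C1)
  show "(\<lambda>p. \<Sum>b\<in>B. x b * b p) \<in> E j" if "finite B" "B \<subseteq> E j" for B j and x :: "('m \<Rightarrow> real) \<Rightarrow> real"
    using that eigenspace_sum[of B "\<lambda>b. b"] unfolding E by blast
  show "\<exists>B. finite B \<and> B \<subseteq> E j \<and> (\<forall>v\<in>E j. \<exists>x. v = (\<lambda>p. \<Sum>b\<in>B. x b * b p))" for j
  proof -
    obtain B where B: "finite B" "B \<subseteq> E j" "E j \<subseteq> real_fun.span B"
      unfolding E using eigenspace_basis[of "\<mu> j"] by metis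
    have "\<exists>x. v = (\<lambda>p. \<Sum>b\<in>B. x b * b p)" if "v \<in> E j" for v
    proof -
      have "v \<in> range (\<lambda>u. \<Sum>b\<in>B. (\<lambda>p. u b * b p))"
        using B(3) that real_fun.span_finite[OF B(1)] by blast
      then obtain u where "v = (\<Sum>b\<in>B. (\<lambda>p. u b * b p))" by blast
      then have "v = (\<lambda>p. \<Sum>b\<in>B. u b * b p)" by (auto simp: fun_eq_iff fun_sum_apply)
      then show ?thesis by blast
    qed
    then show ?thesis using B(1,2) by blast
  qed
  show "(\<integral>x. f x * h x \<partial>normalized V) = 0" if "i \<noteq> j" "f \<in> E i" "h \<in> E j" for i j f h
  proof -
    have fh: "f \<in> eigenspace A G (\<mu> i)" "h \<in> eigenspace A G (\<mu> j)" using that E by auto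
    have "\<mu> i \<noteq> \<mu> j" using assms(1) that(1) by (auto simp: inj_def)
    from eigenspace_orthogonal[OF fh this] show ?thesis
      using eigenspace_measurable[OF fh(1)] eigenspace_measurable[OF fh(2)]
      by (subst integral_normalized(1)) auto
  qed
qed

text \<open>Weyl's upper bound would be violated for large \<open>\<Lambda>\<close> otherwise.\<close>

lemma growth_exponent_le:
  fixes \<mu> :: "nat \<Rightarrow> real"
  assumes "inj \<mu>" and d: "\<And>j. d j = fun_dim (eigenspace A G (\<mu> j))"
    and fin: "\<And>\<Lambda>. \<Lambda> \<ge> \<Lambda>\<^sub>0 \<Longrightarrow> finite {j. 1 \<le> j \<and> \<mu> j \<le> \<Lambda>}"
    and lower: "\<And>\<Lambda>. \<Lambda> \<ge> \<Lambda>\<^sub>0 \<Longrightarrow> c * (1 + \<Lambda>) powr \<beta> \<le> (\<Sum>j | 1 \<le> j \<and> \<mu> j \<le> \<Lambda>. real (d j))"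
    and c: "c > 0" "\<Lambda>\<^sub>0 \<ge> 1"
  shows "\<beta> \<le> CARD('n) / 2"
proof (rule ccontr)
  define \<kappa> where "\<kappa> = CARD('n) / 2"
  assume "\<not> \<beta> \<le> CARD('n) / 2"
  then have \<beta>: "\<beta> - \<kappa> > 0" by (simp add: \<kappa>_def)
  obtain C where C: "C > 0" "\<And>\<Lambda> (J :: nat set) \<theta> B. \<Lambda> \<ge> 1 \<Longrightarrow> finite J \<Longrightarrow> inj_on \<theta> J \<Longrightarrow>
    (\<And>j. j \<in> J \<Longrightarrow> \<theta> j \<le> \<Lambda>) \<Longrightarrow> (\<And>j. j \<in> J \<Longrightarrow> finite (B j)) \<Longrightarrow>
    (\<And>j. j \<in> J \<Longrightarrow> B j \<subseteq> eigenspace A G (\<theta> j)) \<Longrightarrow> (\<And>j. j \<in> J \<Longrightarrow> real_fun.independent (B j)) \<Longrightarrow>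
    (\<Sum>j\<in>J. card (B j)) \<le> C * \<Lambda> powr (CARD('n) / 2)"
    using eigenfunction_count by blast
  have "\<forall>j. \<exists>B. finite B \<and> B \<subseteq> eigenspace A G (\<mu> j) \<and> real_fun.independent B \<and> card B = d j"
    unfolding d using eigenspace_basis by metis
  then obtain B where B: "\<And>j. finite (B j)" "\<And>j. B j \<subseteq> eigenspace A G (\<mu> j)"
    "\<And>j. real_fun.independent (B j)" "\<And>j. card (B j) = d j" by metis
  have bound: "c * \<Lambda> powr (\<beta> - \<kappa>) \<le> C" if \<Lambda>: "\<Lambda> \<ge> \<Lambda>\<^sub>0" for \<Lambda>
  proof -
    have \<Lambda>1: "\<Lambda> \<ge> 1" using \<Lambda> c by simp
    have "c * \<Lambda> powr \<beta> \<le> c * (1 + \<Lambda>) powr \<beta>"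
      using c \<Lambda>1 \<beta> by (intro mult_left_mono powr_mono2) (auto simp: \<kappa>_def)
    also have "\<dots> \<le> (\<Sum>j | 1 \<le> j \<and> \<mu> j \<le> \<Lambda>. real (d j))" by (rule lower[OF \<Lambda>])
    also have "\<dots> = real (\<Sum>j | 1 \<le> j \<and> \<mu> j \<le> \<Lambda>. card (B j))" by (simp add: B(4))
    also have "\<dots> \<le> C * \<Lambda> powr \<kappa>"
      unfolding \<kappa>_def
      by (rule C(2)[OF \<Lambda>1 fin[OF \<Lambda>], of \<mu>]) (use B assms(1) in \<open>auto intro: inj_on_subset\<close>)
    finally have "c * \<Lambda> powr \<beta> / \<Lambda> powr \<kappa> \<le> C" using \<Lambda>1 by (simp add: divide_le_eq)
    then show ?thesis by (simp add: powr_diff)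
  qed
  define \<Lambda> where "\<Lambda> = max \<Lambda>\<^sub>0 ((C / c + 1) powr (1 / (\<beta> - \<kappa>)))"
  have "((C / c + 1) powr (1 / (\<beta> - \<kappa>))) powr (\<beta> - \<kappa>) \<le> \<Lambda> powr (\<beta> - \<kappa>)"
    using \<beta> by (intro powr_mono2) (auto simp: \<Lambda>_def)
  then have "C / c + 1 \<le> \<Lambda> powr (\<beta> - \<kappa>)" using \<beta> C(1) c(1) by (simp add: powr_powr)
  then have "c * (C / c + 1) \<le> c * \<Lambda> powr (\<beta> - \<kappa>)" using c(1) by (intro mult_left_mono) auto
  also have "\<dots> \<le> C" by (rule bound) (simp add: \<Lambda>_def)
  finally show False using c(1) by (simp add: distrib_left)
qed

end

text \<open>For large \<open>y\<close> the blocks between \<open>y\<close> and \<open>2 y\<close> have dimension at least of order \<open>y\<^sup>\<gamma>\<close> each, and their total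
  dimension is at most of order \<open>y\<^bsup>\<alpha> + \<gamma>\<^esup>\<close>. For bounded \<open>y\<close> there are boundedly many blocks, and none if \<open>y < 1/2\<close>.\<close>

lemma block_count:
  fixes \<mu> :: "nat \<Rightarrow> real" and d :: "nat \<Rightarrow> nat"
  assumes \<mu>: "\<mu> 0 = 0" "\<And>j. \<mu> j \<ge> 0" and ex: "\<alpha> \<ge> 0" "\<gamma> \<ge> 0"
    and upper: "\<And>\<Lambda>. \<Lambda> \<ge> 1 \<Longrightarrow> (\<Sum>j | 1 \<le> j \<and> \<mu> j \<le> \<Lambda>. real (d j)) \<le> C\<^sub>D * (1 + \<Lambda>) powr (\<alpha> + \<gamma>)"
    and lower: "\<And>j. j \<ge> 1 \<Longrightarrow> \<mu> j \<ge> \<Lambda>\<^sub>0 \<Longrightarrow> real (d j) \<ge> c\<^sub>d * (1 + \<mu> j) powr \<gamma>"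
    and fin: "\<And>\<Lambda>. \<Lambda> \<ge> \<Lambda>\<^sub>0 \<Longrightarrow> finite {j. 1 \<le> j \<and> \<mu> j \<le> \<Lambda>}"
    and c: "c\<^sub>d > 0" "C\<^sub>D \<ge> 0" "\<Lambda>\<^sub>0 \<ge> 1"
  obtains C where "C \<ge> 0" "\<And>y. y > 0 \<Longrightarrow> finite {j. y \<le> 1 + \<mu> j \<and> 1 + \<mu> j \<le> 2 * y} \<and>
    real (card {j. y \<le> 1 + \<mu> j \<and> 1 + \<mu> j \<le> 2 * y}) \<le> C * y powr \<alpha>"
proof -
  define y0 where "y0 = 1 + \<Lambda>\<^sub>0"
  have y0: "y0 \<ge> 2" using c by (simp add: y0_def)
  have fin': "finite {j. \<mu> j \<le> \<Lambda>}" if "\<Lambda> \<ge> \<Lambda>\<^sub>0" for \<Lambda>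
  proof (rule finite_subset[of _ "insert 0 {j. 1 \<le> j \<and> \<mu> j \<le> \<Lambda>}"])
    show "{j. \<mu> j \<le> \<Lambda>} \<subseteq> insert 0 {j. 1 \<le> j \<and> \<mu> j \<le> \<Lambda>}" by (auto simp: Suc_le_eq)
  qed (use fin[OF that] in simp)
  define M where "M = real (card {j. \<mu> j \<le> 2 * y0})"
  define C1 where "C1 = C\<^sub>D * 3 powr (\<alpha> + \<gamma>) / c\<^sub>d"
  define C2 where "C2 = M * 2 powr \<alpha>"
  have C12: "C1 \<ge> 0" "C2 \<ge> 0" using c by (auto simp: C1_def C2_def M_def)
  show ?thesis
  proof (rule that[of "C1 + C2"])
    show "C1 + C2 \<ge> 0" using C12 by simp
    fix y :: real assume y: "y > 0"
    define X where "X = {j. y \<le> 1 + \<mu> j \<and> 1 + \<mu> j \<le> 2 * y}"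
    have "finite X \<and> real (card X) \<le> (C1 + C2) * y powr \<alpha>"
    proof (cases "y \<ge> y0")
      case True
      have y1: "y \<ge> 1" "2 * y \<ge> \<Lambda>\<^sub>0" using True y0 c by (auto simp: y0_def)
      have XJ: "X \<subseteq> {j. 1 \<le> j \<and> \<mu> j \<le> 2 * y}"
      proof
        fix j assume j: "j \<in> X"
        then have "\<mu> j \<noteq> 0" using True y0 by (auto simp: X_def)
        then have "j \<noteq> 0" using \<mu>(1) by metis
        then show "j \<in> {j. 1 \<le> j \<and> \<mu> j \<le> 2 * y}" using j by (auto simp: X_def)
      qed
      note fX = finite_subset[OF XJ fin[OF y1(2)]]
      have "real (card X) * (c\<^sub>d * y powr \<gamma>) = (\<Sum>j\<in>X. c\<^sub>d * y powr \<gamma>)" by simp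
      also have "\<dots> \<le> (\<Sum>j\<in>X. real (d j))"
      proof (rule sum_mono)
        fix j assume j: "j \<in> X"
        have "c\<^sub>d * y powr \<gamma> \<le> c\<^sub>d * (1 + \<mu> j) powr \<gamma>"
          using j c y ex by (intro mult_left_mono powr_mono2) (auto simp: X_def)
        also have "\<dots> \<le> real (d j)"
          using j XJ True by (intro lower) (auto simp: X_def y0_def)
        finally show "c\<^sub>d * y powr \<gamma> \<le> real (d j)" .
      qed
      also have "\<dots> \<le> (\<Sum>j | 1 \<le> j \<and> \<mu> j \<le> 2 * y. real (d j))"
        by (rule sum_mono2[OF fin[OF y1(2)] XJ]) simp
      also have "\<dots> \<le> C\<^sub>D * (1 + 2 * y) powr (\<alpha> + \<gamma>)" using y1 by (intro upper) simp
      also have "\<dots> \<le> C\<^sub>D * (3 * y) powr (\<alpha> + \<gamma>)"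
        using y1 ex c by (intro mult_left_mono powr_mono2) auto
      also have "\<dots> = (C1 * y powr \<alpha>) * (c\<^sub>d * y powr \<gamma>)"
        using c by (simp add: C1_def powr_mult powr_add)
      finally have "real (card X) \<le> C1 * y powr \<alpha>"
        by (rule mult_right_le_imp_le) (use c y in simp)
      also have "\<dots> \<le> (C1 + C2) * y powr \<alpha>" using C12 by (intro mult_right_mono) auto
      finally show ?thesis using fX by simp
    next
      case False
      have XF: "X \<subseteq> {j. \<mu> j \<le> 2 * y0}" using False by (auto simp: X_def)
      have f0: "finite {j. \<mu> j \<le> 2 * y0}" by (rule fin') (use c in \<open>simp add: y0_def\<close>)
      have "real (card X) \<le> C2 * y powr \<alpha>"
      proof (cases "y < 1/2")
        case True
        have "j \<notin> X" for j using \<mu>(2)[of j] True by (auto simp: X_def)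
        then have "X = {}" by blast
        then show ?thesis using C12 by simp
      next
        case F: False
        have "1 \<le> (2 * y) powr \<alpha>" using F ex by (intro ge_one_powr_ge_zero) auto
        then have "M * 1 \<le> M * (2 * y) powr \<alpha>" by (intro mult_left_mono) (auto simp: M_def)
        moreover have "real (card X) \<le> M" unfolding M_def using card_mono[OF f0 XF] by simp
        ultimately show ?thesis by (simp add: C2_def powr_mult)
      qed
      also have "\<dots> \<le> (C1 + C2) * y powr \<alpha>" using C12 by (intro mult_right_mono) auto
      finally show ?thesis using finite_subset[OF XF f0] by simp
    qed
    then show "finite {j. y \<le> 1 + \<mu> j \<and> 1 + \<mu> j \<le> 2 * y} \<and>
      real (card {j. y \<le> 1 + \<mu> j \<and> 1 + \<mu> j \<le> 2 * y}) \<le> (C1 + C2) * y powr \<alpha>" by (simp add: X_def)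
  qed
qed

theorem theorem4p2:
  fixes A :: "('m::{t2_space, second_countable_topology}, 'n::finite) chart set"
    and G :: "('m, 'n) chart \<Rightarrow> real^'n \<Rightarrow> real^'n^'n"
    and V \<nu> :: "'m measure"
    and \<mu> :: "nat \<Rightarrow> real"
    and E :: "nat \<Rightarrow> ('m \<Rightarrow> real) set"
    and d :: "nat \<Rightarrow> nat"
    and s \<alpha> \<gamma> C\<^sub>d C\<^sub>D c\<^sub>d c\<^sub>D \<Lambda>\<^sub>0 :: real
  assumes "compact_connected_riemannian_manifold A G"
    and "is_riemannian_volume A G V"
    and "\<nu> = normalized V"
    and "distinct_eigenvalues A G \<mu>"
    and "\<And>j. E j = eigenspace A G (\<mu> j)"
    and "\<And>j. d j = fun_dim (E j)"
    and "s > 0" and "\<alpha> \<ge> 0" and "\<gamma> \<ge> 0"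
    and "\<And>j. j \<ge> 1 \<Longrightarrow> real (d j) \<le> C\<^sub>d * (1 + \<mu> j) powr \<gamma>"
    and "\<And>\<Lambda>. \<Lambda> \<ge> 1 \<Longrightarrow>
           (\<Sum>j | 1 \<le> j \<and> \<mu> j \<le> \<Lambda>. real (d j)) \<le> C\<^sub>D * (1 + \<Lambda>) powr (\<alpha> + \<gamma>)"
    and "c\<^sub>d > 0" and "c\<^sub>D > 0" and "\<Lambda>\<^sub>0 \<ge> 1"
    and "\<And>j. j \<ge> 1 \<Longrightarrow> \<mu> j \<ge> \<Lambda>\<^sub>0 \<Longrightarrow> real (d j) \<ge> c\<^sub>d * (1 + \<mu> j) powr \<gamma>"
    and "\<And>\<Lambda>. \<Lambda> \<ge> \<Lambda>\<^sub>0 \<Longrightarrow>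
           (\<Sum>j | 1 \<le> j \<and> \<mu> j \<le> \<Lambda>. real (d j)) \<ge> c\<^sub>D * (1 + \<Lambda>) powr (\<alpha> + \<gamma>)"
  shows "\<exists>c>0. \<forall>R>1. \<exists>n\<^sub>0\<ge>1. \<forall>n\<ge>n\<^sub>0.
    minimax_risk \<nu> n (density_class \<nu> \<mu> E s R (1/2) (3/2)) \<ge>
      ennreal (c * (R - 1) powr (2 * (\<alpha> + \<gamma>) / (s + \<gamma> + 2 * \<alpha>))
                 * real n powr (- (s + \<alpha>) / (s + \<gamma> + 2 * \<alpha>)))"
proof -
  interpret riemannian A G V by standard (fact assms(1,2))+
  have \<nu>: "\<nu> = normalized V" by (fact assms(3))
  have \<mu>: "\<mu> 0 = 0" "strict_mono \<mu>" using assms(4) by (auto simp: distinct_eigenvalues_def)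
  have inj: "inj \<mu>" using \<mu>(2) by (rule strict_mono_imp_inj_on)
  have \<mu>0: "\<mu> j \<ge> 0" for j using strict_mono_less_eq[OF \<mu>(2), of 0 j] \<mu>(1) by simp
  \<comment> \<open>A sum over an infinite set is \<open>0\<close>, so the lower bound on the total dimension forces the set to be finite.\<close>
  have fin: "finite {j. 1 \<le> j \<and> \<mu> j \<le> \<Lambda>}" if "\<Lambda> \<ge> \<Lambda>\<^sub>0" for \<Lambda>
  proof (rule ccontr)
    assume "infinite {j. 1 \<le> j \<and> \<mu> j \<le> \<Lambda>}"
    then have "c\<^sub>D * (1 + \<Lambda>) powr (\<alpha> + \<gamma>) \<le> 0" using assms(16)[OF that] by simp
    moreover have "c\<^sub>D * (1 + \<Lambda>) powr (\<alpha> + \<gamma>) > 0" using assms(13,14) that by simp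
    ultimately show False by simp
  qed
  have exponent: "\<alpha> + \<gamma> \<le> real CARD('n) / 2"
    by (rule growth_exponent_le[OF inj _ fin assms(16) assms(13,14)]) (simp_all add: assms(5,6))
  have CD: "C\<^sub>D \<ge> 0"
  proof -
    have "0 \<le> (\<Sum>j | 1 \<le> j \<and> \<mu> j \<le> 1. real (d j))" by (intro sum_nonneg) simp
    also have "\<dots> \<le> C\<^sub>D * (1 + 1) powr (\<alpha> + \<gamma>)" by (rule assms(11)) simp
    finally show ?thesis by (simp add: zero_le_mult_iff)
  qed
  obtain Cn where Cn: "Cn \<ge> 0" "\<And>y. y > 0 \<Longrightarrow> finite {j. y \<le> 1 + \<mu> j \<and> 1 + \<mu> j \<le> 2 * y} \<and>
    real (card {j. y \<le> 1 + \<mu> j \<and> 1 + \<mu> j \<le> 2 * y}) \<le> Cn * y powr \<alpha>"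
    using block_count[OF \<mu>(1) \<mu>0 assms(8,9,11,15) fin assms(12) CD assms(14)] by blast
  interpret B: orthogonal_blocks \<nu> E
    unfolding \<nu> by (rule orthogonal_blocks_eigenspaces[OF inj assms(5)])
  \<comment> \<open>The number of powers of the Laplacian that make the sum over the high blocks converge.\<close>
  define m where "m = nat \<lceil>s + \<alpha>\<rceil>"
  have m: "2 * real m > s + \<alpha>" using assms(7,8) unfolding m_def by linarith
  obtain K where K: "K > 0" "\<And>f g F N J. f \<in> L2_space \<nu> \<Longrightarrow> g \<in> L2_space \<nu> \<Longrightarrow> N \<ge> (1::nat) \<Longrightarrow>
    L2_norm \<nu> f \<le> F \<Longrightarrow> L2_norm \<nu> g \<le> F * real N ^ (2 * m) \<Longrightarrow>
    (\<And>j v. v \<in> E j \<Longrightarrow> (\<integral>x. g x * v x \<partial>\<nu>) = (- \<mu> j) ^ m * (\<integral>x. f x * v x \<partial>\<nu>)) \<Longrightarrow> finite J \<Longrightarrow>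
    (\<Sum>j\<in>J. (1 + \<mu> j) powr (s / 2) * L2_norm \<nu> (B.Pr j f)) \<le> K * F * real N powr (s + \<alpha>)"
    using B.block_sum_bound[OF Cn(2) \<mu>0 Cn(1) assms(7,8) m] by blast
  obtain C c1 where C: "C > 0" "c1 > 0" and tf:
    "\<And>N. N \<ge> 1 \<Longrightarrow> \<exists>(b :: ('n \<Rightarrow> nat) \<Rightarrow> 'm \<Rightarrow> real) g S. disjoint_family_on S (cells N) \<and>
      (\<forall>a\<in>cells N. b a \<in> borel_measurable borel \<and> g a \<in> borel_measurable borel \<and> S a \<in> sets borel \<and>
        (\<forall>p. \<bar>b a p\<bar> \<le> C * indicator (S a) p) \<and> (\<forall>p. \<bar>g a p\<bar> \<le> C * real N ^ (2 * m) * indicator (S a) p) \<and>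
        (\<integral>p. b a p \<partial>V) = 0 \<and> c1 / real N ^ CARD('n) \<le> (\<integral>p. (b a p)\<^sup>2 \<partial>V) \<and>
        (\<integral>p. (b a p)\<^sup>2 \<partial>V) \<le> C / real N ^ CARD('n) \<and>
        (\<forall>\<theta> v. v \<in> eigenspace A G \<theta> \<longrightarrow> (\<integral>p. g a p * v p \<partial>V) = (- \<theta>) ^ m * (\<integral>p. b a p * v p \<partial>V)))"
    by (rule test_functions[of m]) (rule that)
  obtain c where c: "c > 0" and cal: "\<And>R. R > 1 \<Longrightarrow> \<exists>n\<^sub>0\<ge>1. \<forall>n\<ge>n\<^sub>0. \<exists>N\<ge>(1::nat). \<exists>\<tau>\<ge>0. \<tau> * C \<le> 1/2 \<and>
    \<tau> * (K * C * real N powr (s + \<alpha>)) \<le> R - 1 \<and> real n * (4 * \<tau>\<^sup>2 * (C / vol / real N ^ CARD('n))) \<le> 2 \<and>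
    c * (R - 1) powr (2 * (\<alpha> + \<gamma>) / (s + \<gamma> + 2 * \<alpha>)) * real n powr (- (s + \<alpha>) / (s + \<gamma> + 2 * \<alpha>)) \<le> \<tau>\<^sup>2"
  proof -
    have "0 < K * C" "0 < C / vol" using K(1) C(1) vol_pos by simp_all
    from calibration[OF assms(7-9) exponent C(1) this] show ?thesis using that by blast
  qed
  interpret \<nu>: finite_measure \<nu> unfolding \<nu> by (rule finite_measure_normalized)
  have one: "measure \<nu> (space \<nu>) = 1" unfolding \<nu> by (rule measure_normalized)
  have bounded_L2: "f \<in> L2_space \<nu> \<and> L2_norm \<nu> f \<le> D"
    if "f \<in> borel_measurable borel" "\<And>p. \<bar>f p\<bar> \<le> D" for f D
  proof -
    have D: "D \<ge> 0" using that(2)[of undefined] by simp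
    have fm: "f \<in> borel_measurable \<nu>" using that(1) by (simp add: \<nu> measurable_normalized)
    have sq: "(f p)\<^sup>2 \<le> D\<^sup>2" for p using that(2)[of p] D by (simp add: abs_le_square_iff[symmetric])
    have i: "integrable \<nu> (\<lambda>p. (f p)\<^sup>2)" using fm sq by (intro \<nu>.integrable_const_bound[of _ "D\<^sup>2"]) auto
    have "(\<integral>p. (f p)\<^sup>2 \<partial>\<nu>) \<le> (\<integral>p. D\<^sup>2 \<partial>\<nu>)" using i sq by (intro integral_mono) auto
    then have "(L2_norm \<nu> f)\<^sup>2 \<le> D\<^sup>2" using one by (simp add: L2_norm_square)
    then have "L2_norm \<nu> f \<le> D" using D by (rule power2_le_imp_le)
    then show ?thesis using fm i by (simp add: L2_space_def)
  qed
  \<comment> \<open>The hypercube bound is \<open>\<tau>\<^sup>2 / 8\<close> times the lower bound \<open>c1 / vol\<close> for the sum of the squared norms of the bumps with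
    respect to \<open>\<nu>\<close>.\<close>
  define c' where "c' = c * (c1 / vol / 8)"
  have c': "c' > 0" using c C(2) vol_pos by (simp add: c'_def)
  show ?thesis
  proof (intro exI[of _ c'] conjI allI impI c')
    fix R :: real assume R: "R > 1"
    obtain n0 where n0: "n0 \<ge> 1" "\<And>n. n \<ge> n0 \<Longrightarrow> \<exists>N\<ge>(1::nat). \<exists>\<tau>\<ge>0. \<tau> * C \<le> 1/2 \<and>
      \<tau> * (K * C * real N powr (s + \<alpha>)) \<le> R - 1 \<and> real n * (4 * \<tau>\<^sup>2 * (C / vol / real N ^ CARD('n))) \<le> 2 \<and>
      c * (R - 1) powr (2 * (\<alpha> + \<gamma>) / (s + \<gamma> + 2 * \<alpha>)) * real n powr (- (s + \<alpha>) / (s + \<gamma> + 2 * \<alpha>)) \<le> \<tau>\<^sup>2"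
      using cal[OF R] by blast
    have "minimax_risk \<nu> n (density_class \<nu> \<mu> E s R (1/2) (3/2)) \<ge>
      ennreal (c' * (R - 1) powr (2 * (\<alpha> + \<gamma>) / (s + \<gamma> + 2 * \<alpha>)) * real n powr (- (s + \<alpha>) / (s + \<gamma> + 2 * \<alpha>)))"
      if n: "n \<ge> n0" for n
    proof -
      obtain N \<tau> where N: "N \<ge> (1::nat)" and \<tau>: "\<tau> \<ge> 0" "\<tau> * C \<le> 1/2"
        "\<tau> * (K * C * real N powr (s + \<alpha>)) \<le> R - 1" "real n * (4 * \<tau>\<^sup>2 * (C / vol / real N ^ CARD('n))) \<le> 2"
        "c * (R - 1) powr (2 * (\<alpha> + \<gamma>) / (s + \<gamma> + 2 * \<alpha>)) * real n powr (- (s + \<alpha>) / (s + \<gamma> + 2 * \<alpha>)) \<le> \<tau>\<^sup>2"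
        using n0(2)[OF n] by blast
      define I where "I = (cells N :: ('n \<Rightarrow> nat) set)"
      from tf[OF N, folded I_def] obtain b g :: "('n \<Rightarrow> nat) \<Rightarrow> 'm \<Rightarrow> real" and S where disj: "disjoint_family_on S I" and
        "\<forall>a\<in>I. b a \<in> borel_measurable borel \<and> g a \<in> borel_measurable borel \<and> S a \<in> sets borel \<and>
        (\<forall>p. \<bar>b a p\<bar> \<le> C * indicator (S a) p) \<and> (\<forall>p. \<bar>g a p\<bar> \<le> C * real N ^ (2 * m) * indicator (S a) p) \<and>
        (\<integral>p. b a p \<partial>V) = 0 \<and> c1 / real N ^ CARD('n) \<le> (\<integral>p. (b a p)\<^sup>2 \<partial>V) \<and>
        (\<integral>p. (b a p)\<^sup>2 \<partial>V) \<le> C / real N ^ CARD('n) \<and>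
        (\<forall>\<theta> v. v \<in> eigenspace A G \<theta> \<longrightarrow> (\<integral>p. g a p * v p \<partial>V) = (- \<theta>) ^ m * (\<integral>p. b a p * v p \<partial>V))"
        by (elim exE conjE)
      note all = bspec[OF this(2)]
      note rest = all[THEN conjunct2, THEN conjunct2, THEN conjunct2]
      note bg = all[THEN conjunct1] all[THEN conjunct2, THEN conjunct1] all[THEN conjunct2, THEN conjunct2, THEN conjunct1]
        rest[THEN conjunct1, THEN spec] rest[THEN conjunct2, THEN conjunct1, THEN spec]
        rest[THEN conjunct2, THEN conjunct2, THEN conjunct1]
        rest[THEN conjunct2, THEN conjunct2, THEN conjunct2, THEN conjunct1]
        rest[THEN conjunct2, THEN conjunct2, THEN conjunct2, THEN conjunct2, THEN conjunct1]
        rest[THEN conjunct2, THEN conjunct2, THEN conjunct2, THEN conjunct2, THEN conjunct2, THEN spec, THEN spec, THEN mp]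
      have fI: "finite I" by (simp add: I_def)
      have cI: "real (card I) = real N ^ CARD('n)" by (simp add: I_def card_cells)
      have b2m: "(\<lambda>p. (b a p)\<^sup>2) \<in> borel_measurable borel" if "a \<in> I" for a using bg(1)[OF that] by measurable
      have bL: "b a \<in> L2_space \<nu>" and gL: "g a \<in> L2_space \<nu>" if "a \<in> I" for a
      proof -
        have "\<bar>b a p\<bar> \<le> C" "\<bar>g a p\<bar> \<le> C * real N ^ (2 * m)" for p
          using bg(4)[OF that, of p] bg(5)[OF that, of p] C(1) by (cases "p \<in> S a"; simp)+
        then show "b a \<in> L2_space \<nu>" "g a \<in> L2_space \<nu>"
          using bounded_L2[OF bg(1)[OF that]] bounded_L2[OF bg(2)[OF that]] by blast+
      qed
      have "ennreal (real (card I) * \<tau>\<^sup>2 * (c1 / vol / real N ^ CARD('n)) / 8)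
          \<le> minimax_risk \<nu> n (density_class \<nu> \<mu> E s R (1/2) (3/2))"
      proof (rule assouad_L2[OF \<nu>.finite_measure_axioms one fI, of b S C])
        fix a assume a: "a \<in> I"
        show "b a \<in> borel_measurable \<nu>" "S a \<in> sets \<nu>"
          using bg(1,3)[OF a] by (simp_all add: \<nu> measurable_normalized sets_normalized)
        show "\<bar>b a x\<bar> \<le> C * indicator (S a) x" for x by (rule bg(4)[OF a])
        show "(\<integral>x. b a x \<partial>\<nu>) = 0" using bg(6)[OF a] by (simp add: \<nu> integral_normalized(1)[OF bg(1)[OF a]])
        have b2: "(\<integral>x. (b a x)\<^sup>2 \<partial>\<nu>) = (\<integral>p. (b a p)\<^sup>2 \<partial>V) / vol"
          by (simp add: \<nu> integral_normalized(1)[OF b2m[OF a]])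
        show "c1 / vol / real N ^ CARD('n) \<le> (\<integral>x. (b a x)\<^sup>2 \<partial>\<nu>)"
          using divide_right_mono[OF bg(7)[OF a], of vol] vol_pos by (simp add: b2 mult.commute)
        have "(\<integral>x. (b a x)\<^sup>2 \<partial>\<nu>) \<le> C / vol / real N ^ CARD('n)"
          using divide_right_mono[OF bg(8)[OF a], of vol] vol_pos by (simp add: b2 mult.commute)
        then have "real n * (4 * \<tau>\<^sup>2 * (\<integral>x. (b a x)\<^sup>2 \<partial>\<nu>)) \<le> real n * (4 * \<tau>\<^sup>2 * (C / vol / real N ^ CARD('n)))"
          by (intro mult_left_mono) auto
        then show "real n * (4 * \<tau>\<^sup>2 * (\<integral>x. (b a x)\<^sup>2 \<partial>\<nu>)) \<le> 2" using \<tau>(4) by simp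
      next
        fix \<theta> assume "\<theta> \<subseteq> I"
        define \<sigma> where "\<sigma> a = (if a \<in> \<theta> then 1 else -1 :: real)" for a
        have \<sigma>: "\<bar>\<sigma> a\<bar> = 1" for a by (simp add: \<sigma>_def)
        define f where "f p = (\<Sum>a\<in>I. \<sigma> a * b a p)" for p
        define h where "h p = (\<Sum>a\<in>I. \<sigma> a * g a p)" for p
        have fb: "\<bar>f p\<bar> \<le> C" for p unfolding f_def by (rule abs_signed_sum_le[OF fI disj bg(4) \<sigma>]) (use C(1) in simp_all)
        have hb: "\<bar>h p\<bar> \<le> C * real N ^ (2 * m)" for p unfolding h_def by (rule abs_signed_sum_le[OF fI disj bg(5) \<sigma>]) (use C(1) in simp_all)
        have fm: "f \<in> borel_measurable borel" and hm: "h \<in> borel_measurable borel"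
          unfolding f_def[abs_def] h_def[abs_def] using bg(1,2)
          by (auto intro!: borel_measurable_sum borel_measurable_times)
        have fL: "f \<in> L2_space \<nu>" "L2_norm \<nu> f \<le> C" using bounded_L2[OF fm fb] by auto
        have hL: "h \<in> L2_space \<nu>" "L2_norm \<nu> h \<le> C * real N ^ (2 * m)" using bounded_L2[OF hm hb] by auto
        have f0: "(\<integral>x. f x \<partial>\<nu>) = 0"
        proof -
          have "(\<integral>x. f x \<partial>\<nu>) = (\<integral>x. f x * 1 \<partial>\<nu>)" by simp
          also have "\<dots> = (\<Sum>a\<in>I. \<sigma> a * (\<integral>x. b a x * 1 \<partial>\<nu>))"
            unfolding f_def by (rule integral_mult_sum[OF bL]) (use bounded_L2[of "\<lambda>_. 1" 1] in auto)
          also have "\<dots> = 0"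
            using bg(6) by (intro sum.neutral) (simp add: \<nu> integral_normalized(1)[OF bg(1)])
          finally show ?thesis .
        qed
        have pair: "(\<integral>x. h x * v x \<partial>\<nu>) = (- \<mu> j) ^ m * (\<integral>x. f x * v x \<partial>\<nu>)" if v: "v \<in> E j" for j v
        proof -
          have vE: "v \<in> eigenspace A G (\<mu> j)" using v by (simp add: assms(5))
          have vm: "v \<in> borel_measurable borel" by (rule eigenspace_measurable[OF vE])
          have each: "(\<integral>x. g a x * v x \<partial>\<nu>) = (- \<mu> j) ^ m * (\<integral>x. b a x * v x \<partial>\<nu>)" if a: "a \<in> I" for a
          proof -
            have "(\<lambda>p. g a p * v p) \<in> borel_measurable borel" "(\<lambda>p. b a p * v p) \<in> borel_measurable borel"
              using bg(1,2)[OF a] vm by measurable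
            then show ?thesis unfolding \<nu> using bg(9)[OF a vE] by (simp add: integral_normalized(1))
          qed
          have "(\<integral>x. h x * v x \<partial>\<nu>) = (\<Sum>a\<in>I. \<sigma> a * (\<integral>x. g a x * v x \<partial>\<nu>))"
            unfolding h_def by (rule integral_mult_sum[OF gL B.E_L2[OF v]])
          also have "\<dots> = (- \<mu> j) ^ m * (\<Sum>a\<in>I. \<sigma> a * (\<integral>x. b a x * v x \<partial>\<nu>))"
            unfolding sum_distrib_left by (rule sum.cong[OF refl]) (simp add: each)
          also have "(\<Sum>a\<in>I. \<sigma> a * (\<integral>x. b a x * v x \<partial>\<nu>)) = (\<integral>x. f x * v x \<partial>\<nu>)"
            unfolding f_def by (rule integral_mult_sum[OF bL B.E_L2[OF v], symmetric])
          finally show ?thesis .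
        qed
        have "block_variation_norm \<nu> \<mu> E s (\<lambda>x. 1 + \<tau> * f x) \<le> ennreal (1 + \<tau> * (K * C * real N powr (s + \<alpha>)))"
        proof (rule B.block_variation_norm_perturbation[where f = f and \<mu> = \<mu>, OF _ _ fL(1) f0 \<mu>(1) \<tau>(1)])
          show "(\<lambda>x. 1) \<in> E 0" unfolding assms(5) \<mu>(1) by (rule const_eigenspace)
          show "(\<integral>x. 1 \<partial>\<nu>) = (1 :: real)" using one by simp
          show "(\<Sum>j\<in>J. (1 + \<mu> j) powr (s / 2) * L2_norm \<nu> (B.Pr j f)) \<le> K * C * real N powr (s + \<alpha>)"
            if "finite J" for J
            by (rule K(2)[OF fL(1) hL(1) N fL(2) hL(2) pair that])
        qed
        also have "\<dots> \<le> ennreal R" using \<tau>(3) by (intro ennreal_leI) simp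
        finally have norm: "block_variation_norm \<nu> \<mu> E s (\<lambda>x. 1 + \<tau> * f x) \<le> ennreal R" .
        have \<tau>f: "\<bar>\<tau> * f p\<bar> \<le> 1/2" for p
          using mult_left_mono[OF fb[of p] \<tau>(1)] \<tau>(1,2) by (simp add: abs_mult)
        have range: "1/2 \<le> 1 + \<tau> * f p" "1 + \<tau> * f p \<le> 3/2" for p
          using \<tau>f[of p] unfolding abs_le_iff by linarith+
        have L2: "(\<lambda>x. 1 + \<tau> * f x) \<in> L2_space \<nu>"
          using L2_lincomb[OF fL(1), of "\<lambda>_. 1" \<tau>] bounded_L2[of "\<lambda>_. 1" 1] by (simp add: add.commute)
        have int1: "(\<integral>x. 1 + \<tau> * f x \<partial>\<nu>) = 1"
        proof -
          have "integrable \<nu> f"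
            using fm fb by (intro \<nu>.integrable_const_bound[of _ C]) (auto simp: \<nu> measurable_normalized)
          then show ?thesis using f0 one by simp
        qed
        have "signed_density I b \<tau> \<theta> = (\<lambda>x. 1 + \<tau> * f x)"
          by (simp add: signed_density_def[abs_def] f_def \<sigma>_def)
        then show "signed_density I b \<tau> \<theta> \<in> density_class \<nu> \<mu> E s R (1/2) (3/2)"
          unfolding density_class_def using L2 range int1 norm by simp
      qed (use disj \<tau> C vol_pos in auto)
      moreover have "c' * (R - 1) powr (2 * (\<alpha> + \<gamma>) / (s + \<gamma> + 2 * \<alpha>)) * real n powr (- (s + \<alpha>) / (s + \<gamma> + 2 * \<alpha>))
          \<le> real (card I) * \<tau>\<^sup>2 * (c1 / vol / real N ^ CARD('n)) / 8"
      proof -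
        have "(c1 / vol / 8) * (c * (R - 1) powr (2 * (\<alpha> + \<gamma>) / (s + \<gamma> + 2 * \<alpha>)) *
            real n powr (- (s + \<alpha>) / (s + \<gamma> + 2 * \<alpha>))) \<le> (c1 / vol / 8) * \<tau>\<^sup>2"
          by (rule mult_left_mono[OF \<tau>(5)]) (use C(2) vol_pos in simp)
        moreover have "real (card I) * \<tau>\<^sup>2 * (c1 / vol / real N ^ CARD('n)) / 8 = (c1 / vol / 8) * \<tau>\<^sup>2"
          unfolding cI using N by simp
        ultimately show ?thesis by (simp add: c'_def mult_ac)
      qed
      ultimately show ?thesis by (meson ennreal_leI order_trans)
    qed
    then show "\<exists>n\<^sub>0\<ge>1. \<forall>n\<ge>n\<^sub>0.
      minimax_risk \<nu> n (density_class \<nu> \<mu> E s R (1/2) (3/2)) \<ge>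
      ennreal (c' * (R - 1) powr (2 * (\<alpha> + \<gamma>) / (s + \<gamma> + 2 * \<alpha>)) * real n powr (- (s + \<alpha>) / (s + \<gamma> + 2 * \<alpha>)))"
      using n0(1) by blast
  qed
qed

end
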